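(* Let $(M,\omega)$ be a closed connected symplectic manifold, and let $\theta:\mathrm{Homeo}^\Omega_0(M)\to H_1(M,\mathbb R)/\Gamma$ be the mass flow homomorphism with respect to the Liouville measure of $\omega$. Then $\theta(h)=0$ for every $h\in\mathrm{Hameo}(M,\omega)$.
   Context: Let $(M,\omega)$ be a closed connected symplectic manifold of dimension $2n$ and let $\mu$ be the Liouville measure, induced by the volume form $\Omega=\frac{1}{n!}\omega^n$. Fix a Riemannian distance $d$ on $M$ and put $d_{C^0}(\phi,\psi)=\max_{x\in M}d(\phi(x),\psi(x))$. The group $\mathrm{Homeo}(M)$ of homeomorphisms of $M$ carries the complete metric $\overline d(\phi,\psi)=\max\{d_{C^0}(\phi,\psi),d_{C^0}(\phi^{-1},\psi^{-1})\}$, whose topology is called the $C^0$-topology. For a subgroup $G\subset\mathrm{Homeo}(M)$, $\mathcal P(G,id)$ is the space of continuous paths $\lambda:[0,1]\to G$ with $\lambda(0)=id$, with metric $\overline d(\lambda,\mu)=\max_{t\in[0,1]}\overline d(\lambda(t),\mu(t))$. A smooth function $H:[0,1]\times M\to\mathbb R$ (write $H_t=H(t,\cdot)$) is normalized if $\int_M H_t\,d\mu=0$ for all $t$; $C_m^\infty([0,1]\times M,\mathbb R)$ is the space of such functions. $X_H$ is defined by $X_H\rfloor\omega=dH_t$, and $\phi_H:t\mapsto\phi_H^t$ is the flow of $\dot x=X_H(t,x)$ with $\phi_H^0=id$. On $C_m^\infty([0,1]\times M,\mathbb R)$ use the norm $\|H\|=\int_0^1\left(\max_x H_t(x)-\min_x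 H_t(x)\right)dt$, and let $L_m^{(1,\infty)}([0,1]\times M,\mathbb R)$ be its completion. Let $\mathcal Q=\{(\phi_H,H): H\in C_m^\infty([0,1]\times M,\mathbb R)\}\subset \mathcal P(\mathrm{Homeo}(M),id)\times L_m^{(1,\infty)}([0,1]\times M,\mathbb R)$, and let $\overline{\mathcal Q}$ be its closure with respect to the product metric (the sum of $\overline d$ and $\|\cdot\|$). Then $\mathrm{Hameo}(M,\omega)=\{\lambda(1):(\lambda,H)\in\overline{\mathcal Q}\}\subset\mathrm{Homeo}(M)$ (it is contained in $\mathrm{Homeo}^\Omega_0(M)$). Mass flow homomorphism. $\mathrm{Homeo}^\Omega(M)$ is the group of homeomorphisms preserving $\mu$, with the $C^0$-topology, and $\mathrm{Homeo}^\Omega_0(M)$ is the path-component of the identity in it. For $c=(h_t)\in\mathcal P(\mathrm{Homeo}^\Omega_0(M),id)$ and a continuous map $f:M\to S^1=\mathbb R/\mathbb Z$, the homotopy $f\circ h_t-f:M\to S^1$ vanishes at $t=0$, so it lifts uniquely to a homotopy $\overline{fh_t-f}:M\to\mathbb R$ with $\overline{fh_0-f}=0$; put $\widetilde\theta(c)(f)=\int_M\overline{fh_1-f}\,d\mu$. This depends only on the homotopy class of $f$ and on the homotopy class of $c$ relative to end points, and defines a homomorphism $\widetilde\theta:\widetilde{\mathrm{Homeo}^\Omega_0}(M)\to\mathrm{Hom}([M,S^1],\mathbb R)\cong H_1(M,\mathbb R)$ on the universal covering group $\pi:\widetilde{\mathrm{Homeo}^\Omega_0}(M)\to\mathrm{Homeo}^\Omega_0(M)$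 (homotopy classes of paths from $id$, with $\pi([c])=c(1)$). With $\Gamma=\widetilde\theta(\ker\pi)$, the mass flow homomorphism $\theta:\mathrm{Homeo}^\Omega_0(M)\to H_1(M,\mathbb R)/\Gamma$ is the induced homomorphism. *)

theory Defs
  imports "HOL-Analysis.Analysis" "HOL-Algebra.Coset"
begin

section \<open>Smooth maps between Euclidean spaces\<close>

primrec Ck_on :: "nat \<Rightarrow> ('a::euclidean_space \<Rightarrow> 'b::euclidean_space) \<Rightarrow> 'a set \<Rightarrow> bool" where
  "Ck_on 0 f S \<longleftrightarrow> continuous_on S f"
| "Ck_on (Suc k) f S \<longleftrightarrow>
     (\<forall>x\<in>S. f differentiable (at x)) \<and> (\<forall>v. Ck_on k (\<lambda>x. frechet_derivative f (at x) v) S)"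

text \<open>On a set that need not be open (such as \<open>[0,1] \<times> V\<close>), smooth means: locally the restriction of
  a smooth map on an open set.\<close>

definition smooth_on :: "'a::euclidean_space set \<Rightarrow> ('a \<Rightarrow> 'b::euclidean_space) \<Rightarrow> bool" where
  "smooth_on S f \<longleftrightarrow>
     (\<forall>x\<in>S. \<exists>V g. open V \<and> x \<in> V \<and> (\<forall>k. Ck_on k g V) \<and> (\<forall>y\<in>S \<inter> V. g y = f y))"

section \<open>Closed manifolds and tensors\<close>

text \<open>The manifold is the whole type \<open>'m\<close> together with a smooth atlas; the chart \<open>(U, x)\<close> has domain
  \<open>U\<close> and coordinates \<open>x\<close>. The index type is well-ordered only in order to have an enumerated
  standard basis.\<close>

type_synonym ('m, 'k) chart = "'m set \<times> ('m \<Rightarrow> (real, 'k) vec)"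

definition chart_inv :: "('m, 'k::finite) chart \<Rightarrow> real ^ 'k \<Rightarrow> 'm" where
  "chart_inv c = inv_into (fst c) (snd c)"

definition chart_image :: "('m, 'k::finite) chart \<Rightarrow> (real ^ 'k) set" where
  "chart_image c = snd c ` fst c"

definition is_chart :: "('m::topological_space, 'k::finite) chart \<Rightarrow> bool" where
  "is_chart c \<longleftrightarrow> open (fst c) \<and> open (chart_image c) \<and>
     homeomorphism (fst c) (chart_image c) (snd c) (chart_inv c)"

definition smooth_atlas :: "('m::topological_space, 'k::finite) chart set \<Rightarrow> bool" where
  "smooth_atlas A \<longleftrightarrow> (\<forall>c\<in>A. is_chart c) \<and> (\<Union>c\<in>A. fst c) = UNIV \<and>
     (\<forall>c\<in>A. \<forall>c'\<in>A. smooth_on (snd c ` (fst c \<inter> fst c')) (\<lambda>y. snd c' (chart_inv c y)))"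

text \<open>A covariant 2-tensor field \<open>T\<close> is given by its local representatives: \<open>T c p u v\<close> is the value
  at the point \<open>p\<close> on the two tangent vectors whose coordinates in the chart \<open>c\<close> are \<open>u\<close> and \<open>v\<close>.\<close>

type_synonym ('m, 'k) tensor2 =
  "('m, 'k) chart \<Rightarrow> 'm \<Rightarrow> (real, 'k) vec \<Rightarrow> (real, 'k) vec \<Rightarrow> real"

definition transition_deriv ::
  "('m, 'k::finite) chart \<Rightarrow> ('m, 'k) chart \<Rightarrow> 'm \<Rightarrow> real ^ 'k \<Rightarrow> real ^ 'k" where
  "transition_deriv c c' p = frechet_derivative (\<lambda>y. snd c' (chart_inv c y)) (at (snd c p))"

definition smooth_tensor2 :: "('m, 'k::finite) chart set \<Rightarrow> ('m, 'k) tensor2 \<Rightarrow> bool" where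
  "smooth_tensor2 A T \<longleftrightarrow>
     (\<forall>c\<in>A. \<forall>p\<in>fst c. bilinear (T c p)) \<and>
     (\<forall>c\<in>A. \<forall>u v. smooth_on (chart_image c) (\<lambda>y. T c (chart_inv c y) u v)) \<and>
     (\<forall>c\<in>A. \<forall>c'\<in>A. \<forall>p\<in>fst c \<inter> fst c'. \<forall>u v.
        T c p u v = T c' p (transition_deriv c c' p u) (transition_deriv c c' p v))"

section \<open>Symplectic forms and the Liouville measure\<close>

text \<open>\<open>partial_tensor2 T c p w u v\<close> is the derivative in direction \<open>w\<close> of the coefficient
  \<open>T(u,v)\<close>; for constant \<open>u, v, w\<close> the cyclic sum is the exterior derivative \<open>dT(u,v,w)\<close>.\<close>

definition partial_tensor2 ::
  "('m, 'k::finite) tensor2 \<Rightarrow> ('m, 'k) chart \<Rightarrow> 'm \<Rightarrow> real ^ 'k \<Rightarrow> real ^ 'k \<Rightarrow> real ^ 'k \<Rightarrow> real" where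
  "partial_tensor2 T c p w u v =
     frechet_derivative (\<lambda>y. T c (chart_inv c y) u v) (at (snd c p)) w"

definition ext_deriv2 ::
  "('m, 'k::finite) tensor2 \<Rightarrow> ('m, 'k) chart \<Rightarrow> 'm \<Rightarrow> real ^ 'k \<Rightarrow> real ^ 'k \<Rightarrow> real ^ 'k \<Rightarrow> real" where
  "ext_deriv2 T c p u v w =
     partial_tensor2 T c p u v w + partial_tensor2 T c p v w u + partial_tensor2 T c p w u v"

definition symplectic_form :: "('m, 'k::finite) chart set \<Rightarrow> ('m, 'k) tensor2 \<Rightarrow> bool" where
  "symplectic_form A \<omega> \<longleftrightarrow> smooth_tensor2 A \<omega> \<and>
     (\<forall>c\<in>A. \<forall>p\<in>fst c.
        (\<forall>u. \<omega> c p u u = 0) \<and>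
        (\<forall>u v w. ext_deriv2 \<omega> c p u v w = 0) \<and>
        (\<forall>u. (\<forall>v. \<omega> c p u v = 0) \<longrightarrow> u = 0))"

definition closed_connected_symplectic_manifold ::
  "nat \<Rightarrow> ('m::t2_space, 'k::finite) chart set \<Rightarrow> ('m, 'k) tensor2 \<Rightarrow> bool" where
  "closed_connected_symplectic_manifold n A \<omega> \<longleftrightarrow>
     CARD('k) = 2 * n \<and> compact (UNIV :: 'm set) \<and> connected (UNIV :: 'm set) \<and>
     smooth_atlas A \<and> symplectic_form A \<omega>"

text \<open>A \<open>k\<close>-form on a vector space is a function of a sequence of vectors that depends on the
  first \<open>k\<close> entries only.\<close>

definition wedge ::
  "nat \<Rightarrow> nat \<Rightarrow> ((nat \<Rightarrow> 'v) \<Rightarrow> real) \<Rightarrow> ((nat \<Rightarrow> 'v) \<Rightarrow> real) \<Rightarrow> (nat \<Rightarrow> 'v) \<Rightarrow> real" where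
  "wedge k l \<alpha> \<beta> v =
     (\<Sum>p | p permutes {..<k + l}.
        of_int (sign p) * \<alpha> (\<lambda>i. v (p i)) * \<beta> (\<lambda>i. v (p (k + i)))) / (fact k * fact l)"

primrec wedge_power2 :: "((nat \<Rightarrow> 'v) \<Rightarrow> real) \<Rightarrow> nat \<Rightarrow> (nat \<Rightarrow> 'v) \<Rightarrow> real" where
  "wedge_power2 \<alpha> 0 = (\<lambda>v. 1)"
| "wedge_power2 \<alpha> (Suc m) = wedge 2 (2 * m) \<alpha> (wedge_power2 \<alpha> m)"

definition std_basis :: "nat \<Rightarrow> real ^ 'k::{finite,wellorder}" where
  "std_basis i = axis (sorted_list_of_set UNIV ! i) 1"

definition volume_form ::
  "nat \<Rightarrow> ('m, 'k::finite) tensor2 \<Rightarrow> ('m, 'k) chart \<Rightarrow> 'm \<Rightarrow> (nat \<Rightarrow> real ^ 'k) \<Rightarrow> real" where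
  "volume_form n \<omega> c p v = wedge_power2 (\<lambda>u. \<omega> c p (u 0) (u 1)) n v / fact n"

text \<open>The measure induced by the volume form: its density in coordinates is the absolute
  value of the coefficient of \<open>dx\<^sub>1 \<and> \<dots> \<and> dx\<^sub>2\<^sub>n\<close>. These conditions determine the measure.\<close>

definition liouville_measure ::
  "nat \<Rightarrow> ('m::topological_space, 'k::{finite,wellorder}) chart set \<Rightarrow> ('m, 'k) tensor2 \<Rightarrow>
   'm measure \<Rightarrow> bool" where
  "liouville_measure n A \<omega> \<mu> \<longleftrightarrow> sets \<mu> = sets borel \<and>
     (\<forall>c\<in>A. \<forall>B\<in>sets borel. B \<subseteq> fst c \<longrightarrow>
        emeasure \<mu> B =
          (\<integral>\<^sup>+ y\<in>snd c ` B. ennreal \<bar>volume_form n \<omega> c (chart_inv c y) std_basis\<bar> \<partial>lborel))"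

section \<open>Riemannian distance\<close>

definition riemannian_metric :: "('m, 'k::finite) chart set \<Rightarrow> ('m, 'k) tensor2 \<Rightarrow> bool" where
  "riemannian_metric A g \<longleftrightarrow> smooth_tensor2 A g \<and>
     (\<forall>c\<in>A. \<forall>p\<in>fst c. (\<forall>u v. g c p u v = g c p v u) \<and> (\<forall>u. u \<noteq> 0 \<longrightarrow> 0 < g c p u u))"

definition smooth_curve_on ::
  "('m::topological_space, 'k::finite) chart set \<Rightarrow> real set \<Rightarrow> (real \<Rightarrow> 'm) \<Rightarrow> bool" where
  "smooth_curve_on A I \<gamma> \<longleftrightarrow> continuous_on I \<gamma> \<and>
     (\<forall>c\<in>A. smooth_on {t\<in>I. \<gamma> t \<in> fst c} (\<lambda>t. snd c (\<gamma> t)))"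

text \<open>\<open>S\<close> is the set of break points.\<close>

definition piecewise_smooth_curve ::
  "('m::topological_space, 'k::finite) chart set \<Rightarrow> (real \<Rightarrow> 'm) \<Rightarrow> bool" where
  "piecewise_smooth_curve A \<gamma> \<longleftrightarrow>
     (\<exists>S. finite S \<and> {0, 1} \<subseteq> S \<and> S \<subseteq> {0..1} \<and>
        (\<forall>a\<in>S. \<forall>b\<in>S. a < b \<and> {a<..<b} \<inter> S = {} \<longrightarrow> smooth_curve_on A {a..b} \<gamma>))"

definition speed ::
  "('m, 'k::finite) chart set \<Rightarrow> ('m, 'k) tensor2 \<Rightarrow> (real \<Rightarrow> 'm) \<Rightarrow> real \<Rightarrow> real" where
  "speed A g \<gamma> t =
     (let c = (SOME c. c \<in> A \<and> \<gamma> t \<in> fst c);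
          v = vector_derivative (\<lambda>s. snd c (\<gamma> s)) (at t)
      in sqrt (g c (\<gamma> t) v v))"

definition riemannian_dist ::
  "('m::topological_space, 'k::finite) chart set \<Rightarrow> ('m, 'k) tensor2 \<Rightarrow> 'm \<Rightarrow> 'm \<Rightarrow> real" where
  "riemannian_dist A g x y =
     Inf {integral {0..1} (speed A g \<gamma>) | \<gamma>. piecewise_smooth_curve A \<gamma> \<and> \<gamma> 0 = x \<and> \<gamma> 1 = y}"

section \<open>Homeomorphism groups and their paths\<close>

definition Homeo :: "('m::topological_space \<Rightarrow> 'm) set" where
  "Homeo = {\<phi>. homeomorphism UNIV UNIV \<phi> (inv_into UNIV \<phi>)}"

definition dist_C0 :: "('m \<Rightarrow> 'm \<Rightarrow> real) \<Rightarrow> ('m \<Rightarrow> 'm) \<Rightarrow> ('m \<Rightarrow> 'm) \<Rightarrow> real" where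
  "dist_C0 d \<phi> \<psi> = (SUP x. d (\<phi> x) (\<psi> x))"

definition dist_bar :: "('m \<Rightarrow> 'm \<Rightarrow> real) \<Rightarrow> ('m \<Rightarrow> 'm) \<Rightarrow> ('m \<Rightarrow> 'm) \<Rightarrow> real" where
  "dist_bar d \<phi> \<psi> = max (dist_C0 d \<phi> \<psi>) (dist_C0 d (inv_into UNIV \<phi>) (inv_into UNIV \<psi>))"

definition C0_topology :: "('m::topological_space \<Rightarrow> 'm \<Rightarrow> real) \<Rightarrow> ('m \<Rightarrow> 'm) topology" where
  "C0_topology d = Metric_space.mtopology Homeo (dist_bar d)"

definition paths_from_id ::
  "('m::topological_space \<Rightarrow> 'm \<Rightarrow> real) \<Rightarrow> ('m \<Rightarrow> 'm) set \<Rightarrow> (real \<Rightarrow> 'm \<Rightarrow> 'm) set" where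
  "paths_from_id d G = {\<gamma>. pathin (subtopology (C0_topology d) G) \<gamma> \<and> \<gamma> 0 = id}"

definition path_dist ::
  "('m \<Rightarrow> 'm \<Rightarrow> real) \<Rightarrow> (real \<Rightarrow> 'm \<Rightarrow> 'm) \<Rightarrow> (real \<Rightarrow> 'm \<Rightarrow> 'm) \<Rightarrow> real" where
  "path_dist d \<gamma> \<gamma>' = (SUP t\<in>{0..1}. dist_bar d (\<gamma> t) (\<gamma>' t))"

definition Homeo_vol :: "'m::topological_space measure \<Rightarrow> ('m \<Rightarrow> 'm) set" where
  "Homeo_vol \<mu> = {h \<in> Homeo. distr \<mu> \<mu> h = \<mu>}"

definition Homeo_vol0 ::
  "('m::topological_space \<Rightarrow> 'm \<Rightarrow> real) \<Rightarrow> 'm measure \<Rightarrow> ('m \<Rightarrow> 'm) set" where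
  "Homeo_vol0 d \<mu> = path_component_of_set (subtopology (C0_topology d) (Homeo_vol \<mu>)) id"

section \<open>Hamiltonian homeomorphisms\<close>

definition normalized_hamiltonians ::
  "('m, 'k::finite) chart set \<Rightarrow> 'm measure \<Rightarrow> (real \<Rightarrow> 'm \<Rightarrow> real) set" where
  "normalized_hamiltonians A \<mu> =
     {H. (\<forall>c\<in>A. smooth_on ({0..1} \<times> chart_image c) (\<lambda>(t, y). H t (chart_inv c y))) \<and>
         (\<forall>t\<in>{0..1}. (\<integral>x. H t x \<partial>\<mu>) = 0)}"

text \<open>Coordinates in the chart \<open>c\<close> of the vector \<open>X\<close> at \<open>p\<close> with \<open>\<omega>(X, \<cdot>) = df\<close>.\<close>

definition hamiltonian_field ::
  "('m, 'k::finite) tensor2 \<Rightarrow> ('m \<Rightarrow> real) \<Rightarrow> ('m, 'k) chart \<Rightarrow> 'm \<Rightarrow> real ^ 'k" where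
  "hamiltonian_field \<omega> f c p =
     (THE u. \<forall>v. \<omega> c p u v = frechet_derivative (\<lambda>y. f (chart_inv c y)) (at (snd c p)) v)"

definition is_hamiltonian_flow ::
  "('m::topological_space, 'k::finite) chart set \<Rightarrow> ('m, 'k) tensor2 \<Rightarrow> (real \<Rightarrow> 'm \<Rightarrow> real) \<Rightarrow>
   (real \<Rightarrow> 'm \<Rightarrow> 'm) \<Rightarrow> bool" where
  "is_hamiltonian_flow A \<omega> H \<phi> \<longleftrightarrow>
     \<phi> 0 = id \<and>
     (\<forall>x. continuous_on {0..1} (\<lambda>t. \<phi> t x)) \<and>
     (\<forall>x. \<forall>t\<in>{0..1}. \<forall>c\<in>A. \<phi> t x \<in> fst c \<longrightarrow>
        ((\<lambda>s. snd c (\<phi> s x)) has_vector_derivative hamiltonian_field \<omega> (H t) c (\<phi> t x))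
          (at t within {0..1}))"

definition ham_norm :: "(real \<Rightarrow> 'm \<Rightarrow> real) \<Rightarrow> real" where
  "ham_norm H = integral {0..1} (\<lambda>t. (SUP x. H t x) - (INF x. H t x))"

definition ham_dist :: "(real \<Rightarrow> 'm \<Rightarrow> real) \<Rightarrow> (real \<Rightarrow> 'm \<Rightarrow> real) \<Rightarrow> real" where
  "ham_dist H K = ham_norm (\<lambda>t x. H t x - K t x)"

text \<open>The completion: Cauchy sequences modulo sequences whose distance tends to 0.\<close>

definition ham_cauchy ::
  "('m, 'k::finite) chart set \<Rightarrow> 'm measure \<Rightarrow> (nat \<Rightarrow> real \<Rightarrow> 'm \<Rightarrow> real) set" where
  "ham_cauchy A \<mu> =
     {F. (\<forall>i. F i \<in> normalized_hamiltonians A \<mu>) \<and>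
         (\<forall>e>0. \<exists>N. \<forall>i\<ge>N. \<forall>j\<ge>N. ham_dist (F i) (F j) < e)}"

definition ham_cauchy_rel ::
  "('m, 'k::finite) chart set \<Rightarrow> 'm measure \<Rightarrow> (nat \<Rightarrow> real \<Rightarrow> 'm \<Rightarrow> real) rel" where
  "ham_cauchy_rel A \<mu> =
     {(F, G). F \<in> ham_cauchy A \<mu> \<and> G \<in> ham_cauchy A \<mu> \<and> (\<lambda>i. ham_dist (F i) (G i)) \<longlonglongrightarrow> 0}"

type_synonym 'm completed_ham = "(nat \<Rightarrow> real \<Rightarrow> 'm \<Rightarrow> real) set"

definition ham_completion ::
  "('m, 'k::finite) chart set \<Rightarrow> 'm measure \<Rightarrow> 'm completed_ham set" where
  "ham_completion A \<mu> = ham_cauchy A \<mu> // ham_cauchy_rel A \<mu>"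

definition ham_embed ::
  "('m, 'k::finite) chart set \<Rightarrow> 'm measure \<Rightarrow> (real \<Rightarrow> 'm \<Rightarrow> real) \<Rightarrow> 'm completed_ham" where
  "ham_embed A \<mu> H = ham_cauchy_rel A \<mu> `` {\<lambda>i. H}"

definition ham_completion_dist :: "'m completed_ham \<Rightarrow> 'm completed_ham \<Rightarrow> real" where
  "ham_completion_dist X Y = (THE r. \<forall>F\<in>X. \<forall>G\<in>Y. (\<lambda>i. ham_dist (F i) (G i)) \<longlonglongrightarrow> r)"

text \<open>Paths are functions on all of the reals of which only the restriction to \<open>[0,1]\<close> matters;
  likewise for Hamiltonians.\<close>

definition ham_Q ::
  "('m::topological_space, 'k::finite) chart set \<Rightarrow> ('m, 'k) tensor2 \<Rightarrow> 'm measure \<Rightarrow>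
   ('m \<Rightarrow> 'm \<Rightarrow> real) \<Rightarrow> ((real \<Rightarrow> 'm \<Rightarrow> 'm) \<times> 'm completed_ham) set" where
  "ham_Q A \<omega> \<mu> d =
     {(\<phi>, ham_embed A \<mu> H) | \<phi> H.
        H \<in> normalized_hamiltonians A \<mu> \<and> is_hamiltonian_flow A \<omega> H \<phi> \<and>
        \<phi> \<in> paths_from_id d Homeo}"

definition ham_Q_closure ::
  "('m::topological_space, 'k::finite) chart set \<Rightarrow> ('m, 'k) tensor2 \<Rightarrow> 'm measure \<Rightarrow>
   ('m \<Rightarrow> 'm \<Rightarrow> real) \<Rightarrow> ((real \<Rightarrow> 'm \<Rightarrow> 'm) \<times> 'm completed_ham) set" where
  "ham_Q_closure A \<omega> \<mu> d =
     {(\<gamma>, X). \<gamma> \<in> paths_from_id d Homeo \<and> X \<in> ham_completion A \<mu> \<and>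
        (\<forall>e>0. \<exists>(\<phi>, Y) \<in> ham_Q A \<omega> \<mu> d. path_dist d \<gamma> \<phi> + ham_completion_dist X Y < e)}"

definition Hameo ::
  "('m::topological_space, 'k::finite) chart set \<Rightarrow> ('m, 'k) tensor2 \<Rightarrow> 'm measure \<Rightarrow>
   ('m \<Rightarrow> 'm \<Rightarrow> real) \<Rightarrow> ('m \<Rightarrow> 'm) set" where
  "Hameo A \<omega> \<mu> d = {\<gamma> 1 | \<gamma> X. (\<gamma>, X) \<in> ham_Q_closure A \<omega> \<mu> d}"

section \<open>The mass flow homomorphism\<close>

text \<open>\<open>S\<^sup>1 = \<real>/\<int>\<close> is the unit circle in the complex plane, \<open>s + \<int>\<close> corresponding to
  \<open>cis (2 * pi * s)\<close>; so differences of circle-valued maps become quotients.\<close>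

definition circle_maps :: "('m::topological_space \<Rightarrow> complex) set" where
  "circle_maps = {f. continuous_on UNIV f \<and> f ` UNIV \<subseteq> sphere 0 1}"

definition circle_homotopy :: "('m::topological_space \<Rightarrow> complex) rel" where
  "circle_homotopy = {(f, f'). f \<in> circle_maps \<and> f' \<in> circle_maps \<and>
     homotopic_with_canon (\<lambda>_. True) UNIV (sphere 0 1) f f'}"

text \<open>The group \<open>[M, S\<^sup>1]\<close>.\<close>

definition circle_classes :: "('m::topological_space \<Rightarrow> complex) set monoid" where
  "circle_classes =
     \<lparr>carrier = circle_maps // circle_homotopy,
      mult = (\<lambda>X Y. circle_homotopy `` {(\<lambda>x. f x * g x) | f g. f \<in> X \<and> g \<in> Y}),
      one = circle_homotopy `` {\<lambda>x. 1}\<rparr>"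

definition real_add_group :: "real monoid" where
  "real_add_group = \<lparr>carrier = UNIV, mult = (+), one = 0\<rparr>"

text \<open>The group \<open>Hom([M, S\<^sup>1], \<real>)\<close>, which is identified with \<open>H\<^sub>1(M, \<real>)\<close>.\<close>

definition circle_hom :: "(('m::topological_space \<Rightarrow> complex) set \<Rightarrow> real) monoid" where
  "circle_hom =
     \<lparr>carrier = hom circle_classes real_add_group \<inter> extensional (carrier circle_classes),
      mult = (\<lambda>a b. \<lambda>X\<in>carrier circle_classes. a X + b X),
      one = (\<lambda>X\<in>carrier circle_classes. 0)\<rparr>"

text \<open>\<open>F\<close> is the lift of the homotopy \<open>f \<circ> h\<^sub>t - f\<close> starting at 0; it is unique on
  \<open>[0,1] \<times> M\<close>.\<close>

definition is_flow_lift ::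
  "(real \<Rightarrow> 'm::topological_space \<Rightarrow> 'm) \<Rightarrow> ('m \<Rightarrow> complex) \<Rightarrow> (real \<times> 'm \<Rightarrow> real) \<Rightarrow> bool" where
  "is_flow_lift h f F \<longleftrightarrow> continuous_on ({0..1} \<times> UNIV) F \<and> (\<forall>x. F (0, x) = 0) \<and>
     (\<forall>t\<in>{0..1}. \<forall>x. cis (2 * pi * F (t, x)) = f (h t x) / f x)"

definition path_mass_flow ::
  "'m::topological_space measure \<Rightarrow> (real \<Rightarrow> 'm \<Rightarrow> 'm) \<Rightarrow> ('m \<Rightarrow> complex) \<Rightarrow> real" where
  "path_mass_flow \<mu> h f = (\<integral>x. (SOME F. is_flow_lift h f F) (1, x) \<partial>\<mu>)"

definition path_homotopy ::
  "('m::topological_space \<Rightarrow> 'm \<Rightarrow> real) \<Rightarrow> 'm measure \<Rightarrow> (real \<Rightarrow> 'm \<Rightarrow> 'm) rel" where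
  "path_homotopy d \<mu> =
     {(c, c'). c \<in> paths_from_id d (Homeo_vol0 d \<mu>) \<and> c' \<in> paths_from_id d (Homeo_vol0 d \<mu>) \<and>
        homotopic_with (\<lambda>\<gamma>. \<gamma> 0 = id \<and> \<gamma> 1 = c 1) (top_of_set {0..1})
          (subtopology (C0_topology d) (Homeo_vol0 d \<mu>)) c c'}"

definition universal_cover ::
  "('m::topological_space \<Rightarrow> 'm \<Rightarrow> real) \<Rightarrow> 'm measure \<Rightarrow> (real \<Rightarrow> 'm \<Rightarrow> 'm) set set" where
  "universal_cover d \<mu> = paths_from_id d (Homeo_vol0 d \<mu>) // path_homotopy d \<mu>"

definition cover_proj :: "(real \<Rightarrow> 'm \<Rightarrow> 'm) set \<Rightarrow> 'm \<Rightarrow> 'm" where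
  "cover_proj C = the_elem ((\<lambda>c. c 1) ` C)"

definition mass_flow_cover ::
  "'m::topological_space measure \<Rightarrow> (real \<Rightarrow> 'm \<Rightarrow> 'm) set \<Rightarrow> ('m \<Rightarrow> complex) set \<Rightarrow> real" where
  "mass_flow_cover \<mu> C =
     (\<lambda>X\<in>carrier circle_classes. the_elem ((\<lambda>(c, f). path_mass_flow \<mu> c f) ` (C \<times> X)))"

definition mass_flow_Gamma ::
  "('m::topological_space \<Rightarrow> 'm \<Rightarrow> real) \<Rightarrow> 'm measure \<Rightarrow> (('m \<Rightarrow> complex) set \<Rightarrow> real) set" where
  "mass_flow_Gamma d \<mu> = mass_flow_cover \<mu> ` {C \<in> universal_cover d \<mu>. cover_proj C = id}"

definition mass_flow_target ::
  "('m::topological_space \<Rightarrow> 'm \<Rightarrow> real) \<Rightarrow> 'm measure \<Rightarrow>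
   (('m \<Rightarrow> complex) set \<Rightarrow> real) set monoid" where
  "mass_flow_target d \<mu> = circle_hom Mod mass_flow_Gamma d \<mu>"

definition mass_flow ::
  "('m::topological_space \<Rightarrow> 'm \<Rightarrow> real) \<Rightarrow> 'm measure \<Rightarrow> ('m \<Rightarrow> 'm) \<Rightarrow>
   (('m \<Rightarrow> complex) set \<Rightarrow> real) set" where
  "mass_flow d \<mu> h =
     the_elem ((\<lambda>C. mass_flow_Gamma d \<mu> #>\<^bsub>circle_hom\<^esub> mass_flow_cover \<mu> C) `
       {C \<in> universal_cover d \<mu>. cover_proj C = h})"

end

theory Submission imports Defs
begin

text \<open>For the flow \<open>\<phi>\<close> of a smooth Hamiltonian \<open>H\<close> and a smooth map \<open>f\<close> to the circle with local lifts \<open>k\<close>,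
  the mass flow \<open>\<integral> (f \<circ> \<phi>\<^sub>t - f) d\<mu>\<close> has time derivative \<open>\<integral> dk(X\<^sub>H) \<circ> \<phi>\<^sub>t d\<mu>\<close>, which equals
  \<open>\<integral> dk(X\<^sub>H) d\<mu>\<close> by Liouville's theorem and vanishes because \<open>X\<^sub>H\<close> is divergence free and \<open>dk\<close> is closed.
  So smooth Hamiltonian paths preserve \<open>\<mu>\<close> and have mass flow zero. Both properties pass to
  \<open>C\<^sup>0\<close>-limits of paths: for two uniformly close paths the quotient of the circle-valued homotopies stays near 1,
  so that the difference of their lifts is uniformly small.\<close>

section \<open>Calculus of \<open>C\<^sup>k\<close> maps\<close>

text \<open>The type of points is only a Hausdorff space and \<open>riemannian_dist\<close> is an
  infimum over curves. It must first be shown to be a metric for the given topology; only then does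
  closeness in \<open>path_dist\<close> say anything about continuous functions. A Hamiltonian flow
  is given as a solution of an ODE for each point separately, with continuity but no derivative in
  the point, and a path in the closure is merely continuous. Invariance of \<mu> and mass flow are
  therefore treated through integrals of test functions, which survive uniform limits. Test
  functions of class C^2 suffice: a Hamiltonian field costs one derivative and its divergence
  another. The density enters through its logarithmic derivative \<open>tau\<close>, which cancels
  against the divergence of the field; this one cancellation serves both Liouville's theorem and the
  vanishing of the flux. Finally, \<open>mass_flow\<close> is built from \<open>the_elem\<close> of
  images of classes, so its value becomes accessible only after invariance under homotopy of the
  path and of the circle map, and closure of \<open>mass_flow_Gamma\<close> under differences, are
  known.\<close>

lemma has_derivative_cong_open:
  assumes "open S" "x \<in> S" "\<And>y. y \<in> S \<Longrightarrow> f y = g y"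
  shows "(f has_derivative D) (at x) \<longleftrightarrow> (g has_derivative D) (at x)"
  using assms has_derivative_transform_within_open[of f D x UNIV S g]
    has_derivative_transform_within_open[of g D x UNIV S f] by fastforce

lemma frechet_derivative_cong_open:
  assumes "open S" "x \<in> S" "\<And>y. y \<in> S \<Longrightarrow> f y = g y"
  shows "frechet_derivative f (at x) = frechet_derivative g (at x)"
  unfolding frechet_derivative_def using has_derivative_cong_open[OF assms] by simp

lemma Ck_on_cong:
  assumes "open S" "\<And>y. y \<in> S \<Longrightarrow> f y = g y"
  shows "Ck_on k f S \<longleftrightarrow> Ck_on k g S"
  using assms(2)
proof (induction k arbitrary: f g)
  case 0
  then show ?case by (simp cong: continuous_on_cong)
next
  case (Suc k)
  have 1: "f differentiable (at x) \<longleftrightarrow> g differentiable (at x)" if "x \<in> S" for x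
    unfolding differentiable_def using has_derivative_cong_open[of S x f g] assms(1) that Suc.prems by blast
  have 2: "Ck_on k (\<lambda>x. frechet_derivative f (at x) v) S \<longleftrightarrow>
           Ck_on k (\<lambda>x. frechet_derivative g (at x) v) S" for v
    by (rule Suc.IH) (simp add: frechet_derivative_cong_open[OF assms(1) _ Suc.prems])
  show ?case using 1 2 by simp
qed

lemma Ck_on_subset: "Ck_on k f S \<Longrightarrow> T \<subseteq> S \<Longrightarrow> Ck_on k f T"
  by (induction k arbitrary: f) (auto intro: continuous_on_subset)

lemma Ck_on_SucD: "Ck_on (Suc k) f S \<Longrightarrow> Ck_on k f S"
proof (induction k arbitrary: f)
  case 0
  then show ?case
    by (auto intro!: continuous_at_imp_continuous_on differentiable_imp_continuous_within)
next
  case (Suc k)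
  then show ?case by (metis Ck_on.simps(2))
qed

lemma Ck_on_le: "Ck_on k f S \<Longrightarrow> j \<le> k \<Longrightarrow> Ck_on j f S"
  by (induction k) (auto simp: le_Suc_eq simp del: Ck_on.simps dest: Ck_on_SucD)

lemma Ck_on_continuous_on: "Ck_on k f S \<Longrightarrow> continuous_on S f"
  using Ck_on_le[of k f S 0] by simp

lemma Ck_on_has_derivative:
  "Ck_on (Suc k) f S \<Longrightarrow> x \<in> S \<Longrightarrow> (f has_derivative frechet_derivative f (at x)) (at x)"
  by (simp add: frechet_derivative_works)

lemma Ck_on_frechet:
  "Ck_on (Suc k) f S \<Longrightarrow> Ck_on k (\<lambda>x. frechet_derivative f (at x) v) S"
  by simp

text \<open>\<open>Ck_on\<close> speaks of the chosen \<open>frechet_derivative\<close>. Uniqueness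
  of derivatives on an open set lets an explicit formula \<open>D\<close> take its place, so the
  closure properties below become inductions over the differentiation rules.\<close>

lemma Ck_on_SucI:
  assumes "open S" "\<And>x. x \<in> S \<Longrightarrow> (f has_derivative D x) (at x)" "\<And>v. Ck_on k (\<lambda>x. D x v) S"
  shows "Ck_on (Suc k) f S"
proof -
  have "Ck_on k (\<lambda>x. frechet_derivative f (at x) v) S" for v
  proof (subst Ck_on_cong[OF assms(1)])
    show "frechet_derivative f (at y) v = D y v" if "y \<in> S" for y
      using frechet_derivative_at[OF assms(2)[OF that]] by simp
  qed (use assms(3) in auto)
  moreover have "\<forall>x\<in>S. f differentiable (at x)"
    using assms(2) differentiable_def by blast
  ultimately show ?thesis by simp
qed

lemma Ck_on_local:
  assumes "\<And>x. x \<in> S \<Longrightarrow> \<exists>V. open V \<and> x \<in> V \<and> Ck_on k f V"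
  shows "Ck_on k f S"
  using assms
proof (induction k arbitrary: f)
  case 0
  show ?case unfolding Ck_on.simps
  proof (rule continuous_at_imp_continuous_on, rule ballI)
    fix x assume "x \<in> S"
    then obtain V where "open V" "x \<in> V" "continuous_on V f" using 0 by force
    then show "isCont f x" using continuous_on_eq_continuous_at by blast
  qed
next
  case (Suc k)
  have "f differentiable (at x)" if "x \<in> S" for x
    using Suc.prems[OF that] by auto
  moreover have "Ck_on k (\<lambda>x. frechet_derivative f (at x) v) S" for v
    by (rule Suc.IH) (use Suc.prems in fastforce)
  ultimately show ?case by simp
qed

text \<open>The local extensions in \<open>smooth_on\<close> can differ from \<open>f\<close> only
  off \<open>S\<close>; near a point of an open set there is nothing off \<open>S\<close>.\<close>

lemma smooth_on_open:
  assumes "open S"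
  shows "smooth_on S f \<longleftrightarrow> (\<forall>k. Ck_on k f S)"
proof
  assume L: "smooth_on S f"
  show "\<forall>k. Ck_on k f S"
  proof (rule allI, rule Ck_on_local)
    fix k x assume "x \<in> S"
    then obtain V g where V: "open V" "x \<in> V" "\<forall>k. Ck_on k g V" "\<forall>y\<in>S \<inter> V. g y = f y"
      using L unfolding smooth_on_def by blast
    have "Ck_on k g (S \<inter> V)" using V(3) Ck_on_subset by blast
    then have "Ck_on k f (S \<inter> V)"
      using Ck_on_cong[of "S \<inter> V" g f k] V assms by blast
    then show "\<exists>V. open V \<and> x \<in> V \<and> Ck_on k f V"
      using V \<open>x \<in> S\<close> assms by (intro exI[of _ "S \<inter> V"]) auto
  qed
next
  assume "\<forall>k. Ck_on k f S"
  then show "smooth_on S f" unfolding smooth_on_def using assms by blast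
qed

lemma smooth_on_subset: "smooth_on S f \<Longrightarrow> T \<subseteq> S \<Longrightarrow> smooth_on T f"
  unfolding smooth_on_def by (meson Int_mono order_refl subsetD)

lemma smooth_on_cong: "smooth_on S f \<Longrightarrow> (\<And>x. x \<in> S \<Longrightarrow> f x = g x) \<Longrightarrow> smooth_on S g"
  unfolding smooth_on_def by (metis IntD1)

section \<open>Closure properties of the class C^k\<close>

lemma Ck_on_const [simp]: "Ck_on k (\<lambda>x. c) S"
proof -
  have "Ck_on k (\<lambda>x. c) UNIV"
  proof (induction k arbitrary: c)
    case (Suc k)
    then show ?case by (intro Ck_on_SucI[where D="\<lambda>x v. 0"]) auto
  qed simp
  then show ?thesis using Ck_on_subset by blast
qed

lemma Ck_on_bounded_linear:
  assumes "bounded_linear f"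
  shows "Ck_on k f S"
proof -
  have "Ck_on k f UNIV"
  proof (cases k)
    case 0
    then show ?thesis using assms by (simp add: linear_continuous_on)
  next
    case (Suc j)
    show ?thesis unfolding Suc
      by (rule Ck_on_SucI[where D="\<lambda>x v. f v"])
        (use assms in \<open>auto intro: bounded_linear_imp_has_derivative\<close>)
  qed
  then show ?thesis using Ck_on_subset by blast
qed

lemma Ck_on_id [simp]: "Ck_on k (\<lambda>x. x) S"
  by (rule Ck_on_bounded_linear) (rule bounded_linear_ident)

lemma Ck_on_add:
  assumes "open S" "Ck_on k f S" "Ck_on k g S"
  shows "Ck_on k (\<lambda>x. f x + g x) S"
  using assms(2,3)
proof (induction k arbitrary: f g)
  case 0 then show ?case by (auto intro: continuous_intros)
next
  case (Suc k)
  show ?case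
    by (rule Ck_on_SucI[OF assms(1) has_derivative_add[OF Ck_on_has_derivative[OF Suc.prems(1)] Ck_on_has_derivative[OF Suc.prems(2)]]])
      (use Suc in auto)
qed

text \<open>Leibniz: the derivative is a sum of two terms of the same shape, each with one factor
  differentiated and the other read at the lower class. An arbitrary bilinear \<open>h\<close>
  covers products, scalings and inner products in one induction.\<close>

lemma Ck_on_bilinear:
  assumes "bounded_bilinear h" "open S" "Ck_on k f S" "Ck_on k g S"
  shows "Ck_on k (\<lambda>x. h (f x) (g x)) S"
  using assms(3,4)
proof (induction k arbitrary: f g)
  case 0 then show ?case using bounded_bilinear.continuous_on[OF assms(1)] by auto
next
  case (Suc k)
  show ?case
    by (rule Ck_on_SucI[OF assms(2) bounded_bilinear.FDERIV[OF assms(1) Ck_on_has_derivative[OF Suc.prems(1)] Ck_on_has_derivative[OF Suc.prems(2)]]], assumption, assumption)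
      (intro Ck_on_add[OF assms(2)] Suc.IH Ck_on_SucD[OF Suc.prems(1)] Ck_on_SucD[OF Suc.prems(2)]
        Ck_on_frechet[OF Suc.prems(1)] Ck_on_frechet[OF Suc.prems(2)])
qed

lemmas Ck_on_mult = Ck_on_bilinear[OF bounded_bilinear_mult]
lemmas Ck_on_scaleR = Ck_on_bilinear[OF bounded_bilinear_scaleR]
lemmas Ck_on_inner = Ck_on_bilinear[OF bounded_bilinear_inner]

lemma Ck_on_uminus: "open S \<Longrightarrow> Ck_on k f S \<Longrightarrow> Ck_on k (\<lambda>x. - f x) S"
  using Ck_on_scaleR[of S k "\<lambda>x. -1" f] by simp

lemma Ck_on_diff: "open S \<Longrightarrow> Ck_on k f S \<Longrightarrow> Ck_on k g S \<Longrightarrow> Ck_on k (\<lambda>x. f x - g x) S"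
  using Ck_on_add[of S k f "\<lambda>x. - g x"] Ck_on_uminus[of S k g] by simp

lemma Ck_on_sum:
  assumes "open S" "\<And>i. i \<in> I \<Longrightarrow> Ck_on k (f i) S"
  shows "Ck_on k (\<lambda>x. \<Sum>i\<in>I. f i x) S"
  using assms(2) by (induction I rule: infinite_finite_induct) (auto intro: Ck_on_add assms(1))

lemma Ck_on_prod:
  fixes f :: "'i \<Rightarrow> 'a::euclidean_space \<Rightarrow> real"
  assumes "open S" "\<And>i. i \<in> I \<Longrightarrow> Ck_on k (f i) S"
  shows "Ck_on k (\<lambda>x. \<Prod>i\<in>I. f i x) S"
  using assms(2) by (induction I rule: infinite_finite_induct) (auto intro: Ck_on_mult assms(1))

text \<open>The derivative of the reciprocal is a product that contains the reciprocal itself, so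
  the induction hypothesis for the same \<open>f\<close> applies.\<close>

lemma Ck_on_inverse:
  fixes f :: "'a::euclidean_space \<Rightarrow> real"
  assumes "open S" "Ck_on k f S" "\<And>x. x \<in> S \<Longrightarrow> f x \<noteq> 0"
  shows "Ck_on k (\<lambda>x. inverse (f x)) S"
  using assms(2)
proof (induction k)
  case 0 then show ?case using assms(3) by (auto intro: continuous_intros)
next
  case (Suc k)
  show ?case
  proof (rule Ck_on_SucI[OF assms(1)])
    show "((\<lambda>x. inverse (f x)) has_derivative
        (\<lambda>v. - (inverse (f x) * frechet_derivative f (at x) v * inverse (f x)))) (at x)" if "x \<in> S" for x
      by (rule Deriv.has_derivative_inverse[OF assms(3)[OF that] Ck_on_has_derivative[OF Suc.prems that]])
    show "Ck_on k (\<lambda>x. - (inverse (f x) * frechet_derivative f (at x) v * inverse (f x))) S" for v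
      by (intro Ck_on_uminus Ck_on_mult assms(1) Suc.IH Ck_on_SucD[OF Suc.prems] Ck_on_frechet[OF Suc.prems])
  qed
qed

lemma Ck_on_divide:
  fixes f :: "'a::euclidean_space \<Rightarrow> real"
  assumes "open S" "Ck_on k f S" "Ck_on k g S" "\<And>x. x \<in> S \<Longrightarrow> g x \<noteq> 0"
  shows "Ck_on k (\<lambda>x. f x / g x) S"
  using Ck_on_mult[OF assms(1,2) Ck_on_inverse[OF assms(1,3,4)]] by (simp add: divide_inverse)

lemma linear_basis_expansion:
  fixes f :: "'a::euclidean_space \<Rightarrow> 'b::real_vector"
  assumes "linear f"
  shows "f v = (\<Sum>b\<in>Basis. (v \<bullet> b) *\<^sub>R f b)"
proof -
  have "f v = f (\<Sum>b\<in>Basis. (v \<bullet> b) *\<^sub>R b)" by (simp add: euclidean_representation)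
  also have "\<dots> = (\<Sum>b\<in>Basis. (v \<bullet> b) *\<^sub>R f b)"
    by (simp add: linear_sum[OF assms] linear_cmul[OF assms])
  finally show ?thesis .
qed

text \<open>In the chain rule both the base point and the direction of the derivative of
  \<open>f\<close> move with \<open>x\<close>, while \<open>Ck_on\<close> controls fixed directions
  only. Expanding the direction in the basis separates the two.\<close>

lemma Ck_on_compose:
  assumes "open S" "open T" "\<And>x. x \<in> S \<Longrightarrow> g x \<in> T" "Ck_on k f T" "Ck_on k g S"
  shows "Ck_on k (\<lambda>x. f (g x)) S"
  using assms(4,5)
proof (induction k arbitrary: f)
  case 0 then show ?case using assms(3) by (auto intro: continuous_on_compose2)
next
  case (Suc k)
  show ?case
  proof (rule Ck_on_SucI[OF assms(1)])
    fix x assume x: "x \<in> S"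
    have lin: "linear (frechet_derivative f (at (g x)))"
      using Ck_on_has_derivative[OF Suc.prems(1) assms(3)[OF x]] has_derivative_linear by blast
    have "((\<lambda>x. f (g x)) has_derivative
        (\<lambda>v. frechet_derivative f (at (g x)) (frechet_derivative g (at x) v))) (at x)"
      using diff_chain_at[OF Ck_on_has_derivative[OF Suc.prems(2) x] Ck_on_has_derivative[OF Suc.prems(1) assms(3)[OF x]]]
      by (simp add: o_def)
    moreover have "(\<lambda>v. frechet_derivative f (at (g x)) (frechet_derivative g (at x) v)) =
        (\<lambda>v. \<Sum>b\<in>Basis. (frechet_derivative g (at x) v \<bullet> b) *\<^sub>R frechet_derivative f (at (g x)) b)"
      by (rule ext, rule linear_basis_expansion[OF lin])
    ultimately show "((\<lambda>x. f (g x)) has_derivative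
        (\<lambda>v. \<Sum>b\<in>Basis. (frechet_derivative g (at x) v \<bullet> b) *\<^sub>R frechet_derivative f (at (g x)) b)) (at x)"
      by simp
  next
    fix v
    show "Ck_on k (\<lambda>x. \<Sum>b\<in>Basis. (frechet_derivative g (at x) v \<bullet> b) *\<^sub>R
        frechet_derivative f (at (g x)) b) S"
      by (intro Ck_on_sum Ck_on_scaleR Ck_on_inner Ck_on_const assms(1) Ck_on_frechet[OF Suc.prems(2)]
          Suc.IH[OF Ck_on_frechet[OF Suc.prems(1)] Ck_on_SucD[OF Suc.prems(2)]])
  qed
qed

lemma Ck_on_componentwise:
  fixes f :: "'a::euclidean_space \<Rightarrow> 'b::euclidean_space"
  assumes "open S" "\<And>b. b \<in> Basis \<Longrightarrow> Ck_on k (\<lambda>x. f x \<bullet> b) S"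
  shows "Ck_on k f S"
proof -
  have "Ck_on k (\<lambda>x. \<Sum>b\<in>Basis. (f x \<bullet> b) *\<^sub>R b) S"
    by (intro Ck_on_sum Ck_on_scaleR assms) auto
  then show ?thesis by (simp add: euclidean_representation)
qed

lemma Ck_on_vec:
  fixes f :: "'a::euclidean_space \<Rightarrow> real ^ 'n"
  assumes "open S" "\<And>i. Ck_on k (\<lambda>x. f x $ i) S"
  shows "Ck_on k f S"
  by (rule Ck_on_componentwise[OF assms(1)])
    (use assms(2) in \<open>auto simp: Basis_vec_def inner_axis\<close>)

lemma Ck_on_det:
  fixes M :: "'a::euclidean_space \<Rightarrow> real ^ 'n ^ 'n"
  assumes "open S" "\<And>i j. Ck_on k (\<lambda>x. M x $ i $ j) S"
  shows "Ck_on k (\<lambda>x. det (M x)) S"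
  unfolding det_def by (intro Ck_on_sum Ck_on_mult Ck_on_prod assms Ck_on_const)

section \<open>Lipschitz bounds and the symmetry of second derivatives\<close>

lemma frechet_derivative_basis_bound:
  fixes D :: "'a::euclidean_space \<Rightarrow> 'b::real_normed_vector" and B :: real
  assumes "linear D" "\<And>b. b \<in> Basis \<Longrightarrow> norm (D b) \<le> B"
  shows "norm (D v) \<le> (DIM('a) * B) * norm v"
proof -
  have "norm (D v) = norm (\<Sum>b\<in>Basis. (v \<bullet> b) *\<^sub>R D b)"
    using linear_basis_expansion[OF assms(1)] by metis
  also have "\<dots> \<le> (\<Sum>b\<in>(Basis::'a set). norm v * B)"
    by (rule sum_norm_le) (auto intro!: mult_mono Basis_le_norm assms(2))
  finally show ?thesis by (simp add: mult_ac)
qed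

text \<open>Only derivatives in fixed directions are known to be continuous. Bounding those along
  basis vectors on the compact \<open>K\<close> bounds the operator norm, and convexity allows the
  mean value inequality.\<close>

lemma Ck_on_lipschitz:
  fixes f :: "'a::euclidean_space \<Rightarrow> 'b::euclidean_space"
  assumes "open S" "Ck_on (Suc k) f S" "compact K" "convex K" "K \<subseteq> S"
  obtains L where "L \<ge> 0" "\<And>x y. x \<in> K \<Longrightarrow> y \<in> K \<Longrightarrow> norm (f x - f y) \<le> L * norm (x - y)"
proof -
  have "\<exists>B. \<forall>x\<in>K. norm (frechet_derivative f (at x) b) \<le> B" for b
  proof -
    have "continuous_on K (\<lambda>x. frechet_derivative f (at x) b)"
      using Ck_on_continuous_on[OF Ck_on_frechet[OF assms(2)]] assms(5) continuous_on_subset by blast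
    then have "bounded ((\<lambda>x. frechet_derivative f (at x) b) ` K)"
      using assms(3) compact_continuous_image compact_imp_bounded by blast
    then show ?thesis by (auto simp: bounded_iff)
  qed
  then obtain B where B: "\<And>b x. x \<in> K \<Longrightarrow> norm (frechet_derivative f (at x) b) \<le> B b" by metis
  define C where "C = (\<Sum>b\<in>(Basis::'a set). \<bar>B b\<bar>)"
  have C: "norm (frechet_derivative f (at x) b) \<le> C" if "x \<in> K" "b \<in> Basis" for x b
  proof -
    have "B b \<le> \<bar>B b\<bar>" by simp
    also have "\<dots> \<le> C" unfolding C_def using that by (intro member_le_sum) auto
    finally show ?thesis using B[OF that(1), of b] by linarith
  qed
  have "C \<ge> 0" unfolding C_def by (simp add: sum_nonneg)
  show ?thesis
  proof
    show "DIM('a) * C \<ge> 0" using \<open>C \<ge> 0\<close> by simp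
    fix x y assume xy: "x \<in> K" "y \<in> K"
    show "norm (f x - f y) \<le> (DIM('a) * C) * norm (x - y)"
    proof (rule differentiable_bound[OF assms(4) _ _ xy])
      fix z assume z: "z \<in> K"
      have d: "(f has_derivative frechet_derivative f (at z)) (at z)"
        using Ck_on_has_derivative[OF assms(2)] z assms(5) by blast
      then show "(f has_derivative frechet_derivative f (at z)) (at z within K)"
        by (rule has_derivative_at_withinI)
      show "onorm (frechet_derivative f (at z)) \<le> DIM('a) * C"
        by (rule onorm_le) (rule frechet_derivative_basis_bound[OF has_derivative_linear[OF d] C[OF z]])
    qed
  qed
qed

text \<open>The mean value theorem is applied twice: in direction \<open>u\<close> to the difference
  of \<open>f\<close> at points that are \<open>t *\<^sub>R v\<close> apart, then in direction
  \<open>v\<close> to the derivative along \<open>u\<close>.\<close>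

lemma second_difference_mean_value:
  fixes f :: "'a::euclidean_space \<Rightarrow> real"
  assumes f: "Ck_on 2 f S" and "open S" "s > 0" "t > 0"
    and inS: "\<And>a b. 0 \<le> a \<Longrightarrow> a \<le> s \<Longrightarrow> 0 \<le> b \<Longrightarrow> b \<le> t \<Longrightarrow> x + a *\<^sub>R u + b *\<^sub>R v \<in> S"
  shows "\<exists>a b. 0 < a \<and> a < s \<and> 0 < b \<and> b < t \<and>
     f (x + s *\<^sub>R u + t *\<^sub>R v) - f (x + s *\<^sub>R u) - f (x + t *\<^sub>R v) + f x =
     s * t * frechet_derivative (\<lambda>y. frechet_derivative f (at y) u) (at (x + a *\<^sub>R u + b *\<^sub>R v)) v"
proof -
  have f1: "Ck_on (Suc (Suc 0)) f S" using f by (simp only: numeral_2_eq_2)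
  let ?D = "\<lambda>y. frechet_derivative f (at y) u"
  have D: "Ck_on (Suc 0) ?D S" by (rule Ck_on_frechet[OF f1])
  have der: "((\<lambda>c. h (z + c *\<^sub>R w)) has_real_derivative frechet_derivative h (at (z + c *\<^sub>R w)) w) (at c)"
    if "z + c *\<^sub>R w \<in> S" "Ck_on (Suc k) h S" for h :: "'a \<Rightarrow> real" and z w c k
  proof -
    have hd: "(h has_derivative frechet_derivative h (at (z + c *\<^sub>R w))) (at (z + c *\<^sub>R w))"
      by (rule Ck_on_has_derivative[OF that(2,1)])
    have "((\<lambda>c. z + c *\<^sub>R w) has_derivative (\<lambda>e. e *\<^sub>R w)) (at c)"
      by (auto intro!: derivative_eq_intros)
    from diff_chain_at[OF this hd]
    have "((\<lambda>c. h (z + c *\<^sub>R w)) has_derivative (\<lambda>e. frechet_derivative h (at (z + c *\<^sub>R w)) (e *\<^sub>R w))) (at c)"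
      by (simp add: o_def)
    then show ?thesis
      using linear_cmul[OF has_derivative_linear[OF hd]]
      by (simp add: has_field_derivative_def mult.commute[of _ "frechet_derivative h (at (z + c *\<^sub>R w)) w"])
  qed
  have "\<exists>a. 0 < a \<and> a < s \<and> (f (x + t *\<^sub>R v + s *\<^sub>R u) - f (x + s *\<^sub>R u)) - (f (x + t *\<^sub>R v + 0 *\<^sub>R u) - f (x + 0 *\<^sub>R u))
      = (s - 0) * (?D (x + t *\<^sub>R v + a *\<^sub>R u) - ?D (x + a *\<^sub>R u))"
  proof (rule MVT2[OF \<open>s > 0\<close>])
    fix c assume c: "0 \<le> c" "c \<le> s"
    have "x + c *\<^sub>R u + t *\<^sub>R v \<in> S" "x + c *\<^sub>R u + 0 *\<^sub>R v \<in> S"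
      using c \<open>t > 0\<close> by (intro inS; simp)+
    then have "x + t *\<^sub>R v + c *\<^sub>R u \<in> S" "x + c *\<^sub>R u \<in> S" by (simp_all add: add_ac)
    then show "((\<lambda>c. f (x + t *\<^sub>R v + c *\<^sub>R u) - f (x + c *\<^sub>R u)) has_real_derivative
        (?D (x + t *\<^sub>R v + c *\<^sub>R u) - ?D (x + c *\<^sub>R u))) (at c)"
      by (intro DERIV_diff der[OF _ f1])
  qed
  then obtain a where a: "0 < a" "a < s"
    and ae: "(f (x + t *\<^sub>R v + s *\<^sub>R u) - f (x + s *\<^sub>R u)) - (f (x + t *\<^sub>R v) - f x)
      = s * (?D (x + t *\<^sub>R v + a *\<^sub>R u) - ?D (x + a *\<^sub>R u))"
    by auto
  have "\<exists>b. 0 < b \<and> b < t \<and> ?D (x + a *\<^sub>R u + t *\<^sub>R v) - ?D (x + a *\<^sub>R u + 0 *\<^sub>R v)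
     = (t - 0) * frechet_derivative ?D (at (x + a *\<^sub>R u + b *\<^sub>R v)) v"
    by (rule MVT2[OF \<open>t > 0\<close> der[OF inS D]]) (use a in auto)
  then obtain b where b: "0 < b" "b < t"
    and be: "?D (x + a *\<^sub>R u + t *\<^sub>R v) - ?D (x + a *\<^sub>R u) = t * frechet_derivative ?D (at (x + a *\<^sub>R u + b *\<^sub>R v)) v"
    by auto
  show ?thesis
    using a b ae be by (intro exI[of _ a] exI[of _ b]) (simp add: add_ac)
qed

text \<open>The second difference does not see the order of \<open>u\<close> and \<open>v\<close>.
  So a value of one mixed derivative near \<open>x\<close> is also a value of the other near
  \<open>x\<close>, which contradicts a gap between them at \<open>x\<close>.\<close>

theorem second_derivative_symmetric:
  fixes f :: "'a::euclidean_space \<Rightarrow> real"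
  assumes f: "Ck_on 2 f S" and S: "open S" "x \<in> S"
  shows "frechet_derivative (\<lambda>y. frechet_derivative f (at y) u) (at x) v =
         frechet_derivative (\<lambda>y. frechet_derivative f (at y) v) (at x) u"
    (is "?A x = ?B x")
proof (rule ccontr)
  assume ne: "?A x \<noteq> ?B x"
  define e where "e = \<bar>?A x - ?B x\<bar> / 2"
  have e: "e > 0" using ne by (simp add: e_def)
  have f1: "Ck_on (Suc (Suc 0)) f S" using f by (simp only: numeral_2_eq_2)
  have cA: "continuous_on S ?A" and cB: "continuous_on S ?B"
    using f1 by simp_all
  obtain d0 where d0: "d0 > 0" "ball x d0 \<subseteq> S" using S openE by blast
  obtain d1 where d1: "d1 > 0" "\<And>y. y \<in> S \<Longrightarrow> dist y x < d1 \<Longrightarrow> \<bar>?A y - ?A x\<bar> < e"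
    using cA e S(2) unfolding continuous_on_iff dist_real_def by metis
  obtain d2 where d2: "d2 > 0" "\<And>y. y \<in> S \<Longrightarrow> dist y x < d2 \<Longrightarrow> \<bar>?B y - ?B x\<bar> < e"
    using cB e S(2) unfolding continuous_on_iff dist_real_def by metis
  define d where "d = min d0 (min d1 d2)"
  have d: "d > 0" using d0 d1 d2 by (simp add: d_def)
  \<comment> \<open>The side is so short that the whole parallelogram lies within
    \<open>d / 2\<close> of \<open>x\<close>; the summand 1 covers \<open>u = v = 0\<close>.\<close>
  define s where "s = d / (2 * (norm u + norm v + 1))"
  have s: "s > 0" using d by (simp add: s_def add_nonneg_pos)
  have near: "dist (x + a *\<^sub>R u + b *\<^sub>R v) x < d" if "0 \<le> a" "a \<le> s" "0 \<le> b" "b \<le> s" for a b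
  proof -
    have "dist (x + a *\<^sub>R u + b *\<^sub>R v) x = norm (a *\<^sub>R u + b *\<^sub>R v)" by (simp add: dist_norm add.assoc)
    also have "\<dots> \<le> a * norm u + b * norm v"
      using that by (intro order_trans[OF norm_triangle_ineq]) simp
    also have "\<dots> \<le> s * norm u + s * norm v"
      using that by (intro add_mono mult_right_mono) auto
    also have "\<dots> \<le> s * (norm u + norm v + 1)" using s by (simp add: algebra_simps)
    also have "\<dots> = d / 2"
      using add_nonneg_pos[of "norm u + norm v" 1] by (simp add: s_def field_simps)
    also have "\<dots> < d" using d by simp
    finally show ?thesis .
  qed
  have inS: "x + a *\<^sub>R u + b *\<^sub>R v \<in> S" if "0 \<le> a" "a \<le> s" "0 \<le> b" "b \<le> s" for a b
    using near[OF that] d0(2) by (auto simp: d_def dist_commute)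
  obtain a b where ab: "0 < a" "a < s" "0 < b" "b < s" and
    E1: "f (x + s *\<^sub>R u + s *\<^sub>R v) - f (x + s *\<^sub>R u) - f (x + s *\<^sub>R v) + f x = s * s * ?A (x + a *\<^sub>R u + b *\<^sub>R v)"
    using second_difference_mean_value[OF f S(1) s s inS] by blast
  have inS': "x + a *\<^sub>R v + b *\<^sub>R u \<in> S" if "0 \<le> a" "a \<le> s" "0 \<le> b" "b \<le> s" for a b
    using inS[OF that(3,4,1,2)] by (simp add: add_ac)
  obtain a' b' where ab': "0 < a'" "a' < s" "0 < b'" "b' < s" and
    E2: "f (x + s *\<^sub>R v + s *\<^sub>R u) - f (x + s *\<^sub>R v) - f (x + s *\<^sub>R u) + f x = s * s * ?B (x + a' *\<^sub>R v + b' *\<^sub>R u)"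
    using second_difference_mean_value[OF f S(1) s s inS'] by blast
  have swap: "x + s *\<^sub>R v + s *\<^sub>R u = x + s *\<^sub>R u + s *\<^sub>R v" by simp
  have "s * s * ?A (x + a *\<^sub>R u + b *\<^sub>R v) = s * s * ?B (x + a' *\<^sub>R v + b' *\<^sub>R u)"
    using E1 E2 unfolding swap by linarith
  then have "?A (x + a *\<^sub>R u + b *\<^sub>R v) = ?B (x + a' *\<^sub>R v + b' *\<^sub>R u)"
    using s by (simp del: mult_cancel_left add: mult_left_cancel)
  moreover have "x + a' *\<^sub>R v + b' *\<^sub>R u = x + b' *\<^sub>R u + a' *\<^sub>R v" by simp
  ultimately have eq: "?A (x + a *\<^sub>R u + b *\<^sub>R v) = ?B (x + b' *\<^sub>R u + a' *\<^sub>R v)" by (simp only:)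
  have "\<bar>?A (x + a *\<^sub>R u + b *\<^sub>R v) - ?A x\<bar> < e"
    using ab near[of a b] inS[of a b] by (intro d1(2)) (auto simp: d_def)
  moreover have "\<bar>?B (x + b' *\<^sub>R u + a' *\<^sub>R v) - ?B x\<bar> < e"
    using ab' near[of b' a'] inS[of b' a'] by (intro d2(2)) (auto simp: d_def)
  \<comment> \<open>Two numbers that lie within half the gap of different end points cannot be
    equal.\<close>
  moreover have False if "\<bar>p - a\<bar> < r" "\<bar>q - b\<bar> < r" "p = q" "r = \<bar>a - b\<bar> / 2" for p q a b r :: real
    using that by (auto simp: abs_if split: if_splits)
  ultimately show False using eq e_def by metis
qed

section \<open>Compact metric spaces without a metric type class\<close>

text \<open>The distance of the manifold is an explicit function on a type of class
  \<open>t2_space\<close>, so the metric axioms and the agreement with the topology are carried as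
  hypotheses; \<open>riemannian_compact_dist\<close> supplies them.\<close>

locale compact_dist =
  fixes d :: "'m::t2_space \<Rightarrow> 'm \<Rightarrow> real"
  assumes compact_UNIV: "compact (UNIV :: 'm set)"
    and d_nonneg: "0 \<le> d x y"
    and d_zero: "d x y = 0 \<longleftrightarrow> x = y"
    and d_sym: "d x y = d y x"
    and d_tri: "d x z \<le> d x y + d y z"
    and open_iff: "open S \<longleftrightarrow> (\<forall>x\<in>S. \<exists>e>0. \<forall>y. d x y < e \<longrightarrow> y \<in> S)"
begin

lemma d_refl [simp]: "d x x = 0" by (simp add: d_zero)

lemma open_dball: "open {y. d x y < e}"
  unfolding open_iff
proof
  fix y assume "y \<in> {y. d x y < e}"
  then show "\<exists>r>0. \<forall>z. d y z < r \<longrightarrow> z \<in> {y. d x y < e}"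
    by (intro exI[of _ "e - d x y"]) (use d_tri[of x _ y] in \<open>smt (verit) mem_Collect_eq\<close>)
qed

lemma finite_dball_cover:
  assumes "\<And>x. r x > 0"
  obtains C where "finite C" "\<And>y. \<exists>x\<in>C. d x y < r x"
proof -
  have "\<exists>C\<subseteq>UNIV. finite C \<and> UNIV \<subseteq> (\<Union>x\<in>C. {y. d x y < r x})"
    by (rule compactE_image[OF compact_UNIV, of UNIV "\<lambda>x. {y. d x y < r x}"])
      (use assms in \<open>auto simp: open_dball intro!: exI[of _ "_::'m"]\<close>)
  then show ?thesis using that by blast
qed

lemma bounded_d: "\<exists>B>0. \<forall>x y. d x y \<le> B"
proof -
  obtain C where C: "finite C" "\<And>y. \<exists>x\<in>C. d x y < 1"
    using finite_dball_cover[of "\<lambda>_. 1"] by auto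
  define B where "B = (\<Sum>x\<in>C. \<Sum>y\<in>C. d x y)"
  have B: "d x y \<le> B" if "x \<in> C" "y \<in> C" for x y
  proof -
    have "d x y \<le> (\<Sum>y\<in>C. d x y)" using that C(1) by (intro member_le_sum) (auto simp: d_nonneg)
    also have "\<dots> \<le> B" unfolding B_def
      using that C(1) by (intro member_le_sum) (auto simp: d_nonneg sum_nonneg)
    finally show ?thesis .
  qed
  have "d x y \<le> B + 2" for x y
  proof -
    obtain a b where "a \<in> C" "b \<in> C" "d a x < 1" "d b y < 1" using C(2) by metis
    then show ?thesis using B[of a b] d_tri[of x y a] d_tri[of a y b] d_sym[of x a] by linarith
  qed
  moreover have "B \<ge> 0" unfolding B_def by (intro sum_nonneg d_nonneg)
  ultimately show ?thesis by (intro exI[of _ "B + 2"]) auto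
qed

text \<open>Lebesgue's number lemma for a property of pairs instead of a cover. Halving the radii of
  the finite cover leaves room for the second point.\<close>

lemma lebesgue_number:
  assumes "\<And>x. \<exists>r>0. \<forall>y z. d x y < r \<longrightarrow> d x z < r \<longrightarrow> P y z"
  shows "\<exists>r>0. \<forall>y z. d y z < r \<longrightarrow> P y z"
proof -
  obtain r where r: "\<And>x. r x > 0" "\<And>x y z. d x y < r x \<Longrightarrow> d x z < r x \<Longrightarrow> P y z"
    using assms by metis
  obtain C where C: "finite C" "\<And>y. \<exists>x\<in>C. d x y < r x / 2"
    using finite_dball_cover[of "\<lambda>x. r x / 2"] r(1) by auto
  then have ne: "C \<noteq> {}" by blast
  define s where "s = Min ((\<lambda>x. r x / 2) ` C)"
  have s: "s > 0" unfolding s_def using C(1) ne r(1) by (subst Min_gr_iff) auto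
  have "P y z" if "d y z < s" for y z
  proof -
    obtain x where x: "x \<in> C" "d x y < r x / 2" using C(2) by blast
    have "s \<le> r x / 2" unfolding s_def using x(1) C(1) by (intro Min_le) auto
    then have "d x z < r x" using that x d_tri[of x z y] by linarith
    moreover have "d x y < r x" using x(2) r(1)[of x] by linarith
    ultimately show ?thesis using r(2) by blast
  qed
  then show ?thesis using s by blast
qed

lemma continuous_iff:
  fixes f :: "'m \<Rightarrow> 'b::metric_space"
  shows "continuous_on UNIV f \<longleftrightarrow> (\<forall>x. \<forall>e>0. \<exists>r>0. \<forall>y. d x y < r \<longrightarrow> dist (f x) (f y) < e)"
proof
  assume L: "continuous_on UNIV f"
  show "\<forall>x. \<forall>e>0. \<exists>r>0. \<forall>y. d x y < r \<longrightarrow> dist (f x) (f y) < e"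
  proof (intro allI impI)
    fix x and e :: real assume "e > 0"
    have "open (f -` ball (f x) e)" using L by (intro open_vimage) auto
    then have "\<exists>r>0. \<forall>y. d x y < r \<longrightarrow> y \<in> f -` ball (f x) e"
      unfolding open_iff using \<open>e > 0\<close> by auto
    then show "\<exists>r>0. \<forall>y. d x y < r \<longrightarrow> dist (f x) (f y) < e" by simp
  qed
next
  assume R: "\<forall>x. \<forall>e>0. \<exists>r>0. \<forall>y. d x y < r \<longrightarrow> dist (f x) (f y) < e"
  have "open (f -` B)" if "open B" for B
    unfolding open_iff
  proof
    fix x assume "x \<in> f -` B"
    then obtain e where "e > 0" "ball (f x) e \<subseteq> B" using \<open>open B\<close> openE by blast
    then show "\<exists>r>0. \<forall>y. d x y < r \<longrightarrow> y \<in> f -` B" using R by (metis mem_ball subsetD vimageI)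
  qed
  then show "continuous_on UNIV f" using continuous_on_open_vimage[of UNIV f] by auto
qed

lemma uniformly_continuous:
  fixes f :: "'m \<Rightarrow> 'b::metric_space"
  assumes "continuous_on UNIV f" "e > 0"
  shows "\<exists>r>0. \<forall>x y. d x y < r \<longrightarrow> dist (f x) (f y) < e"
proof (rule lebesgue_number)
  fix x
  obtain r where r: "r > 0" "\<And>y. d x y < r \<Longrightarrow> dist (f x) (f y) < e / 2"
    using assms half_gt_zero unfolding continuous_iff by metis
  have "dist (f y) (f z) < e" if "d x y < r" "d x z < r" for y z
    using dist_triangle_half_r[OF r(2)[OF that(1)] r(2)[OF that(2)]] .
  then show "\<exists>r>0. \<forall>y z. d x y < r \<longrightarrow> d x z < r \<longrightarrow> dist (f y) (f z) < e" using r(1) by blast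
qed

subsection \<open>The \<open>C\<^sup>0\<close>-metric on homeomorphisms\<close>

lemma HomeoD:
  assumes "h \<in> Homeo"
  shows "continuous_on UNIV h" "continuous_on UNIV (inv_into UNIV h)" "bij h" "inv_into UNIV h (h x) = x" "h (inv_into UNIV h x) = x"
proof -
  show "continuous_on UNIV h" "continuous_on UNIV (inv_into UNIV h)" "inv_into UNIV h (h x) = x" "h (inv_into UNIV h x) = x"
    using assms unfolding Homeo_def homeomorphism_def by auto
  show "bij h"
    using assms unfolding Homeo_def homeomorphism_def by (intro o_bij[of "inv_into UNIV h"]) auto
qed

lemma HomeoI:
  assumes "continuous_on UNIV h" "continuous_on UNIV k" "\<And>x. k (h x) = x" "\<And>x. h (k x) = x"
  shows "h \<in> Homeo" "inv_into UNIV h = k"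
proof -
  show "inv_into UNIV h = k" using assms by (metis inv_unique_comp comp_def fun_eq_iff id_apply)
  then show "h \<in> Homeo" unfolding Homeo_def homeomorphism_def using assms
    by (auto simp: image_iff) metis+
qed

lemma id_Homeo: "id \<in> Homeo" by (rule HomeoI[of id id]) (auto simp: id_def)

lemma comp_Homeo:
  assumes "f \<in> Homeo" "h \<in> Homeo"
  shows "f \<circ> h \<in> Homeo" "inv_into UNIV (f \<circ> h) = inv_into UNIV h \<circ> inv_into UNIV f"
proof -
  have "continuous_on UNIV (f \<circ> h)" "continuous_on UNIV (inv_into UNIV h \<circ> inv_into UNIV f)"
    using continuous_on_compose2[OF HomeoD(1)[OF assms(1)] HomeoD(1)[OF assms(2)]]
      continuous_on_compose2[OF HomeoD(2)[OF assms(2)] HomeoD(2)[OF assms(1)]] by (auto simp: o_def)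
  then show "f \<circ> h \<in> Homeo" "inv_into UNIV (f \<circ> h) = inv_into UNIV h \<circ> inv_into UNIV f"
    using HomeoI[of "f \<circ> h" "inv_into UNIV h \<circ> inv_into UNIV f"] assms by (simp_all add: HomeoD)
qed

lemma inv_Homeo: "f \<in> Homeo \<Longrightarrow> inv_into UNIV f \<in> Homeo"
  by (rule HomeoI[of _ f]) (auto simp: HomeoD)

lemma bdd_above_d: "bdd_above (range (\<lambda>x. d (\<phi> x) (\<psi> x)))"
  using bounded_d by (auto simp: bdd_above_def)

lemma d_le_dist_C0: "d (\<phi> x) (\<psi> x) \<le> dist_C0 d \<phi> \<psi>"
  unfolding dist_C0_def by (rule cSUP_upper[OF _ bdd_above_d]) simp

lemma dist_C0_least: "(\<And>x. d (\<phi> x) (\<psi> x) \<le> B) \<Longrightarrow> dist_C0 d \<phi> \<psi> \<le> B"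
  unfolding dist_C0_def by (rule cSUP_least) auto

lemma dist_C0_nonneg: "0 \<le> dist_C0 d \<phi> \<psi>"
  using d_le_dist_C0[of \<phi> undefined \<psi>] d_nonneg order_trans by blast

lemma dist_C0_sym: "dist_C0 d \<phi> \<psi> = dist_C0 d \<psi> \<phi>"
  unfolding dist_C0_def by (simp add: d_sym)

lemma dist_C0_tri: "dist_C0 d \<phi> \<eta> \<le> dist_C0 d \<phi> \<psi> + dist_C0 d \<psi> \<eta>"
proof (rule dist_C0_least)
  fix x
  show "d (\<phi> x) (\<eta> x) \<le> dist_C0 d \<phi> \<psi> + dist_C0 d \<psi> \<eta>"
    using d_tri[of "\<phi> x" "\<eta> x" "\<psi> x"] d_le_dist_C0[of \<phi> x \<psi>] d_le_dist_C0[of \<psi> x \<eta>] by linarith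
qed

lemma dist_C0_zero: "dist_C0 d \<phi> \<psi> = 0 \<Longrightarrow> \<phi> = \<psi>"
  using d_le_dist_C0[of \<phi> _ \<psi>] d_nonneg d_zero by (metis antisym ext)

lemma dist_C0_refl [simp]: "dist_C0 d \<phi> \<phi> = 0"
  unfolding dist_C0_def by simp

sublocale HM: Metric_space Homeo "dist_bar d"
proof
  show "0 \<le> dist_bar d \<phi> \<psi>" for \<phi> \<psi> unfolding dist_bar_def using dist_C0_nonneg le_max_iff_disj by blast
  show "dist_bar d \<phi> \<psi> = dist_bar d \<psi> \<phi>" for \<phi> \<psi> unfolding dist_bar_def by (simp add: dist_C0_sym)
  show "dist_bar d \<phi> \<psi> = 0 \<longleftrightarrow> \<phi> = \<psi>" if "\<phi> \<in> Homeo" "\<psi> \<in> Homeo" for \<phi> \<psi>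
  proof
    assume "dist_bar d \<phi> \<psi> = 0"
    then have "dist_C0 d \<phi> \<psi> = 0" unfolding dist_bar_def using dist_C0_nonneg[of \<phi> \<psi>] by linarith
    then show "\<phi> = \<psi>" by (rule dist_C0_zero)
  qed (simp add: dist_bar_def)
  show "dist_bar d \<phi> \<eta> \<le> dist_bar d \<phi> \<psi> + dist_bar d \<psi> \<eta>" for \<phi> \<psi> \<eta>
    unfolding dist_bar_def
    using dist_C0_tri[of \<phi> \<eta> \<psi>] dist_C0_tri[of "inv_into UNIV \<phi>" "inv_into UNIV \<eta>" "inv_into UNIV \<psi>"] by linarith
qed

lemma C0_topology_eq: "C0_topology d = HM.mtopology" by (simp add: C0_topology_def)

lemma topspace_C0 [simp]: "topspace (C0_topology d) = Homeo" by (simp add: C0_topology_eq)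

lemma d_le_dist_bar: "d (\<phi> x) (\<psi> x) \<le> dist_bar d \<phi> \<psi>"
  using d_le_dist_C0[of \<phi> x \<psi>] unfolding dist_bar_def by linarith

lemma dist_bar_bounded: "\<exists>B. \<forall>\<phi> \<psi>. dist_bar d \<phi> \<psi> \<le> B"
proof -
  obtain B where "\<And>x y. d x y \<le> B" using bounded_d by blast
  then show ?thesis unfolding dist_bar_def by (meson dist_C0_least max.bounded_iff)
qed

lemma dist_bar_le_path_dist: "t \<in> {0..1} \<Longrightarrow> dist_bar d (\<gamma> t) (\<gamma>' t) \<le> path_dist d \<gamma> \<gamma>'"
  unfolding path_dist_def using dist_bar_bounded by (intro cSUP_upper) (auto simp: bdd_above_def)

text \<open>\<open>pathin\<close> for the C^0-topology in epsilon form, as \<open>pathin_C0\<close>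
  proves; values of the path outside [0,1] are left free.\<close>

definition cpaths :: "(real \<Rightarrow> 'm \<Rightarrow> 'm) set" where
  "cpaths = {c. c ` {0..1} \<subseteq> Homeo \<and> (\<forall>s\<in>{0..1}. \<forall>e>0. \<exists>r>0. \<forall>t\<in>{0..1}. \<bar>t - s\<bar> < r \<longrightarrow> dist_bar d (c s) (c t) < e)}"

lemma pathin_C0: "pathin (C0_topology d) c \<longleftrightarrow> c \<in> cpaths"
proof
  assume L: "pathin (C0_topology d) c"
  have img: "c ` {0..1} \<subseteq> Homeo" using continuous_map_image_subset_topspace[OF L[unfolded pathin_def]] by simp
  show "c \<in> cpaths"
    unfolding cpaths_def
  proof (intro CollectI conjI img ballI allI impI)
    fix s e :: real assume s: "s \<in> {0..1}" "e > 0"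
    obtain U where U: "openin (top_of_set {0..1}) U" "s \<in> U" "\<forall>y\<in>U. c y \<in> HM.mball (c s) e"
      using L[unfolded pathin_def C0_topology_eq HM.continuous_map_to_metric, rule_format, of s e] s by auto
    obtain r where "r > 0" "\<forall>t\<in>{0..1}. dist t s < r \<longrightarrow> t \<in> U"
      using U(1,2) unfolding openin_euclidean_subtopology_iff by blast
    then show "\<exists>r>0. \<forall>t\<in>{0..1}. \<bar>t - s\<bar> < r \<longrightarrow> dist_bar d (c s) (c t) < e"
      using U(3) by (auto simp: dist_real_def)
  qed
next
  assume R: "c \<in> cpaths"
  show "pathin (C0_topology d) c"
    unfolding pathin_def C0_topology_eq HM.continuous_map_to_metric
  proof (intro ballI allI impI)
    fix s e :: real assume s: "s \<in> topspace (top_of_set {0..1})" "e > 0"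
    then have "\<exists>r>0. \<forall>t\<in>{0..1}. \<bar>t - s\<bar> < r \<longrightarrow> dist_bar d (c s) (c t) < e"
      using R unfolding cpaths_def by simp
    then obtain r where r: "r > 0" "\<forall>t\<in>{0..1}. \<bar>t - s\<bar> < r \<longrightarrow> dist_bar d (c s) (c t) < e"
      by blast
    show "\<exists>U. openin (top_of_set {0..1}) U \<and> s \<in> U \<and> (\<forall>y\<in>U. c y \<in> HM.mball (c s) e)"
      using r s R unfolding cpaths_def
      by (intro exI[of _ "{0..1} \<inter> ball s r"])
        (auto simp: openin_open_Int dist_real_def abs_minus_commute)
  qed
qed

lemma paths_from_id_iff: "c \<in> paths_from_id d G \<longleftrightarrow> c \<in> cpaths \<and> c ` {0..1} \<subseteq> G \<and> c 0 = id"
  unfolding paths_from_id_def using pathin_subtopology[of "C0_topology d" G c] pathin_C0 by auto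

lemma paths_from_id_Homeo: "c \<in> paths_from_id d Homeo \<longleftrightarrow> c \<in> cpaths \<and> c 0 = id"
  unfolding paths_from_id_iff cpaths_def by auto

lemma cpaths_Homeo: "c \<in> cpaths \<Longrightarrow> t \<in> {0..1} \<Longrightarrow> c t \<in> Homeo"
  unfolding cpaths_def by auto

lemma cpathsD:
  "c \<in> cpaths \<Longrightarrow> s \<in> {0..1} \<Longrightarrow> e > 0 \<Longrightarrow>
    \<exists>r>0. \<forall>t\<in>{0..1}. \<bar>t - s\<bar> < r \<longrightarrow> dist_bar d (c s) (c t) < e"
  by (simp add: cpaths_def)

text \<open>The distance from \<open>c s x\<close> to \<open>c t y\<close> splits at
  \<open>c s y\<close>. The first part is continuity of the single map \<open>c s\<close>; the
  second is at most \<open>dist_bar d (c s) (c t)\<close>, whatever \<open>y\<close> is.\<close>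

lemma cpaths_continuous:
  assumes "c \<in> cpaths"
  shows "continuous_on ({0..1} \<times> UNIV) (\<lambda>(t, x). c t x)"
  unfolding continuous_on_topological
proof (intro ballI allI impI)
  fix p :: "real \<times> 'm" and B :: "'m set"
  assume p: "p \<in> {0..1} \<times> UNIV" and B: "open B" "(case p of (t, x) \<Rightarrow> c t x) \<in> B"
  obtain s x where sx: "p = (s, x)" "s \<in> {0..1}" using p by blast
  obtain e where e: "e > 0" "\<And>y. d (c s x) y < e \<Longrightarrow> y \<in> B"
    using B unfolding sx open_iff by auto
  obtain r where r: "r > 0" "\<And>t. t \<in> {0..1} \<Longrightarrow> \<bar>t - s\<bar> < r \<Longrightarrow> dist_bar d (c s) (c t) < e / 2"
    using cpathsD[OF assms sx(2), of "e / 2"] e(1) by auto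
  have "open (c s -` {y. d (c s x) y < e / 2})"
    by (rule open_vimage[OF open_dball HomeoD(1)[OF cpaths_Homeo[OF assms sx(2)]]])
  then have op: "open (ball s r \<times> (c s -` {y. d (c s x) y < e / 2}))" by (intro open_Times) auto
  have "c t y \<in> B" if "t \<in> {0..1}" "\<bar>t - s\<bar> < r" "d (c s x) (c s y) < e / 2" for t y
  proof (rule e(2))
    have "d (c s y) (c t y) < e / 2" using d_le_dist_bar[of "c s" y "c t"] r(2)[OF that(1,2)] by linarith
    then show "d (c s x) (c t y) < e" using d_tri[of "c s x" "c t y" "c s y"] that by linarith
  qed
  then show "\<exists>A. open A \<and> p \<in> A \<and> (\<forall>y\<in>{0..1} \<times> UNIV. y \<in> A \<longrightarrow> (case y of (t, x) \<Rightarrow> c t x) \<in> B)"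
    using op r(1) e(1)
    by (intro exI[of _ "ball s r \<times> (c s -` {y. d (c s x) y < e / 2})"])
      (auto simp: sx dist_real_def abs_minus_commute)
qed

text \<open>Two paths with the same end become a loop at the identity. In this way differences of
  mass flows land in \<open>mass_flow_Gamma\<close> without a multiplication on the universal
  cover.\<close>

lemma cpaths_concat_reverse:
  assumes "c \<in> paths_from_id d G" "c' \<in> paths_from_id d G" "c 1 = c' 1"
  shows "(\<lambda>t. if t \<le> 1/2 then c (2 * t) else c' (2 - 2 * t)) \<in> paths_from_id d G" (is "?j \<in> _")
proof -
  let ?X = "subtopology (C0_topology d) G"
  have c: "continuous_map (top_of_set {0..1}) ?X c" "continuous_map (top_of_set {0..1}) ?X c'"
    using assms unfolding paths_from_id_def pathin_def by auto
  have "continuous_map (top_of_set {0..1}) ?X ?j"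
  proof (rule continuous_map_cases_le)
    have "continuous_map (subtopology (top_of_set {0..1}) {x \<in> topspace (top_of_set {0..1}). x \<le> 1 / 2}) (top_of_set {0..1}) (\<lambda>t::real. 2 * t)"
      by (auto simp: subtopology_subtopology continuous_map_in_subtopology continuous_intros)
    from continuous_map_compose[OF this c(1)]
    show "continuous_map (subtopology (top_of_set {0..1}) {x \<in> topspace (top_of_set {0..1}). x \<le> 1 / 2}) ?X (\<lambda>t. c (2 * t))"
      by (simp only: o_def)
    have "continuous_map (subtopology (top_of_set {0..1}) {x \<in> topspace (top_of_set {0..1}). 1 / 2 \<le> x}) (top_of_set {0..1}) (\<lambda>t::real. 2 - 2 * t)"
      by (auto simp: subtopology_subtopology continuous_map_in_subtopology continuous_intros)
    from continuous_map_compose[OF this c(2)]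
    show "continuous_map (subtopology (top_of_set {0..1}) {x \<in> topspace (top_of_set {0..1}). 1 / 2 \<le> x}) ?X (\<lambda>t. c' (2 - 2 * t))"
      by (simp only: o_def)
    show "c (2 * t) = c' (2 - 2 * t)" if "t \<in> topspace (top_of_set {0..1})" "t = 1 / 2" for t :: real
      unfolding that(2) using assms(3) by simp
  qed (auto simp: continuous_map_in_subtopology)
  then show ?thesis using assms unfolding paths_from_id_def pathin_def by simp
qed

subsection \<open>Borel measures are determined by continuous functions\<close>

text \<open>Closed sets generate the Borel sets and are stable under intersection. The indicator of
  a nonempty closed set is the pointwise limit of continuous cut-offs of the distance to it, written
  as an infimum, and dominated convergence applies.\<close>

lemma measure_eqI_continuous:
  fixes M N :: "'m measure"
  assumes sM: "sets M = sets borel" and sN: "sets N = sets borel"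
    and fM: "finite_measure M" and fN: "finite_measure N"
    and eq: "\<And>u :: 'm \<Rightarrow> real. continuous_on UNIV u \<Longrightarrow> integral\<^sup>L M u = integral\<^sup>L N u"
  shows "M = N"
proof -
  have lim: "(\<lambda>n. integral\<^sup>L M (\<lambda>x. max 0 (1 - real n * (INF y\<in>C. d x y)))) \<longlonglongrightarrow> measure M C"
    if C: "closed C" "C \<noteq> {}" and sM: "sets M = sets borel" and fM: "finite_measure M"
      and cont: "\<And>n. continuous_on UNIV (\<lambda>x. max 0 (1 - real n * (INF y\<in>C. d x y)))" for C and M :: "'m measure"
  proof -
    interpret finite_measure M by (rule fM)
    have [measurable_cong]: "sets M = sets borel" by (rule sM)
    have "(\<lambda>n. integral\<^sup>L M (\<lambda>x. max 0 (1 - real n * (INF y\<in>C. d x y)))) \<longlonglongrightarrow> integral\<^sup>L M (indicator C)"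
    proof (rule integral_dominated_convergence[where w="\<lambda>_. 1"])
      show "indicator C \<in> borel_measurable M" 
        by (rule borel_measurable_indicator) (use C(1) sM in auto)
      show "(\<lambda>x. max 0 (1 - real n * (INF y\<in>C. d x y))) \<in> borel_measurable M" for n
        using borel_measurable_continuous_onI[OF cont] by measurable
      show "AE x in M. (\<lambda>n. max 0 (1 - real n * (INF y\<in>C. d x y))) \<longlonglongrightarrow> indicator C x"
      proof (rule AE_I2)
        fix x
        show "(\<lambda>n. max 0 (1 - real n * (INF y\<in>C. d x y))) \<longlonglongrightarrow> indicator C x"
        proof (cases "x \<in> C")
          case True
          have "(INF y\<in>C. d x y) = 0"
          proof (rule antisym)
            have "(INF y\<in>C. d x y) \<le> d x x"
              using True by (intro cINF_lower) (auto simp: bdd_below_def intro: d_nonneg)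
            then show "(INF y\<in>C. d x y) \<le> 0" by simp
          qed (use C(2) in \<open>auto intro!: cINF_greatest d_nonneg\<close>)
          then show ?thesis using True by simp
        next
          case False
          then obtain e where e: "e > 0" "\<And>y. d x y < e \<Longrightarrow> y \<notin> C"
            using C(1) unfolding closed_def open_iff by auto
          have le: "e \<le> (INF y\<in>C. d x y)"
            using C(2) e(2) by (intro cINF_greatest) (auto simp: not_less[symmetric])
          obtain n0 :: nat where n0: "1 / e < real n0" using reals_Archimedean2 by blast
          have "max 0 (1 - real n * (INF y\<in>C. d x y)) = 0" if "n \<ge> n0" for n
          proof -
            have "1 \<le> real n0 * e" using n0 e(1) by (simp add: field_simps)
            also have "\<dots> \<le> real n * (INF y\<in>C. d x y)" using that le e(1) by (intro mult_mono) auto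
            finally show ?thesis by simp
          qed
          then have "eventually (\<lambda>n. max 0 (1 - real n * (INF y\<in>C. d x y)) = 0) sequentially"
            unfolding eventually_sequentially by blast
          then show ?thesis using False by (simp add: tendsto_eventually)
        qed
      qed
      have "0 \<le> (INF y\<in>C. d x y)" for x using C(2) by (auto intro!: cINF_greatest d_nonneg)
      then show "AE x in M. norm (max 0 (1 - real n * (INF y\<in>C. d x y))) \<le> 1" for n
        by (intro AE_I2) auto
    qed auto
    moreover have "integral\<^sup>L M (indicator C) = measure M C" using C(1) sM by simp
    ultimately show ?thesis by simp
  qed
  have cont: "continuous_on UNIV (\<lambda>x. max 0 (1 - real n * (INF y\<in>C. d x y)))" if "C \<noteq> {}" for n C
  proof -
    have "continuous_on UNIV (\<lambda>x. INF y\<in>C. d x y)"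
      unfolding continuous_iff
    proof (intro allI impI)
      fix x and e :: real assume "e > 0"
      have "(INF y\<in>C. d a y) \<le> d a b + (INF y\<in>C. d b y)" for a b
      proof -
        have "(INF y\<in>C. d a y) - d a b \<le> (INF y\<in>C. d b y)"
        proof (rule cINF_greatest[OF that])
          fix y assume "y \<in> C"
          then have "(INF y\<in>C. d a y) \<le> d a y" by (intro cINF_lower) (auto simp: bdd_below_def intro: d_nonneg)
          then show "(INF y\<in>C. d a y) - d a b \<le> d b y" using d_tri[of a y b] by linarith
        qed
        then show ?thesis by linarith
      qed
      then have "\<bar>(INF y\<in>C. d a y) - (INF y\<in>C. d b y)\<bar> \<le> d a b" for a b
        by (smt (verit) d_sym)
      then show "\<exists>r>0. \<forall>y. d x y < r \<longrightarrow> dist (INF z\<in>C. d x z) (INF z\<in>C. d y z) < e"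
        unfolding dist_real_def using \<open>e > 0\<close> le_less_trans by blast
    qed
    then show ?thesis by (intro continuous_intros)
  qed
  interpret M: finite_measure M by (rule fM)
  interpret N: finite_measure N by (rule fN)
  have "emeasure M C = emeasure N C" if "closed C" for C
  proof (cases "C = {}")
    case False
    have "measure M C = measure N C"
      using LIMSEQ_unique[OF lim[OF that False sM fM cont[OF False]]] lim[OF that False sN fN cont[OF False]]
      by (simp add: eq[OF cont[OF False]])
    then show ?thesis by (simp add: M.emeasure_eq_measure N.emeasure_eq_measure)
  qed simp
  then show ?thesis
    by (intro measure_eqI_generator_eq[of "Collect closed" UNIV M N "\<lambda>_. UNIV"])
      (auto simp: sM sN borel_eq_closed Int_stable_def)
qed

text \<open>Tested on continuous functions, invariance is a closed condition: uniform continuity of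
  \<open>u\<close> makes the integrals of \<open>u\<close> after \<open>h\<close> and after a nearby
  \<open>k\<close> close.\<close>

lemma preserves_measure_limit:
  fixes \<mu> :: "'m measure"
  assumes \<mu>: "sets \<mu> = sets borel" "finite_measure \<mu>" and h: "h \<in> Homeo"
    and approx: "\<And>e. e > 0 \<Longrightarrow> \<exists>k\<in>Homeo_vol \<mu>. \<forall>x. d (h x) (k x) < e"
  shows "h \<in> Homeo_vol \<mu>"
proof -
  interpret finite_measure \<mu> by (rule \<mu>)
  have [measurable_cong]: "sets \<mu> = sets borel" by (rule \<mu>)
  have sp: "space \<mu> = UNIV" using sets_eq_imp_space_eq[OF \<mu>(1)] by simp
  have meas: "k \<in> measurable \<mu> \<mu>" if "k \<in> Homeo" for k
    using borel_measurable_continuous_onI[OF HomeoD(1)[OF that]] by measurable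
  have int: "integrable \<mu> u" if "continuous_on UNIV u" for u :: "'m \<Rightarrow> real"
  proof -
    have "bounded (range u)" using compact_continuous_image[OF that compact_UNIV] compact_imp_bounded by blast
    then obtain B where "\<And>x. norm (u x) \<le> B" by (auto simp: bounded_iff)
    then show ?thesis
      using borel_measurable_continuous_onI[OF that] by (intro integrable_const_bound[where B=B]) (auto, measurable)
  qed
  have "integral\<^sup>L (distr \<mu> \<mu> h) u = integral\<^sup>L \<mu> u" if u: "continuous_on UNIV u" for u :: "'m \<Rightarrow> real"
  proof -
    have [measurable]: "u \<in> borel_measurable \<mu>" using borel_measurable_continuous_onI[OF u] by measurable
    have cc: "continuous_on UNIV (\<lambda>x. u (k x))" if "k \<in> Homeo" for k
      using continuous_on_compose2[OF u HomeoD(1)[OF that]] by auto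
    have bound: "\<bar>(\<integral>x. u (h x) \<partial>\<mu>) - integral\<^sup>L \<mu> u\<bar> \<le> e * measure \<mu> UNIV" if e: "e > 0" for e
    proof -
      obtain r where r: "r > 0" "\<And>x y. d x y < r \<Longrightarrow> dist (u x) (u y) < e"
        using uniformly_continuous[OF u e] by blast
      obtain k where k: "k \<in> Homeo_vol \<mu>" "\<And>x. d (h x) (k x) < r" using approx[OF r(1)] by blast
      then have kH: "k \<in> Homeo" and kd: "distr \<mu> \<mu> k = \<mu>" by (auto simp: Homeo_vol_def)
      have "integral\<^sup>L \<mu> u = integral\<^sup>L (distr \<mu> \<mu> k) u" by (simp add: kd)
      also have "\<dots> = (\<integral>x. u (k x) \<partial>\<mu>)" by (rule integral_distr[OF meas[OF kH]]) simp
      finally have "(\<integral>x. u (h x) \<partial>\<mu>) - integral\<^sup>L \<mu> u = (\<integral>x. u (h x) - u (k x) \<partial>\<mu>)"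
        using int[OF cc[OF h]] int[OF cc[OF kH]] by simp
      moreover have "norm (\<integral>x. u (h x) - u (k x) \<partial>\<mu>) \<le> (\<integral>x. e \<partial>\<mu>)"
      proof (rule order_trans[OF integral_norm_bound integral_mono])
        show "norm (u (h x) - u (k x)) \<le> e" for x using r(2)[OF k(2)[of x]] by (simp add: dist_norm less_imp_le)
      qed (use int[OF cc[OF h]] int[OF cc[OF kH]] in auto)
      ultimately show ?thesis by (simp add: sp mult.commute)
    qed
    have "\<bar>(\<integral>x. u (h x) \<partial>\<mu>) - integral\<^sup>L \<mu> u\<bar> \<le> 0 + e" if e: "e > 0" for e
    proof -
      \<comment> \<open>The summand 1 keeps the divisor positive when the total mass is 0.\<close>
      have pos: "measure \<mu> UNIV + 1 > 0" by (simp add: add_nonneg_pos)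
      then have "e / (measure \<mu> UNIV + 1) * measure \<mu> UNIV \<le> e" using e by (simp add: field_simps)
      then show ?thesis using bound[of "e / (measure \<mu> UNIV + 1)"] e pos by simp
    qed
    then have "\<bar>(\<integral>x. u (h x) \<partial>\<mu>) - integral\<^sup>L \<mu> u\<bar> \<le> 0" by (rule field_le_epsilon)
    then show ?thesis using integral_distr[OF meas[OF h], of u] by simp
  qed
  then have "distr \<mu> \<mu> h = \<mu>"
    by (intro measure_eqI_continuous) (auto simp: \<mu> meas[OF h] intro: finite_measure_distr)
  then show ?thesis using h by (simp add: Homeo_vol_def)
qed

end

section \<open>Lifting to the real line\<close>

text \<open>The space carries no uniform structure here, so uniformity is sought in time only: a
  tube over the compact \<open>C\<close> around each \<open>s\<close>, then a Lebesgue number for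
  [0,1].\<close>

lemma uniform_in_time:
  fixes \<Phi> :: "real \<times> 'm::topological_space \<Rightarrow> 'b::metric_space"
  assumes "compact C" "continuous_on ({0..1} \<times> C) \<Phi>" "e > 0"
  shows "\<exists>r>0. \<forall>s\<in>{0..1}. \<forall>t\<in>{0..1}. \<bar>s - t\<bar> < r \<longrightarrow> (\<forall>x\<in>C. dist (\<Phi> (s, x)) (\<Phi> (t, x)) < e)"
proof -
  have "\<exists>X. open X \<and> s \<in> X \<and> (\<forall>t\<in>X \<inter> {0..1}. \<forall>x\<in>C. dist (\<Phi> (t, x)) (\<Phi> (s, x)) \<le> e / 3)"
    if s: "s \<in> {0..1}" for s
  proof -
    have "e / 3 > 0" using assms(3) by simp
    from continuous_on_prod_compactE[OF assms(2,1) s this] show ?thesis by metis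
  qed
  then obtain X where X: "\<And>s. s \<in> {0..1} \<Longrightarrow> open (X s) \<and> s \<in> X s"
    "\<And>s t x. s \<in> {0..1} \<Longrightarrow> t \<in> X s \<Longrightarrow> t \<in> {0..1} \<Longrightarrow> x \<in> C \<Longrightarrow> dist (\<Phi> (t, x)) (\<Phi> (s, x)) \<le> e / 3"
    by (metis IntI)
  have "{0..1} \<subseteq> \<Union>(X ` {0..1})" "\<And>G. G \<in> X ` {0..1} \<Longrightarrow> open G" using X(1) by auto
  from Heine_Borel_lemma[OF compact_Icc this]
  obtain r where r: "r > 0" "\<And>s. s \<in> {0..1} \<Longrightarrow> \<exists>a\<in>{0..1}. ball s r \<subseteq> X a"
    by (metis (no_types, lifting) imageE)
  have "dist (\<Phi> (s, x)) (\<Phi> (t, x)) < e" if st: "s \<in> {0..1}" "t \<in> {0..1}" "\<bar>s - t\<bar> < r" "x \<in> C" for s t x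
  proof -
    obtain a where a: "a \<in> {0..1}" "ball s r \<subseteq> X a" using r(2)[OF st(1)] by blast
    have "s \<in> X a" "t \<in> X a" using a(2) st r(1) by (auto simp: dist_real_def)
    then have "dist (\<Phi> (s, x)) (\<Phi> (a, x)) \<le> e / 3" "dist (\<Phi> (t, x)) (\<Phi> (a, x)) \<le> e / 3"
      using X(2)[OF a(1)] st by blast+
    then show ?thesis
      using dist_triangle2[of "\<Phi> (s, x)" "\<Phi> (t, x)" "\<Phi> (a, x)"] assms(3) by linarith
  qed
  then show ?thesis using r(1) by blast
qed

section \<open>The principal argument, counted in full turns, as a local inverse of the covering of
  the circle\<close>

definition arg_turn :: "complex \<Rightarrow> real" where
  "arg_turn z = Im (Ln z) / (2 * pi)"

lemma arg_turn_1 [simp]: "arg_turn 1 = 0" by (simp add: arg_turn_def)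

lemma cis_arg_turn: "norm z = 1 \<Longrightarrow> cis (2 * pi * arg_turn z) = z"
proof -
  assume z: "norm z = 1"
  then have "z \<noteq> 0" by auto
  then have "cis (Im (Ln z)) = exp (Ln z)" using z by (simp add: exp_eq_polar)
  then show ?thesis using \<open>z \<noteq> 0\<close> by (simp add: arg_turn_def)
qed

lemma arg_turn_cis: "\<bar>k\<bar> < 1/2 \<Longrightarrow> arg_turn (cis (2 * pi * k)) = k"
proof -
  assume k: "\<bar>k\<bar> < 1/2"
  have "-pi < 2 * pi * k" "2 * pi * k \<le> pi"
    using k mult_strict_left_mono[of "-1/2" k "2 * pi"] mult_left_mono[of k "1/2" "2 * pi"] by auto
  then have "Ln (exp (\<i> * of_real (2 * pi * k))) = \<i> * of_real (2 * pi * k)" by (intro Ln_exp) auto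
  then show ?thesis by (simp add: arg_turn_def cis_conv_exp)
qed

lemma near_one_Re: "norm (z - 1) < 1 \<Longrightarrow> 0 < Re z"
  using abs_Re_le_cmod[of "z - 1"] by auto

text \<open>The factor 2 in the linear bound for \<open>Ln\<close> near 1 is absorbed by the
  division by \<open>2 * pi\<close>.\<close>

lemma arg_turn_bound:
  assumes "norm (z - 1) < 1/2"
  shows "\<bar>arg_turn z\<bar> \<le> norm (z - 1)"
proof -
  have "\<bar>Im (Ln z)\<bar> \<le> 2 * norm (z - 1)"
    using norm_Ln_le[of "z - 1"] assms abs_Im_le_cmod[of "Ln z"] by simp
  then have "\<bar>arg_turn z\<bar> * (2 * pi) \<le> 2 * norm (z - 1)" by (simp add: arg_turn_def abs_mult)
  moreover have "2 * norm (z - 1) \<le> norm (z - 1) * (2 * pi)"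
    using pi_gt3 mult_left_mono[of 1 pi "norm (z - 1)"] by simp
  ultimately have "\<bar>arg_turn z\<bar> * (2 * pi) \<le> norm (z - 1) * (2 * pi)" by linarith
  then show ?thesis using pi_gt_zero by simp
qed

lemma continuous_on_arg_turn:
  assumes "continuous_on S f" "\<And>x. x \<in> S \<Longrightarrow> norm (f x - 1) < 1"
  shows "continuous_on S (\<lambda>x. arg_turn (f x))"
proof -
  have "f x \<notin> \<real>\<^sub>\<le>\<^sub>0" if "x \<in> S" for x
    using near_one_Re[OF assms(2)[OF that]] by (auto simp: complex_nonpos_Reals_iff)
  then show ?thesis unfolding arg_turn_def by (intro continuous_intros assms) auto
qed

text \<open>To leave the principal range, a continuous lift that starts at 0 would have to pass
  through 1/2 or -1/2. There its image on the circle is -1, at distance 2 from 1.\<close>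

lemma small_lift:
  fixes k :: "real \<Rightarrow> real"
  assumes "continuous_on {0..1} k" "k 0 = 0" "\<And>t. t \<in> {0..1} \<Longrightarrow> norm (cis (2 * pi * k t) - 1) < 1"
    and t: "t \<in> {0..1}"
  shows "k t = arg_turn (cis (2 * pi * k t))"
proof -
  have "\<bar>k t\<bar> < 1/2"
  proof (rule ccontr)
    assume "\<not> \<bar>k t\<bar> < 1/2"
    then have "\<exists>s\<ge>0. s \<le> t \<and> \<bar>k s\<bar> = 1/2"
      using t assms(2) by (intro IVT') (auto intro!: continuous_intros continuous_on_subset[OF assms(1)])
    then obtain s where "0 \<le> s" "s \<le> t" and ks: "\<bar>k s\<bar> = 1/2" by blast
    then have s: "s \<in> {0..1}" "\<bar>k s\<bar> = 1/2" using t by auto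
    then have "k s = 1/2 \<or> k s = -1/2" by linarith
    then have "2 * pi * k s = pi \<or> 2 * pi * k s = - pi" by (elim disjE) (simp_all only:, simp_all)
    then have "cis (2 * pi * k s) = -1" by (elim disjE; simp only:; simp add: complex_eq_iff)
    then show False using assms(3)[OF s(1)] by (simp add: norm_minus_commute)
  qed
  then show ?thesis by (simp add: arg_turn_cis)
qed

lemma cis_sum: "cis (2 * pi * (\<Sum>j\<in>J. k j)) = (\<Prod>j\<in>J. cis (2 * pi * k j))"
  by (induction J rule: infinite_finite_induct) (auto simp: distrib_left cis_mult[symmetric])

text \<open>Time is cut into steps so short that successive quotients of \<open>\<Phi>\<close> stay
  within 1 of 1, uniformly in space. Their principal arguments are continuous, and the sum is the
  lift.\<close>

lemma circle_homotopy_lift: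
  fixes \<Phi> :: "real \<times> 'm::topological_space \<Rightarrow> complex"
  assumes "compact (UNIV :: 'm set)" "continuous_on ({0..1} \<times> UNIV) \<Phi>"
    and n1: "\<And>t x. t \<in> {0..1} \<Longrightarrow> norm (\<Phi> (t, x)) = 1"
  shows "\<exists>F. continuous_on ({0..1} \<times> UNIV) F \<and> (\<forall>x. F (0, x) = 0) \<and>
     (\<forall>t\<in>{0..1}. \<forall>x. cis (2 * pi * F (t, x)) = \<Phi> (t, x) / \<Phi> (0, x))"
proof -
  obtain r where r: "r > 0" "\<And>s t x. s \<in> {0..1} \<Longrightarrow> t \<in> {0..1} \<Longrightarrow> \<bar>s - t\<bar> < r \<Longrightarrow> dist (\<Phi> (s, x)) (\<Phi> (t, x)) < 1"
    using uniform_in_time[OF assms(1,2), of 1] by auto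
  obtain N :: nat where N: "N > 0" "1 / real N < r"
    using r(1) by (metis of_nat_0_less_iff reals_Archimedean2 divide_less_eq inverse_eq_divide ex_inverse_of_nat_less)
  \<comment> \<open>Time is stopped at \<open>j / N\<close>. For every \<open>t\<close> the
    quotients over \<open>j\<close> then telescope from \<open>\<Phi> (0, x)\<close> to
    \<open>\<Phi> (t, x)\<close>, so one finite sum serves all times and is jointly
    continuous.\<close>
  define m where "m j t = min t (real j / real N)" for j :: nat and t
  have m01: "m j t \<in> {0..1}" if "t \<in> {0..1}" for j t using that by (auto simp: m_def)
  have mm: "\<bar>m (Suc j) t - m j t\<bar> < r" for j t
  proof -
    have "\<bar>m (Suc j) t - m j t\<bar> \<le> real (Suc j) / real N - real j / real N"
      unfolding m_def using divide_right_mono[of "real j" "real (Suc j)" "real N"] by linarith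
    also have "\<dots> = 1 / real N" by (simp add: diff_divide_distrib[symmetric])
    finally show ?thesis using N(2) by linarith
  qed
  define R where "R j p = \<Phi> (m (Suc j) (fst p), snd p) / \<Phi> (m j (fst p), snd p)" for j and p :: "real \<times> 'm"
  have R1: "norm (R j (t, x)) = 1" and R2: "norm (R j (t, x) - 1) < 1" if "t \<in> {0..1}" for j t x
  proof -
    have nz: "\<Phi> (m j t, x) \<noteq> 0" using n1[OF m01[OF that, of j], of x] by auto
    show "norm (R j (t, x)) = 1" unfolding R_def by (simp add: norm_divide n1[OF m01[OF that]])
    have "R j (t, x) - 1 = (\<Phi> (m (Suc j) t, x) - \<Phi> (m j t, x)) / \<Phi> (m j t, x)"
      unfolding R_def using nz by (simp add: field_simps)
    then have "norm (R j (t, x) - 1) = norm (\<Phi> (m (Suc j) t, x) - \<Phi> (m j t, x))"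
      by (simp add: norm_divide n1[OF m01[OF that]])
    then show "norm (R j (t, x) - 1) < 1"
      using r(2)[OF m01[OF that] m01[OF that] mm, of j x] by (simp add: dist_norm)
  qed
  have cR: "continuous_on ({0..1} \<times> UNIV) (R j)" for j
  proof -
    have "continuous_on ({0..1} \<times> UNIV) (\<lambda>p. \<Phi> (m j (fst p), snd p))" for j
      by (rule continuous_on_compose2[OF assms(2)])
        (use m01 in \<open>auto simp: m_def intro!: continuous_intros\<close>)
    then show ?thesis unfolding R_def using n1 m01
      by (intro continuous_on_divide) (auto, metis norm_zero zero_neq_one)
  qed
  define F where "F p = (\<Sum>j<N. arg_turn (R j p))" for p
  have "continuous_on ({0..1} \<times> UNIV) F"
    unfolding F_def by (intro continuous_on_sum continuous_on_arg_turn cR) (use R2 in auto)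
  moreover have "F (0, x) = 0" for x
  proof -
    have "R j (0, x) = 1" for j
      using n1[of 0 x] unfolding R_def m_def by (auto simp: min_def)
    then show ?thesis unfolding F_def by simp
  qed
  moreover have "cis (2 * pi * F (t, x)) = \<Phi> (t, x) / \<Phi> (0, x)" if t: "t \<in> {0..1}" for t x
  proof -
    have "cis (2 * pi * F (t, x)) = (\<Prod>j<N. R j (t, x))"
      unfolding F_def cis_sum using cis_arg_turn R1[OF t] by simp
    also have "\<dots> = \<Phi> (m N t, x) / \<Phi> (m 0 t, x)"
      unfolding R_def fst_conv snd_conv
      by (rule prod_lessThan_telescope[of N "\<lambda>j. \<Phi> (m j t, x)"]) (metis n1 m01[OF t] norm_zero zero_neq_one)
    also have "\<dots> = \<Phi> (t, x) / \<Phi> (0, x)" using t N(1) by (simp add: m_def)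
    finally show ?thesis .
  qed
  ultimately show ?thesis by blast
qed

section \<open>Mass flow of paths\<close>

lemma circle_mapsD: "f \<in> circle_maps \<Longrightarrow> continuous_on UNIV f" "f \<in> circle_maps \<Longrightarrow> norm (f x) = 1"
  "f \<in> circle_maps \<Longrightarrow> f x \<noteq> 0"
proof -
  assume f: "f \<in> circle_maps"
  then have "f x \<in> sphere 0 1" unfolding circle_maps_def by blast
  then show "norm (f x) = 1" "f x \<noteq> 0" by auto
qed (auto simp: circle_maps_def)

lemma circle_mapsI: "continuous_on UNIV f \<Longrightarrow> (\<And>x. norm (f x) = 1) \<Longrightarrow> f \<in> circle_maps"
  unfolding circle_maps_def by auto

lemma is_flow_liftD:
  "is_flow_lift h f F \<Longrightarrow> t \<in> {0..1} \<Longrightarrow> cis (2 * pi * F (t, x)) = f (h t x) / f x"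
  "is_flow_lift h f F \<Longrightarrow> F (0, x) = 0"
  unfolding is_flow_lift_def by auto

lemma is_flow_lift_slice:
  assumes "is_flow_lift h f F"
  shows "continuous_on {0..1} (\<lambda>t. F (t, x))" "continuous_on UNIV (\<lambda>x. F (1, x))"
  using assms unfolding is_flow_lift_def
  by (auto intro!: continuous_on_compose2[of "{0..1} \<times> UNIV" F] continuous_intros)

text \<open>The difference of the two lifts is a lift of the quotient
  \<open>f (h t x) / f (h' t x)\<close>, which stays near 1. By \<open>small_lift\<close> it is the
  principal argument of that quotient, hence small, and 0 where the two points coincide.\<close>

lemma flow_lift_close:
  assumes F: "is_flow_lift h f F" and F': "is_flow_lift h' f F'" and f: "f \<in> circle_maps"
    and e: "e \<le> 1/2" "\<And>t x. t \<in> {0..1} \<Longrightarrow> norm (f (h t x) - f (h' t x)) < e" and t: "t \<in> {0..1}"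
  shows "\<bar>F (t, x) - F' (t, x)\<bar> \<le> e" "h t x = h' t x \<Longrightarrow> F (t, x) = F' (t, x)"
proof -
  let ?k = "\<lambda>t. F (t, x) - F' (t, x)"
  have z: "cis (2 * pi * ?k t) = f (h t x) / f (h' t x)" if "t \<in> {0..1}" for t
  proof -
    have "cis (2 * pi * ?k t) = cis (2 * pi * F (t, x)) / cis (2 * pi * F' (t, x))"
      by (simp add: cis_divide right_diff_distrib)
    also have "\<dots> = f (h t x) / f (h' t x)"
      unfolding is_flow_liftD(1)[OF F that] is_flow_liftD(1)[OF F' that]
      using circle_mapsD(3)[OF f] by (simp add: field_simps)
    finally show ?thesis .
  qed
  have near: "norm (f (h t x) / f (h' t x) - 1) < e" if "t \<in> {0..1}" for t
  proof -
    have "f (h t x) / f (h' t x) - 1 = (f (h t x) - f (h' t x)) / f (h' t x)"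
      using circle_mapsD(3)[OF f] by (simp add: field_simps)
    then show ?thesis using e(2)[OF that, of x] circle_mapsD(2)[OF f] by (simp add: norm_divide)
  qed
  have k: "?k t = arg_turn (cis (2 * pi * ?k t))"
  proof (rule small_lift[OF _ _ _ t])
    show "continuous_on {0..1} ?k" by (intro continuous_intros is_flow_lift_slice[OF F] is_flow_lift_slice[OF F'])
    show "?k 0 = 0" using F F' unfolding is_flow_lift_def by simp
    show "norm (cis (2 * pi * ?k t) - 1) < 1" if "t \<in> {0..1}" for t
      unfolding z[OF that] using near[OF that] e(1) by linarith
  qed
  show "\<bar>F (t, x) - F' (t, x)\<bar> \<le> e"
    using arg_turn_bound[of "f (h t x) / f (h' t x)"] near[OF t] e(1) k unfolding z[OF t] by linarith
  show "F (t, x) = F' (t, x)" if "h t x = h' t x"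
    using k unfolding z[OF t] that using circle_mapsD(3)[OF f] by simp
qed

lemma flow_lift_unique:
  assumes "is_flow_lift h f F" "is_flow_lift h f F'" "f \<in> circle_maps" "t \<in> {0..1}"
  shows "F (t, x) = F' (t, x)"
  by (rule flow_lift_close(2)[OF assms(1-3), of "1/2"]) (use assms(4) in auto)

lemma path_mass_flow_eq:
  assumes "is_flow_lift h f F" "f \<in> circle_maps"
  shows "path_mass_flow \<mu> h f = (\<integral>x. F (1, x) \<partial>\<mu>)"
proof -
  have "is_flow_lift h f (SOME F. is_flow_lift h f F)" by (rule someI[of "is_flow_lift h f", OF assms(1)])
  then have "(SOME F. is_flow_lift h f F) (1, x) = F (1, x)" for x
    using flow_lift_unique[OF _ assms, of _ 1 x] by auto
  then show ?thesis unfolding path_mass_flow_def by simp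
qed

locale compact_dist_measure = compact_dist d for d :: "'m::t2_space \<Rightarrow> 'm \<Rightarrow> real" +
  fixes \<mu> :: "'m measure"
  assumes sets_mu: "sets \<mu> = sets borel" and finite_mu: "finite_measure \<mu>"
begin

sublocale mu: finite_measure \<mu> by (rule finite_mu)

lemma space_mu: "space \<mu> = UNIV" using sets_eq_imp_space_eq[OF sets_mu] by simp

lemma measurable_continuous:
  "continuous_on UNIV u \<Longrightarrow> u \<in> borel_measurable \<mu>"
  using borel_measurable_continuous_onI[of u] measurable_cong_sets[OF sets_mu refl, of borel] by auto

lemma integrable_continuous:
  fixes u :: "'m \<Rightarrow> real"
  assumes "continuous_on UNIV u"
  shows "integrable \<mu> u"
proof -
  have "bounded (range u)" using compact_continuous_image[OF assms compact_UNIV] compact_imp_bounded by blast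
  then obtain B where "\<And>x. norm (u x) \<le> B" by (auto simp: bounded_iff)
  then show ?thesis
    by (intro mu.integrable_const_bound[where B=B]) (auto simp: measurable_continuous assms)
qed

lemma Homeo_measurable: "h \<in> Homeo \<Longrightarrow> h \<in> measurable \<mu> \<mu>"
  using measurable_continuous[OF HomeoD(1)] measurable_cong_sets[OF refl sets_mu, of \<mu>] by auto

lemma integral_Homeo_vol:
  fixes u :: "'m \<Rightarrow> real"
  assumes "h \<in> Homeo_vol \<mu>" "continuous_on UNIV u"
  shows "(\<integral>x. u (h x) \<partial>\<mu>) = integral\<^sup>L \<mu> u"
proof -
  have "h \<in> Homeo" "distr \<mu> \<mu> h = \<mu>" using assms(1) by (auto simp: Homeo_vol_def)
  then show ?thesis
    using integral_distr[OF Homeo_measurable measurable_continuous[OF assms(2)], of h] by simp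
qed

lemma abs_integral_diff_le:
  fixes u v :: "'m \<Rightarrow> real"
  assumes "continuous_on UNIV u" "continuous_on UNIV v" "\<And>x. \<bar>u x - v x\<bar> \<le> e"
  shows "\<bar>integral\<^sup>L \<mu> u - integral\<^sup>L \<mu> v\<bar> \<le> e * measure \<mu> UNIV"
proof -
  note i = integrable_continuous[OF assms(1)] integrable_continuous[OF assms(2)]
  have "\<bar>\<integral>x. u x - v x \<partial>\<mu>\<bar> \<le> (\<integral>x. \<bar>u x - v x\<bar> \<partial>\<mu>)" by (rule integral_abs_bound)
  also have "\<dots> \<le> (\<integral>x. e \<partial>\<mu>)" by (rule integral_mono) (use i assms(3) in auto)
  finally show ?thesis using i by (simp add: space_mu mult.commute)
qed

lemma flow_lift_exists:
  assumes "c \<in> cpaths" "c 0 = id" "f \<in> circle_maps"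
  obtains F where "is_flow_lift c f F"
proof -
  have "continuous_on ({0..1} \<times> UNIV) (\<lambda>p. f (case p of (t, x) \<Rightarrow> c t x))"
    by (rule continuous_on_compose2[OF circle_mapsD(1)[OF assms(3)] cpaths_continuous[OF assms(1)]]) auto
  from circle_homotopy_lift[OF compact_UNIV this] show ?thesis
    using that circle_mapsD(2)[OF assms(3)] assms(2) unfolding is_flow_lift_def by auto
qed

text \<open>The first estimate carries vanishing mass flow to C^0-limits of paths; the second makes
  the mass flow locally constant along homotopies with fixed ends.\<close>

lemma path_mass_flow_close:
  assumes c: "c \<in> cpaths" "c 0 = id" and c': "c' \<in> cpaths" "c' 0 = id" and f: "f \<in> circle_maps"
    and e: "e \<le> 1/2" "\<And>t x. t \<in> {0..1} \<Longrightarrow> norm (f (c t x) - f (c' t x)) < e"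
  shows "\<bar>path_mass_flow \<mu> c f - path_mass_flow \<mu> c' f\<bar> \<le> e * measure \<mu> UNIV"
    "c 1 = c' 1 \<Longrightarrow> path_mass_flow \<mu> c f = path_mass_flow \<mu> c' f"
proof -
  obtain F where F: "is_flow_lift c f F" by (rule flow_lift_exists[OF c f])
  obtain F' where F': "is_flow_lift c' f F'" by (rule flow_lift_exists[OF c' f])
  note cl = flow_lift_close[OF F F' f e, of 1]
  show "\<bar>path_mass_flow \<mu> c f - path_mass_flow \<mu> c' f\<bar> \<le> e * measure \<mu> UNIV"
    unfolding path_mass_flow_eq[OF F f] path_mass_flow_eq[OF F' f]
    by (rule abs_integral_diff_le[OF is_flow_lift_slice(2)[OF F] is_flow_lift_slice(2)[OF F']]) (use cl in auto)
  show "path_mass_flow \<mu> c f = path_mass_flow \<mu> c' f" if "c 1 = c' 1"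
    unfolding path_mass_flow_eq[OF F f] path_mass_flow_eq[OF F' f] using cl(2) that by simp
qed

text \<open>Since \<open>f' / f\<close> stays near 1, it is \<open>cis (2 * pi * k)\<close> for a
  continuous real-valued \<open>k\<close>. The lift changes by \<open>k (c t x) - k x\<close>, and
  at time 1 this integrates to 0 because \<open>c 1\<close> preserves \<mu>.\<close>

lemma path_mass_flow_circle_close:
  assumes c: "c \<in> cpaths" "c 0 = id" "c 1 \<in> Homeo_vol \<mu>"
    and f: "f \<in> circle_maps" and f': "f' \<in> circle_maps" and near: "\<And>x. norm (f' x - f x) < 1"
  shows "path_mass_flow \<mu> c f' = path_mass_flow \<mu> c f"
proof -
  obtain F where F: "is_flow_lift c f F" by (rule flow_lift_exists[OF c(1,2) f])
  let ?k = "\<lambda>x. arg_turn (f' x / f x)"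
  have "norm (f' x / f x - 1) = norm (f' x - f x)" for x
  proof -
    have "f' x / f x - 1 = (f' x - f x) / f x" using circle_mapsD(3)[OF f, of x] by (simp add: field_simps)
    then show ?thesis by (simp add: norm_divide circle_mapsD(2)[OF f])
  qed
  then have ck: "continuous_on UNIV ?k"
    using near circle_mapsD(1,3)[OF f] circle_mapsD(1)[OF f']
    by (intro continuous_on_arg_turn continuous_on_divide) auto
  have k: "cis (2 * pi * ?k x) = f' x / f x" for x
    by (intro cis_arg_turn) (simp add: norm_divide circle_mapsD(2) f f')
  let ?F' = "\<lambda>(t, x). F (t, x) + (?k (c t x) - ?k x)"
  have F': "is_flow_lift c f' ?F'"
    unfolding is_flow_lift_def
  proof (intro conjI allI ballI)
    have "continuous_on ({0..1} \<times> UNIV) (\<lambda>p. ?k (case p of (t, x) \<Rightarrow> c t x))"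
      by (rule continuous_on_compose2[OF ck cpaths_continuous[OF c(1)]]) auto
    moreover have "continuous_on ({0..1} \<times> UNIV) (\<lambda>p :: real \<times> 'm. ?k (snd p))"
      by (rule continuous_on_compose2[OF ck]) (auto intro: continuous_intros)
    ultimately have "continuous_on ({0..1} \<times> UNIV) (\<lambda>p. F p + (?k (case p of (t, x) \<Rightarrow> c t x) - ?k (snd p)))"
      using F unfolding is_flow_lift_def by (intro continuous_on_add continuous_on_diff) auto
    then show "continuous_on ({0..1} \<times> UNIV) ?F'" by (simp add: case_prod_unfold)
    show "?F' (0, x) = 0" for x using F c(2) unfolding is_flow_lift_def by simp
    show "cis (2 * pi * ?F' (t, x)) = f' (c t x) / f' x" if "t \<in> {0..1}" for t x
    proof -
      have "cis (2 * pi * ?F' (t, x)) = cis (2 * pi * F (t, x)) * (cis (2 * pi * ?k (c t x)) / cis (2 * pi * ?k x))"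
        by (simp add: cis_divide cis_mult algebra_simps)
      also have "\<dots> = f' (c t x) / f' x"
        unfolding k using F that circle_mapsD(3)[OF f] circle_mapsD(3)[OF f']
        unfolding is_flow_lift_def by (simp add: field_simps)
      finally show ?thesis .
    qed
  qed
  have "c 1 \<in> Homeo" using c(3) by (simp add: Homeo_vol_def)
  have ckc: "continuous_on UNIV (\<lambda>x. ?k (c 1 x))"
    using continuous_on_compose2[OF ck HomeoD(1)[OF \<open>c 1 \<in> Homeo\<close>]] by auto
  have "path_mass_flow \<mu> c f' = (\<integral>x. F (1, x) + (?k (c 1 x) - ?k x) \<partial>\<mu>)"
    unfolding path_mass_flow_eq[OF F' f'] by simp
  also have "\<dots> = (\<integral>x. F (1, x) \<partial>\<mu>) + ((\<integral>x. ?k (c 1 x) \<partial>\<mu>) - (\<integral>x. ?k x \<partial>\<mu>))"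
    using integrable_continuous[OF ck] integrable_continuous[OF ckc]
      integrable_continuous[OF is_flow_lift_slice(2)[OF F]] by simp
  finally show ?thesis using integral_Homeo_vol[OF c(3) ck] path_mass_flow_eq[OF F f] by simp
qed

section \<open>Homotopy invariance of the mass flow\<close>

lemma locally_constant_unit_interval:
  fixes T :: "real \<Rightarrow> 'a"
  assumes "\<And>s. s \<in> {0..1} \<Longrightarrow> \<exists>r>0. \<forall>t\<in>{0..1}. \<bar>t - s\<bar> < r \<longrightarrow> T s = T t"
  shows "T 0 = T 1"
proof (rule connected_local_const[of "{0..1::real}"])
  show "\<forall>a\<in>{0..1}. \<forall>\<^sub>F b in at a within {0..1}. T a = T b"
    using assms unfolding eventually_at dist_real_def by blast
qed auto

lemma path_mass_flow_circle_homotopy: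
  assumes c: "c \<in> cpaths" "c 0 = id" "c 1 \<in> Homeo_vol \<mu>" and h: "(f, f') \<in> circle_homotopy"
  shows "path_mass_flow \<mu> c f = path_mass_flow \<mu> c f'"
proof -
  obtain H where H: "continuous_on ({0..1} \<times> UNIV) H" "H ` ({0..1} \<times> UNIV) \<subseteq> sphere 0 1"
    "\<And>x. H (0::real, x) = f x" "\<And>x. H (1, x) = f' x"
  proof -
    have eq: "prod_topology (top_of_set {0..1::real}) euclidean = top_of_set ({0..1} \<times> (UNIV::'m set))"
      using prod_topology_subtopology_eu[of "{0..1::real}" "UNIV::'m set"] by (simp only: subtopology_UNIV)
    show ?thesis
      using h that unfolding circle_homotopy_def homotopic_with_def subtopology_UNIV eq
        continuous_map_in_subtopology by (auto simp: image_subset_iff Pi_iff)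
  qed
  obtain r where r: "r > 0" "\<And>s t x. s \<in> {0..1} \<Longrightarrow> t \<in> {0..1} \<Longrightarrow> \<bar>s - t\<bar> < r \<Longrightarrow> dist (H (s, x)) (H (t, x)) < 1"
    using uniform_in_time[OF compact_UNIV H(1), of 1] by auto
  have cm: "(\<lambda>x. H (s, x)) \<in> circle_maps" if "s \<in> {0..1}" for s
    using H(2) that continuous_on_compose2[OF H(1), of UNIV "\<lambda>x. (s, x)"]
      continuous_on_Pair[OF continuous_on_const[of UNIV s] continuous_on_id]
    by (intro circle_mapsI) (auto simp: image_subset_iff)
  have "path_mass_flow \<mu> c (\<lambda>x. H (0, x)) = path_mass_flow \<mu> c (\<lambda>x. H (1, x))"
  proof (rule locally_constant_unit_interval)
    fix s :: real assume s: "s \<in> {0..1}"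
    have "path_mass_flow \<mu> c (\<lambda>x. H (s, x)) = path_mass_flow \<mu> c (\<lambda>x. H (t, x))"
      if "t \<in> {0..1}" "\<bar>t - s\<bar> < r" for t
      by (rule path_mass_flow_circle_close[OF c cm[OF that(1)] cm[OF s]])
        (use r(2)[OF s that(1)] that(2) in \<open>simp add: dist_norm abs_minus_commute\<close>)
    then show "\<exists>r>0. \<forall>t\<in>{0..1}. \<bar>t - s\<bar> < r \<longrightarrow>
        path_mass_flow \<mu> c (\<lambda>x. H (s, x)) = path_mass_flow \<mu> c (\<lambda>x. H (t, x))"
      using r(1) by blast
  qed
  then show ?thesis by (simp add: H(3,4))
qed

lemma Homeo_vol0_subset: "Homeo_vol0 d \<mu> \<subseteq> Homeo_vol \<mu>"
  unfolding Homeo_vol0_def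
  using path_component_of_subset_topspace[of "subtopology (C0_topology d) (Homeo_vol \<mu>)" id] by auto

abbreviation "P \<equiv> paths_from_id d (Homeo_vol0 d \<mu>)"

lemma P_D: "c \<in> P \<Longrightarrow> c \<in> cpaths" "c \<in> P \<Longrightarrow> c 0 = id" "c \<in> P \<Longrightarrow> c 1 \<in> Homeo_vol \<mu>"
proof -
  assume c: "c \<in> P"
  show "c \<in> cpaths" "c 0 = id" using c unfolding paths_from_id_iff by auto
  have "c 1 \<in> c ` {0..1}" by simp
  then show "c 1 \<in> Homeo_vol \<mu>" using c Homeo_vol0_subset unfolding paths_from_id_iff by blast
qed

lemma path_mass_flow_path_homotopy:
  assumes h: "(c, c') \<in> path_homotopy d \<mu>" and f: "f \<in> circle_maps"
  shows "path_mass_flow \<mu> c f = path_mass_flow \<mu> c' f" "c 1 = c' 1"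
proof -
  let ?X = "subtopology (C0_topology d) (Homeo_vol0 d \<mu>)"
  have cP: "c \<in> P" "c' \<in> P" using h unfolding path_homotopy_def by auto
  obtain H where H: "continuous_map (prod_topology (top_of_set {0..1::real}) (top_of_set {0..1::real})) ?X H"
    "\<And>t. H (0, t) = c t" "\<And>t. H (1, t) = c' t"
    "\<And>s. s \<in> {0..1} \<Longrightarrow> H (s, 0) = id \<and> H (s, 1) = c 1"
    using h unfolding path_homotopy_def homotopic_with_def by fastforce
  show "c 1 = c' 1" using H(3)[of 1] H(4)[of 1] by simp
  have HP: "(\<lambda>t. H (s, t)) \<in> P" if "s \<in> {0..1}" for s
  proof -
    have "continuous_map (top_of_set {0..1}) (prod_topology (top_of_set {0..1}) (top_of_set {0..1})) (\<lambda>t::real. (s, t))"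
      using that by (auto simp: continuous_map_pairwise o_def intro!: continuous_intros)
    from continuous_map_compose[OF this H(1)] show ?thesis
      using H(4)[OF that] unfolding paths_from_id_def pathin_def by (simp add: o_def)
  qed
  have HM: "continuous_map (prod_topology (top_of_set {0..1}) (top_of_set {0..1})) HM.mtopology H"
    using H(1) by (simp add: continuous_map_in_subtopology C0_topology_eq)
  obtain r where r: "r > 0" "\<And>x y. d x y < r \<Longrightarrow> dist (f x) (f y) < 1/2"
    using uniformly_continuous[OF circle_mapsD(1)[OF f], of "1/2"] by auto
  have "path_mass_flow \<mu> (\<lambda>t. H (0, t)) f = path_mass_flow \<mu> (\<lambda>t. H (1, t)) f"
  proof (rule locally_constant_unit_interval)
    fix s :: real assume s: "s \<in> {0..1}"
    \<comment> \<open>The distance between the paths at parameters \<open>a\<close> and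
      \<open>s\<close> is jointly continuous in parameter and time and vanishes for
      \<open>a = s\<close>. Compactness of the time interval then makes it small for all times at
      once.\<close>
    have "continuous_map (prod_topology (top_of_set {0..1}) (top_of_set {0..1})) euclidean
        (\<lambda>p::real\<times>real. dist_bar d (H p) (H (s, snd p)))"
    proof -
      have "continuous_map (prod_topology (top_of_set {0..1}) (top_of_set {0..1}))
          (prod_topology (top_of_set {0..1}) (top_of_set {0..1})) (\<lambda>p::real\<times>real. (s, snd p))"
        using s by (auto simp: continuous_map_pairwise o_def continuous_map_snd continuous_map_in_subtopology continuous_intros)
      from continuous_map_compose[OF this HM] have "continuous_map (prod_topology (top_of_set {0..1}) (top_of_set {0..1}))
          HM.mtopology (\<lambda>p::real\<times>real. H (s, snd p))" by (simp add: o_def)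
      then show ?thesis
        using continuous_map_mdist[of _ HM.Self H "\<lambda>p. H (s, snd p)", unfolded mtopology_of_def HM.mspace_Self HM.mdist_Self] HM by blast
    qed
    then have cont: "continuous_on ({0..1} \<times> {0..1}) (\<lambda>p. dist_bar d (H p) (H (s, snd p)))"
      by (simp only: prod_topology_subtopology_eu continuous_map_iff_continuous)
    have "r / 2 > 0" using r(1) by simp
    from continuous_on_prod_compactE[OF cont compact_Icc s this]
    obtain X where X: "s \<in> X" "open X" "\<And>a t. a \<in> X \<Longrightarrow> a \<in> {0..1} \<Longrightarrow> t \<in> {0..1} \<Longrightarrow>
        dist (dist_bar d (H (a, t)) (H (s, t))) (dist_bar d (H (s, t)) (H (s, t))) \<le> r / 2"
      by (metis IntI snd_conv)
    obtain q where q: "q > 0" "ball s q \<subseteq> X" using X(1,2) openE by blast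
    have "path_mass_flow \<mu> (\<lambda>t. H (s, t)) f = path_mass_flow \<mu> (\<lambda>t. H (a, t)) f"
      if a: "a \<in> {0..1}" "\<bar>a - s\<bar> < q" for a
    proof (rule path_mass_flow_close(2)[where e="1/2"])
      fix t :: real and x assume t: "t \<in> {0..1}"
      have "a \<in> X" using q(2) a(2) by (auto simp: dist_real_def abs_minus_commute)
      moreover have z: "dist_bar d (H (s, t)) (H (s, t)) = 0" by (simp add: dist_bar_def)
      ultimately have "dist_bar d (H (a, t)) (H (s, t)) < r"
        using X(3)[OF _ a(1) t] r(1) unfolding z dist_real_def by linarith
      then have "d (H (s, t) x) (H (a, t) x) < r"
        using d_le_dist_bar[of "H (a, t)" x "H (s, t)"] d_sym[of "H (s, t) x" "H (a, t) x"] by linarith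
      then show "norm (f (H (s, t) x) - f (H (a, t) x)) < 1/2" using r(2) by (simp add: dist_norm)
    qed (use P_D[OF HP[OF s]] P_D[OF HP[OF a(1)]] f H(4)[OF s] H(4)[OF a(1)] in auto)
    then show "\<exists>r>0. \<forall>t\<in>{0..1}. \<bar>t - s\<bar> < r \<longrightarrow>
        path_mass_flow \<mu> (\<lambda>t. H (s, t)) f = path_mass_flow \<mu> (\<lambda>u. H (t, u)) f"
      using q(1) by blast
  qed
  then show "path_mass_flow \<mu> c f = path_mass_flow \<mu> c' f" by (simp add: H(2,3))
qed

lemma path_mass_flow_concat_reverse:
  assumes c: "c \<in> P" and c': "c' \<in> P" and eq: "c 1 = c' 1" and f: "f \<in> circle_maps"
  shows "path_mass_flow \<mu> (\<lambda>t. if t \<le> 1/2 then c (2 * t) else c' (2 - 2 * t)) f =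
    path_mass_flow \<mu> c f - path_mass_flow \<mu> c' f"
proof -
  obtain F where F: "is_flow_lift c f F" by (rule flow_lift_exists[OF P_D(1,2)[OF c] f])
  obtain F' where F': "is_flow_lift c' f F'" by (rule flow_lift_exists[OF P_D(1,2)[OF c'] f])
  \<comment> \<open>On the way back \<open>F'\<close> is shifted so that it continues
    \<open>F (1, x)\<close> at time 1/2. At time 1 the term \<open>F' (0, x)\<close> is 0, and the
    difference \<open>F (1, x) - F' (1, x)\<close> remains.\<close>
  let ?J = "\<lambda>p. if fst p \<le> 1/2 then F (2 * fst p, snd p)
     else F (1, snd p) + (F' (2 - 2 * fst p, snd p) - F' (1, snd p))"
  have J: "is_flow_lift (\<lambda>t. if t \<le> 1/2 then c (2 * t) else c' (2 - 2 * t)) f ?J"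
    unfolding is_flow_lift_def
  proof (intro conjI allI ballI)
    have cF: "continuous_on ({0..1} \<times> UNIV) F" "continuous_on ({0..1} \<times> UNIV) F'"
      using F F' unfolding is_flow_lift_def by auto
    show "continuous_on ({0..1} \<times> UNIV) ?J"
    proof (rule continuous_on_cases_le)
      fix p :: "real \<times> 'm" assume "fst p = 1/2"
      then have "2 * fst p = 1" "2 - 2 * fst p = 1" by simp_all
      then show "F (2 * fst p, snd p) = F (1, snd p) + (F' (2 - 2 * fst p, snd p) - F' (1, snd p))" by simp
    qed (auto intro!: continuous_intros continuous_on_compose2[OF cF(1)] continuous_on_compose2[OF cF(2)])
    show "?J (0, x) = 0" for x using F unfolding is_flow_lift_def by simp
    show "cis (2 * pi * ?J (t, x)) = f ((if t \<le> 1/2 then c (2 * t) else c' (2 - 2 * t)) x) / f x"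
      if t: "t \<in> {0..1}" for t x
    proof (cases "t \<le> 1/2")
      case True
      then show ?thesis using F t unfolding is_flow_lift_def by simp
    next
      case False
      have "cis (2 * pi * ?J (t, x)) = cis (2 * pi * F (1, x)) * (cis (2 * pi * F' (2 - 2 * t, x)) / cis (2 * pi * F' (1, x)))"
        using False by (simp add: cis_divide cis_mult algebra_simps)
      also have "\<dots> = f (c 1 x) / f x * ((f (c' (2 - 2 * t) x) / f x) / (f (c' 1 x) / f x))"
        using F F' t False unfolding is_flow_lift_def by simp
      also have "\<dots> = f (c' (2 - 2 * t) x) / f x"
        unfolding eq using circle_mapsD(3)[OF f] by (simp add: field_simps)
      finally show ?thesis using False by simp
    qed
  qed
  have "F' (0, x) = 0" for x using F' unfolding is_flow_lift_def by simp
  then show ?thesis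
    unfolding path_mass_flow_eq[OF J f] path_mass_flow_eq[OF F f] path_mass_flow_eq[OF F' f]
    using integrable_continuous[OF is_flow_lift_slice(2)[OF F]] integrable_continuous[OF is_flow_lift_slice(2)[OF F']]
    by simp
qed

section \<open>From paths to the universal cover and the quotient by the image of the loops\<close>

lemma path_homotopy_refl: "c \<in> P \<Longrightarrow> (c, c) \<in> path_homotopy d \<mu>"
  unfolding path_homotopy_def
  by (auto simp: paths_from_id_def pathin_def)

lemma circle_homotopy_refl: "f \<in> circle_maps \<Longrightarrow> (f, f) \<in> circle_homotopy"
  unfolding circle_homotopy_def circle_maps_def by (auto simp: image_subset_iff Pi_iff continuous_map_in_subtopology)

text \<open>Stands for \<open>mass_flow_cover\<close> of the class of \<open>c\<close>, with one
  path and one representative of each circle class in place of \<open>the_elem\<close> of an image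
  over all of them.\<close>

definition path_hom :: "(real \<Rightarrow> 'm \<Rightarrow> 'm) \<Rightarrow> ('m \<Rightarrow> complex) set \<Rightarrow> real" where
  "path_hom c = (\<lambda>X\<in>carrier circle_classes. path_mass_flow \<mu> c (SOME f. f \<in> X))"

lemma circle_classE:
  assumes "X \<in> carrier circle_classes"
  obtains f where "f \<in> circle_maps" "X = circle_homotopy `` {f}" "f \<in> X"
  using assms circle_homotopy_refl unfolding circle_classes_def quotient_def by fastforce

lemma circle_class_rep:
  assumes "X \<in> carrier (circle_classes :: ('m \<Rightarrow> complex) set monoid)"
  shows "(SOME f. f \<in> X) \<in> circle_maps" "(SOME f. f \<in> X) \<in> X"
proof -
  obtain f where f: "X = circle_homotopy `` {f}" "f \<in> X" using circle_classE[OF assms] by metis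
  show "(SOME f. f \<in> X) \<in> X" by (rule someI[of "\<lambda>f. f \<in> X", OF f(2)])
  then show "(SOME f. f \<in> X) \<in> circle_maps" using f(1) unfolding circle_homotopy_def by auto
qed

lemma image_eq_singletonI: "x \<in> S \<Longrightarrow> (\<And>x. x \<in> S \<Longrightarrow> F x = y) \<Longrightarrow> F ` S = {y}"
  by auto

text \<open>\<open>the_elem\<close> has a determined value only on a singleton; the two homotopy
  invariances, in the path and in the circle map, make the image one.\<close>

lemma mass_flow_cover_class:
  assumes c: "c \<in> P"
  shows "mass_flow_cover \<mu> (path_homotopy d \<mu> `` {c}) = path_hom c"
proof -
  have "the_elem ((\<lambda>(c, f). path_mass_flow \<mu> c f) ` ((path_homotopy d \<mu> `` {c}) \<times> X)) =
      path_mass_flow \<mu> c (SOME f. f \<in> X)" if X: "X \<in> carrier circle_classes" for X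
  proof -
    obtain f where f: "f \<in> circle_maps" "X = circle_homotopy `` {f}" "f \<in> X" by (rule circle_classE[OF X])
    have eq: "path_mass_flow \<mu> c' f' = path_mass_flow \<mu> c f" if "(c, c') \<in> path_homotopy d \<mu>" "f' \<in> X" for c' f'
    proof -
      have f': "(f, f') \<in> circle_homotopy" using that(2) f(2) by simp
      then have "f' \<in> circle_maps" unfolding circle_homotopy_def by auto
      then show ?thesis
        using path_mass_flow_path_homotopy(1)[OF that(1), of f'] path_mass_flow_circle_homotopy[OF P_D[OF c] f'] by simp
    qed
    have "(\<lambda>(c, f). path_mass_flow \<mu> c f) ` ((path_homotopy d \<mu> `` {c}) \<times> X) = {path_mass_flow \<mu> c f}"
    proof (rule image_eq_singletonI)
      show "(c, f) \<in> (path_homotopy d \<mu> `` {c}) \<times> X" using path_homotopy_refl[OF c] f(3) by simp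
    qed (use eq in auto)
    then show ?thesis using eq[OF path_homotopy_refl[OF c] circle_class_rep(2)[OF X]] by simp
  qed
  then show ?thesis unfolding mass_flow_cover_def path_hom_def by (intro restrict_ext)
qed

lemma cover_proj_class:
  assumes "c \<in> P"
  shows "cover_proj (path_homotopy d \<mu> `` {c}) = c 1"
proof -
  \<comment> \<open>Any circle map serves: equality of end points is the second part of a lemma that
    is stated for a circle map.\<close>
  have one: "(\<lambda>x. 1) \<in> (circle_maps :: ('m \<Rightarrow> complex) set)" by (rule circle_mapsI) auto
  have "(\<lambda>c. c 1) ` (path_homotopy d \<mu> `` {c}) = {c 1}"
  proof (rule image_eq_singletonI)
    show "c \<in> path_homotopy d \<mu> `` {c}" using path_homotopy_refl[OF assms] by simp
    show "c' 1 = c 1" if "c' \<in> path_homotopy d \<mu> `` {c}" for c'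
      using path_mass_flow_path_homotopy(2)[OF _ one, of c c'] that by simp
  qed
  then show ?thesis unfolding cover_proj_def by simp
qed

lemma universal_cover_fibre:
  "F ` {C \<in> universal_cover d \<mu>. cover_proj C = h} = (\<lambda>c. F (path_homotopy d \<mu> `` {c})) ` {c \<in> P. c 1 = h}"
proof -
  have "{C \<in> universal_cover d \<mu>. cover_proj C = h} = (\<lambda>c. path_homotopy d \<mu> `` {c}) ` {c \<in> P. c 1 = h}"
    unfolding universal_cover_def quotient_def using cover_proj_class by auto
  then show ?thesis by (simp add: image_image)
qed

lemma mass_flow_Gamma_eq: "mass_flow_Gamma d \<mu> = path_hom ` {c \<in> P. c 1 = id}"
  unfolding mass_flow_Gamma_def universal_cover_fibre by (rule image_cong) (auto simp: mass_flow_cover_class)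

text \<open>\<open>c\<close> followed by the reverse of \<open>c'\<close> is a loop at the identity,
  and its mass flow is the difference.\<close>

lemma path_hom_diff:
  assumes "c \<in> P" "c' \<in> P" "c 1 = c' 1"
  shows "(\<lambda>X\<in>carrier circle_classes. path_hom c X - path_hom c' X) \<in> mass_flow_Gamma d \<mu>"
proof -
  let ?j = "\<lambda>t. if t \<le> 1/2 then c (2 * t) else c' (2 - 2 * t)"
  have "?j \<in> P" by (rule cpaths_concat_reverse[OF assms])
  moreover have "?j 1 = id" using P_D(2)[OF assms(2)] by simp
  moreover have "path_hom ?j = (\<lambda>X\<in>carrier circle_classes. path_hom c X - path_hom c' X)"
    using path_mass_flow_concat_reverse[OF assms circle_class_rep(1)]
    by (auto simp: path_hom_def restrict_def fun_eq_iff)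
  ultimately show ?thesis
    unfolding mass_flow_Gamma_eq by (intro image_eqI[where x="?j"]) simp_all
qed

text \<open>Any other path to the same end differs from \<gamma> by a loop, so its homomorphism lies
  in \<open>mass_flow_Gamma\<close> because that of \<gamma> is 0. All cosets in the definition of
  \<open>mass_flow\<close> are then translates of \<open>mass_flow_Gamma\<close> by its own
  elements.\<close>

lemma mass_flow_eq_Gamma:
  assumes \<gamma>: "\<gamma> \<in> P" and zero: "\<And>f. f \<in> circle_maps \<Longrightarrow> path_mass_flow \<mu> \<gamma> f = 0"
  shows "mass_flow d \<mu> (\<gamma> 1) = mass_flow_Gamma d \<mu>"
proof -
  let ?\<Gamma> = "mass_flow_Gamma d \<mu>"
  let ?C = "carrier (circle_classes :: ('m \<Rightarrow> complex) set monoid)"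
  have ext: "restrict a ?C = a" if "a \<in> ?\<Gamma>" for a
    using that unfolding mass_flow_Gamma_eq path_hom_def by auto
  have \<gamma>0: "path_hom \<gamma> X = 0" if "X \<in> ?C" for X
    using that zero circle_class_rep(1)[OF that] by (simp add: path_hom_def)
  have diff: "(\<lambda>X\<in>?C. a X - b X) \<in> ?\<Gamma>" if "a \<in> ?\<Gamma>" "b \<in> ?\<Gamma>" for a b
    using that path_hom_diff unfolding mass_flow_Gamma_eq by fastforce
  have end_in: "path_hom c \<in> ?\<Gamma>" if "c \<in> P" "c 1 = \<gamma> 1" for c
  proof -
    have "(\<lambda>X\<in>?C. path_hom c X - path_hom \<gamma> X) = path_hom c"
      using \<gamma>0 by (auto simp: path_hom_def restrict_def fun_eq_iff)
    then show ?thesis using path_hom_diff[OF that(1) \<gamma> that(2)] by simp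
  qed
  \<comment> \<open>Closure under differences does the work of a subgroup: 0 is \<open>b - b\<close>
    and the negative of \<open>b\<close> is \<open>0 - b\<close>, so sums with \<open>b\<close> stay
    inside, and every \<open>e\<close> is \<open>(e - b) + b\<close>.\<close>
  have coset: "?\<Gamma> #>\<^bsub>circle_hom\<^esub> b = ?\<Gamma>" if b: "b \<in> ?\<Gamma>" for b
  proof -
    have zero: "(\<lambda>X\<in>?C. b X - b X) \<in> ?\<Gamma>" by (rule diff[OF b b])
    have neg: "(\<lambda>X\<in>?C. - b X) \<in> ?\<Gamma>"
      using diff[OF zero b] by (auto cong: restrict_cong)
    have "(\<lambda>X\<in>?C. a X + b X) \<in> ?\<Gamma>" if a: "a \<in> ?\<Gamma>" for a
      using diff[OF a neg] by (auto cong: restrict_cong)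
    moreover have "\<exists>a\<in>?\<Gamma>. e = (\<lambda>X\<in>?C. a X + b X)" if e: "e \<in> ?\<Gamma>" for e
    proof (rule bexI[OF _ diff[OF e b]])
      show "e = (\<lambda>X\<in>?C. (\<lambda>X\<in>?C. e X - b X) X + b X)"
      proof
        fix X show "e X = (\<lambda>X\<in>?C. (\<lambda>X\<in>?C. e X - b X) X + b X) X"
          using fun_cong[OF ext[OF e], of X] by (cases "X \<in> ?C") simp_all
      qed
    qed
    ultimately show ?thesis unfolding r_coset_def circle_hom_def by fastforce
  qed
  have "(\<lambda>C. ?\<Gamma> #>\<^bsub>circle_hom\<^esub> mass_flow_cover \<mu> C) ` {C \<in> universal_cover d \<mu>. cover_proj C = \<gamma> 1} = {?\<Gamma>}"
    unfolding universal_cover_fibre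
    by (rule image_eq_singletonI[of \<gamma>]) (use \<gamma> in \<open>auto simp: mass_flow_cover_class coset end_in\<close>)
  then show ?thesis unfolding mass_flow_def by simp
qed

text \<open>The path itself joins the identity to each of its points inside
  \<open>Homeo_vol \<mu>\<close>.\<close>

lemma paths_Homeo_vol0:
  assumes \<gamma>: "\<gamma> \<in> cpaths" "\<gamma> 0 = id" "\<And>t. t \<in> {0..1} \<Longrightarrow> \<gamma> t \<in> Homeo_vol \<mu>"
  shows "\<gamma> \<in> P"
proof -
  let ?X = "subtopology (C0_topology d) (Homeo_vol \<mu>)"
  have "pathin ?X \<gamma>"
    using \<gamma> pathin_subtopology[of "C0_topology d" "Homeo_vol \<mu>" \<gamma>] pathin_C0 by auto
  then have "path_connectedin ?X (\<gamma> ` {0..1})" by (rule path_connectedin_path_image)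
  moreover have "id \<in> \<gamma> ` {0..1}" using \<gamma>(2) by force
  ultimately have "\<gamma> ` {0..1} \<subseteq> Homeo_vol0 d \<mu>"
    unfolding Homeo_vol0_def by (intro path_component_of_maximal)
  then show ?thesis using \<gamma> unfolding paths_from_id_iff by auto
qed

end

section \<open>Closed manifolds\<close>

locale closed_manifold =
  fixes A :: "('m::t2_space, 'k::finite) chart set"
  assumes cpt: "compact (UNIV :: 'm set)" and conn: "connected (UNIV :: 'm set)"
    and atlas: "smooth_atlas A"
begin

lemma chart_homeomorphism:
  assumes "c \<in> A"
  shows "open (fst c)" "open (chart_image c)" "continuous_on (fst c) (snd c)"
    "continuous_on (chart_image c) (chart_inv c)"
    "p \<in> fst c \<Longrightarrow> snd c p \<in> chart_image c" "p \<in> fst c \<Longrightarrow> chart_inv c (snd c p) = p"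
    "y \<in> chart_image c \<Longrightarrow> chart_inv c y \<in> fst c" "y \<in> chart_image c \<Longrightarrow> snd c (chart_inv c y) = y"
proof -
  have "is_chart c" using atlas assms unfolding smooth_atlas_def by blast
  then have op: "open (fst c)" "open (chart_image c)"
    and h: "homeomorphism (fst c) (chart_image c) (snd c) (chart_inv c)"
    unfolding is_chart_def by auto
  show "open (fst c)" "open (chart_image c)" by (rule op)+
  show "continuous_on (fst c) (snd c)" "continuous_on (chart_image c) (chart_inv c)"
    "p \<in> fst c \<Longrightarrow> snd c p \<in> chart_image c" "p \<in> fst c \<Longrightarrow> chart_inv c (snd c p) = p"
    "y \<in> chart_image c \<Longrightarrow> chart_inv c y \<in> fst c" "y \<in> chart_image c \<Longrightarrow> snd c (chart_inv c y) = y"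
    using h unfolding homeomorphism_def by auto
qed

lemmas chart_open = chart_homeomorphism(1)
lemmas image_open = chart_homeomorphism(2)
lemmas chart_cont = chart_homeomorphism(3)
lemmas inv_cont = chart_homeomorphism(4)
lemmas chart_in = chart_homeomorphism(5)
lemmas inv_chart = chart_homeomorphism(6)
lemmas inv_in = chart_homeomorphism(7)
lemmas chart_inv_eq = chart_homeomorphism(8)

lemma chart_at: "\<exists>c\<in>A. p \<in> fst c"
  using atlas unfolding smooth_atlas_def by blast

definition overlap :: "('m, 'k) chart \<Rightarrow> ('m, 'k) chart \<Rightarrow> (real ^ 'k) set" where
  "overlap c c' = {y \<in> chart_image c. chart_inv c y \<in> fst c'}"

lemma overlap_eq:
  assumes "c \<in> A"
  shows "overlap c c' = snd c ` (fst c \<inter> fst c')"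
proof
  show "overlap c c' \<subseteq> snd c ` (fst c \<inter> fst c')"
  proof
    fix y assume "y \<in> overlap c c'"
    then show "y \<in> snd c ` (fst c \<inter> fst c')"
      unfolding overlap_def by (intro image_eqI[of y "snd c" "chart_inv c y"]) (auto simp: chart_inv_eq[OF assms] inv_in[OF assms])
  qed
  show "snd c ` (fst c \<inter> fst c') \<subseteq> overlap c c'"
    unfolding overlap_def by (auto simp: chart_in[OF assms] inv_chart[OF assms])
qed

lemma open_inv_vimage: "c \<in> A \<Longrightarrow> open N \<Longrightarrow> open {y \<in> chart_image c. chart_inv c y \<in> N}"
  using continuous_open_preimage[OF inv_cont image_open, of c N] by (simp add: vimage_def Int_def)

lemma overlap_open: "c \<in> A \<Longrightarrow> c' \<in> A \<Longrightarrow> open (overlap c c')"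
  unfolding overlap_def by (intro open_inv_vimage chart_open)

lemma open_chart_vimage: "c \<in> A \<Longrightarrow> open B \<Longrightarrow> open {p \<in> fst c. snd c p \<in> B}"
  using continuous_open_preimage[OF chart_cont chart_open, of c B] by (simp add: vimage_def Int_def)

lemma chart_inv_image:
  assumes "c \<in> A" "B \<subseteq> chart_image c"
  shows "chart_inv c ` B = {p \<in> fst c. snd c p \<in> B}"
proof
  show "chart_inv c ` B \<subseteq> {p \<in> fst c. snd c p \<in> B}"
    using assms(2) inv_in[OF assms(1)] chart_inv_eq[OF assms(1)] by auto
  show "{p \<in> fst c. snd c p \<in> B} \<subseteq> chart_inv c ` B"
    by (auto intro!: image_eqI inv_chart[OF assms(1), symmetric])
qed

lemma open_chart_inv_image: "c \<in> A \<Longrightarrow> open B \<Longrightarrow> B \<subseteq> chart_image c \<Longrightarrow> open (chart_inv c ` B)"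
  by (simp add: chart_inv_image open_chart_vimage)

lemma compact_chart_inv_image: "c \<in> A \<Longrightarrow> compact K \<Longrightarrow> K \<subseteq> chart_image c \<Longrightarrow> compact (chart_inv c ` K)"
  by (rule compact_continuous_image[OF continuous_on_subset[OF inv_cont]])

lemma transition_Ck:
  assumes "c \<in> A" "c' \<in> A"
  shows "Ck_on k (\<lambda>y. snd c' (chart_inv c y)) (overlap c c')"
proof -
  have "smooth_on (overlap c c') (\<lambda>y. snd c' (chart_inv c y))"
    using atlas assms unfolding smooth_atlas_def overlap_eq[OF assms(1)] by blast
  then show ?thesis using smooth_on_open[OF overlap_open[OF assms]] by blast
qed

lemma transition_derivative:
  assumes "c \<in> A" "c' \<in> A" "p \<in> fst c" "p \<in> fst c'"
  shows "((\<lambda>y. snd c' (chart_inv c y)) has_derivative transition_deriv c c' p) (at (snd c p))"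
  unfolding transition_deriv_def
  by (rule Ck_on_has_derivative[OF transition_Ck[OF assms(1,2), of "Suc 0"]])
    (use assms in \<open>auto simp: overlap_def chart_in inv_chart\<close>)

definition Ck_map :: "nat \<Rightarrow> ('m \<Rightarrow> 'b::euclidean_space) \<Rightarrow> bool" where
  "Ck_map k f \<longleftrightarrow> (\<forall>c\<in>A. Ck_on k (\<lambda>y. f (chart_inv c y)) (chart_image c))"

lemma Ck_mapD: "Ck_map k f \<Longrightarrow> c \<in> A \<Longrightarrow> Ck_on k (\<lambda>y. f (chart_inv c y)) (chart_image c)"
  unfolding Ck_map_def by blast

text \<open>Transition maps are of every class C^k, so a check in one chart around each point passes
  to all charts by composition.\<close>

lemma Ck_map_local:
  assumes "\<And>p. \<exists>c\<in>A. \<exists>B. open B \<and> B \<subseteq> chart_image c \<and> p \<in> fst c \<and> snd c p \<in> B \<and>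
      Ck_on k (\<lambda>y. f (chart_inv c y)) B"
  shows "Ck_map k f"
  unfolding Ck_map_def
proof (intro ballI Ck_on_local)
  fix c' y assume c': "c' \<in> A" and y: "y \<in> chart_image c'"
  obtain c B where c: "c \<in> A" and B: "open B" "B \<subseteq> chart_image c" "chart_inv c' y \<in> fst c"
    "snd c (chart_inv c' y) \<in> B" "Ck_on k (\<lambda>y. f (chart_inv c y)) B"
    using assms[of "chart_inv c' y"] by blast
  let ?W = "{z \<in> chart_image c'. chart_inv c' z \<in> {p \<in> fst c. snd c p \<in> B}}"
  have W: "open ?W" by (intro open_inv_vimage c' open_chart_vimage c B(1))
  have T: "Ck_on k (\<lambda>z. snd c (chart_inv c' z)) ?W"
    by (rule Ck_on_subset[OF transition_Ck[OF c' c]]) (auto simp: overlap_def)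
  have "Ck_on k (\<lambda>z. f (chart_inv c (snd c (chart_inv c' z)))) ?W"
    by (rule Ck_on_compose[OF W B(1) _ B(5) T]) auto
  moreover have "Ck_on k (\<lambda>z. f (chart_inv c (snd c (chart_inv c' z)))) ?W \<longleftrightarrow>
      Ck_on k (\<lambda>z. f (chart_inv c' z)) ?W"
    by (rule Ck_on_cong[OF W]) (simp add: inv_chart[OF c])
  ultimately show "\<exists>V. open V \<and> y \<in> V \<and> Ck_on k (\<lambda>y. f (chart_inv c' y)) V"
    using W y B(3,4) by (intro exI[of _ ?W]) auto
qed

lemma Ck_map_continuous:
  assumes "Ck_map k f"
  shows "continuous_on UNIV f"
proof (rule continuous_at_imp_continuous_on, rule ballI)
  fix p
  obtain c where c: "c \<in> A" "p \<in> fst c" using chart_at by blast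
  have "continuous_on (fst c) (\<lambda>q. f (chart_inv c (snd c q)))"
    by (rule continuous_on_compose2[OF Ck_on_continuous_on[OF Ck_mapD[OF assms c(1)]] chart_cont[OF c(1)]])
      (use chart_in[OF c(1)] in auto)
  then have "continuous_on (fst c) f"
    by (rule continuous_on_eq) (simp add: inv_chart[OF c(1)])
  then show "isCont f p" using c continuous_on_eq_continuous_at[OF chart_open[OF c(1)]] by blast
qed

lemma Ck_map_mult:
  fixes f h :: "'m \<Rightarrow> real"
  shows "Ck_map k f \<Longrightarrow> Ck_map k h \<Longrightarrow> Ck_map k (\<lambda>p. f p * h p)"
  unfolding Ck_map_def using image_open Ck_on_mult by blast

lemma Ck_map_scaleR:
  "Ck_map k f \<Longrightarrow> Ck_map k h \<Longrightarrow> Ck_map k (\<lambda>p. f p *\<^sub>R h p)"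
  unfolding Ck_map_def using image_open Ck_on_scaleR by blast

lemma Ck_map_const [simp]: "Ck_map k (\<lambda>p. a)" unfolding Ck_map_def by simp

lemma Ck_map_sum: "(\<And>i. i \<in> I \<Longrightarrow> Ck_map k (f i)) \<Longrightarrow> Ck_map k (\<lambda>p. \<Sum>i\<in>I. f i p)"
  unfolding Ck_map_def by (intro ballI Ck_on_sum) (auto intro: image_open)

lemma Ck_map_divide:
  fixes f h :: "'m \<Rightarrow> real"
  assumes "Ck_map k f" "Ck_map k h" "\<And>p. h p \<noteq> 0"
  shows "Ck_map k (\<lambda>p. f p / h p)"
  using assms unfolding Ck_map_def by (intro ballI Ck_on_divide) (auto intro: image_open)

subsection \<open>Partitions of unity\<close>

text \<open>Differentiation lowers exponent and class together; at 0 the difference quotient is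
  bounded by a power of \<open>\<bar>h\<bar>\<close>. Cut-offs of finite smoothness built from this
  polynomial take the place of the usual exponential ones.\<close>

lemma Ck_on_pos_power: "Ck_on k (\<lambda>s::real. max 0 s ^ Suc k) UNIV"
proof (induction k)
  case 0
  show ?case by (auto intro!: continuous_intros)
next
  case (Suc k)
  show ?case
  proof (rule Ck_on_SucI[where D="\<lambda>s v. (real (Suc (Suc k)) * max 0 s ^ Suc k) * v"])
    fix s :: real
    have "((\<lambda>s. max 0 s ^ Suc (Suc k)) has_real_derivative real (Suc (Suc k)) * max 0 s ^ Suc k) (at s)"
    proof (cases "s = 0")
      case False
      show ?thesis
      proof (cases "s > 0")
        case True
        have "((\<lambda>s. s ^ Suc (Suc k)) has_real_derivative real (Suc (Suc k)) * s ^ Suc k) (at s)"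
          using DERIV_pow[of "Suc (Suc k)" s] by simp
        then show ?thesis
          using True has_field_derivative_transform_within_open[of "\<lambda>s. s ^ Suc (Suc k)" _ s "{0<..}"
              "\<lambda>s. max 0 s ^ Suc (Suc k)"] by (simp add: max_def)
      next
        case neg: False
        have "((\<lambda>s::real. 0) has_real_derivative 0) (at s)" by simp
        then show ?thesis
          using neg False has_field_derivative_transform_within_open[of "\<lambda>s. 0" 0 s "{..<0}"
              "\<lambda>s. max 0 s ^ Suc (Suc k)"] by (simp add: max_def)
      qed
    next
      case True
      have "((\<lambda>h. (max 0 (0 + h) ^ Suc (Suc k) - max 0 0 ^ Suc (Suc k)) / h) \<longlongrightarrow> 0) (at (0::real))"
      proof (rule Lim_null_comparison)
        show "\<forall>\<^sub>F h in at (0::real). norm ((max 0 (0 + h) ^ Suc (Suc k) - max 0 0 ^ Suc (Suc k)) / h) \<le> \<bar>h\<bar> ^ Suc k"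
          unfolding eventually_at_filter
        proof (intro always_eventually allI impI)
          fix h :: real assume h: "h \<noteq> 0"
          have "norm ((max 0 (0 + h) ^ Suc (Suc k) - max 0 0 ^ Suc (Suc k)) / h) = max 0 h ^ Suc (Suc k) / \<bar>h\<bar>"
            by (simp add: abs_mult)
          also have "\<dots> \<le> \<bar>h\<bar> ^ Suc (Suc k) / \<bar>h\<bar>"
            by (intro divide_right_mono power_mono) auto
          also have "\<dots> = \<bar>h\<bar> ^ Suc k" using h by simp
          finally show "norm ((max 0 (0 + h) ^ Suc (Suc k) - max 0 0 ^ Suc (Suc k)) / h) \<le> \<bar>h\<bar> ^ Suc k" .
        qed
        show "((\<lambda>h. \<bar>h\<bar> ^ Suc k) \<longlongrightarrow> 0) (at (0::real))"
          by (auto intro!: tendsto_eq_intros)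
      qed
      then show ?thesis using True by (simp add: DERIV_def)
    qed
    then show "((\<lambda>s. max 0 s ^ Suc (Suc k)) has_derivative (\<lambda>v. (real (Suc (Suc k)) * max 0 s ^ Suc k) * v)) (at s)"
      unfolding has_field_derivative_def .
  next
    show "Ck_on k (\<lambda>s. (real (Suc (Suc k)) * max 0 s ^ Suc k) * v) UNIV" for v :: real
      by (intro Ck_on_mult Ck_on_const Suc.IH open_UNIV)
  qed simp
qed

text \<open>Exponent 3 is what \<open>Ck_on_pos_power\<close> yields for class C^2, and the square
  of the norm avoids the kink of the norm at the centre. At class C^2 the Hamiltonian field is C^1
  and has a divergence.\<close>

definition bump :: "('m, 'k) chart \<Rightarrow> real ^ 'k \<Rightarrow> real \<Rightarrow> 'm \<Rightarrow> real" where
  "bump c a r p = (if p \<in> fst c then max 0 (r\<^sup>2 - (norm (snd c p - a))\<^sup>2) ^ 3 else 0)"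

lemma bump_nonneg: "0 \<le> bump c a r p" by (simp add: bump_def)

lemma bump_nonzero: "r > 0 \<Longrightarrow> bump c a r p \<noteq> 0 \<longleftrightarrow> p \<in> fst c \<and> snd c p \<in> ball a r"
proof -
  assume r: "r > 0"
  have "(norm (snd c p - a))\<^sup>2 < r\<^sup>2 \<longleftrightarrow> norm (snd c p - a) < r"
    using power2_less_imp_less[OF _ less_imp_le[OF r]] power_strict_mono[of "norm (snd c p - a)" r 2] by auto
  then show ?thesis unfolding bump_def by (auto simp: dist_norm norm_minus_commute max_def)
qed

text \<open>On the image of the closed ball the chart \<open>c\<close> itself serves. That image is
  compact, hence closed in a Hausdorff space, and off it the function is 0 on an open set.\<close>

lemma bump_Ck:
  assumes c: "c \<in> A" and r: "r > 0" "cball a r \<subseteq> chart_image c"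
  shows "Ck_map 2 (bump c a r)"
proof (rule Ck_map_local)
  fix p
  let ?K = "chart_inv c ` cball a r"
  show "\<exists>c'\<in>A. \<exists>B. open B \<and> B \<subseteq> chart_image c' \<and> p \<in> fst c' \<and> snd c' p \<in> B \<and>
      Ck_on 2 (\<lambda>y. bump c a r (chart_inv c' y)) B"
  proof (cases "p \<in> ?K")
    case True
    then have p: "p \<in> fst c" using inv_in[OF c] r(2) by auto
    have "Ck_on 2 (\<lambda>y. max 0 (r\<^sup>2 - (y - a) \<bullet> (y - a)) ^ 3) (chart_image c)"
    proof (rule Ck_on_compose[where f="\<lambda>s. max 0 s ^ 3" and T=UNIV])
      show "Ck_on 2 (\<lambda>s::real. max 0 s ^ 3) UNIV"
        using Ck_on_pos_power[of 2] by (simp add: eval_nat_numeral)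
      show "Ck_on 2 (\<lambda>y. r\<^sup>2 - (y - a) \<bullet> (y - a)) (chart_image c)"
        by (intro Ck_on_diff Ck_on_inner Ck_on_const Ck_on_id image_open c)
    qed (auto intro: image_open c)
    moreover have "Ck_on 2 (\<lambda>y. max 0 (r\<^sup>2 - (y - a) \<bullet> (y - a)) ^ 3) (chart_image c) \<longleftrightarrow>
        Ck_on 2 (\<lambda>y. bump c a r (chart_inv c y)) (chart_image c)"
      by (rule Ck_on_cong[OF image_open[OF c]])
        (simp add: bump_def inv_in[OF c] chart_inv_eq[OF c] power2_norm_eq_inner)
    ultimately have "Ck_on 2 (\<lambda>y. bump c a r (chart_inv c y)) (chart_image c)" by simp
    then show ?thesis
      using c p image_open[OF c] chart_in[OF c p] by (intro bexI[of _ c] exI[of _ "chart_image c"]) simp_all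
  next
    case False
    obtain c' where c': "c' \<in> A" "p \<in> fst c'" using chart_at by blast
    have "closed ?K" using compact_imp_closed[OF compact_chart_inv_image[OF c compact_cball r(2)]] .
    let ?B = "{y \<in> chart_image c'. chart_inv c' y \<in> - ?K}"
    have B: "open ?B" using \<open>closed ?K\<close> by (intro open_inv_vimage c') auto
    have z: "bump c a r q = 0" if "q \<notin> ?K" for q
    proof (rule ccontr)
      assume "bump c a r q \<noteq> 0"
      then have "q \<in> fst c" "snd c q \<in> cball a r" using bump_nonzero[OF r(1)] by auto
      then have "q \<in> ?K" using chart_inv_image[OF c r(2)] by simp
      then show False using that by simp
    qed
    have "Ck_on 2 (\<lambda>y. bump c a r (chart_inv c' y)) ?B \<longleftrightarrow> Ck_on 2 (\<lambda>y. 0::real) ?B"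
      by (rule Ck_on_cong[OF B]) (simp add: z)
    then have "Ck_on 2 (\<lambda>y. bump c a r (chart_inv c' y)) ?B" by simp
    then show ?thesis
      using B c' False chart_in[OF c'] inv_chart[OF c'] by (intro bexI[of _ c'] exI[of _ ?B]) simp_all
  qed
qed

text \<open>Bumps over a finite subcover, divided by their positive sum. The index of a piece is its
  centre, a point of the manifold, so the neighbourhood \<open>N i\<close> and later the values of
  functions at \<open>i\<close> can be attached to the piece directly.\<close>

theorem partition_of_unity:
  assumes N: "\<And>p. open (N p)" "\<And>p. p \<in> N p"
  obtains I \<eta> ch rad where "finite (I :: 'm set)"
    "\<And>i. i \<in> I \<Longrightarrow> ch i \<in> A \<and> i \<in> fst (ch i) \<and> rad i > 0 \<and> cball (snd (ch i) i) (rad i) \<subseteq> chart_image (ch i)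
        \<and> chart_inv (ch i) ` cball (snd (ch i) i) (rad i) \<subseteq> N i"
    "\<And>i. i \<in> I \<Longrightarrow> Ck_map 2 (\<eta> i)" "\<And>i p. 0 \<le> \<eta> i p" "\<And>p. (\<Sum>i\<in>I. \<eta> i p) = (1::real)"
    "\<And>i p. i \<in> I \<Longrightarrow> \<eta> i p \<noteq> 0 \<Longrightarrow> p \<in> chart_inv (ch i) ` cball (snd (ch i) i) (rad i)"
proof -
  define Q where "Q p c r \<longleftrightarrow> c \<in> A \<and> p \<in> fst c \<and> r > 0 \<and>
    cball (snd c p) r \<subseteq> {y \<in> chart_image c. chart_inv c y \<in> N p}" for p c r
  have "\<exists>c r. Q p c r" for p
  proof -
    obtain c where c: "c \<in> A" "p \<in> fst c" using chart_at by blast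
    have "open {y \<in> chart_image c. chart_inv c y \<in> N p}" by (intro open_inv_vimage c N)
    moreover have "snd c p \<in> {y \<in> chart_image c. chart_inv c y \<in> N p}"
      using c chart_in inv_chart N(2) by auto
    ultimately obtain r where "r > 0" "cball (snd c p) r \<subseteq> {y \<in> chart_image c. chart_inv c y \<in> N p}"
      using open_contains_cball by blast
    then show ?thesis unfolding Q_def using c by blast
  qed
  then obtain ch rad where "\<And>p. Q p (ch p) (rad p)" by metis
  then have cr: "\<And>p. ch p \<in> A" "\<And>p. p \<in> fst (ch p)" "\<And>p. rad p > 0"
    "\<And>p. cball (snd (ch p) p) (rad p) \<subseteq> {y \<in> chart_image (ch p). chart_inv (ch p) y \<in> N p}"
    unfolding Q_def by simp_all
  have sub: "cball (snd (ch p) p) (rad p) \<subseteq> chart_image (ch p)" for p using cr(4) by blast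
  define D where "D p = {q \<in> fst (ch p). snd (ch p) q \<in> ball (snd (ch p) p) (rad p)}" for p
  have opD: "open (D p)" for p unfolding D_def by (intro open_chart_vimage cr open_ball)
  have "p \<in> D p" for p unfolding D_def using cr(2,3) by simp
  then have cov: "UNIV \<subseteq> (\<Union>p\<in>UNIV. D p)" by blast
  obtain I where "I \<subseteq> UNIV" and I: "finite I" "UNIV \<subseteq> (\<Union>p\<in>I. D p)"
    by (rule compactE_image[OF cpt opD cov])
  let ?b = "\<lambda>p. bump (ch p) (snd (ch p) p) (rad p)"
  define \<eta> where "\<eta> i p = ?b i p / (\<Sum>j\<in>I. ?b j p)" for i p
  have pos: "(\<Sum>j\<in>I. ?b j p) > 0" for p
  proof -
    obtain j where j: "j \<in> I" "p \<in> D j" using I(2) by blast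
    then have "?b j p \<noteq> 0" using bump_nonzero[OF cr(3)] by (simp add: D_def)
    then have "?b j p > 0" using bump_nonneg[of "ch j" "snd (ch j) j" "rad j" p] by linarith
    then show ?thesis using I(1) j(1) by (intro sum_pos2) (auto simp: bump_nonneg)
  qed
  have bC: "Ck_map 2 (?b i)" for i by (rule bump_Ck[OF cr(1,3) sub])
  show ?thesis
  proof
    show "finite I" by (rule I)
    show "ch i \<in> A \<and> i \<in> fst (ch i) \<and> rad i > 0 \<and> cball (snd (ch i) i) (rad i) \<subseteq> chart_image (ch i)
        \<and> chart_inv (ch i) ` cball (snd (ch i) i) (rad i) \<subseteq> N i" for i
      using cr(1,2,3)[of i] cr(4)[of i] by auto
    have "(\<Sum>j\<in>I. ?b j p) \<noteq> 0" for p using pos[of p] by linarith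
    then show "Ck_map 2 (\<eta> i)" for i
      unfolding \<eta>_def by (intro Ck_map_divide Ck_map_sum bC)
    show "0 \<le> \<eta> i p" for i p unfolding \<eta>_def by (simp add: bump_nonneg sum_nonneg)
    show "(\<Sum>i\<in>I. \<eta> i p) = 1" for p
      unfolding \<eta>_def sum_divide_distrib[symmetric] using pos[of p] by simp
    show "p \<in> chart_inv (ch i) ` cball (snd (ch i) i) (rad i)" if "\<eta> i p \<noteq> 0" for i p
    proof -
      have "?b i p \<noteq> 0" using that unfolding \<eta>_def by auto
      then have "p \<in> fst (ch i)" "snd (ch i) p \<in> cball (snd (ch i) i) (rad i)"
        using bump_nonzero[OF cr(3)] by auto
      then show ?thesis using chart_inv_image[OF cr(1) sub] by simp
    qed
  qed
qed

end

section \<open>The Riemannian distance\<close>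

lemma bilinear_expansion:
  fixes T :: "'a::euclidean_space \<Rightarrow> 'a \<Rightarrow> real"
  assumes "bilinear T"
  shows "T u v = (\<Sum>i\<in>Basis. \<Sum>j\<in>Basis. (u \<bullet> i) * (v \<bullet> j) * T i j)"
proof -
  have l: "linear (\<lambda>x. T x y)" "linear (T x)" for x y using assms unfolding bilinear_def by auto
  have "T u v = (\<Sum>i\<in>Basis. (u \<bullet> i) *\<^sub>R T i v)" by (rule linear_basis_expansion[OF l(1)])
  also have "\<dots> = (\<Sum>i\<in>Basis. (u \<bullet> i) *\<^sub>R (\<Sum>j\<in>Basis. (v \<bullet> j) *\<^sub>R T i j))"
    by (rule sum.cong[OF refl]) (rule arg_cong[OF linear_basis_expansion[OF l(2)]])
  finally show ?thesis by (simp add: sum_distrib_left mult.assoc)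
qed

lemma has_derivative_imp_has_vector_derivative:
  fixes G :: "real \<Rightarrow> 'b::real_normed_vector"
  assumes "(G has_derivative D) F"
  shows "(G has_vector_derivative D 1) F"
proof -
  have "D = (\<lambda>h. h *\<^sub>R D 1)"
  proof
    fix h show "D h = h *\<^sub>R D 1"
      using linear_cmul[OF has_derivative_linear[OF assms], of h 1] by (simp only: real_scaleR_def mult_1_right)
  qed
  then show ?thesis
    unfolding has_vector_derivative_def by (rule has_derivative_eq_rhs[OF assms])
qed

context closed_manifold
begin

section \<open>Tensors and smooth curves in charts\<close>

lemma smooth_tensor2D:
  assumes "smooth_tensor2 A T" "c \<in> A"
  shows "p \<in> fst c \<Longrightarrow> bilinear (T c p)" "Ck_on k (\<lambda>y. T c (chart_inv c y) u v) (chart_image c)"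
    "c' \<in> A \<Longrightarrow> p \<in> fst c \<Longrightarrow> p \<in> fst c' \<Longrightarrow>
      T c p u v = T c' p (transition_deriv c c' p u) (transition_deriv c c' p v)"
proof -
  have "smooth_on (chart_image c) (\<lambda>y. T c (chart_inv c y) u v)"
    using assms unfolding smooth_tensor2_def by blast
  then show "Ck_on k (\<lambda>y. T c (chart_inv c y) u v) (chart_image c)"
    using smooth_on_open[OF image_open[OF assms(2)]] by blast
  show "p \<in> fst c \<Longrightarrow> bilinear (T c p)" using assms unfolding smooth_tensor2_def by blast
  show "c' \<in> A \<Longrightarrow> p \<in> fst c \<Longrightarrow> p \<in> fst c' \<Longrightarrow>
      T c p u v = T c' p (transition_deriv c c' p u) (transition_deriv c c' p v)"
    using assms unfolding smooth_tensor2_def by blast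
qed

text \<open>Smoothness of a tensor is stated for fixed vectors; expansion in the basis lets the
  vectors vary along with the point.\<close>

lemma smooth_tensor2_continuous:
  assumes "smooth_tensor2 A T" "c \<in> A"
    and "continuous_on S y" "continuous_on S u" "continuous_on S v" "\<And>s. s \<in> S \<Longrightarrow> y s \<in> chart_image c"
  shows "continuous_on S (\<lambda>s. T c (chart_inv c (y s)) (u s) (v s))"
proof -
  have "continuous_on S (\<lambda>s. \<Sum>i\<in>Basis. \<Sum>j\<in>Basis. (u s \<bullet> i) * (v s \<bullet> j) * T c (chart_inv c (y s)) i j)"
  proof (intro continuous_on_sum continuous_on_mult continuous_on_inner assms(3-5) continuous_on_const)
    fix i j :: "real ^ 'k"
    show "continuous_on S (\<lambda>s. T c (chart_inv c (y s)) i j)"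
      by (rule continuous_on_compose2[OF Ck_on_continuous_on[OF smooth_tensor2D(2)[OF assms(1,2), of 0 i j]] assms(3)])
        (use assms(6) in auto)
  qed
  moreover have "T c (chart_inv c (y s)) (u s) (v s) =
      (\<Sum>i\<in>Basis. \<Sum>j\<in>Basis. (u s \<bullet> i) * (v s \<bullet> j) * T c (chart_inv c (y s)) i j)" if "s \<in> S" for s
    by (rule bilinear_expansion[OF smooth_tensor2D(1)[OF assms(1,2) inv_in[OF assms(2) assms(6)[OF that]]]])
  ultimately show ?thesis by (subst continuous_on_cong[OF refl]) auto
qed

text \<open>\<open>G\<close> continues the coordinate curve smoothly past the end points of the
  interval, while continuity keeps the curve itself in the chart near \<open>t\<close>.\<close>

lemma curve_local:
  assumes "smooth_curve_on A {a..b} \<gamma>" "t \<in> {a..b}" "c \<in> A" "\<gamma> t \<in> fst c"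
  obtains V G where "open V" "t \<in> V" "\<And>k. Ck_on k G V"
    "\<And>s. s \<in> {a..b} \<Longrightarrow> s \<in> V \<Longrightarrow> \<gamma> s \<in> fst c \<and> G s = snd c (\<gamma> s)"
proof -
  have sm: "smooth_on {t\<in>{a..b}. \<gamma> t \<in> fst c} (\<lambda>t. snd c (\<gamma> t))" and co: "continuous_on {a..b} \<gamma>"
    using assms(1,3) unfolding smooth_curve_on_def by blast+
  obtain V G where V: "open V" "t \<in> V" "\<forall>k. Ck_on k G V"
      "\<forall>y\<in>{t\<in>{a..b}. \<gamma> t \<in> fst c} \<inter> V. G y = snd c (\<gamma> y)"
    using sm assms(2,4) unfolding smooth_on_def by blast
  obtain W where W: "open W" "t \<in> W" "\<forall>s\<in>{a..b}. s \<in> W \<longrightarrow> \<gamma> s \<in> fst c"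
    using co chart_open[OF assms(3)] assms(2,4) unfolding continuous_on_topological by blast
  show ?thesis
  proof (rule that[of "V \<inter> W" G])
    show "Ck_on k G (V \<inter> W)" for k using V(3) Ck_on_subset[of k G V] by blast
  qed (use V W in auto)
qed

lemma curve_interior:
  assumes "smooth_curve_on A {a..b} \<gamma>" "t \<in> {a<..<b}" "c \<in> A" "\<gamma> t \<in> fst c"
  obtains v W where "((\<lambda>s. snd c (\<gamma> s)) has_vector_derivative v) (at t)"
    "open W" "t \<in> W" "\<And>s. s \<in> W \<Longrightarrow> \<gamma> s \<in> fst c"
proof -
  obtain V G where V: "open V" "t \<in> V" "\<And>k. Ck_on k G V"
    "\<And>s. s \<in> {a..b} \<Longrightarrow> s \<in> V \<Longrightarrow> \<gamma> s \<in> fst c \<and> G s = snd c (\<gamma> s)"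
    by (rule curve_local[OF assms(1) _ assms(3,4)]) (use assms(2) in auto)
  have D: "(G has_derivative frechet_derivative G (at t)) (at t)"
    by (rule Ck_on_has_derivative[OF V(3)[of "Suc 0"] V(2)])
  have "(G has_vector_derivative frechet_derivative G (at t) 1) (at t)"
    by (rule has_derivative_imp_has_vector_derivative[OF D])
  then have "((\<lambda>s. snd c (\<gamma> s)) has_vector_derivative frechet_derivative G (at t) 1) (at t)"
    unfolding has_vector_derivative_def
    by (rule has_derivative_transform_within_open[of _ _ _ _ "V \<inter> {a<..<b}"]) (use V assms(2) in auto)
  then show ?thesis
    by (rule that[of _ "V \<inter> {a<..<b}"]) (use V assms(2) in auto)
qed

lemma smooth_curve_affine:
  assumes "smooth_curve_on A {a..b} \<gamma>" "\<And>t. t \<in> {a'..b'} \<Longrightarrow> \<kappa> * t + \<beta> \<in> {a..b}"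
  shows "smooth_curve_on A {a'..b'} (\<lambda>t. \<gamma> (\<kappa> * t + \<beta>))"
  unfolding smooth_curve_on_def
proof (intro conjI ballI)
  have co: "continuous_on {a..b} \<gamma>" using assms(1) unfolding smooth_curve_on_def by blast
  show "continuous_on {a'..b'} (\<lambda>t. \<gamma> (\<kappa> * t + \<beta>))"
    by (rule continuous_on_compose2[OF co]) (use assms(2) in \<open>auto intro!: continuous_intros\<close>)
  fix c assume c: "c \<in> A"
  show "smooth_on {t \<in> {a'..b'}. \<gamma> (\<kappa> * t + \<beta>) \<in> fst c} (\<lambda>t. snd c (\<gamma> (\<kappa> * t + \<beta>)))"
    unfolding smooth_on_def
  proof
    fix t assume t: "t \<in> {t \<in> {a'..b'}. \<gamma> (\<kappa> * t + \<beta>) \<in> fst c}"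
    obtain V G where V: "open V" "\<kappa> * t + \<beta> \<in> V" "\<And>k. Ck_on k G V"
      "\<And>s. s \<in> {a..b} \<Longrightarrow> s \<in> V \<Longrightarrow> \<gamma> s \<in> fst c \<and> G s = snd c (\<gamma> s)"
      by (rule curve_local[OF assms(1) assms(2) c]) (use t in auto)
    have W: "open ((\<lambda>t. \<kappa> * t + \<beta>) -` V)" using V(1) by (intro open_vimage continuous_intros)
    have "Ck_on k (\<lambda>t. G (\<kappa> * t + \<beta>)) ((\<lambda>t. \<kappa> * t + \<beta>) -` V)" for k
      by (rule Ck_on_compose[OF W V(1) _ V(3)]) (auto intro!: Ck_on_add Ck_on_mult W)
    then show "\<exists>V g. open V \<and> t \<in> V \<and> (\<forall>k. Ck_on k g V) \<and>
        (\<forall>y\<in>{t \<in> {a'..b'}. \<gamma> (\<kappa> * t + \<beta>) \<in> fst c} \<inter> V. g y = snd c (\<gamma> (\<kappa> * y + \<beta>)))"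
      using W V(2,4) assms(2)
      by (intro exI[of _ "(\<lambda>t. \<kappa> * t + \<beta>) -` V"] exI[of _ "\<lambda>t. G (\<kappa> * t + \<beta>)"]) auto
  qed
qed

lemma smooth_curve_cong:
  assumes "smooth_curve_on A I \<gamma>" "\<And>t. t \<in> I \<Longrightarrow> \<gamma> t = \<gamma>' t"
  shows "smooth_curve_on A I \<gamma>'"
proof -
  have "{t \<in> I. \<gamma> t \<in> fst c} = {t \<in> I. \<gamma>' t \<in> fst c}" for c :: "('m, 'k) chart" using assms(2) by auto
  note eq = this
  have "smooth_on {t \<in> I. \<gamma>' t \<in> fst c} (\<lambda>t. snd c (\<gamma>' t))" if c: "c \<in> A" for c
  proof -
    have "smooth_on {t \<in> I. \<gamma> t \<in> fst c} (\<lambda>t. snd c (\<gamma> t))"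
      using assms(1) c unfolding smooth_curve_on_def by blast
    then have "smooth_on {t \<in> I. \<gamma>' t \<in> fst c} (\<lambda>t. snd c (\<gamma> t))" unfolding eq .
    then show ?thesis by (rule smooth_on_cong) (simp add: assms(2))
  qed
  moreover have "continuous_on I \<gamma>'"
    using assms(1) unfolding smooth_curve_on_def by (metis assms(2) continuous_on_eq)
  ultimately show ?thesis unfolding smooth_curve_on_def by blast
qed

lemma smooth_curve_segment:
  assumes c: "c \<in> A" and seg: "\<And>t. t \<in> {0..1} \<Longrightarrow> y0 + t *\<^sub>R w \<in> chart_image c"
  shows "smooth_curve_on A {0..1} (\<lambda>t. chart_inv c (y0 + t *\<^sub>R w))"
  unfolding smooth_curve_on_def
proof (intro conjI ballI)
  show "continuous_on {0..1} (\<lambda>t. chart_inv c (y0 + t *\<^sub>R w))"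
    by (rule continuous_on_compose2[OF inv_cont[OF c]]) (use seg in \<open>auto intro!: continuous_intros\<close>)
  fix c' assume c': "c' \<in> A"
  let ?W = "(\<lambda>t::real. y0 + t *\<^sub>R w) -` overlap c c'"
  have W: "open ?W" by (intro open_vimage overlap_open c c' continuous_intros)
  have "Ck_on k (\<lambda>t. snd c' (chart_inv c (y0 + t *\<^sub>R w))) ?W" for k
    by (rule Ck_on_compose[OF W overlap_open[OF c c'] _ transition_Ck[OF c c']])
      (auto intro!: Ck_on_add Ck_on_scaleR W)
  then have "smooth_on ?W (\<lambda>t. snd c' (chart_inv c (y0 + t *\<^sub>R w)))" using smooth_on_open[OF W] by blast
  then show "smooth_on {t \<in> {0..1}. chart_inv c (y0 + t *\<^sub>R w) \<in> fst c'} (\<lambda>t. snd c' (chart_inv c (y0 + t *\<^sub>R w)))"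
    by (rule smooth_on_subset) (use seg in \<open>auto simp: overlap_def\<close>)
qed

end

section \<open>Break points of piecewise smooth curves\<close>

lemma break_points_around:
  assumes "finite S" "{0, 1} \<subseteq> S" "t \<in> {0..1} - S"
  obtains a b :: real where "a \<in> S" "b \<in> S" "a < t" "t < b" "{a<..<b} \<inter> S = {}"
proof -
  let ?L = "{s \<in> S. s < t}" and ?R = "{s \<in> S. t < s}"
  have t: "0 < t" "t < 1" using assms by (auto simp: less_eq_real_def)
  have L: "finite ?L" "?L \<noteq> {}" and R: "finite ?R" "?R \<noteq> {}" using assms t by auto
  have "Max ?L \<in> ?L" "Min ?R \<in> ?R" by (rule Max_in[OF L], rule Min_in[OF R])
  moreover have "{Max ?L<..<Min ?R} \<inter> S = {}"
  proof (rule ccontr)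
    assume "{Max ?L<..<Min ?R} \<inter> S \<noteq> {}"
    then obtain s where s: "Max ?L < s" "s < Min ?R" "s \<in> S" by auto
    then have "s \<noteq> t" using assms by auto
    then have "s \<in> ?L \<or> s \<in> ?R" using s(3) by auto
    then show False using s Max_ge[OF L(1), of s] Min_le[OF R(1), of s] by fastforce
  qed
  ultimately show ?thesis using that[of "Max ?L" "Min ?R"] by blast
qed

text \<open>Piecewise smoothness is expressed through neighbouring elements of a finite set. This is
  induction along that set in increasing order, by a least counterexample and its
  predecessor.\<close>

lemma break_point_induct:
  fixes S :: "real set"
  assumes S: "finite S" "{0, 1} \<subseteq> S" "S \<subseteq> {0..1}" and s: "s \<in> S" and "Q 0"
    and step: "\<And>a b. a \<in> S \<Longrightarrow> b \<in> S \<Longrightarrow> a < b \<Longrightarrow> {a<..<b} \<inter> S = {} \<Longrightarrow> Q a \<Longrightarrow> Q b"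
  shows "Q s"
proof (rule ccontr)
  assume "\<not> Q s"
  let ?B = "{b \<in> S. \<not> Q b}"
  have B: "finite ?B" "?B \<noteq> {}" using S(1) s \<open>\<not> Q s\<close> by auto
  define b where "b = Min ?B"
  have b: "b \<in> S" "\<not> Q b" using Min_in[OF B] unfolding b_def by auto
  then have "b \<noteq> 0" using \<open>Q 0\<close> by auto
  moreover have "0 \<le> b" using b(1) S(3) by auto
  ultimately have b0: "0 < b" by simp
  let ?L = "{a \<in> S. a < b}"
  have L: "finite ?L" "?L \<noteq> {}" using S b0 by auto
  have a: "Max ?L \<in> S" "Max ?L < b" using Max_in[OF L] by auto
  have "{Max ?L<..<b} \<inter> S = {}" using Max_ge[OF L(1)] by fastforce
  moreover have "Q (Max ?L)"
  proof (rule ccontr)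
    assume "\<not> Q (Max ?L)"
    then have "Max ?L \<in> ?B" using a(1) by simp
    from Min_le[OF B(1) this] have "b \<le> Max ?L" by (simp only: b_def[symmetric])
    then show False using a(2) by simp
  qed
  ultimately show False using step[OF a(1) b(1) a(2)] b(2) by blast
qed

lemma has_integral_affine01:
  fixes f :: "real \<Rightarrow> real"
  assumes "(f has_integral l) {0..1}" "\<kappa> \<noteq> 0"
  shows "((\<lambda>t. \<bar>\<kappa>\<bar> * f (\<kappa> * t + \<beta>)) has_integral l) ((\<lambda>x. (x - \<beta>) / \<kappa>) ` {0..1})"
proof -
  have "(f has_integral l) (cbox 0 1)" using assms(1) by simp
  from has_integral_affinity[OF this assms(2), of \<beta>]
  have "((\<lambda>t. f (\<kappa> * t + \<beta>)) has_integral (1 / \<bar>\<kappa>\<bar>) * l) ((\<lambda>x. (x - \<beta>) / \<kappa>) ` {0..1})"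
    by (simp add: diff_divide_distrib)
  from has_integral_mult_right[OF this, of "\<bar>\<kappa>\<bar>"] show ?thesis using assms(2) by simp
qed

lemma piecewiseE:
  assumes "piecewise_smooth_curve A \<gamma>"
  obtains S where "finite S" "{0, 1} \<subseteq> S" "S \<subseteq> {0..1}"
    "\<And>a b. a \<in> S \<Longrightarrow> b \<in> S \<Longrightarrow> a < b \<Longrightarrow> {a<..<b} \<inter> S = {} \<Longrightarrow> smooth_curve_on A {a..b} \<gamma>"
proof -
  obtain S where S: "finite S \<and> {0, 1} \<subseteq> S \<and> S \<subseteq> {0..1} \<and>
      (\<forall>a\<in>S. \<forall>b\<in>S. a < b \<and> {a<..<b} \<inter> S = {} \<longrightarrow> smooth_curve_on A {a..b} \<gamma>)"
    using assms unfolding piecewise_smooth_curve_def by (elim exE)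
  show ?thesis by (rule that[of S]) (use S in auto)
qed

locale riemannian_manifold = closed_manifold A for A :: "('m::t2_space, 'k::finite) chart set" +
  fixes g :: "('m, 'k) tensor2"
  assumes metric: "riemannian_metric A g"
begin

lemma metric_tensor: "smooth_tensor2 A g" using metric unfolding riemannian_metric_def by blast

lemma metric_bilinear: "c \<in> A \<Longrightarrow> p \<in> fst c \<Longrightarrow> bilinear (g c p)"
  by (rule smooth_tensor2D(1)[OF metric_tensor])

lemma metric_pos: "c \<in> A \<Longrightarrow> p \<in> fst c \<Longrightarrow> u \<noteq> 0 \<Longrightarrow> 0 < g c p u u"
  using metric unfolding riemannian_metric_def by blast

lemma metric_scale:
  assumes "c \<in> A" "p \<in> fst c"
  shows "g c p (a *\<^sub>R u) (a *\<^sub>R u) = a\<^sup>2 * g c p u u"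
  using bilinear_lmul[OF metric_bilinear[OF assms]] bilinear_rmul[OF metric_bilinear[OF assms]]
  by (simp add: power2_eq_square)

lemma metric_nonneg: "c \<in> A \<Longrightarrow> p \<in> fst c \<Longrightarrow> 0 \<le> g c p u u"
  using metric_pos[of c p u] metric_scale[of c p 0 u] by (cases "u = 0") auto

text \<open>By homogeneity it is enough to take the extreme values of the length over
  \<open>K\<close> times the unit sphere, which is compact and on which the length is
  positive.\<close>

lemma metric_bounds:
  assumes c: "c \<in> A" and K: "compact K" "K \<subseteq> chart_image c"
  obtains m M where "m > 0" "M > 0"
    "\<And>y u. y \<in> K \<Longrightarrow> m * norm u \<le> sqrt (g c (chart_inv c y) u u)"
    "\<And>y u. y \<in> K \<Longrightarrow> sqrt (g c (chart_inv c y) u u) \<le> M * norm u"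
proof (cases "K = {}")
  case True
  then show ?thesis using that[of 1 1] by simp
next
  case False
  let ?F = "\<lambda>p. sqrt (g c (chart_inv c (fst p)) (snd p) (snd p))"
  let ?C = "K \<times> sphere (0 :: real ^ 'k) 1"
  obtain b :: "real ^ 'k" where b: "b \<in> Basis" using nonempty_Basis by blast
  then have ne: "?C \<noteq> {}" using False by (auto intro!: exI[of _ b] simp: norm_Basis)
  have cC: "compact ?C" by (intro compact_Times K compact_sphere)
  have cont: "continuous_on ?C ?F"
    by (intro continuous_on_real_sqrt smooth_tensor2_continuous[OF metric_tensor c] continuous_intros)
      (use K(2) in auto)
  obtain p where p: "p \<in> ?C" "\<And>q. q \<in> ?C \<Longrightarrow> ?F p \<le> ?F q"
    using continuous_attains_inf[OF cC ne cont] by blast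
  obtain p' where p': "p' \<in> ?C" "\<And>q. q \<in> ?C \<Longrightarrow> ?F q \<le> ?F p'"
    using continuous_attains_sup[OF cC ne cont] by blast
  have fp: "?F q > 0" if "q \<in> ?C" for q
  proof -
    have "snd q \<noteq> 0" using that by auto
    moreover have "chart_inv c (fst q) \<in> fst c" using that K(2) inv_in[OF c] by auto
    ultimately show ?thesis using metric_pos[OF c] by simp
  qed
  have scale: "sqrt (g c (chart_inv c y) u u) = norm u * ?F (y, u /\<^sub>R norm u)" if "y \<in> K" "u \<noteq> 0" for y u
  proof -
    have "chart_inv c y \<in> fst c" using that(1) K(2) inv_in[OF c] by auto
    from metric_scale[OF c this, of "norm u" "u /\<^sub>R norm u"] that(2)
    show ?thesis by (simp add: real_sqrt_mult)
  qed
  have mem: "(y, u /\<^sub>R norm u) \<in> ?C" if "y \<in> K" "u \<noteq> 0" for y and u :: "real ^ 'k" using that by simp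
  have z: "sqrt (g c (chart_inv c y) 0 0) = 0" if "y \<in> K" for y
    using metric_scale[OF c, of "chart_inv c y" 0 0] that K(2) inv_in[OF c] by auto
  show ?thesis
  proof (rule that[of "?F p" "?F p'"])
    show "?F p > 0" "?F p' > 0" by (rule fp[OF p(1)], rule fp[OF p'(1)])
    fix y and u :: "real ^ 'k" assume y: "y \<in> K"
    show "?F p * norm u \<le> sqrt (g c (chart_inv c y) u u)"
    proof (cases "u = 0")
      case False
      show ?thesis unfolding scale[OF y False] using mult_right_mono[OF p(2)[OF mem[OF y False]], of "norm u"]
        by (simp add: mult.commute)
    qed (simp add: z[OF y])
    show "sqrt (g c (chart_inv c y) u u) \<le> ?F p' * norm u"
    proof (cases "u = 0")
      case False
      show ?thesis unfolding scale[OF y False] using mult_right_mono[OF p'(2)[OF mem[OF y False]], of "norm u"]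
        by (simp add: mult.commute)
    qed (simp add: z[OF y])
  qed
qed

lemma speed_nonneg: "0 \<le> speed A g \<gamma> t"
proof -
  have "\<exists>c. c \<in> A \<and> \<gamma> t \<in> fst c" using chart_at by blast
  then have "(SOME c. c \<in> A \<and> \<gamma> t \<in> fst c) \<in> A \<and> \<gamma> t \<in> fst (SOME c. c \<in> A \<and> \<gamma> t \<in> fst c)" by (rule someI_ex)
  then show ?thesis unfolding speed_def Let_def using metric_nonneg by simp
qed

text \<open>\<open>speed\<close> picks some chart around the point; the chain rule together with the
  transformation law of the tensor shows that every chart gives the same number.\<close>

lemma speed_eq:
  assumes \<gamma>: "smooth_curve_on A {a..b} \<gamma>" "t \<in> {a<..<b}" and c: "c \<in> A" "\<gamma> t \<in> fst c"
    and v: "((\<lambda>s. snd c (\<gamma> s)) has_vector_derivative v) (at t)"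
  shows "speed A g \<gamma> t = sqrt (g c (\<gamma> t) v v)"
proof -
  define c' where "c' = (SOME c. c \<in> A \<and> \<gamma> t \<in> fst c)"
  have "\<exists>c. c \<in> A \<and> \<gamma> t \<in> fst c" using chart_at by blast
  then have c': "c' \<in> A" "\<gamma> t \<in> fst c'" unfolding c'_def using someI_ex by (metis (mono_tags, lifting))+
  obtain w W where "((\<lambda>s. snd c (\<gamma> s)) has_vector_derivative w) (at t)"
    and W: "open W" "t \<in> W" "\<And>s. s \<in> W \<Longrightarrow> \<gamma> s \<in> fst c"
    by (rule curve_interior[OF \<gamma> c]) blast
  note T = transition_derivative[OF c(1) c'(1) c(2) c'(2)]
  have "((\<lambda>s. snd c' (chart_inv c (snd c (\<gamma> s)))) has_vector_derivative transition_deriv c c' (\<gamma> t) v) (at t)"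
    using diff_chain_at[OF v[unfolded has_vector_derivative_def] T]
    unfolding has_vector_derivative_def o_def
    by (simp add: linear_cmul[OF has_derivative_linear[OF T]])
  then have "((\<lambda>s. snd c' (\<gamma> s)) has_vector_derivative transition_deriv c c' (\<gamma> t) v) (at t)"
    unfolding has_vector_derivative_def
    by (rule has_derivative_transform_within_open[OF _ W(1,2)]) (simp add: inv_chart[OF c(1)] W(3))
  then have "vector_derivative (\<lambda>s. snd c' (\<gamma> s)) (at t) = transition_deriv c c' (\<gamma> t) v"
    by (rule vector_derivative_at)
  then show ?thesis
    unfolding speed_def Let_def c'_def[symmetric]
    using smooth_tensor2D(3)[OF metric_tensor c(1) c'(1) c(2) c'(2), of v v] by simp
qed

lemma speed_cong:
  assumes "open N" "t \<in> N" "\<And>s. s \<in> N \<Longrightarrow> \<gamma> s = \<gamma>' s"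
  shows "speed A g \<gamma> t = speed A g \<gamma>' t"
proof -
  have "((\<lambda>s. snd c (\<gamma> s)) has_vector_derivative v) (at t) \<longleftrightarrow> ((\<lambda>s. snd c (\<gamma>' s)) has_vector_derivative v) (at t)" for c :: "('m, 'k) chart" and v
    unfolding has_vector_derivative_def by (rule has_derivative_cong_open[OF assms(1,2)]) (simp add: assms(3))
  then show ?thesis unfolding speed_def vector_derivative_def assms(3)[OF assms(2)] by simp
qed

lemma speed_affine:
  assumes \<gamma>: "smooth_curve_on A {a..b} \<gamma>" "\<kappa> * t + \<beta> \<in> {a<..<b}"
  shows "speed A g (\<lambda>t. \<gamma> (\<kappa> * t + \<beta>)) t = \<bar>\<kappa>\<bar> * speed A g \<gamma> (\<kappa> * t + \<beta>)"
proof -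
  define c where "c = (SOME c. c \<in> A \<and> \<gamma> (\<kappa> * t + \<beta>) \<in> fst c)"
  have "\<exists>c. c \<in> A \<and> \<gamma> (\<kappa> * t + \<beta>) \<in> fst c" using chart_at by blast
  then have c: "c \<in> A" "\<gamma> (\<kappa> * t + \<beta>) \<in> fst c" unfolding c_def using someI_ex by (metis (mono_tags, lifting))+
  obtain v W where v: "((\<lambda>s. snd c (\<gamma> s)) has_vector_derivative v) (at (\<kappa> * t + \<beta>))"
    by (rule curve_interior[OF \<gamma> c]) blast
  have "((\<lambda>t. \<kappa> * t + \<beta>) has_vector_derivative \<kappa>) (at t)"
    by (auto intro!: derivative_eq_intros simp: has_real_derivative_iff_has_vector_derivative[symmetric])
  from vector_diff_chain_at[OF this v]
  have "((\<lambda>s. snd c (\<gamma> (\<kappa> * s + \<beta>))) has_vector_derivative \<kappa> *\<^sub>R v) (at t)" by (simp add: o_def)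
  then show ?thesis
    unfolding speed_def Let_def c_def[symmetric]
    by (simp add: vector_derivative_at[OF v] vector_derivative_at metric_scale[OF c] real_sqrt_mult)
qed

text \<open>Near each time the speed agrees with a continuous expression in the extension
  \<open>G\<close>, except possibly at \<open>a\<close> and \<open>b\<close>: there the two-sided
  \<open>vector_derivative\<close> also sees the curve outside the piece.\<close>

lemma speed_integrable_piece:
  assumes \<gamma>: "smooth_curve_on A {a..b} \<gamma>"
  shows "speed A g \<gamma> integrable_on {a..b}"
proof (rule integrable_on_little_subintervals[of "a" "b", unfolded cbox_interval], rule ballI)
  fix x assume x: "x \<in> {a..b}"
  obtain c where c: "c \<in> A" "\<gamma> x \<in> fst c" using chart_at by blast
  obtain V G where V: "open V" "x \<in> V" "\<And>k. Ck_on k G V"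
    "\<And>s. s \<in> {a..b} \<Longrightarrow> s \<in> V \<Longrightarrow> \<gamma> s \<in> fst c \<and> G s = snd c (\<gamma> s)"
    by (rule curve_local[OF \<gamma> x c]) blast
  let ?G' = "\<lambda>s. frechet_derivative G (at s) 1"
  let ?h = "\<lambda>s. sqrt (g c (chart_inv c (G s)) (?G' s) (?G' s))"
  obtain d where d: "d > 0" "ball x d \<subseteq> V" using V(1,2) openE by blast
  have "speed A g \<gamma> integrable_on {u..v}" if uv: "{u..v} \<subseteq> ball x d" "{u..v} \<subseteq> {a..b}" for u v
  proof -
    have sub: "{u..v} \<subseteq> V" using uv d by blast
    have im: "G s \<in> chart_image c" if "s \<in> {u..v}" for s
      using V(4)[of s] uv(2) sub that chart_in[OF c(1), of "\<gamma> s"] by auto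
    have "continuous_on {u..v} ?h"
      by (intro continuous_on_real_sqrt smooth_tensor2_continuous[OF metric_tensor c(1)]
          continuous_on_subset[OF Ck_on_continuous_on[OF V(3)[of 0]] sub]
          continuous_on_subset[OF Ck_on_continuous_on[OF Ck_on_frechet[OF V(3)[of "Suc 0"]]] sub] im)
    then have int: "?h integrable_on {u..v}" by (rule integrable_continuous_interval)
    show ?thesis
    proof (rule integrable_spike_finite[of "{a, b}" "{u..v}" "speed A g \<gamma>" ?h])
      fix s assume s: "s \<in> {u..v} - {a, b}"
      then have s': "s \<in> {a<..<b}" "s \<in> V" using uv sub by (auto simp: less_eq_real_def)
      have D: "(G has_derivative frechet_derivative G (at s)) (at s)"
        by (rule Ck_on_has_derivative[OF V(3)[of "Suc 0"] s'(2)])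
      have "(G has_vector_derivative ?G' s) (at s)"
        by (rule has_derivative_imp_has_vector_derivative[OF D])
      then have "((\<lambda>s. snd c (\<gamma> s)) has_vector_derivative ?G' s) (at s)"
        unfolding has_vector_derivative_def
        by (rule has_derivative_transform_within_open[of _ _ _ _ "V \<inter> {a<..<b}"]) (use V s' in auto)
      moreover have "\<gamma> s \<in> fst c" "G s = snd c (\<gamma> s)" using V(4)[of s] s' by auto
      ultimately show "speed A g \<gamma> s = ?h s"
        using speed_eq[OF \<gamma> s'(1) c(1)] by (simp add: inv_chart[OF c(1)])
    qed (use int in auto)
  qed
  then show "\<exists>d>0. \<forall>u v. x \<in> {u..v} \<and> {u..v} \<subseteq> ball x d \<and> {u..v} \<subseteq> {a..b} \<longrightarrow> speed A g \<gamma> integrable_on {u..v}"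
    using d(1) by blast
qed

lemma piecewise_continuous_integrable:
  assumes "piecewise_smooth_curve A \<gamma>"
  shows "continuous_on {0..1} \<gamma>" "speed A g \<gamma> integrable_on {0..1}"
proof -
  obtain S where S: "finite S" "{0, 1} \<subseteq> S" "S \<subseteq> {0..1}"
    and pc: "\<And>a b. a \<in> S \<Longrightarrow> b \<in> S \<Longrightarrow> a < b \<Longrightarrow> {a<..<b} \<inter> S = {} \<Longrightarrow> smooth_curve_on A {a..b} \<gamma>"
    by (rule piecewiseE[OF assms]) blast
  have "continuous_on {0..1} \<gamma> \<and> speed A g \<gamma> integrable_on {0..1}"
  proof (rule break_point_induct[OF S, where Q="\<lambda>s. continuous_on {0..s} \<gamma> \<and> speed A g \<gamma> integrable_on {0..s}"])
    fix a b assume ab: "a \<in> S" "b \<in> S" "a < b" "{a<..<b} \<inter> S = {}"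
      and IH: "continuous_on {0..a} \<gamma> \<and> speed A g \<gamma> integrable_on {0..a}"
    have a: "0 \<le> a" using ab(1) S(3) by auto
    then have eq: "{0..b} = {0..a} \<union> {a..b}" using ab(3) by auto
    have sm: "smooth_curve_on A {a..b} \<gamma>" by (rule pc[OF ab])
    have "continuous_on {0..b} \<gamma>"
      unfolding eq using IH sm by (intro continuous_on_closed_Un) (auto simp: smooth_curve_on_def)
    moreover have "speed A g \<gamma> integrable_on {0..b}"
      using Henstock_Kurzweil_Integration.integrable_combine[OF a less_imp_le[OF ab(3)]] IH speed_integrable_piece[OF sm] by blast
    ultimately show "continuous_on {0..b} \<gamma> \<and> speed A g \<gamma> integrable_on {0..b}" by blast
  qed (use S integrable_on_refl[of "speed A g \<gamma>" "0::real"] in auto)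
  then show "continuous_on {0..1} \<gamma>" "speed A g \<gamma> integrable_on {0..1}" by auto
qed

text \<open>The distance is the infimum of these lengths. Symmetry and the triangle inequality come
  from closing this relation under reversal and concatenation, so that no infimum is handled before
  the end.\<close>

definition joined :: "'m \<Rightarrow> 'm \<Rightarrow> real \<Rightarrow> bool" where
  "joined p q l \<longleftrightarrow> (\<exists>\<gamma>. piecewise_smooth_curve A \<gamma> \<and> \<gamma> 0 = p \<and> \<gamma> 1 = q \<and> (speed A g \<gamma> has_integral l) {0..1})"

lemma joinedE:
  assumes "joined p q l"
  obtains \<gamma> where "piecewise_smooth_curve A \<gamma>" "\<gamma> 0 = p" "\<gamma> 1 = q" "(speed A g \<gamma> has_integral l) {0..1}"
  using assms unfolding joined_def by (elim exE conjE)

lemma joined_nonneg: "joined p q l \<Longrightarrow> 0 \<le> l"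
  by (erule joinedE) (rule has_integral_nonneg, assumption, rule speed_nonneg)

lemma riemannian_dist_eq: "riemannian_dist A g p q = Inf {l. joined p q l}"
proof -
  have "{integral {0..1} (speed A g \<gamma>) | \<gamma>. piecewise_smooth_curve A \<gamma> \<and> \<gamma> 0 = p \<and> \<gamma> 1 = q} = {l. joined p q l}"
  proof (intro equalityI subsetI)
    fix l assume "l \<in> {integral {0..1} (speed A g \<gamma>) | \<gamma>. piecewise_smooth_curve A \<gamma> \<and> \<gamma> 0 = p \<and> \<gamma> 1 = q}"
    then obtain \<gamma> where \<gamma>: "l = integral {0..1} (speed A g \<gamma>)" "piecewise_smooth_curve A \<gamma>" "\<gamma> 0 = p" "\<gamma> 1 = q"
      by (elim CollectE exE conjE)
    then show "l \<in> {l. joined p q l}"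
      using integrable_integral[OF piecewise_continuous_integrable(2)[OF \<gamma>(2)]] unfolding joined_def by (intro CollectI exI[of _ \<gamma>]) simp
  next
    fix l assume "l \<in> {l. joined p q l}"
    then obtain \<gamma> where \<gamma>: "piecewise_smooth_curve A \<gamma>" "\<gamma> 0 = p" "\<gamma> 1 = q" "(speed A g \<gamma> has_integral l) {0..1}"
      by (elim CollectE joinedE)
    then show "l \<in> {integral {0..1} (speed A g \<gamma>) | \<gamma>. piecewise_smooth_curve A \<gamma> \<and> \<gamma> 0 = p \<and> \<gamma> 1 = q}"
      using integral_unique[OF \<gamma>(4)] by (intro CollectI exI[of _ \<gamma>]) simp
  qed
  then show ?thesis unfolding riemannian_dist_def by simp
qed

lemma joined_sym:
  assumes "joined p q l"
  shows "joined q p l"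
proof -
  obtain \<gamma> where \<gamma>: "piecewise_smooth_curve A \<gamma>" "\<gamma> 0 = p" "\<gamma> 1 = q" "(speed A g \<gamma> has_integral l) {0..1}"
    by (rule joinedE[OF assms])
  obtain S where S: "finite S" "{0, 1} \<subseteq> S" "S \<subseteq> {0..1}"
    and pc: "\<And>a b. a \<in> S \<Longrightarrow> b \<in> S \<Longrightarrow> a < b \<Longrightarrow> {a<..<b} \<inter> S = {} \<Longrightarrow> smooth_curve_on A {a..b} \<gamma>"
    by (rule piecewiseE[OF \<gamma>(1)]) blast
  \<comment> \<open>The reversal keeps the shape \<open>\<kappa> * t + \<beta>\<close> with
    coefficients -1 and 1, to match \<open>smooth_curve_affine\<close> and
    \<open>speed_affine\<close>.\<close>
  let ?\<gamma> = "\<lambda>t. \<gamma> (-1 * t + 1)" and ?S = "(\<lambda>s. 1 - s) ` S"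
  have S': "finite ?S" "{0, 1} \<subseteq> ?S" "?S \<subseteq> {0..1}"
    using S by (auto simp: image_iff intro: bexI[of _ 1] bexI[of _ 0])
  have mem: "s \<in> ?S \<longleftrightarrow> 1 - s \<in> S" for s by force
  have sm: "smooth_curve_on A {1 - b..1 - a} \<gamma>" if "a \<in> ?S" "b \<in> ?S" "a < b" "{a<..<b} \<inter> ?S = {}" for a b
  proof (rule pc)
    show "{1 - b<..<1 - a} \<inter> S = {}"
    proof (rule ccontr)
      assume "{1 - b<..<1 - a} \<inter> S \<noteq> {}"
      then obtain s where "s \<in> S" "1 - b < s" "s < 1 - a" by auto
      then have "1 - s \<in> {a<..<b} \<inter> ?S" by auto
      then show False using that(4) by blast
    qed
  qed (use that mem in auto)
  have pw: "piecewise_smooth_curve A ?\<gamma>"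
    unfolding piecewise_smooth_curve_def
  proof (intro exI[of _ ?S] conjI S' ballI impI)
    fix a b assume "a \<in> ?S" "b \<in> ?S" "a < b \<and> {a<..<b} \<inter> ?S = {}"
    then show "smooth_curve_on A {a..b} ?\<gamma>" by (intro smooth_curve_affine[OF sm[of a b]]) auto
  qed
  have "((\<lambda>t. \<bar>-1\<bar> * speed A g \<gamma> (-1 * t + 1)) has_integral l) ((\<lambda>x. (x - 1) / -1) ` {0..1})"
    by (rule has_integral_affine01[OF \<gamma>(4)]) simp
  moreover have "(\<lambda>x. (x - 1) / -1) ` {0..1::real} = {0..1}"
  proof (intro equalityI subsetI)
    fix x :: real assume "x \<in> {0..1}"
    then show "x \<in> (\<lambda>x. (x - 1) / -1) ` {0..1}" by (intro image_eqI[of x _ "1 - x"]) auto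
  qed auto
  ultimately have "((\<lambda>t. speed A g \<gamma> (-1 * t + 1)) has_integral l) {0..1}" by simp
  then have "(speed A g ?\<gamma> has_integral l) {0..1}"
  proof (rule has_integral_spike_finite[OF S'(1), rotated])
    fix t assume "t \<in> {0..1} - ?S"
    then obtain a b where ab: "a \<in> ?S" "b \<in> ?S" "a < t" "t < b" "{a<..<b} \<inter> ?S = {}"
      using break_points_around[OF S'(1,2)] by metis
    show "speed A g ?\<gamma> t = speed A g \<gamma> (-1 * t + 1)"
      using speed_affine[OF sm[OF ab(1,2) _ ab(5)], of "-1" t 1] ab by simp
  qed
  then show ?thesis unfolding joined_def using pw \<gamma>(2,3) by (intro exI[of _ ?\<gamma>]) simp
qed

lemma joined_trans:
  assumes "joined p q l" "joined q r l'"
  shows "joined p r (l + l')"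
proof -
  obtain \<gamma> where \<gamma>: "piecewise_smooth_curve A \<gamma>" "\<gamma> 0 = p" "\<gamma> 1 = q" "(speed A g \<gamma> has_integral l) {0..1}"
    by (rule joinedE[OF assms(1)])
  obtain \<delta> where \<delta>: "piecewise_smooth_curve A \<delta>" "\<delta> 0 = q" "\<delta> 1 = r" "(speed A g \<delta> has_integral l') {0..1}"
    by (rule joinedE[OF assms(2)])
  obtain S where S: "finite S" "{0, 1} \<subseteq> S" "S \<subseteq> {0..1}"
    and pc: "\<And>a b. a \<in> S \<Longrightarrow> b \<in> S \<Longrightarrow> a < b \<Longrightarrow> {a<..<b} \<inter> S = {} \<Longrightarrow> smooth_curve_on A {a..b} \<gamma>"
    by (rule piecewiseE[OF \<gamma>(1)]) blast
  obtain S' where S': "finite S'" "{0, 1} \<subseteq> S'" "S' \<subseteq> {0..1}"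
    and pc': "\<And>a b. a \<in> S' \<Longrightarrow> b \<in> S' \<Longrightarrow> a < b \<Longrightarrow> {a<..<b} \<inter> S' = {} \<Longrightarrow> smooth_curve_on A {a..b} \<delta>"
    by (rule piecewiseE[OF \<delta>(1)]) blast
  let ?j = "\<lambda>t. if t \<le> 1/2 then \<gamma> (2 * t + 0) else \<delta> (2 * t + (-1))"
  let ?L = "(\<lambda>s. s / 2) ` S" and ?R = "(\<lambda>s. (s + 1) / 2) ` S'"
  have memL: "s \<in> ?L \<longleftrightarrow> 2 * s \<in> S" for s
    using image_eqI[of s "\<lambda>s. s / 2" "2 * s" S] by auto
  have memR: "s \<in> ?R \<longleftrightarrow> 2 * s - 1 \<in> S'" for s
  proof
    assume "s \<in> ?R"
    then obtain s' where "s' \<in> S'" "s = (s' + 1) / 2" by blast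
    moreover from this have "2 * s - 1 = s'" by simp
    ultimately show "2 * s - 1 \<in> S'" by simp
  qed (auto intro: image_eqI[of s "\<lambda>s. (s + 1) / 2" "2 * s - 1" S'])
  have T: "finite (?L \<union> ?R)" "{0, 1} \<subseteq> ?L \<union> ?R" "?L \<union> ?R \<subseteq> {0..1}"
    using S S' memL[of 0] memR[of 1] by auto
  \<comment> \<open>As 1/2 is a break point of both halves, no interval between neighbouring break
    points straddles it.\<close>
  have half: "1/2 \<in> ?L" "1/2 \<in> ?R" using S S' memL[of "1/2"] memR[of "1/2"] by auto
  have smL: "smooth_curve_on A {2 * a..2 * b} \<gamma>"
    if "a \<in> ?L \<union> ?R" "b \<in> ?L \<union> ?R" "a < b" "{a<..<b} \<inter> (?L \<union> ?R) = {}" "b \<le> 1/2" for a b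
  proof (rule pc)
    have R: "s = 1/2" if "s \<in> ?R" "s \<le> 1/2" for s using that S'(3) memR[of s] by force
    have inL: "s \<in> ?L" if "s \<in> ?L \<union> ?R" "s \<le> 1/2" for s
    proof (cases "s \<in> ?L")
      case False
      then have "s = 1/2" using R that by blast
      then show ?thesis using half(1) by (simp only:)
    qed
    have "a \<le> 1/2" using that by linarith
    then show "2 * a \<in> S" using inL[OF that(1)] unfolding memL by blast
    show "2 * b \<in> S" using inL[OF that(2,5)] unfolding memL .
    show "{2 * a<..<2 * b} \<inter> S = {}"
    proof (rule ccontr)
      assume "{2 * a<..<2 * b} \<inter> S \<noteq> {}"
      then obtain s where "s \<in> S" "2 * a < s" "s < 2 * b" by auto
      then have "s / 2 \<in> {a<..<b} \<inter> (?L \<union> ?R)" by auto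
      then show False using that(4) by blast
    qed
  qed (use that in auto)
  have smR: "smooth_curve_on A {2 * a - 1..2 * b - 1} \<delta>"
    if "a \<in> ?L \<union> ?R" "b \<in> ?L \<union> ?R" "a < b" "{a<..<b} \<inter> (?L \<union> ?R) = {}" "1/2 \<le> a" for a b
  proof (rule pc')
    have L: "s = 1/2" if "s \<in> ?L" "1/2 \<le> s" for s using that S(3) memL[of s] by force
    have inR: "s \<in> ?R" if "s \<in> ?L \<union> ?R" "1/2 \<le> s" for s
    proof (cases "s \<in> ?R")
      case False
      then have "s = 1/2" using L that by blast
      then show ?thesis using half(2) by (simp only:)
    qed
    show "2 * a - 1 \<in> S'" using inR[OF that(1,5)] unfolding memR .
    have "1/2 \<le> b" using that by linarith
    then show "2 * b - 1 \<in> S'" using inR[OF that(2)] unfolding memR by blast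
    show "{2 * a - 1<..<2 * b - 1} \<inter> S' = {}"
    proof (rule ccontr)
      assume "{2 * a - 1<..<2 * b - 1} \<inter> S' \<noteq> {}"
      then obtain s where "s \<in> S'" "2 * a - 1 < s" "s < 2 * b - 1" by auto
      then have "(s + 1) / 2 \<in> {a<..<b} \<inter> (?L \<union> ?R)" by auto
      then show False using that(4) by blast
    qed
  qed (use that in auto)
  have side: "b \<le> 1/2 \<or> 1/2 \<le> a" if "{a<..<b} \<inter> (?L \<union> ?R) = {}" for a b
    using that half by (meson IntI UnI1 disjoint_iff greaterThanLessThan_iff not_le)
  have jR: "?j t = \<delta> (2 * t + (-1))" if "1/2 \<le> t" for t
  proof (cases "t = 1/2")
    case True
    then have e: "2 * t + 0 = 1" "2 * t + (-1) = 0" by simp_all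
    show ?thesis unfolding e using \<gamma>(3) \<delta>(2) by simp
  qed (use that in simp)
  have pw: "piecewise_smooth_curve A ?j"
    unfolding piecewise_smooth_curve_def
  proof (intro exI[of _ "?L \<union> ?R"] conjI T ballI impI)
    fix a b assume ab: "a \<in> ?L \<union> ?R" "b \<in> ?L \<union> ?R" "a < b \<and> {a<..<b} \<inter> (?L \<union> ?R) = {}"
    from side[of a b] ab(3) consider "b \<le> 1/2" | "1/2 \<le> a" by blast
    then show "smooth_curve_on A {a..b} ?j"
    proof cases
      case 1
      have "smooth_curve_on A {a..b} (\<lambda>t. \<gamma> (2 * t + 0))"
        by (rule smooth_curve_affine[OF smL[OF ab(1,2) _ _ 1]]) (use ab in auto)
      then show ?thesis by (rule smooth_curve_cong) (use 1 in auto)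
    next
      case 2
      have "smooth_curve_on A {a..b} (\<lambda>t. \<delta> (2 * t + (-1)))"
        by (rule smooth_curve_affine[OF smR[OF ab(1,2) _ _ 2]]) (use ab in auto)
      then show ?thesis
      proof (rule smooth_curve_cong)
        fix t assume "t \<in> {a..b}"
        then have "1/2 \<le> t" using 2 by simp
        then show "\<delta> (2 * t + (-1)) = ?j t" by (rule jR[symmetric])
      qed
    qed
  qed
  have "((\<lambda>t. \<bar>2\<bar> * speed A g \<gamma> (2 * t + 0)) has_integral l) ((\<lambda>x. (x - 0) / 2) ` {0..1})"
    by (rule has_integral_affine01[OF \<gamma>(4)]) simp
  moreover have "(\<lambda>x. (x - 0) / 2) ` {0..1::real} = {0..1/2}"
  proof (intro equalityI subsetI)
    fix x :: real assume "x \<in> {0..1/2}"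
    then show "x \<in> (\<lambda>x. (x - 0) / 2) ` {0..1}" by (intro image_eqI[of x _ "2 * x"]) auto
  qed auto
  ultimately have i1: "((\<lambda>t. \<bar>2\<bar> * speed A g \<gamma> (2 * t + 0)) has_integral l) {0..1/2}" by simp
  have I1: "(speed A g ?j has_integral l) {0..1/2}"
  proof (rule has_integral_spike_finite[OF T(1) _ i1])
    fix t assume t: "t \<in> {0..1/2} - (?L \<union> ?R)"
    then have "t \<in> {0..1} - (?L \<union> ?R)" by auto
    then obtain a b where ab: "a \<in> ?L \<union> ?R" "b \<in> ?L \<union> ?R" "a < t" "t < b" "{a<..<b} \<inter> (?L \<union> ?R) = {}"
      using break_points_around[OF T(1,2)] by metis
    have b: "b \<le> 1/2" using side[OF ab(5)] ab(3) t by auto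
    have "speed A g ?j t = speed A g (\<lambda>t. \<gamma> (2 * t + 0)) t"
      by (rule speed_cong[of "{a<..<b}"]) (use ab b in auto)
    also have "\<dots> = \<bar>2\<bar> * speed A g \<gamma> (2 * t + 0)"
      by (rule speed_affine[OF smL[OF ab(1,2) _ ab(5) b]]) (use ab in auto)
    finally show "speed A g ?j t = \<bar>2\<bar> * speed A g \<gamma> (2 * t + 0)" .
  qed
  have "((\<lambda>t. \<bar>2\<bar> * speed A g \<delta> (2 * t + (-1))) has_integral l') ((\<lambda>x. (x - (-1)) / 2) ` {0..1})"
    by (rule has_integral_affine01[OF \<delta>(4)]) simp
  moreover have "(\<lambda>x. (x - (-1)) / 2) ` {0..1::real} = {1/2..1}"
  proof (intro equalityI subsetI)
    fix x :: real assume "x \<in> {1/2..1}"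
    then show "x \<in> (\<lambda>x. (x - (-1)) / 2) ` {0..1}" by (intro image_eqI[of x _ "2 * x - 1"]) auto
  qed auto
  ultimately have i2: "((\<lambda>t. \<bar>2\<bar> * speed A g \<delta> (2 * t + (-1))) has_integral l') {1/2..1}" by simp
  have I2: "(speed A g ?j has_integral l') {1/2..1}"
  proof (rule has_integral_spike_finite[OF T(1) _ i2])
    fix t assume t: "t \<in> {1/2..1} - (?L \<union> ?R)"
    then have "t \<in> {0..1} - (?L \<union> ?R)" by auto
    then obtain a b where ab: "a \<in> ?L \<union> ?R" "b \<in> ?L \<union> ?R" "a < t" "t < b" "{a<..<b} \<inter> (?L \<union> ?R) = {}"
      using break_points_around[OF T(1,2)] by metis
    have a: "1/2 \<le> a" using side[OF ab(5)] ab(4) t by auto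
    have "speed A g ?j t = speed A g (\<lambda>t. \<delta> (2 * t + (-1))) t"
    proof (rule speed_cong[of "{a<..<b}"])
      fix s assume "s \<in> {a<..<b}"
      then have "1/2 \<le> s" using a by simp
      then show "?j s = \<delta> (2 * s + (-1))" by (rule jR)
    qed (use ab in auto)
    also have "\<dots> = \<bar>2\<bar> * speed A g \<delta> (2 * t + (-1))"
      by (rule speed_affine[OF smR[OF ab(1,2) _ ab(5) a]]) (use ab in auto)
    finally show "speed A g ?j t = \<bar>2\<bar> * speed A g \<delta> (2 * t + (-1))" .
  qed
  have "(speed A g ?j has_integral (l + l')) {0..1}"
    by (rule has_integral_combine[OF _ _ I1 I2]) auto
  then show ?thesis unfolding joined_def using pw \<gamma>(2) \<delta>(3) by (intro exI[of _ ?j]) simp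
qed

text \<open>A curve from \<open>p\<close> either reaches the boundary of the chart ball, and its
  part up to the first exit already costs \<open>m * r\<close>, or it stays inside and its length
  controls the displacement in the chart.\<close>

lemma joined_lower:
  assumes c: "c \<in> A" "p \<in> fst c" and r: "r > 0" "cball (snd c p) r \<subseteq> chart_image c"
    and m: "m > 0" "\<And>y u. y \<in> cball (snd c p) r \<Longrightarrow> m * norm u \<le> sqrt (g c (chart_inv c y) u u)"
    and j: "joined p q l"
  shows "m * r \<le> l \<or> (q \<in> fst c \<and> snd c q \<in> ball (snd c p) r \<and> m * norm (snd c q - snd c p) \<le> l)"
proof -
  obtain \<gamma> where \<gamma>: "piecewise_smooth_curve A \<gamma>" "\<gamma> 0 = p" "\<gamma> 1 = q" "(speed A g \<gamma> has_integral l) {0..1}"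
    by (rule joinedE[OF j])
  obtain S where S: "finite S" "{0, 1} \<subseteq> S" "S \<subseteq> {0..1}"
    and pc: "\<And>a b. a \<in> S \<Longrightarrow> b \<in> S \<Longrightarrow> a < b \<Longrightarrow> {a<..<b} \<inter> S = {} \<Longrightarrow> smooth_curve_on A {a..b} \<gamma>"
    by (rule piecewiseE[OF \<gamma>(1)]) blast
  note ci = piecewise_continuous_integrable[OF \<gamma>(1)]
  let ?y = "\<lambda>t. snd c (\<gamma> t)"
  define Ob where "Ob = {q \<in> fst c. snd c q \<in> ball (snd c p) r}"
  define K where "K = {q \<in> fst c. snd c q \<in> cball (snd c p) r}"
  have Ob: "open Ob" unfolding Ob_def by (rule open_chart_vimage[OF c(1) open_ball])
  have K: "closed K"
    using compact_imp_closed[OF compact_chart_inv_image[OF c(1) compact_cball r(2)]] chart_inv_image[OF c(1) r(2)]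
    unfolding K_def by simp
  have OK: "Ob \<subseteq> K" unfolding Ob_def K_def by auto
  have core: "m * norm (?y t1 - snd c p) \<le> l" if t1: "t1 \<in> {0..1}" and inK: "\<And>t. t \<in> {0..t1} \<Longrightarrow> \<gamma> t \<in> K" for t1
  proof -
    have ycont: "continuous_on {0..t1} ?y"
      by (rule continuous_on_compose2[OF chart_cont[OF c(1)] continuous_on_subset[OF ci(1)]])
        (use t1 inK in \<open>auto simp: K_def\<close>)
    \<comment> \<open>The value 0 off the smooth times does not affect the integral and keeps the
      bound by the speed valid at every time.\<close>
    define f' where "f' s = (if s \<in> {0<..<t1} - S then vector_derivative ?y (at s) else 0)" for s
    have der: "(?y has_vector_derivative f' s) (at s) \<and> norm (f' s) \<le> speed A g \<gamma> s / m"
      if s: "s \<in> {0<..<t1} - S" for s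
    proof -
      have "s \<in> {0..1} - S" using s t1 by auto
      then obtain a b where ab: "a \<in> S" "b \<in> S" "a < s" "s < b" "{a<..<b} \<inter> S = {}"
        using break_points_around[OF S(1,2)] by metis
      have sm: "smooth_curve_on A {a..b} \<gamma>" by (rule pc[OF ab(1,2) _ ab(5)]) (use ab in auto)
      have sK: "\<gamma> s \<in> fst c" "?y s \<in> cball (snd c p) r" using inK[of s] s by (auto simp: K_def)
      obtain v W where v: "(?y has_vector_derivative v) (at s)"
        by (rule curve_interior[OF sm _ c(1) sK(1)]) (use ab in auto)
      have "speed A g \<gamma> s = sqrt (g c (\<gamma> s) v v)"
        by (rule speed_eq[OF sm _ c(1) sK(1) v]) (use ab in auto)
      then have "m * norm v \<le> speed A g \<gamma> s" using m(2)[OF sK(2), of v] by (simp add: inv_chart[OF c(1) sK(1)])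
      then have "norm v \<le> speed A g \<gamma> s / m" using m(1) by (simp add: field_simps)
      moreover have "f' s = v" using s vector_derivative_at[OF v] by (simp add: f'_def)
      ultimately show ?thesis using v by simp
    qed
    have f'int: "(f' has_integral (?y t1 - ?y 0)) {0..t1}"
      by (rule fundamental_theorem_of_calculus_interior_strong[OF S(1)]) (use t1 ycont der in auto)
    have spi: "speed A g \<gamma> integrable_on {0..t1}"
      by (rule integrable_subinterval_real[OF ci(2)]) (use t1 in auto)
    have "norm (integral {0..t1} f') \<le> integral {0..t1} (\<lambda>s. speed A g \<gamma> s / m)"
    proof (rule Henstock_Kurzweil_Integration.integral_norm_bound_integral)
      show "f' integrable_on {0..t1}" using f'int by (rule has_integral_integrable)
      show "(\<lambda>s. speed A g \<gamma> s / m) integrable_on {0..t1}" using spi by (rule integrable_on_divide)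
      show "norm (f' s) \<le> speed A g \<gamma> s / m" if "s \<in> {0..t1}" for s
        using der[of s] m(1) speed_nonneg[of \<gamma> s] by (cases "s \<in> {0<..<t1} - S") (auto simp: f'_def)
    qed
    also have "\<dots> = integral {0..t1} (speed A g \<gamma>) / m" by simp
    also have "\<dots> \<le> integral {0..1} (speed A g \<gamma>) / m"
    proof (rule divide_right_mono)
      show "integral {0..t1} (speed A g \<gamma>) \<le> integral {0..1} (speed A g \<gamma>)"
        by (rule integral_subset_le[OF _ spi ci(2)]) (use t1 speed_nonneg in auto)
    qed (use m(1) in simp)
    finally show ?thesis
      using integral_unique[OF f'int] integral_unique[OF \<gamma>(4)] m(1) \<gamma>(2) by (simp add: field_simps)
  qed
  show ?thesis
  proof (cases "\<forall>t\<in>{0..1}. \<gamma> t \<in> Ob")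
    case True
    then have "\<gamma> 1 \<in> Ob" by simp
    moreover have "m * norm (?y 1 - snd c p) \<le> l" by (rule core) (use True OK in auto)
    ultimately show ?thesis using \<gamma>(3) by (auto simp: Ob_def)
  next
    case False
    define T where "T = {t \<in> {0..1}. \<gamma> t \<in> - Ob}"
    have Tc: "closed T"
      using continuous_closed_preimage[OF ci(1) closed_atLeastAtMost closed_Compl[OF Ob]]
      unfolding T_def by (simp add: vimage_def Int_def)
    have Tne: "T \<noteq> {}" using False by (auto simp: T_def)
    have Tb: "bdd_below T" unfolding T_def by (auto simp: bdd_below_def intro: exI[of _ 0])
    \<comment> \<open>The first time outside the open ball. Up to and including \<open>t1\<close>
      the curve lies in the compact closed ball, so \<open>core\<close> still applies there.\<close>
    define t1 where "t1 = Inf T"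
    have t1T: "t1 \<in> T" unfolding t1_def by (rule closed_contains_Inf[OF Tne Tb Tc])
    have before: "\<gamma> t \<in> Ob" if "t \<in> {0..<t1}" for t
    proof (rule ccontr)
      assume "\<gamma> t \<notin> Ob"
      then have "t \<in> T" using that t1T by (auto simp: T_def)
      then have "t1 \<le> t" unfolding t1_def using Tb by (intro cInf_lower)
      then show False using that by simp
    qed
    have "p \<in> Ob" using c(2) r(1) by (simp add: Ob_def)
    then have "t1 \<noteq> 0" using t1T \<gamma>(2) by (auto simp: T_def)
    then have t1: "0 < t1" "t1 \<le> 1" using t1T by (auto simp: T_def)
    have cl: "closure {0..<t1} = {0..t1}" using t1 by simp
    have "\<gamma> ` closure {0..<t1} \<subseteq> K"
      by (rule image_closure_subset[OF continuous_on_subset[OF ci(1)] K]) (use t1 before OK cl in auto)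
    then have inK: "\<gamma> t \<in> K" if "t \<in> {0..t1}" for t using that unfolding cl by blast
    have "\<gamma> t1 \<in> K" "\<gamma> t1 \<notin> Ob" using inK[of t1] t1 t1T by (auto simp: T_def)
    then have "r \<le> norm (?y t1 - snd c p)" by (auto simp: K_def Ob_def dist_norm norm_minus_commute)
    then have "m * r \<le> m * norm (?y t1 - snd c p)" using m(1) by simp
    also have "\<dots> \<le> l" by (rule core) (use t1 inK in auto)
    finally show ?thesis ..
  qed
qed

text \<open>The straight segment in the chart is the competing curve.\<close>

lemma joined_upper:
  assumes c: "c \<in> A" "p \<in> fst c" and r: "cball (snd c p) r \<subseteq> chart_image c"
    and M: "M > 0" "\<And>y u. y \<in> cball (snd c p) r \<Longrightarrow> sqrt (g c (chart_inv c y) u u) \<le> M * norm u"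
    and q: "q \<in> fst c" "snd c q \<in> cball (snd c p) r"
  shows "\<exists>l. joined p q l \<and> l \<le> M * norm (snd c q - snd c p)"
proof -
  let ?w = "snd c q - snd c p"
  let ?\<gamma> = "\<lambda>t. chart_inv c (snd c p + t *\<^sub>R ?w)"
  have seg: "snd c p + t *\<^sub>R ?w \<in> cball (snd c p) r" if "t \<in> {0..1}" for t
  proof -
    have "norm (t *\<^sub>R ?w) \<le> norm ?w" using that mult_right_mono[of t 1 "norm ?w"] by simp
    then show ?thesis using q(2) by (simp add: dist_norm norm_minus_commute)
  qed
  have sm: "smooth_curve_on A {0..1} ?\<gamma>" by (rule smooth_curve_segment[OF c(1)]) (use seg r in blast)
  have pw: "piecewise_smooth_curve A ?\<gamma>"
    unfolding piecewise_smooth_curve_def by (rule exI[of _ "{0, 1}"]) (use sm in auto)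
  have ends: "?\<gamma> 0 = p" "?\<gamma> 1 = q" using c q by (simp_all add: inv_chart)
  let ?l = "integral {0..1} (speed A g ?\<gamma>)"
  have int: "(speed A g ?\<gamma> has_integral ?l) {0..1}"
    by (rule integrable_integral[OF piecewise_continuous_integrable(2)[OF pw]])
  have sp: "speed A g ?\<gamma> t \<le> M * norm ?w" if t: "t \<in> {0<..<1}" for t
  proof -
    have y: "snd c p + t *\<^sub>R ?w \<in> cball (snd c p) r" by (rule seg) (use t in auto)
    then have im: "snd c p + t *\<^sub>R ?w \<in> chart_image c" using r by blast
    have "((\<lambda>t. snd c p + t *\<^sub>R ?w) has_vector_derivative ?w) (at t)"
      by (auto intro!: derivative_eq_intros)
    then have "((\<lambda>s. snd c (?\<gamma> s)) has_vector_derivative ?w) (at t)"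
      unfolding has_vector_derivative_def
      by (rule has_derivative_transform_within_open[of _ _ _ _ "{0<..<1}"])
        (use t seg r in \<open>auto simp: chart_inv_eq[OF c(1)] subset_eq simp del: mem_cball\<close>)
    from speed_eq[OF sm t c(1) inv_in[OF c(1) im] this] show ?thesis using M(2)[OF y] by simp
  qed
  have int': "((\<lambda>t. if t \<in> {0, 1} then 0 else speed A g ?\<gamma> t) has_integral ?l) {0..1}"
    by (rule has_integral_spike_finite[OF _ _ int, of "{0, 1}"]) auto
  have "?l \<le> M * norm ?w * (1 - 0)"
  proof (rule has_integral_le[OF int'])
    show "((\<lambda>t. M * norm ?w) has_integral M * norm ?w * (1 - 0)) {0..1::real}"
      using has_integral_const_real[of "M * norm ?w" 0 1] by simp
    fix t :: real assume "t \<in> {0..1}"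
    then show "(if t \<in> {0, 1} then 0 else speed A g ?\<gamma> t) \<le> M * norm ?w"
      using sp[of t] M(1) by auto
  qed
  then show ?thesis using int pw ends unfolding joined_def by (intro exI[of _ ?l]) (auto intro: exI[of _ ?\<gamma>])
qed

lemma chart_ball_data:
  obtains c r m M where "c \<in> A" "p \<in> fst c" "r > 0" "cball (snd c p) r \<subseteq> chart_image c" "m > 0" "M > 0"
    "\<And>q l. joined p q l \<Longrightarrow> m * r \<le> l \<or> (q \<in> fst c \<and> snd c q \<in> ball (snd c p) r \<and> m * norm (snd c q - snd c p) \<le> l)"
    "\<And>q. q \<in> fst c \<Longrightarrow> snd c q \<in> cball (snd c p) r \<Longrightarrow> \<exists>l. joined p q l \<and> l \<le> M * norm (snd c q - snd c p)"
proof -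
  obtain c where c: "c \<in> A" "p \<in> fst c" using chart_at by blast
  obtain r where r: "r > 0" "cball (snd c p) r \<subseteq> chart_image c"
    using image_open[OF c(1)] chart_in[OF c] open_contains_cball by blast
  obtain m M where mM: "m > 0" "M > 0"
    "\<And>y u. y \<in> cball (snd c p) r \<Longrightarrow> m * norm u \<le> sqrt (g c (chart_inv c y) u u)"
    "\<And>y u. y \<in> cball (snd c p) r \<Longrightarrow> sqrt (g c (chart_inv c y) u u) \<le> M * norm u"
    by (rule metric_bounds[OF c(1) compact_cball r(2)]) blast
  show ?thesis
    by (rule that[OF c r mM(1,2) joined_lower[OF c r mM(1,3)] joined_upper[OF c r(2) mM(2,4)]])
qed

text \<open>Being joined by a curve is an equivalence relation in which every point is related to a
  whole chart ball around it; a connected space has only one class.\<close>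

lemma joined_exists: "\<exists>l. joined p q l"
proof (rule connected_equivalence_relation[OF conn, where R="\<lambda>p q. \<exists>l. joined p q l"])
  show "\<exists>l. joined q p l" if "\<exists>l. joined p q l" for p q using that joined_sym by blast
  show "\<exists>l. joined p r l" if "\<exists>l. joined p q l" "\<exists>l. joined q r l" for p q r using that joined_trans by blast
  fix p :: 'm
  obtain c r and m M :: real where c: "c \<in> A" "p \<in> fst c" and r: "r > 0" "cball (snd c p) r \<subseteq> chart_image c"
    and up: "\<And>q. q \<in> fst c \<Longrightarrow> snd c q \<in> cball (snd c p) r \<Longrightarrow> \<exists>l. joined p q l \<and> l \<le> M * norm (snd c q - snd c p)"
    by (rule chart_ball_data[of p]) blast
  have "open {q \<in> fst c. snd c q \<in> ball (snd c p) r}" by (rule open_chart_vimage[OF c(1) open_ball])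
  then show "\<exists>T. openin (top_of_set UNIV) T \<and> p \<in> T \<and> (\<forall>q\<in>T. \<exists>l. joined p q l)"
    using c r(1) up by (intro exI[of _ "{q \<in> fst c. snd c q \<in> ball (snd c p) r}"]) force
qed auto

abbreviation "d \<equiv> riemannian_dist A g"

lemma bdd_joined: "bdd_below {l. joined p q l}"
  using joined_nonneg by (auto simp: bdd_below_def)

lemma ne_joined: "{l. joined p q l} \<noteq> {}"
  using joined_exists by auto

lemma dist_le: "joined p q l \<Longrightarrow> d p q \<le> l"
  unfolding riemannian_dist_eq by (rule cInf_lower[OF _ bdd_joined]) simp

lemma dist_less: "d p q < e \<Longrightarrow> \<exists>l<e. joined p q l"
  unfolding riemannian_dist_eq using cInf_lessD[OF ne_joined] by blast

lemma dist_ge: "(\<And>l. joined p q l \<Longrightarrow> b \<le> l) \<Longrightarrow> b \<le> d p q"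
  unfolding riemannian_dist_eq by (rule cInf_greatest[OF ne_joined]) simp

text \<open>The lower length bound in a chart ball gives definiteness and puts metric balls inside
  open sets; the upper bound puts chart balls inside metric balls.\<close>

theorem riemannian_compact_dist: "compact_dist d"
proof
  show "compact (UNIV :: 'm set)" by (rule cpt)
  show "0 \<le> d x y" for x y by (rule dist_ge) (rule joined_nonneg)
  show "d x y = d y x" for x y
    by (rule antisym; rule dist_ge; rule dist_le; rule joined_sym)
  show "d x z \<le> d x y + d y z" for x y z
  proof -
    have "d x z - l \<le> d y z" if "joined x y l" for l
      by (rule dist_ge) (use dist_le[OF joined_trans[OF that]] in force)
    then have "d x z - d y z \<le> l" if "joined x y l" for l using that by force
    then have "d x z - d y z \<le> d x y" by (rule dist_ge)
    then show ?thesis by simp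
  qed
  show "d x y = 0 \<longleftrightarrow> x = y" for x y
  proof -
    obtain c r and m M :: real where c: "c \<in> A" "x \<in> fst c" and r: "r > 0" "cball (snd c x) r \<subseteq> chart_image c"
      and m: "m > 0" "M > 0"
      and low: "\<And>q l. joined x q l \<Longrightarrow> m * r \<le> l \<or> (q \<in> fst c \<and> snd c q \<in> ball (snd c x) r \<and> m * norm (snd c q - snd c x) \<le> l)"
      and up: "\<And>q. q \<in> fst c \<Longrightarrow> snd c q \<in> cball (snd c x) r \<Longrightarrow> \<exists>l. joined x q l \<and> l \<le> M * norm (snd c q - snd c x)"
      by (rule chart_ball_data[of x]) blast
    show ?thesis
    proof
      assume d0: "d x y = 0"
      have mr: "m * r > 0" using m r by simp
      obtain l where "l < m * r" "joined x y l" using dist_less[of x y "m * r"] d0 mr by auto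
      then have y: "y \<in> fst c" using low[of y l] by auto
      show "x = y"
      proof (rule ccontr)
        assume "x \<noteq> y"
        then have "snd c y - snd c x \<noteq> 0" using c(2) y inv_chart[OF c(1)] by (metis eq_iff_diff_eq_0)
        then have pos: "m * norm (snd c y - snd c x) > 0" using m(1) by simp
        obtain l where "l < min (m * r) (m * norm (snd c y - snd c x))" "joined x y l"
          using dist_less[of x y "min (m * r) (m * norm (snd c y - snd c x))"] d0 mr pos by auto
        then show False using low[of y l] by auto
      qed
    next
      assume "x = y"
      then have "d x y \<le> 0" using up[OF c(2)] r(1) dist_le by force
      moreover have "0 \<le> d x y" by (rule dist_ge) (rule joined_nonneg)
      ultimately show "d x y = 0" by simp
    qed
  qed
  show "open S \<longleftrightarrow> (\<forall>x\<in>S. \<exists>e>0. \<forall>y. d x y < e \<longrightarrow> y \<in> S)" for S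
  proof
    assume S: "open S"
    show "\<forall>x\<in>S. \<exists>e>0. \<forall>y. d x y < e \<longrightarrow> y \<in> S"
    proof
      fix x assume x: "x \<in> S"
      obtain c r and m M :: real where c: "c \<in> A" "x \<in> fst c" and r: "r > 0" "cball (snd c x) r \<subseteq> chart_image c"
        and m: "m > 0" "M > 0"
        and low: "\<And>q l. joined x q l \<Longrightarrow> m * r \<le> l \<or> (q \<in> fst c \<and> snd c q \<in> ball (snd c x) r \<and> m * norm (snd c q - snd c x) \<le> l)"
        by (rule chart_ball_data[of x]) blast
      have "open {y \<in> chart_image c. chart_inv c y \<in> S}" by (rule open_inv_vimage[OF c(1) S])
      moreover have "snd c x \<in> {y \<in> chart_image c. chart_inv c y \<in> S}" using c x by (simp add: chart_in inv_chart)
      ultimately obtain s where s: "s > 0" "ball (snd c x) s \<subseteq> {y \<in> chart_image c. chart_inv c y \<in> S}"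
        using openE by blast
      \<comment> \<open>Below \<open>m * r\<close> the connecting curve cannot have left the chart
        ball; below \<open>m * s\<close> its end point lies in the ball of radius
        \<open>s\<close>.\<close>
      have "y \<in> S" if y: "d x y < m * min r s" for y
      proof -
        obtain l where l: "l < m * min r s" "joined x y l" using dist_less[OF y] by blast
        have "m * min r s \<le> m * r" "m * min r s \<le> m * s" using m(1) by auto
        then have yc: "y \<in> fst c" "m * norm (snd c y - snd c x) < m * s" using low[OF l(2)] l(1) by linarith+
        then have "snd c y \<in> ball (snd c x) s" using m(1) by (simp add: dist_norm norm_minus_commute)
        then have "chart_inv c (snd c y) \<in> S" using s(2) by blast
        then show ?thesis by (simp add: inv_chart[OF c(1) yc(1)])
      qed
      moreover have "m * min r s > 0" using m r s by simp
      ultimately show "\<exists>e>0. \<forall>y. d x y < e \<longrightarrow> y \<in> S" by blast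
    qed
  next
    assume R: "\<forall>x\<in>S. \<exists>e>0. \<forall>y. d x y < e \<longrightarrow> y \<in> S"
    show "open S"
      unfolding open_subopen[of S]
    proof
      fix x assume x: "x \<in> S"
      then obtain e where e: "e > 0" "\<And>y. d x y < e \<Longrightarrow> y \<in> S" using R by blast
      obtain c r and m M :: real where c: "c \<in> A" "x \<in> fst c" and r: "r > 0" "cball (snd c x) r \<subseteq> chart_image c"
        and m: "m > 0" "M > 0"
        and up: "\<And>q. q \<in> fst c \<Longrightarrow> snd c q \<in> cball (snd c x) r \<Longrightarrow> \<exists>l. joined x q l \<and> l \<le> M * norm (snd c q - snd c x)"
        by (rule chart_ball_data[of x]) blast
      \<comment> \<open>Radius \<open>r\<close> keeps the segment from \<open>x\<close> inside the
        chart ball, radius \<open>e / M\<close> keeps its length below \<open>e\<close>.\<close>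
      let ?T = "{q \<in> fst c. snd c q \<in> ball (snd c x) (min r (e / M))}"
      have "open ?T" by (rule open_chart_vimage[OF c(1) open_ball])
      moreover have "x \<in> ?T" using c r e m by simp
      moreover have "?T \<subseteq> S"
      proof
        fix q assume q: "q \<in> ?T"
        then have qc: "q \<in> fst c" "snd c q \<in> cball (snd c x) r" "norm (snd c q - snd c x) < e / M"
          by (auto simp: dist_norm norm_minus_commute)
        obtain l where l: "joined x q l" "l \<le> M * norm (snd c q - snd c x)" using up[OF qc(1,2)] by blast
        have "M * norm (snd c q - snd c x) < e" using qc(3) m(2) by (simp add: field_simps)
        then show "q \<in> S" using e(2) dist_le[OF l(1)] l(2) by force
      qed
      ultimately show "\<exists>T. open T \<and> x \<in> T \<and> T \<subseteq> S" by blast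
    qed
  qed
qed

end

section \<open>Powers of a two-form\<close>

definition multilin :: "nat \<Rightarrow> ((nat \<Rightarrow> 'v::real_vector) \<Rightarrow> real) \<Rightarrow> bool" where
  "multilin m \<beta> \<longleftrightarrow> (\<forall>i<m. \<forall>v. linear (\<lambda>x. \<beta> (v(i := x))))"

abbreviation form_power :: "('v \<Rightarrow> 'v \<Rightarrow> real) \<Rightarrow> nat \<Rightarrow> (nat \<Rightarrow> 'v) \<Rightarrow> real" where
  "form_power T m \<equiv> wedge_power2 (\<lambda>u. T (u 0) (u 1)) m"

definition wedge_term :: "('v \<Rightarrow> 'v \<Rightarrow> real) \<Rightarrow> ((nat \<Rightarrow> 'v) \<Rightarrow> real) \<Rightarrow> (nat \<Rightarrow> nat) \<Rightarrow> (nat \<Rightarrow> 'v) \<Rightarrow> real" where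
  "wedge_term T \<beta> p v = of_int (sign p) * T (v (p 0)) (v (p 1)) * \<beta> (\<lambda>i. v (p (2 + i)))"

lemma form_power_Suc:
  "form_power T (Suc m) v = (\<Sum>p | p permutes {..<2 + 2 * m}. wedge_term T (form_power T m) p v) / (fact 2 * fact (2 * m))"
  by (simp add: wedge_def wedge_term_def)

text \<open>Naming the changed vector by the slot \<open>a\<close> that receives it, instead of by
  its index \<open>p a\<close>, shows which factor it enters.\<close>

lemma wedge_term_update:
  assumes p: "p permutes {..<2 + 2 * m}" and a: "a < 2 + 2 * m"
  shows "wedge_term T \<beta> p (v(p a := x)) =
    (if a = 0 then of_int (sign p) * T x (v (p 1)) * \<beta> (\<lambda>i. v (p (2 + i)))
     else if a = 1 then of_int (sign p) * T (v (p 0)) x * \<beta> (\<lambda>i. v (p (2 + i)))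
     else of_int (sign p) * T (v (p 0)) (v (p 1)) * \<beta> ((\<lambda>i. v (p (2 + i)))(a - 2 := x)))"
proof -
  have inj: "p b = p a \<longleftrightarrow> b = a" for b using injD[OF permutes_inj[OF p]] by blast
  have low: "(\<lambda>i. (v(p a := x)) (p (2 + i))) = (\<lambda>i. v (p (2 + i)))" if "a < 2"
    using that by (intro ext) (simp add: inj)
  have high: "(\<lambda>i. (v(p a := x)) (p (2 + i))) = (\<lambda>i. v (p (2 + i)))(a - 2 := x)" if "\<not> a < 2"
    using that by (intro ext) (auto simp: inj)
  consider "a = 0" | "a = 1" | "a \<noteq> 0" "a \<noteq> 1" by blast
  then show ?thesis
  proof cases
    case 1
    show ?thesis unfolding wedge_term_def using low inj[of 1] 1 by simp
  next
    case 2
    show ?thesis unfolding wedge_term_def using low inj[of 0] 2 by simp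
  next
    case 3
    then have "\<not> a < 2" by auto
    then show ?thesis unfolding wedge_term_def high[OF \<open>\<not> a < 2\<close>] using 3 inj[of 0] inj[of 1] by simp
  qed
qed

lemma multilin_form_power:
  assumes T: "bilinear T"
  shows "multilin (2 * m) (form_power T m)"
proof (induction m)
  case 0
  then show ?case by (simp add: multilin_def)
next
  case (Suc m)
  have lT: "linear (\<lambda>x. T x y)" "linear (T x)" for x y using T unfolding bilinear_def by auto
  show ?case
    unfolding multilin_def
  proof (intro allI impI)
    fix i v assume i: "i < 2 * Suc m"
    have "linear (\<lambda>x. wedge_term T (form_power T m) p (v(i := x)))" if "p \<in> {p. p permutes {..<2 + 2 * m}}" for p
    proof -
      have p: "p permutes {..<2 + 2 * m}" using that by simp
      obtain a where a: "a < 2 + 2 * m" "p a = i"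
        using i permutes_image[OF p] by (metis add_2_eq_Suc imageE lessThan_iff mult_Suc_right)
      show ?thesis
        unfolding a(2)[symmetric] wedge_term_update[OF p a(1)]
      proof (cases "a = 0")
        case True
        then show "linear (\<lambda>x. if a = 0 then of_int (sign p) * T x (v (p 1)) * form_power T m (\<lambda>i. v (p (2 + i)))
          else if a = 1 then of_int (sign p) * T (v (p 0)) x * form_power T m (\<lambda>i. v (p (2 + i)))
          else of_int (sign p) * T (v (p 0)) (v (p 1)) * form_power T m ((\<lambda>i. v (p (2 + i)))(a - 2 := x)))"
          using lT(1)[of "v (p 1)"] by (auto simp: linear_iff algebra_simps)
      next
        case a0: False
        show "linear (\<lambda>x. if a = 0 then of_int (sign p) * T x (v (p 1)) * form_power T m (\<lambda>i. v (p (2 + i)))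
          else if a = 1 then of_int (sign p) * T (v (p 0)) x * form_power T m (\<lambda>i. v (p (2 + i)))
          else of_int (sign p) * T (v (p 0)) (v (p 1)) * form_power T m ((\<lambda>i. v (p (2 + i)))(a - 2 := x)))"
        proof (cases "a = 1")
          case True
          then show ?thesis using lT(2)[of "v (p 0)"] by (auto simp: linear_iff algebra_simps)
        next
          case False
          have "linear (\<lambda>x. form_power T m ((\<lambda>i. v (p (2 + i)))(a - 2 := x)))"
            using Suc.IH a(1) a0 False unfolding multilin_def by auto
          then show ?thesis using a0 False by (simp add: linear_iff algebra_simps)
        qed
      qed
    qed
    then have "linear (\<lambda>x. \<Sum>p | p permutes {..<2 + 2 * m}. wedge_term T (form_power T m) p (v(i := x)))"
      by (rule linear_compose_sum[rule_format])
    then show "linear (\<lambda>x. form_power T (Suc m) (v(i := x)))"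
      unfolding form_power_Suc by (simp add: linear_iff add_divide_distrib)
  qed
qed

text \<open>Composition with the transposition of \<open>i\<close> and \<open>j\<close> permutes the
  summands, flips each sign and leaves the vectors unchanged, so the sum equals its
  negative.\<close>

lemma signed_sum_alternating:
  assumes "finite S" "i \<in> S" "j \<in> S" "i \<noteq> j" "v i = v j"
  shows "(\<Sum>p | p permutes S. of_int (sign p) * G (\<lambda>a. v (p a))) = (0::real)" (is "?s = 0")
proof -
  let ?t = "Transposition.transpose i j"
  have t: "?t permutes S" using assms by (intro permutes_swap_id)
  have "?s = (\<Sum>p | p permutes S. of_int (sign (?t \<circ> p)) * G (\<lambda>a. v ((?t \<circ> p) a)))"
    by (rule setum_permutations_compose_left[OF t])
  also have "\<dots> = (\<Sum>p | p permutes S. - (of_int (sign p) * G (\<lambda>a. v (p a))))"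
  proof (rule sum.cong[OF refl])
    fix p assume "p \<in> {p. p permutes S}"
    then have "permutation p" using assms(1) permutation_permutes by blast
    then have "sign (?t \<circ> p) = - sign p"
      using assms(4) by (simp add: sign_compose permutation_swap_id sign_swap_id)
    moreover have "v (?t b) = v b" for b using assms(5) by (auto simp: Transposition.transpose_def)
    ultimately show "of_int (sign (?t \<circ> p)) * G (\<lambda>a. v ((?t \<circ> p) a)) = - (of_int (sign p) * G (\<lambda>a. v (p a)))"
      by simp
  qed
  finally show ?thesis by (simp add: sum_negf)
qed

lemma form_power_alternating:
  assumes "i < 2 * m" "j < 2 * m" "i \<noteq> j" "v i = v j"
  shows "form_power T m v = 0"
proof (cases m)
  case (Suc k)
  have "(\<Sum>p | p permutes {..<2 + 2 * k}. wedge_term T (form_power T k) p v) =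
      (\<Sum>p | p permutes {..<2 + 2 * k}. of_int (sign p) *
        (\<lambda>u. T (u 0) (u 1) * form_power T k (\<lambda>i. u (2 + i))) (\<lambda>a. v (p a)))"
    by (simp add: wedge_term_def mult.assoc)
  also have "\<dots> = 0" by (rule signed_sum_alternating[of _ i j]) (use assms Suc in auto)
  finally show ?thesis unfolding Suc form_power_Suc by simp
qed (use assms in simp)

text \<open>A derivative of the form that arises from substituting \<open>B\<close> in either
  argument extends to all powers as a derivation: one vector at a time is replaced by its image
  under \<open>B\<close>.\<close>

lemma form_power_has_derivative:
  fixes T :: "'a::real_normed_vector \<Rightarrow> 'v::real_vector \<Rightarrow> 'v \<Rightarrow> real"
  assumes D: "\<And>u v. ((\<lambda>y. T y u v) has_derivative (\<lambda>h. T' h u v)) (at y0)"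
    and B: "\<And>h u v. T' h u v = T y0 (B h u) v + T y0 u (B h v)"
  shows "((\<lambda>y. form_power (T y) m v) has_derivative
    (\<lambda>h. \<Sum>i<2 * m. form_power (T y0) m (v(i := B h (v i))))) (at y0)"
proof (induction m arbitrary: v)
  case 0
  then show ?case by simp
next
  case (Suc m)
  let ?\<beta> = "\<lambda>y. form_power (T y) m"
  have tm: "((\<lambda>y. wedge_term (T y) (?\<beta> y) p v) has_derivative
      (\<lambda>h. \<Sum>a<2 + 2 * m. wedge_term (T y0) (?\<beta> y0) p (v(p a := B h (v (p a)))))) (at y0)"
    if p: "p permutes {..<2 + 2 * m}" for p
  proof -
    let ?u = "\<lambda>i. v (p (2 + i))"
    have "((\<lambda>y. of_int (sign p) * T y (v (p 0)) (v (p 1)) * ?\<beta> y ?u) has_derivative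
        (\<lambda>h. of_int (sign p) * T y0 (v (p 0)) (v (p 1)) * (\<Sum>i<2 * m. ?\<beta> y0 (?u(i := B h (?u i)))) +
          (of_int (sign p) * T' h (v (p 0)) (v (p 1))) * ?\<beta> y0 ?u)) (at y0)"
      by (intro has_derivative_mult Suc.IH has_derivative_mult_right D)
    moreover have "of_int (sign p) * T y0 (v (p 0)) (v (p 1)) * (\<Sum>i<2 * m. ?\<beta> y0 (?u(i := B h (?u i)))) +
          (of_int (sign p) * T' h (v (p 0)) (v (p 1))) * ?\<beta> y0 ?u =
        (\<Sum>a<2 + 2 * m. wedge_term (T y0) (?\<beta> y0) p (v(p a := B h (v (p a)))))" for h
    proof -
      have "(\<Sum>a<2 + 2 * m. wedge_term (T y0) (?\<beta> y0) p (v(p a := B h (v (p a))))) =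
          wedge_term (T y0) (?\<beta> y0) p (v(p 0 := B h (v (p 0)))) +
          (wedge_term (T y0) (?\<beta> y0) p (v(p 1 := B h (v (p 1)))) +
          (\<Sum>i<2 * m. wedge_term (T y0) (?\<beta> y0) p (v(p (2 + i) := B h (v (p (2 + i)))))))"
        by (simp only: add_2_eq_Suc sum.lessThan_Suc_shift One_nat_def add_Suc add_0)
      also have "(\<Sum>i<2 * m. wedge_term (T y0) (?\<beta> y0) p (v(p (2 + i) := B h (v (p (2 + i)))))) =
          (\<Sum>i<2 * m. of_int (sign p) * T y0 (v (p 0)) (v (p 1)) * ?\<beta> y0 (?u(i := B h (?u i))))"
        by (rule sum.cong[OF refl]) (subst wedge_term_update[OF p]; simp)
      finally have eqn: "(\<Sum>a<2 + 2 * m. wedge_term (T y0) (?\<beta> y0) p (v(p a := B h (v (p a))))) =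
          wedge_term (T y0) (?\<beta> y0) p (v(p 0 := B h (v (p 0)))) +
          (wedge_term (T y0) (?\<beta> y0) p (v(p 1 := B h (v (p 1)))) +
          (\<Sum>i<2 * m. of_int (sign p) * T y0 (v (p 0)) (v (p 1)) * ?\<beta> y0 (?u(i := B h (?u i)))))" .
      have w0: "wedge_term (T y0) (?\<beta> y0) p (v(p 0 := x)) = of_int (sign p) * T y0 x (v (p 1)) * ?\<beta> y0 ?u" for x
        by (subst wedge_term_update[OF p]) simp_all
      have w1: "wedge_term (T y0) (?\<beta> y0) p (v(p 1 := x)) = of_int (sign p) * T y0 (v (p 0)) x * ?\<beta> y0 ?u" for x
        by (subst wedge_term_update[OF p]) simp_all
      show ?thesis
        unfolding eqn w0 w1 B sum_distrib_left[symmetric] by (simp only: algebra_simps)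
    qed
    ultimately show ?thesis unfolding wedge_term_def[abs_def] by simp
  qed
  have "((\<lambda>y. form_power (T y) (Suc m) v) has_derivative
      (\<lambda>h. (\<Sum>p | p permutes {..<2 + 2 * m}. \<Sum>a<2 + 2 * m. wedge_term (T y0) (?\<beta> y0) p (v(p a := B h (v (p a)))))
         / (fact 2 * fact (2 * m)))) (at y0)"
    unfolding form_power_Suc
    by (intro bounded_linear.has_derivative[OF bounded_linear_divide] has_derivative_sum tm) simp
  moreover have "(\<Sum>p | p permutes {..<2 + 2 * m}. \<Sum>a<2 + 2 * m. wedge_term (T y0) (?\<beta> y0) p (v(p a := B h (v (p a)))))
         / (fact 2 * fact (2 * m)) = (\<Sum>i<2 * Suc m. form_power (T y0) (Suc m) (v(i := B h (v i))))" for h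
  proof -
    \<comment> \<open>For fixed \<open>p\<close> the slots \<open>a\<close> and the indices
      \<open>p a\<close> run over the same set. With indices in place of slots, the range no longer
      depends on \<open>p\<close> and the two sums can be exchanged.\<close>
    have "(\<Sum>a<2 + 2 * m. wedge_term (T y0) (?\<beta> y0) p (v(p a := B h (v (p a))))) =
        (\<Sum>i<2 + 2 * m. wedge_term (T y0) (?\<beta> y0) p (v(i := B h (v i))))" if "p permutes {..<2 + 2 * m}" for p
      using sum.permute[OF that, of "\<lambda>i. wedge_term (T y0) (?\<beta> y0) p (v(i := B h (v i)))"] by (simp add: o_def)
    then have "(\<Sum>p | p permutes {..<2 + 2 * m}. \<Sum>a<2 + 2 * m. wedge_term (T y0) (?\<beta> y0) p (v(p a := B h (v (p a))))) =
        (\<Sum>i<2 + 2 * m. \<Sum>p | p permutes {..<2 + 2 * m}. wedge_term (T y0) (?\<beta> y0) p (v(i := B h (v i))))"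
      by (subst sum.swap) simp
    moreover have "2 * Suc m = 2 + 2 * m" by simp
    ultimately show ?thesis unfolding form_power_Suc sum_divide_distrib[symmetric] by (simp only:)
  qed
  ultimately show ?case by (simp only:)
qed

lemma std_basis_bij:
  "bij_betw (\<lambda>i. sorted_list_of_set (UNIV :: 'k::{finite,wellorder} set) ! i) {..<card (UNIV :: 'k set)} UNIV"
  by (rule bij_betw_nth) simp_all

text \<open>In top degree, replacing the basis vector \<open>e\<^sub>i\<close> by its image keeps
  only the i-th component of that image, since every other component repeats a basis vector. The
  diagonal entries add up to the trace.\<close>

lemma form_power_trace:
  fixes T :: "(real, 'k::{finite,wellorder}) vec \<Rightarrow> (real, 'k) vec \<Rightarrow> real"
  assumes T: "bilinear T" and n: "card (UNIV :: 'k set) = 2 * n"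
  shows "(\<Sum>i<2 * n. form_power T n (std_basis(i := B (std_basis i)))) =
    (\<Sum>k\<in>UNIV. B (axis k 1) $ k) * form_power T n (std_basis :: nat \<Rightarrow> (real, 'k) vec)"
proof -
  let ?x = "\<lambda>i. sorted_list_of_set (UNIV :: 'k set) ! i"
  let ?L = "form_power T n"
  let ?e = "std_basis :: nat \<Rightarrow> (real, 'k) vec"
  have bij: "bij_betw ?x {..<2 * n} UNIV" using std_basis_bij[where 'k='k] n by simp
  have one: "?L (?e(i := B (?e i))) = (B (?e i) $ ?x i) * ?L ?e" if i: "i < 2 * n" for i
  proof -
    have lin: "linear (\<lambda>x. ?L (?e(i := x)))" using multilin_form_power[OF T] i unfolding multilin_def by blast
    have "?L (?e(i := B (?e i))) = ?L (?e(i := \<Sum>k\<in>UNIV. (B (?e i) $ k) *\<^sub>R axis k 1))"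
      using basis_expansion[of "B (?e i)"] by (simp add: scalar_mult_eq_scaleR)
    also have "\<dots> = (\<Sum>k\<in>UNIV. (B (?e i) $ k) *\<^sub>R ?L (?e(i := axis k 1)))"
    proof -
      define F where "F x = ?L (?e(i := x))" for x
      have lF: "linear F" using lin unfolding F_def .
      have "F (\<Sum>k\<in>UNIV. (B (?e i) $ k) *\<^sub>R axis k 1) = (\<Sum>k\<in>UNIV. (B (?e i) $ k) *\<^sub>R F (axis k 1))"
        by (simp only: linear_sum[OF lF] linear_cmul[OF lF])
      then show ?thesis unfolding F_def .
    qed
    also have "\<dots> = (\<Sum>k\<in>UNIV. if k = ?x i then (B (?e i) $ k) * ?L ?e else 0)"
    proof (rule sum.cong[OF refl])
      fix k
      obtain j where j: "j < 2 * n" "k = ?x j" using bij unfolding bij_betw_def by blast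
      have ej: "axis k 1 = ?e j" using j(2) by (simp add: std_basis_def)
      show "(B (?e i) $ k) *\<^sub>R ?L (?e(i := axis k 1)) = (if k = ?x i then (B (?e i) $ k) * ?L ?e else 0)"
      proof (cases "j = i")
        case True
        then show ?thesis using j ej by simp
      next
        case False
        then have "k \<noteq> ?x i" using bij i j unfolding bij_betw_def inj_on_def by auto
        moreover have "?L (?e(i := ?e j)) = 0"
          by (rule form_power_alternating[of i n j]) (use False i j in auto)
        ultimately show ?thesis by (simp add: ej)
      qed
    qed
    finally show ?thesis by simp
  qed
  have "(\<Sum>i<2 * n. ?L (?e(i := B (?e i)))) = (\<Sum>i<2 * n. (\<lambda>k. (B (axis k 1) $ k) * ?L ?e) (?x i))"
  proof (rule sum.cong[OF refl])
    fix i assume "i \<in> {..<2 * n}"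
    then have i: "i < 2 * n" by simp
    have ei: "?e i = axis (?x i) 1" by (simp add: std_basis_def)
    show "?L (?e(i := B (?e i))) = (\<lambda>k. (B (axis k 1) $ k) * ?L ?e) (?x i)"
      unfolding one[OF i] by (simp only: ei)
  qed
  also have "\<dots> = (\<Sum>k\<in>UNIV. (B (axis k 1) $ k) * ?L ?e)"
    by (rule sum.reindex_bij_betw[OF bij])
  finally show ?thesis by (simp add: sum_distrib_right)
qed

section \<open>Hamiltonian fields in coordinates\<close>

lemma Ck_on_eqI: "open S \<Longrightarrow> Ck_on k f S \<Longrightarrow> (\<And>y. y \<in> S \<Longrightarrow> f y = g y) \<Longrightarrow> Ck_on k g S"
  using Ck_on_cong by blast

lemma axis_1_nth: "axis i (1::real) $ a = (if a = i then 1 else 0)" by (simp add: axis_def)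

lemma vec_axis_expansion: "(v :: (real, 'k::finite) vec) = (\<Sum>i\<in>UNIV. v $ i *\<^sub>R axis i 1)"
  using basis_expansion[of v] by (simp add: scalar_mult_eq_scaleR)

lemma linear_axis_expansion:
  fixes f :: "(real, 'k::finite) vec \<Rightarrow> 'b::real_vector"
  assumes "linear f"
  shows "f v = (\<Sum>i\<in>UNIV. v $ i *\<^sub>R f (axis i 1))"
proof -
  have "f v = f (\<Sum>i\<in>UNIV. v $ i *\<^sub>R axis i 1)" using vec_axis_expansion[of v] by simp
  also have "\<dots> = (\<Sum>i\<in>UNIV. v $ i *\<^sub>R f (axis i 1))"
    by (simp only: linear_sum[OF assms] linear_cmul[OF assms])
  finally show ?thesis .
qed

text \<open>The form in one chart: \<open>w y\<close> is the bilinear form at the coordinate point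
  \<open>y\<close>. What concerns a single chart is proved here on an open set of Euclidean space
  and transferred by \<open>symplectic_chart\<close>.\<close>

locale symplectic_domain =
  fixes V :: "(real, 'k::{finite,wellorder}) vec set"
    and w :: "(real, 'k) vec \<Rightarrow> (real, 'k) vec \<Rightarrow> (real, 'k) vec \<Rightarrow> real" and n :: nat
  assumes V: "open V" and dim: "card (UNIV :: 'k set) = 2 * n"
    and bil: "y \<in> V \<Longrightarrow> bilinear (w y)"
    and smooth: "Ck_on k (\<lambda>y. w y u v) V"
    and alt: "y \<in> V \<Longrightarrow> w y u u = 0"
    and nondeg: "y \<in> V \<Longrightarrow> (\<And>v. w y u v = 0) \<Longrightarrow> u = 0"
    and closed: "y \<in> V \<Longrightarrow> frechet_derivative (\<lambda>z. w z u v) (at y) x +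
       frechet_derivative (\<lambda>z. w z v x) (at y) u + frechet_derivative (\<lambda>z. w z x u) (at y) v = 0"
begin

definition dw where "dw y h u v = frechet_derivative (\<lambda>z. w z u v) (at y) h"

lemma lin1: "y \<in> V \<Longrightarrow> linear (\<lambda>x. w y x v)" and lin2: "y \<in> V \<Longrightarrow> linear (w y u)"
  using bil unfolding bilinear_def by auto

lemma skew: "y \<in> V \<Longrightarrow> w y u v = - w y v u"
  using alt[of y "u + v"] alt[of y u] alt[of y v]
  by (simp add: linear_add[OF lin1] linear_add[OF lin2])

lemma dw_has_derivative: "y \<in> V \<Longrightarrow> ((\<lambda>z. w z u v) has_derivative (\<lambda>h. dw y h u v)) (at y)"
  unfolding dw_def by (rule Ck_on_has_derivative[OF smooth[of "Suc 0"]])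

lemma dw_eqI: "y \<in> V \<Longrightarrow> ((\<lambda>z. w z u v) has_derivative D) (at y) \<Longrightarrow> dw y h u v = D h"
  using has_derivative_unique[OF dw_has_derivative] by metis

lemma dw_linear2:
  assumes y: "y \<in> V"
  shows "linear (dw y h u)"
proof (rule linearI)
  fix v v'
  have "((\<lambda>z. w z u v + w z u v') has_derivative (\<lambda>h. dw y h u v + dw y h u v')) (at y)"
    by (intro has_derivative_add dw_has_derivative y)
  then have "((\<lambda>z. w z u (v + v')) has_derivative (\<lambda>h. dw y h u v + dw y h u v')) (at y)"
    by (rule has_derivative_transform_within_open[OF _ V y]) (simp add: linear_add[OF lin2])
  then show "dw y h u (v + v') = dw y h u v + dw y h u v'" by (rule dw_eqI[OF y])
next
  fix a :: real and v
  have "((\<lambda>z. a * w z u v) has_derivative (\<lambda>h. a * dw y h u v)) (at y)"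
    by (intro has_derivative_mult_right dw_has_derivative y)
  then have "((\<lambda>z. w z u (a *\<^sub>R v)) has_derivative (\<lambda>h. a * dw y h u v)) (at y)"
    by (rule has_derivative_transform_within_open[OF _ V y]) (simp add: linear_cmul[OF lin2])
  then show "dw y h u (a *\<^sub>R v) = a *\<^sub>R dw y h u v" using dw_eqI[OF y] by simp
qed

lemma dw_skew:
  assumes y: "y \<in> V"
  shows "dw y h u v = - dw y h v u"
proof -
  have "((\<lambda>z. - w z v u) has_derivative (\<lambda>h. - dw y h v u)) (at y)"
    by (intro has_derivative_minus dw_has_derivative y)
  then have "((\<lambda>z. w z u v) has_derivative (\<lambda>h. - dw y h v u)) (at y)"
    by (rule has_derivative_transform_within_open[OF _ V y]) (simp add: skew[of _ u v])
  then show ?thesis by (rule dw_eqI[OF y])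
qed

lemma dw_linear_dir: "y \<in> V \<Longrightarrow> linear (\<lambda>h. dw y h u v)"
  using has_derivative_linear[OF dw_has_derivative] .

lemma dw_Ck: "Ck_on k (\<lambda>y. dw y h u v) V"
  unfolding dw_def by (rule Ck_on_frechet[OF smooth])

lemma dw_closed: "y \<in> V \<Longrightarrow> dw y x u v + dw y u v x + dw y v x u = 0"
  using closed[of y u v x] unfolding dw_def by simp

section \<open>The inverse of the form and the vectors that represent linear functionals\<close>

definition W where "W y = (\<chi> a b. w y (axis a 1) (axis b 1))"

lemma W_mult: "y \<in> V \<Longrightarrow> (W y *v x) $ a = w y (axis a 1) x"
  using linear_axis_expansion[OF lin2, of y "axis a 1" x]
  by (simp add: W_def matrix_vector_mult_def mult.commute)

lemma axis_ext1:
  assumes y: "y \<in> V" and "\<And>a. w y (axis a 1) x = 0"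
  shows "x = 0"
proof (rule nondeg[OF y])
  fix v
  have "w y v x = (\<Sum>a\<in>UNIV. v $ a *\<^sub>R w y (axis a 1) x)"
    by (rule linear_axis_expansion[OF lin1[OF y]])
  then have "w y v x = 0" using assms(2) by simp
  then show "w y x v = 0" using skew[OF y, of x v] by simp
qed

lemma det_W: "y \<in> V \<Longrightarrow> det (W y) \<noteq> 0"
proof -
  assume y: "y \<in> V"
  have "x = 0" if "W y *v x = 0" for x
    by (rule axis_ext1[OF y]) (metis W_mult[OF y] that zero_index)
  then have "\<exists>B. B ** W y = mat 1" unfolding matrix_left_invertible_ker by blast
  then show ?thesis using invertible_left_inverse invertible_det_nz by blast
qed

text \<open>The vector paired by \<open>w\<close> with the i-th coordinate functional, a column of
  the inverse matrix of \<open>W\<close>. Cramer's rule writes it with determinants, so its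
  smoothness in \<open>y\<close> is visible.\<close>

definition dual where
  "dual y i = (\<chi> k. det (\<chi> a c. if c = k then (axis i 1 :: (real, 'k) vec) $ a else W y $ a $ c) / det (W y))"

lemma dual:
  assumes y: "y \<in> V"
  shows "w y z (dual y i) = z $ i"
proof -
  have "W y *v dual y i = axis i 1"
    using cramer[OF det_W[OF y], of "dual y i" "axis i 1"] unfolding dual_def by simp
  then have e: "w y (axis a 1) (dual y i) = (if a = i then 1 else 0)" for a
    using W_mult[OF y, of "dual y i" a] by (simp only: axis_1_nth)
  have "w y z (dual y i) = (\<Sum>a\<in>UNIV. z $ a *\<^sub>R w y (axis a 1) (dual y i))"
    by (rule linear_axis_expansion[OF lin1[OF y]])
  also have "\<dots> = (\<Sum>a\<in>UNIV. if a = i then z $ a else 0)"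
    by (rule sum.cong[OF refl]) (simp add: e)
  finally show ?thesis by simp
qed

lemma dual_Ck: "Ck_on k (\<lambda>y. dual y i $ l) V"
proof -
  have wC: "Ck_on k (\<lambda>y. W y $ a $ b) V" for a b unfolding W_def by (simp add: smooth)
  have "Ck_on k (\<lambda>y. det (\<chi> a c. if c = l then (axis i 1 :: (real, 'k) vec) $ a else W y $ a $ c) / det (W y)) V"
  proof (rule Ck_on_divide[OF V Ck_on_det[OF V] Ck_on_det[OF V wC] det_W])
    show "Ck_on k (\<lambda>y. (\<chi> a c. if c = l then (axis i 1 :: (real, 'k) vec) $ a else W y $ a $ c) $ a $ c) V" for a c
      by (cases "c = l") (simp_all add: wC)
  qed
  then show ?thesis unfolding dual_def by simp
qed

lemma dual_expansion:
  assumes y: "y \<in> V"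
  shows "v = (\<Sum>j\<in>UNIV. w y (axis j 1) v *\<^sub>R dual y j)"
proof -
  let ?s = "\<Sum>j\<in>UNIV. w y (axis j 1) v *\<^sub>R dual y j"
  have "w y (axis a 1) (v - ?s) = 0" for a
  proof -
    have "w y (axis a 1) ?s = (\<Sum>j\<in>UNIV. w y (axis j 1) v * axis a 1 $ j)"
      by (simp add: linear_sum[OF lin2[OF y]] linear_cmul[OF lin2[OF y]] dual[OF y])
    also have "\<dots> = (\<Sum>j\<in>UNIV. if j = a then w y (axis j 1) v else 0)"
      by (rule sum.cong[OF refl]) (simp add: axis_1_nth)
    finally show ?thesis by (simp add: linear_diff[OF lin2[OF y]])
  qed
  then have "v - ?s = 0" by (rule axis_ext1[OF y])
  then show ?thesis by simp
qed

text \<open>\<open>dual_expansion\<close> writes \<open>v\<close> through the numbers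
  \<open>w y (axis j 1) v\<close>, so the values of the functional on the dual vectors are the
  components of the representing vector. This solves the equation of a Hamiltonian field
  explicitly.\<close>

lemma represent:
  assumes y: "y \<in> V" and \<phi>: "linear \<phi>"
  shows "w y (\<chi> j. \<phi> (dual y j)) v = \<phi> v"
proof -
  have "\<phi> v = \<phi> (\<Sum>j\<in>UNIV. w y (axis j 1) v *\<^sub>R dual y j)" using dual_expansion[OF y, of v] by simp
  also have "\<dots> = (\<Sum>j\<in>UNIV. w y (axis j 1) v *\<^sub>R \<phi> (dual y j))"
    by (simp only: linear_sum[OF \<phi>] linear_cmul[OF \<phi>])
  also have "\<dots> = (\<Sum>j\<in>UNIV. (\<chi> j. \<phi> (dual y j)) $ j *\<^sub>R w y (axis j 1) v)"
    by (simp add: mult.commute)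
  also have "\<dots> = w y (\<chi> j. \<phi> (dual y j)) v"
    by (rule linear_axis_expansion[OF lin1[OF y], symmetric])
  finally show ?thesis ..
qed

definition field :: "((real, 'k) vec \<Rightarrow> real) \<Rightarrow> (real, 'k) vec \<Rightarrow> (real, 'k) vec" where
  "field K y = (\<chi> j. frechet_derivative K (at y) (dual y j))"

lemma field_eq:
  "y \<in> V \<Longrightarrow> K differentiable (at y) \<Longrightarrow> w y (field K y) v = frechet_derivative K (at y) v"
  unfolding field_def by (rule represent) (simp_all add: linear_frechet_derivative)

lemma field_unique:
  assumes "y \<in> V" "K differentiable (at y)" "\<And>v. w y u v = frechet_derivative K (at y) v"
  shows "u = field K y"
proof -
  have "w y (u - field K y) v = 0" for v
    using assms(3)[of v] field_eq[OF assms(1,2), of v] by (simp add: linear_diff[OF lin1[OF assms(1)]])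
  then have "u - field K y = 0" by (rule nondeg[OF assms(1)])
  then show ?thesis by simp
qed

lemma field_Ck:
  assumes K: "Ck_on (Suc k) K V"
  shows "Ck_on k (\<lambda>y. field K y $ j) V"
proof -
  have "Ck_on k (\<lambda>y. \<Sum>l\<in>UNIV. dual y j $ l * frechet_derivative K (at y) (axis l 1)) V"
    by (intro Ck_on_sum Ck_on_mult V dual_Ck Ck_on_frechet[OF K])
  then show ?thesis
  proof (rule Ck_on_eqI[OF V])
    fix y assume "y \<in> V"
    from linear_axis_expansion[OF has_derivative_linear[OF Ck_on_has_derivative[OF K this]], of "dual y j"]
    show "(\<Sum>l\<in>UNIV. dual y j $ l * frechet_derivative K (at y) (axis l 1)) = field K y $ j"
      by (simp add: field_def)
  qed
qed

subsection \<open>The Liouville density\<close>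

definition pf where "pf y = form_power (w y) n std_basis / fact n"

definition rho where "rho y = \<bar>pf y\<bar>"

text \<open>Half the trace of \<open>w\<^sup>-\<^sup>1 \<partial>\<^sub>h w\<close>, the logarithmic
  derivative of the density in direction \<open>h\<close>.\<close>

definition tau where "tau y h = (\<Sum>k\<in>UNIV. dw y h (axis k 1) (dual y k)) / 2"

lemma rho_nonneg: "0 \<le> rho y" by (simp add: rho_def)

text \<open>Writing \<open>\<partial>\<^sub>h w (u, v) = w (B u, v) + w (u, B v)\<close> with \<open>B = w\<^sup>-\<^sup>1 \<partial>\<^sub>h w / 2\<close> exhibits the derivative of
  the top power as its trace with \<open>B\<close>; this replaces the identification of \<open>w\<^sup>n\<close> with a Pfaffian.\<close>

lemma pf_has_derivative:
  assumes y: "y \<in> V"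
  shows "(pf has_derivative (\<lambda>h. tau y h * pf y)) (at y)"
proof -
  define B where "B h x = (\<chi> j. dw y h x (dual y j) / 2)" for h x
  have B1: "w y (B h x) v = dw y h x v / 2" for h x v
    unfolding B_def by (rule represent[OF y]) (use dw_linear2[OF y] in \<open>simp add: linear_iff add_divide_distrib\<close>)
  have "dw y h u v = w y (B h u) v + w y u (B h v)" for h u v
    using skew[OF y, of u "B h v"] dw_skew[OF y, of h u v] by (simp add: B1)
  then have "((\<lambda>y. form_power (w y) n std_basis) has_derivative
    (\<lambda>h. \<Sum>i<2 * n. form_power (w y) n (std_basis(i := B h (std_basis i))))) (at y)"
    by (rule form_power_has_derivative[OF dw_has_derivative[OF y]])
  then have "((\<lambda>y. form_power (w y) n std_basis) has_derivative
    (\<lambda>h. (\<Sum>k\<in>UNIV. B h (axis k 1) $ k) * form_power (w y) n std_basis)) (at y)"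
    by (simp only: form_power_trace[OF bil[OF y] dim])
  moreover have "(\<Sum>k\<in>UNIV. B h (axis k 1) $ k) = tau y h" for h
    by (simp add: B_def tau_def sum_divide_distrib)
  ultimately have "((\<lambda>y. form_power (w y) n std_basis) has_derivative
    (\<lambda>h. tau y h * form_power (w y) n std_basis)) (at y)" by simp
  from bounded_linear.has_derivative[OF bounded_linear_divide this, of "fact n"]
  show ?thesis unfolding pf_def[abs_def] by simp
qed

text \<open>Where \<open>f\<close> vanishes its derivative vanishes too, and the absolute value does
  not change the size of \<open>f\<close>; elsewhere the sign is locally constant. So the density is
  differentiable without a separate proof that the top power has no zeros.\<close>

lemma has_derivative_abs_at:
  fixes f :: "'a::real_normed_vector \<Rightarrow> real"
  assumes "(f has_derivative (\<lambda>h. t h * f x)) (at x)"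
  shows "((\<lambda>y. \<bar>f y\<bar>) has_derivative (\<lambda>h. t h * \<bar>f x\<bar>)) (at x)"
proof (cases "f x = 0")
  case True
  then show ?thesis using assms by (simp add: has_derivative_iff_norm)
next
  case False
  have "continuous (at x) f" using has_derivative_continuous[OF assms] .
  then have "((\<lambda>y. f y * sgn (f x)) \<longlongrightarrow> f x * sgn (f x)) (at x)" unfolding isCont_def by (intro tendsto_intros)
  moreover have pos: "f x * sgn (f x) > 0" using False by (simp add: abs_sgn[symmetric])
  ultimately have "eventually (\<lambda>y. 0 < f y * sgn (f x)) (at x)" by (rule order_tendstoD)
  then have ev: "eventually (\<lambda>y. f y * sgn (f x) = \<bar>f y\<bar>) (at x)"
    by eventually_elim (auto simp: sgn_real_def abs_if split: if_splits)
  have "((\<lambda>y. f y * sgn (f x)) has_derivative (\<lambda>h. (t h * f x) * sgn (f x))) (at x)"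
    by (rule has_derivative_mult_left[OF assms])
  then have "((\<lambda>y. \<bar>f y\<bar>) has_derivative (\<lambda>h. (t h * f x) * sgn (f x))) (at x)"
    by (rule has_derivative_transform_eventually[OF _ ev]) (simp_all add: abs_sgn[symmetric])
  moreover have "(t h * f x) * sgn (f x) = t h * \<bar>f x\<bar>" for h
    by (simp add: abs_sgn mult.assoc)
  ultimately show ?thesis by (simp only:)
qed

lemma rho_has_derivative:
  "y \<in> V \<Longrightarrow> (rho has_derivative (\<lambda>h. tau y h * rho y)) (at y)"
  unfolding rho_def[abs_def] by (rule has_derivative_abs_at[OF pf_has_derivative])

lemma dw_dual: "y \<in> V \<Longrightarrow> dw y h u (dual y k) = (\<Sum>l\<in>UNIV. dual y k $ l * dw y h u (axis l 1))"
  using linear_axis_expansion[OF dw_linear2, of y h u "dual y k"] by simp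

lemma tau_Ck: "Ck_on k (\<lambda>y. tau y h) V"
proof -
  have "Ck_on k (\<lambda>y. (\<Sum>k\<in>UNIV. \<Sum>l\<in>UNIV. dual y k $ l * dw y h (axis k 1) (axis l 1)) * (1 / 2)) V"
    by (intro Ck_on_sum Ck_on_mult V dual_Ck dw_Ck Ck_on_const)
  then show ?thesis
    by (rule Ck_on_eqI[OF V]) (simp add: tau_def dw_dual)
qed

lemma rho_continuous: "continuous_on V rho"
  by (rule continuous_at_imp_continuous_on) (use rho_has_derivative has_derivative_continuous in blast)

lemma rho_Ck: "Ck_on (Suc 0) rho V"
proof (rule Ck_on_SucI[OF V rho_has_derivative])
  show "Ck_on 0 (\<lambda>y. tau y h * rho y) V" for h
    using Ck_on_continuous_on[OF tau_Ck] rho_continuous by (auto intro: continuous_intros)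
qed

lemma tau_linear: "y \<in> V \<Longrightarrow> linear (tau y)"
  unfolding tau_def using dw_linear_dir
  by (simp add: linear_iff sum.distrib add_divide_distrib sum_distrib_left sum_divide_distrib)

text \<open>The trace of the derivative of the field pairs the symmetric second derivative of \<open>K\<close> with the skew
  inverse of \<open>w\<close>; closedness of \<open>w\<close> turns the remaining terms into \<open>tau\<close>.\<close>

lemma field_divergence:
  assumes K: "Ck_on 2 K V" and y: "y \<in> V"
  shows "(\<Sum>k\<in>UNIV. frechet_derivative (\<lambda>z. field K z $ k) (at y) (axis k 1)) = - tau y (field K y)"
proof -
  have K': "Ck_on (Suc (Suc 0)) K V" using K by (simp only: numeral_2_eq_2)
  let ?X = "field K y"
  let ?D = "\<lambda>h. (\<chi> a. frechet_derivative (\<lambda>z. field K z $ a) (at y) h)"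
  let ?H = "\<lambda>h v. frechet_derivative (\<lambda>z. frechet_derivative K (at z) v) (at y) h"
  have XD: "((\<lambda>z. field K z $ a) has_derivative frechet_derivative (\<lambda>z. field K z $ a) (at y)) (at y)" for a
    by (rule Ck_on_has_derivative[OF field_Ck[OF K'] y])
  have HD: "((\<lambda>z. frechet_derivative K (at z) v) has_derivative (\<lambda>h. ?H h v)) (at y)" for v
    by (rule Ck_on_has_derivative[OF Ck_on_frechet[OF K'] y])
  have Hsym: "?H h v = ?H v h" for h v by (rule second_derivative_symmetric[OF K V y])
  \<comment> \<open>The derivative of \<open>K\<close> along a fixed \<open>v\<close> is
    \<open>w z (field K z) v\<close>; this identity is differentiated at \<open>y\<close> in
    direction \<open>h\<close>.\<close>
  have key: "w y (?D h) v = ?H h v - dw y h ?X v" for h v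
  proof -
    have "((\<lambda>z. \<Sum>a\<in>UNIV. field K z $ a * w z (axis a 1) v) has_derivative
        (\<lambda>h. \<Sum>a\<in>UNIV. ?X $ a * dw y h (axis a 1) v + frechet_derivative (\<lambda>z. field K z $ a) (at y) h * w y (axis a 1) v)) (at y)"
      by (intro has_derivative_sum has_derivative_mult XD dw_has_derivative y)
    moreover have "(\<Sum>a\<in>UNIV. field K z $ a * w z (axis a 1) v) = frechet_derivative K (at z) v" if z: "z \<in> V" for z
    proof -
      have "K differentiable (at z)" using K' z by simp
      from field_eq[OF z this, of v] show ?thesis
        using linear_axis_expansion[OF lin1[OF z], of "field K z" v] by simp
    qed
    ultimately have "((\<lambda>z. frechet_derivative K (at z) v) has_derivative
        (\<lambda>h. \<Sum>a\<in>UNIV. ?X $ a * dw y h (axis a 1) v + frechet_derivative (\<lambda>z. field K z $ a) (at y) h * w y (axis a 1) v)) (at y)"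
      by (rule has_derivative_transform_within_open[OF _ V y]) simp
    from fun_cong[OF has_derivative_unique[OF HD this], of h]
    have "?H h v = (\<Sum>a\<in>UNIV. ?X $ a * dw y h (axis a 1) v) +
        (\<Sum>a\<in>UNIV. frechet_derivative (\<lambda>z. field K z $ a) (at y) h * w y (axis a 1) v)"
      by (simp add: sum.distrib)
    moreover have "linear (\<lambda>u. dw y h u v)"
      using dw_linear2[OF y, of h v] unfolding dw_skew[OF y, of h _ v] by (simp add: linear_iff)
    from linear_axis_expansion[OF this, of ?X]
    have "(\<Sum>a\<in>UNIV. ?X $ a * dw y h (axis a 1) v) = dw y h ?X v" by simp
    moreover have "(\<Sum>a\<in>UNIV. frechet_derivative (\<lambda>z. field K z $ a) (at y) h * w y (axis a 1) v) = w y (?D h) v"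
      using linear_axis_expansion[OF lin1[OF y], of "?D h" v] by simp
    ultimately show ?thesis by simp
  qed
  let ?G = "\<lambda>k l. dual y k $ l"
  have Gskew: "?G k l = - ?G l k" for k l
    using skew[OF y, of "dual y l" "dual y k"] dual[OF y, of "dual y l" k] dual[OF y, of "dual y k" l] by simp
  \<comment> \<open>Exchanging the summation indices costs a sign because the inverse matrix
    \<open>?G\<close> is skew; only the skew part of \<open>F\<close> survives the
    contraction.\<close>
  have swap: "(\<Sum>k\<in>UNIV. \<Sum>l\<in>UNIV. ?G k l * F k l) = - (\<Sum>k\<in>UNIV. \<Sum>l\<in>UNIV. ?G k l * F l k)" for F :: "'k \<Rightarrow> 'k \<Rightarrow> real"
  proof -
    have "(\<Sum>k\<in>UNIV. \<Sum>l\<in>UNIV. ?G k l * F k l) = (\<Sum>l\<in>UNIV. \<Sum>k\<in>UNIV. ?G k l * F k l)" by (rule sum.swap)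
    also have "\<dots> = (\<Sum>l\<in>UNIV. \<Sum>k\<in>UNIV. - (?G l k * F k l))"
      by (intro sum.cong refl) (subst Gskew, simp)
    finally show ?thesis by (simp add: sum_negf)
  qed
  have S0: "(\<Sum>k\<in>UNIV. ?H (axis k 1) (dual y k)) = 0"
  proof -
    have lH: "linear (\<lambda>v. ?H (axis k 1) v)" for k
    proof -
      have "(\<lambda>v. ?H (axis k 1) v) = (\<lambda>v. ?H v (axis k 1))" by (rule ext, rule Hsym)
      then show ?thesis using has_derivative_linear[OF HD[of "axis k 1"]] by (simp only:)
    qed
    have "?H (axis k 1) (dual y k) = (\<Sum>l\<in>UNIV. ?G k l * ?H (axis k 1) (axis l 1))" for k
      using linear_axis_expansion[OF lH[of k], of "dual y k"] by simp
    then have "(\<Sum>k\<in>UNIV. ?H (axis k 1) (dual y k)) = (\<Sum>k\<in>UNIV. \<Sum>l\<in>UNIV. ?G k l * ?H (axis k 1) (axis l 1))" by simp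
    moreover have "\<dots> = - \<dots>" using swap[of "\<lambda>k l. ?H (axis k 1) (axis l 1)"] Hsym by simp
    ultimately show ?thesis by simp
  qed
  have S1: "(\<Sum>k\<in>UNIV. dw y (axis k 1) ?X (dual y k)) = tau y ?X"
  proof -
    note e1 = dw_dual[OF y]
    let ?s = "\<Sum>k\<in>UNIV. \<Sum>l\<in>UNIV. ?G k l * dw y (axis k 1) ?X (axis l 1)"
    have "2 * ?s = ?s - (\<Sum>k\<in>UNIV. \<Sum>l\<in>UNIV. ?G k l * dw y (axis l 1) ?X (axis k 1))"
      using swap[of "\<lambda>k l. dw y (axis k 1) ?X (axis l 1)"] by simp
    also have "\<dots> = (\<Sum>k\<in>UNIV. \<Sum>l\<in>UNIV. ?G k l * dw y ?X (axis k 1) (axis l 1))"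
    proof -
      have "dw y (axis k 1) ?X (axis l 1) - dw y (axis l 1) ?X (axis k 1) = dw y ?X (axis k 1) (axis l 1)" for k l
        using dw_closed[OF y, of "axis k 1" ?X "axis l 1"] dw_skew[OF y, of "axis l 1" ?X "axis k 1"]
          dw_skew[OF y, of ?X "axis l 1" "axis k 1"] by simp
      then show ?thesis by (simp add: sum_subtractf[symmetric] right_diff_distrib[symmetric])
    qed
    finally show ?thesis unfolding e1 tau_def by simp
  qed
  have "(\<Sum>k\<in>UNIV. frechet_derivative (\<lambda>z. field K z $ k) (at y) (axis k 1)) =
      (\<Sum>k\<in>UNIV. w y (?D (axis k 1)) (dual y k))"
    by (simp add: dual[OF y])
  also have "\<dots> = - tau y ?X" unfolding key by (simp add: sum_subtractf S0 S1)
  finally show ?thesis .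
qed

end

section \<open>Integration in charts\<close>

text \<open>Every difference quotient has integral 0 by translation invariance. The mean value
  theorem bounds the quotients uniformly, and dominated convergence passes to the
  derivative.\<close>

lemma integral_derivative_compact_support:
  fixes z :: "'a::euclidean_space \<Rightarrow> real"
  assumes z: "Ck_on (Suc 0) z V" and V: "open V" and K: "compact K" "K \<subseteq> V"
    and supp: "\<And>y. y \<notin> K \<Longrightarrow> z y = 0"
  shows "(\<integral>y. frechet_derivative z (at y) e \<partial>lborel) = 0"
proof -
  have opK: "open (- K)" using compact_imp_closed[OF K(1)] by (simp add: open_Compl)
  have zU: "Ck_on (Suc 0) z UNIV"
  proof (rule Ck_on_local)
    fix x :: 'a
    show "\<exists>U. open U \<and> x \<in> U \<and> Ck_on (Suc 0) z U"
    proof (cases "x \<in> K")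
      case True
      then show ?thesis using z V K(2) by (intro exI[of _ V]) auto
    next
      case False
      have "Ck_on (Suc 0) z (- K)"
        by (rule Ck_on_eqI[OF opK Ck_on_const[of "Suc 0" 0]]) (simp add: supp)
      then show ?thesis using opK False by (intro exI[of _ "- K"]) simp
    qed
  qed
  let ?D = "\<lambda>y. frechet_derivative z (at y) e"
  have Dc: "continuous_on UNIV ?D" using Ck_on_frechet[OF zU, of e] by simp
  have zc: "continuous_on UNIV z" by (rule Ck_on_continuous_on[OF zU])
  have D0: "?D y = 0" if "y \<notin> K" for y
  proof -
    have "frechet_derivative z (at y) = frechet_derivative (\<lambda>y. 0) (at y)"
      by (rule frechet_derivative_cong_open[OF opK]) (use that supp in auto)
    then show ?thesis by simp
  qed
  have der: "((\<lambda>t. z (y + t *\<^sub>R e)) has_real_derivative ?D (y + t *\<^sub>R e)) (at t)" for y t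
  proof -
    have hd: "(z has_derivative frechet_derivative z (at (y + t *\<^sub>R e))) (at (y + t *\<^sub>R e))"
      by (rule Ck_on_has_derivative[OF zU UNIV_I])
    have "((\<lambda>t. y + t *\<^sub>R e) has_vector_derivative e) (at t)" by (auto intro!: derivative_eq_intros)
    from diff_chain_at[OF this[unfolded has_vector_derivative_def] hd]
    have "((\<lambda>t. z (y + t *\<^sub>R e)) has_vector_derivative ?D (y + t *\<^sub>R e)) (at t)"
      unfolding has_vector_derivative_def o_def
      by (simp add: linear_cmul[OF has_derivative_linear[OF hd]])
    then show ?thesis by (simp add: has_real_derivative_iff_has_vector_derivative)
  qed
  have "bounded (?D ` K)"
    by (rule compact_imp_bounded[OF compact_continuous_image[OF continuous_on_subset[OF Dc] K(1)]]) simp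
  then obtain C where C: "\<And>y. y \<in> K \<Longrightarrow> \<bar>?D y\<bar> \<le> C" by (auto simp: bounded_iff)
  define C' where "C' = max C 0"
  have C': "\<bar>?D y\<bar> \<le> C'" for y using C[of y] D0[of y] by (cases "y \<in> K") (auto simp: C'_def)
  obtain R where R: "\<And>y. y \<in> K \<Longrightarrow> norm y \<le> R" using compact_imp_bounded[OF K(1)] by (auto simp: bounded_iff)
  \<comment> \<open>The steps \<open>h m\<close> are at most 1, so all difference quotients vanish
    outside this enlarged ball.\<close>
  define B where "B = cball (0::'a) (R + norm e)"
  define h where "h m = 1 / real (Suc m)" for m :: nat
  have h: "0 < h m" "h m \<le> 1" for m unfolding h_def by auto
  let ?q = "\<lambda>m y. (z (y + h m *\<^sub>R e) - z y) / h m"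
  have zint: "integrable lborel z"
  proof -
    have "integrable lborel (\<lambda>x. indicator K x *\<^sub>R z x)"
      by (rule borel_integrable_compact[OF K(1) continuous_on_subset[OF zc]]) simp
    moreover have "(\<lambda>x. indicator K x *\<^sub>R z x) = z" using supp by (auto simp: fun_eq_iff indicator_def)
    ultimately show ?thesis by simp
  qed
  have mz: "z \<in> borel_measurable borel" by (rule borel_measurable_continuous_onI[OF zc])
  have shift: "integrable lborel (\<lambda>y. z (y + c))" "(\<integral>y. z (y + c) \<partial>lborel) = (\<integral>y. z y \<partial>lborel)" for c
  proof -
    have "integrable (distr lborel borel ((+) c)) z" using zint by (simp add: lborel_distr_plus)
    then show "integrable lborel (\<lambda>y. z (y + c))"
      by (subst (asm) integrable_distr_eq) (simp_all add: mz add.commute)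
    have "(\<integral>y. z y \<partial>lborel) = (\<integral>y. z y \<partial>(distr lborel borel ((+) c)))" by (simp add: lborel_distr_plus)
    also have "\<dots> = (\<integral>y. z (c + y) \<partial>lborel)" by (rule integral_distr) (simp_all add: mz)
    finally show "(\<integral>y. z (y + c) \<partial>lborel) = (\<integral>y. z y \<partial>lborel)" by (simp add: add.commute)
  qed
  have q0: "(\<integral>y. ?q m y \<partial>lborel) = 0" for m
    using shift[of "h m *\<^sub>R e"] zint by simp
  have mvt: "\<bar>?q m y\<bar> \<le> C'" for m y
  proof -
    have "\<exists>t>0. t < h m \<and> z (y + h m *\<^sub>R e) - z (y + 0 *\<^sub>R e) = (h m - 0) * ?D (y + t *\<^sub>R e)"
      by (rule MVT2[OF h(1) der])
    then obtain t where "z (y + h m *\<^sub>R e) - z y = h m * ?D (y + t *\<^sub>R e)" by auto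
    then show ?thesis using C' h(1)[of m] by simp
  qed
  have qsupp: "?q m y = 0" if "y \<notin> B" for m y
  proof -
    have ny: "norm y > R + norm e" using that by (simp add: B_def)
    have "norm (h m *\<^sub>R e) \<le> norm e" using h[of m] mult_right_mono[of "h m" 1 "norm e"] by simp
    then have "norm (y + h m *\<^sub>R e) > R"
      using ny norm_diff_ineq[of y "h m *\<^sub>R e"] by linarith
    moreover have "norm y > R" using ny norm_ge_zero[of e] by linarith
    ultimately have "y \<notin> K" "y + h m *\<^sub>R e \<notin> K" using R by (auto simp: not_le[symmetric])
    then show ?thesis by (simp add: supp)
  qed
  have "(\<lambda>m. \<integral>y. ?q m y \<partial>lborel) \<longlonglongrightarrow> (\<integral>y. ?D y \<partial>lborel)"
  proof (rule integral_dominated_convergence[where w="\<lambda>y. indicator B y *\<^sub>R C'"])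
    show "integrable lborel (\<lambda>y. indicator B y *\<^sub>R C')"
      unfolding B_def by (rule borel_integrable_compact) auto
    show "?D \<in> borel_measurable lborel" using borel_measurable_continuous_onI[OF Dc] by simp
    show "?q m \<in> borel_measurable lborel" for m
      using zint shift(1)[of "h m *\<^sub>R e"] by (intro borel_measurable_divide borel_measurable_diff) auto
    show "AE y in lborel. (\<lambda>m. ?q m y) \<longlonglongrightarrow> ?D y"
    proof (rule AE_I2)
      fix y
      have "((\<lambda>t. (z (y + t *\<^sub>R e) - z y) / t) \<longlongrightarrow> ?D y) (at 0)"
        using der[of y 0] by (simp add: DERIV_def)
      moreover have "filterlim h (at 0) sequentially"
        unfolding filterlim_at h_def using LIMSEQ_inverse_real_of_nat by (auto simp: inverse_eq_divide)
      ultimately show "(\<lambda>m. ?q m y) \<longlonglongrightarrow> ?D y" by (rule filterlim_compose)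
    qed
    show "AE y in lborel. norm (?q m y) \<le> indicator B y *\<^sub>R C'" for m
      using mvt qsupp by (intro AE_I2) (auto simp: indicator_def)
  qed
  then show ?thesis unfolding q0 by (simp add: LIMSEQ_const_iff)
qed

text \<open>Weighted by \<open>rho\<close>, a Hamiltonian field is divergence free, by
  \<open>field_divergence\<close> and \<open>rho_has_derivative\<close>. So on \<open>N\<close> the
  integrand is the divergence of \<open>k\<close>, \<open>rho\<close> and the field multiplied
  together, a field with support in \<open>K\<close>.\<close>

lemma (in symplectic_domain) integral_derivative_along_field:
  assumes N: "open N" "N \<subseteq> V" and K: "compact K" "K \<subseteq> N"
    and F: "Ck_on 2 F V" and supp: "\<And>y. y \<in> V - K \<Longrightarrow> F y = 0" and k: "Ck_on (Suc 0) k N"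
  shows "(LINT y:K|lborel. frechet_derivative k (at y) (field F y) * rho y) = 0"
proof -
  have F': "Ck_on (Suc (Suc 0)) F V" using F by (simp only: numeral_2_eq_2)
  have opK: "open (V - K)" using V compact_imp_closed[OF K(1)] by (rule open_Diff)
  have X0: "field F y = 0" if y: "y \<in> V - K" for y
  proof -
    have "frechet_derivative F (at y) = frechet_derivative (\<lambda>y. 0) (at y)"
      by (rule frechet_derivative_cong_open[OF opK y]) (rule supp)
    then show ?thesis by (simp add: field_def vec_eq_iff)
  qed
  \<comment> \<open>Extension by 0 off \<open>N\<close> turns the j-th component into a function on
    the whole space with support in \<open>K\<close>.\<close>
  define z where "z j y = (if y \<in> N then k y * rho y * field F y $ j else 0)" for j y
  have XC: "Ck_on (Suc 0) (\<lambda>y. field F y $ j) N" for j by (rule Ck_on_subset[OF field_Ck[OF F'] N(2)])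
  have rC: "Ck_on (Suc 0) rho N" by (rule Ck_on_subset[OF rho_Ck N(2)])
  have zC: "Ck_on (Suc 0) (z j) N" for j
    by (rule Ck_on_eqI[OF N(1) Ck_on_mult[OF N(1) Ck_on_mult[OF N(1) k rC] XC[of j]]]) (simp add: z_def)
  have z0: "z j y = 0" if "y \<notin> K" for j y
    using X0[of y] that N(2) by (auto simp: z_def)
  let ?Dz = "\<lambda>j y. frechet_derivative (z j) (at y) (axis j 1)"
  let ?g = "\<lambda>y. frechet_derivative k (at y) (field F y) * rho y"
  have int0: "(\<integral>y. ?Dz j y \<partial>lborel) = 0" for j
    by (rule integral_derivative_compact_support[OF zC N(1) K z0])
  have Dz0: "?Dz j y = 0" if "y \<notin> K" for j y
  proof -
    have "open (- K)" using compact_imp_closed[OF K(1)] by (simp add: open_Compl)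
    then have "frechet_derivative (z j) (at y) = frechet_derivative (\<lambda>y. 0) (at y)"
      by (rule frechet_derivative_cong_open) (use that z0 in auto)
    then show ?thesis by simp
  qed
  have sum_eq: "(\<Sum>j\<in>UNIV. ?Dz j y) = ?g y" if y: "y \<in> N" for y
  proof -
    have yV: "y \<in> V" using y N(2) by blast
    have kD: "(k has_derivative frechet_derivative k (at y)) (at y)" by (rule Ck_on_has_derivative[OF k y])
    have XD: "((\<lambda>y. field F y $ j) has_derivative frechet_derivative (\<lambda>y. field F y $ j) (at y)) (at y)" for j
      by (rule Ck_on_has_derivative[OF XC y])
    have "?Dz j y = k y * rho y * frechet_derivative (\<lambda>y. field F y $ j) (at y) (axis j 1) +
        (k y * (tau y (axis j 1) * rho y) + frechet_derivative k (at y) (axis j 1) * rho y) * field F y $ j" for j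
    proof -
      have "((\<lambda>y. k y * rho y * field F y $ j) has_derivative
        (\<lambda>h. k y * rho y * frechet_derivative (\<lambda>y. field F y $ j) (at y) h +
          (k y * (tau y h * rho y) + frechet_derivative k (at y) h * rho y) * field F y $ j)) (at y)"
        by (intro has_derivative_mult kD XD rho_has_derivative yV)
      then have "(z j has_derivative
        (\<lambda>h. k y * rho y * frechet_derivative (\<lambda>y. field F y $ j) (at y) h +
          (k y * (tau y h * rho y) + frechet_derivative k (at y) h * rho y) * field F y $ j)) (at y)"
        by (rule has_derivative_transform_within_open[OF _ N(1) y]) (simp add: z_def)
      from fun_cong[OF frechet_derivative_at[OF this], of "axis j 1"] show ?thesis by (rule sym)
    qed
    then have "(\<Sum>j\<in>UNIV. ?Dz j y) =
        k y * rho y * (\<Sum>j\<in>UNIV. frechet_derivative (\<lambda>y. field F y $ j) (at y) (axis j 1)) +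
        k y * rho y * (\<Sum>j\<in>UNIV. field F y $ j * tau y (axis j 1)) +
        rho y * (\<Sum>j\<in>UNIV. field F y $ j * frechet_derivative k (at y) (axis j 1))"
      by (simp add: sum.distrib sum_distrib_left algebra_simps)
    moreover have "(\<Sum>j\<in>UNIV. field F y $ j * tau y (axis j 1)) = tau y (field F y)"
      using linear_axis_expansion[OF tau_linear[OF yV], of "field F y"] by simp
    moreover have "(\<Sum>j\<in>UNIV. field F y $ j * frechet_derivative k (at y) (axis j 1)) = frechet_derivative k (at y) (field F y)"
      using linear_axis_expansion[OF has_derivative_linear[OF kD], of "field F y"] by simp
    ultimately show ?thesis using field_divergence[OF F yV] by simp
  qed
  have "indicator K y *\<^sub>R ?g y = (\<Sum>j\<in>UNIV. ?Dz j y)" for y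
  proof (cases "y \<in> K")
    case True
    then show ?thesis using sum_eq[of y] K(2) by auto
  qed (simp add: Dz0)
  moreover have "integrable lborel (?Dz j)" for j
  proof -
    have "continuous_on K (?Dz j)"
      using Ck_on_continuous_on[OF Ck_on_frechet[OF zC]] K(2) continuous_on_subset by blast
    then have "integrable lborel (\<lambda>y. indicator K y *\<^sub>R ?Dz j y)" by (rule borel_integrable_compact[OF K(1)])
    moreover have "(\<lambda>y. indicator K y *\<^sub>R ?Dz j y) = ?Dz j" using Dz0 by (auto simp: fun_eq_iff indicator_def)
    ultimately show ?thesis by simp
  qed
  ultimately show ?thesis unfolding set_lebesgue_integral_def by (simp add: int0)
qed

section \<open>The Liouville measure in charts\<close>

locale liouville_manifold = closed_manifold A for A :: "('m::t2_space, 'k::{finite,wellorder}) chart set" +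
  fixes \<omega> :: "('m, 'k) tensor2" and \<mu> :: "'m measure" and n :: nat
  assumes dimension: "card (UNIV :: 'k set) = 2 * n"
    and symplectic: "symplectic_form A \<omega>" and liouville: "liouville_measure n A \<omega> \<mu>"
begin

lemma omega_tensor: "smooth_tensor2 A \<omega>" using symplectic unfolding symplectic_form_def by blast

lemma symplectic_chart:
  assumes c: "c \<in> A"
  shows "symplectic_domain (chart_image c) (\<lambda>y. \<omega> c (chart_inv c y)) n"
proof
  have s: "\<And>p u. p \<in> fst c \<Longrightarrow> \<omega> c p u u = 0"
      "\<And>p u v w. p \<in> fst c \<Longrightarrow> ext_deriv2 \<omega> c p u v w = 0"
      "\<And>p u. p \<in> fst c \<Longrightarrow> (\<forall>v. \<omega> c p u v = 0) \<Longrightarrow> u = 0"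
    using symplectic c unfolding symplectic_form_def by blast+
  show "open (chart_image c)" by (rule image_open[OF c])
  show "card (UNIV :: 'k set) = 2 * n" by (rule dimension)
  show "Ck_on k (\<lambda>y. \<omega> c (chart_inv c y) u v) (chart_image c)" for k u v
    by (rule smooth_tensor2D(2)[OF omega_tensor c])
  fix y assume y: "y \<in> chart_image c"
  note p = inv_in[OF c y]
  show "bilinear (\<omega> c (chart_inv c y))" by (rule smooth_tensor2D(1)[OF omega_tensor c p])
  show "\<omega> c (chart_inv c y) u u = 0" for u by (rule s(1)[OF p])
  show "u = 0" if "\<And>v. \<omega> c (chart_inv c y) u v = 0" for u using s(3)[OF p] that by blast
  show "frechet_derivative (\<lambda>z. \<omega> c (chart_inv c z) u v) (at y) x +
      frechet_derivative (\<lambda>z. \<omega> c (chart_inv c z) v x) (at y) u +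
      frechet_derivative (\<lambda>z. \<omega> c (chart_inv c z) x u) (at y) v = 0" for u v x
    using s(2)[OF p, of x u v] unfolding ext_deriv2_def partial_tensor2_def chart_inv_eq[OF c y] .
qed

definition dens :: "('m, 'k) chart \<Rightarrow> (real, 'k) vec \<Rightarrow> real" where
  "dens c y = \<bar>volume_form n \<omega> c (chart_inv c y) std_basis\<bar>"

lemma dens_eq: "c \<in> A \<Longrightarrow> dens c = symplectic_domain.rho (\<lambda>y. \<omega> c (chart_inv c y)) n"
  by (rule ext) (simp add: dens_def symplectic_domain.rho_def[OF symplectic_chart]
      symplectic_domain.pf_def[OF symplectic_chart] volume_form_def)

lemma dens_nonneg: "0 \<le> dens c y" by (simp add: dens_def)

lemma dens_continuous: "c \<in> A \<Longrightarrow> continuous_on (chart_image c) (dens c)"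
  unfolding dens_eq by (rule symplectic_domain.rho_continuous[OF symplectic_chart])

lemma sets_liouville: "sets \<mu> = sets borel" using liouville unfolding liouville_measure_def by blast

lemma emeasure_chart:
  assumes "c \<in> A" "B \<in> sets borel" "B \<subseteq> fst c"
  shows "emeasure \<mu> B = (\<integral>\<^sup>+ y. ennreal (dens c y) * indicator (snd c ` B) y \<partial>lborel)"
  using liouville assms unfolding liouville_measure_def dens_def by blast

lemma chart_image_mem:
  assumes "c \<in> A" "B \<subseteq> fst c"
  shows "y \<in> snd c ` B \<longleftrightarrow> y \<in> chart_image c \<and> chart_inv c y \<in> B"
proof
  assume "y \<in> snd c ` B"
  then obtain p where "p \<in> B" "y = snd c p" by blast
  then show "y \<in> chart_image c \<and> chart_inv c y \<in> B"
    using assms chart_in[OF assms(1)] inv_chart[OF assms(1)] by auto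
next
  assume "y \<in> chart_image c \<and> chart_inv c y \<in> B"
  then show "y \<in> snd c ` B"
    using chart_inv_eq[OF assms(1), of y] by (intro image_eqI[of y "snd c" "chart_inv c y"]) auto
qed

text \<open>Continuity of the density bounds the mass of small chart balls, and finitely many of
  them cover the manifold.\<close>

lemma finite_liouville: "finite_measure \<mu>"
proof
  have sp: "space \<mu> = UNIV" using sets_eq_imp_space_eq[OF sets_liouville] by simp
  have "\<exists>U. open U \<and> p \<in> U \<and> emeasure \<mu> U < \<infinity>" for p
  proof -
    obtain c where c: "c \<in> A" "p \<in> fst c" using chart_at by blast
    obtain r where r: "r > 0" "cball (snd c p) r \<subseteq> chart_image c"
      using image_open[OF c(1)] chart_in[OF c] open_contains_cball by blast
    let ?K = "cball (snd c p) r" and ?U = "{q \<in> fst c. snd c q \<in> ball (snd c p) r}"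
    have U: "open ?U" by (rule open_chart_vimage[OF c(1) open_ball])
    have "compact (dens c ` ?K)"
      by (rule compact_continuous_image[OF continuous_on_subset[OF dens_continuous[OF c(1)] r(2)] compact_cball])
    from compact_imp_bounded[OF this] obtain M where "\<forall>x\<in>dens c ` ?K. norm x \<le> M"
      unfolding bounded_iff by blast
    then have M: "\<And>y. y \<in> ?K \<Longrightarrow> dens c y \<le> M" by force
    have "emeasure \<mu> ?U = (\<integral>\<^sup>+ y. ennreal (dens c y) * indicator (snd c ` ?U) y \<partial>lborel)"
      by (rule emeasure_chart[OF c(1)]) (use U in auto)
    also have "\<dots> \<le> (\<integral>\<^sup>+ y. ennreal M * indicator ?K y \<partial>lborel)"
      by (rule nn_integral_mono) (auto simp: indicator_def intro!: ennreal_leI M)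
    also have "\<dots> = ennreal M * emeasure lborel ?K" by (rule nn_integral_cmult_indicator) simp
    also have "\<dots> < \<infinity>" using emeasure_lborel_cball_finite[of "snd c p" r] by (simp add: ennreal_mult_less_top)
    finally show ?thesis using U c r(1) by (intro exI[of _ ?U]) auto
  qed
  then obtain U where U: "\<And>p. open (U p)" "\<And>p. p \<in> U p" "\<And>p. emeasure \<mu> (U p) < \<infinity>" by metis
  have cov: "UNIV \<subseteq> (\<Union>p\<in>UNIV. U p)" using U(2) by blast
  obtain I where I: "I \<subseteq> UNIV" "finite I" "UNIV \<subseteq> (\<Union>p\<in>I. U p)"
    by (rule compactE_image[OF cpt U(1) cov])
  have Us: "U p \<in> sets \<mu>" for p unfolding sets_liouville by (rule borel_open[OF U(1)])
  have "(\<Union>p\<in>I. U p) = UNIV" using I(3) by blast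
  then have "emeasure \<mu> UNIV = emeasure \<mu> (\<Union>p\<in>I. U p)" by simp
  also have "\<dots> \<le> (\<Sum>p\<in>I. emeasure \<mu> (U p))"
    by (rule emeasure_subadditive_finite[OF I(2)]) (use Us in auto)
  also have "\<dots> < \<infinity>" using U(3) I(2) by simp
  finally show "emeasure \<mu> (space \<mu>) \<noteq> \<infinity>" unfolding sp by simp
qed

text \<open>The defining property of \<mu> concerns Borel subsets of chart domains. It identifies
  the restriction of \<mu> to the domain with that of the image \<open>D\<close> of a weighted
  Lebesgue measure, and \<open>u\<close> vanishes off the domain.\<close>

lemma integral_chart:
  fixes u :: "'m \<Rightarrow> real"
  assumes c: "c \<in> A" and K: "K \<in> sets borel" "K \<subseteq> chart_image c" and u: "u \<in> borel_measurable borel"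
    and supp: "\<And>p. u p \<noteq> 0 \<Longrightarrow> p \<in> chart_inv c ` K"
  shows "integral\<^sup>L \<mu> u = (LINT y:K|lborel. u (chart_inv c y) * dens c y)"
proof -
  let ?U = "fst c" and ?V = "chart_image c"
  \<comment> \<open>A default value off the chart image turns the inverse chart into a Borel map on
    the whole space.\<close>
  obtain p0 :: 'm where "p0 \<in> UNIV" by blast
  define ci where "ci y = (if y \<in> ?V then chart_inv c y else p0)" for y
  have Ub: "?U \<in> sets borel" using chart_open[OF c] by simp
  have Vb: "?V \<in> sets borel" using image_open[OF c] by simp
  have ci: "ci \<in> borel_measurable borel"
    unfolding ci_def by (rule borel_measurable_continuous_on_if[OF Vb inv_cont[OF c]]) simp
  define r where "r y = (if y \<in> ?V then dens c y else 0)" for y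
  have r: "r \<in> borel_measurable borel"
    unfolding r_def by (rule borel_measurable_continuous_on_if[OF Vb dens_continuous[OF c]]) simp
  have r0: "0 \<le> r y" for y by (simp add: r_def dens_nonneg)
  define D where "D = distr (density lborel (\<lambda>y. ennreal (r y))) borel ci"
  have D: "sets D = sets borel" by (simp add: D_def)
  have eqD: "emeasure \<mu> B = emeasure D B" if B: "B \<in> sets borel" "B \<subseteq> ?U" for B
  proof -
    have "emeasure D B = emeasure (density lborel (\<lambda>y. ennreal (r y))) (ci -` B)"
      unfolding D_def using ci B(1) by (subst emeasure_distr) simp_all
    also have "\<dots> = (\<integral>\<^sup>+ y. ennreal (r y) * indicator (ci -` B) y \<partial>lborel)"
      using r measurable_sets[OF ci, of B] B(1) by (intro emeasure_density) simp_all
    also have "\<dots> = (\<integral>\<^sup>+ y. ennreal (dens c y) * indicator (snd c ` B) y \<partial>lborel)"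
    proof (rule nn_integral_cong)
      fix y
      show "ennreal (r y) * indicator (ci -` B) y = ennreal (dens c y) * indicator (snd c ` B) y"
        using chart_image_mem[OF c B(2), of y] by (cases "y \<in> ?V") (simp_all add: r_def ci_def indicator_def)
    qed
    finally show ?thesis using emeasure_chart[OF c B] by simp
  qed
  have dens_eqD: "density \<mu> (\<lambda>p. ennreal (indicator ?U p)) = density D (\<lambda>p. ennreal (indicator ?U p))"
  proof (rule measure_eqI)
    fix B assume "B \<in> sets (density \<mu> (\<lambda>p. ennreal (indicator ?U p)))"
    then have B: "B \<in> sets borel" by (simp add: sets_liouville)
    have e: "ennreal (indicator ?U p) * indicator B p = indicator (?U \<inter> B) p" for p :: 'm
      by (simp add: indicator_def)
    have mI: "(\<lambda>p. ennreal (indicator ?U p)) \<in> borel_measurable M" if "sets M = sets borel" for M :: "'m measure"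
      using Ub that by (intro measurable_compose[OF borel_measurable_indicator measurable_ennreal]) simp
    have "emeasure (density \<mu> (\<lambda>p. ennreal (indicator ?U p))) B = emeasure \<mu> (?U \<inter> B)"
      using B Ub sets_liouville by (subst emeasure_density[OF mI[OF sets_liouville]]) (simp_all add: e)
    also have "\<dots> = emeasure D (?U \<inter> B)" by (rule eqD) (use B Ub in auto)
    also have "\<dots> = emeasure (density D (\<lambda>p. ennreal (indicator ?U p))) B"
      using B Ub D by (subst emeasure_density[OF mI[OF D]]) (simp_all add: e)
    finally show "emeasure (density \<mu> (\<lambda>p. ennreal (indicator ?U p))) B =
        emeasure (density D (\<lambda>p. ennreal (indicator ?U p))) B" .
  qed (simp add: sets_liouville D)
  have uU: "indicat_real ?U p * u p = u p" for p
    using supp[of p] inv_in[OF c] K(2) by (cases "u p = 0") (auto simp: indicator_def)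
  have mu: "u \<in> borel_measurable M" if "sets M = sets borel" for M :: "'m measure"
    by (subst measurable_cong_sets[OF that refl]) (rule u)
  have mi: "(\<lambda>p. indicator ?U p :: real) \<in> borel_measurable M" if "sets M = sets borel" for M :: "'m measure"
    using Ub that by (intro borel_measurable_indicator) simp
  have dm: "integral\<^sup>L (density M (\<lambda>p. ennreal (indicator ?U p))) u = integral\<^sup>L M u" if "sets M = sets borel" for M :: "'m measure"
    using integral_density[OF mu[OF that] mi[OF that]] by (simp add: uU)
  have "integral\<^sup>L \<mu> u = integral\<^sup>L D u" using dm[OF sets_liouville] dm[OF D] dens_eqD by simp
  also have "\<dots> = integral\<^sup>L (density lborel (\<lambda>y. ennreal (r y))) (\<lambda>y. u (ci y))"
    unfolding D_def by (rule integral_distr) (use ci u in simp_all)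
  also have "\<dots> = (\<integral>y. r y *\<^sub>R u (ci y) \<partial>lborel)"
    by (rule integral_density) (use r r0 measurable_compose[OF ci u] in simp_all)
  also have "\<dots> = (\<integral>y. indicator K y *\<^sub>R (u (chart_inv c y) * dens c y) \<partial>lborel)"
  proof (rule Bochner_Integration.integral_cong[OF refl])
    fix y
    show "r y *\<^sub>R u (ci y) = indicator K y *\<^sub>R (u (chart_inv c y) * dens c y)"
    proof (cases "y \<in> K")
      case True
      then show ?thesis using K(2) by (auto simp: r_def ci_def)
    next
      case False
      have "u (chart_inv c y) = 0" if y: "y \<in> ?V"
      proof (rule ccontr)
        assume "u (chart_inv c y) \<noteq> 0"
        then obtain y' where "y' \<in> K" "chart_inv c y = chart_inv c y'" using supp by blast
        then have "y = y'" using chart_inv_eq[OF c] y K(2) by (metis subsetD)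
        then show False using \<open>y' \<in> K\<close> False by simp
      qed
      then show ?thesis using False by (simp add: r_def ci_def)
    qed
  qed
  finally show ?thesis unfolding set_lebesgue_integral_def .
qed

end

section \<open>Euclidean tools for flows\<close>

subsection \<open>Smooth dependence on a parameter\<close>

lemma smooth_on_continuous_on:
  assumes "smooth_on S f"
  shows "continuous_on S f"
  unfolding continuous_on_eq_continuous_within
proof
  fix x assume x: "x \<in> S"
  obtain V g where V: "open V" "x \<in> V" "\<forall>k. Ck_on k g V" "\<forall>y\<in>S \<inter> V. g y = f y"
    using assms x unfolding smooth_on_def by blast
  obtain d where d: "d > 0" "ball x d \<subseteq> V" using V(1,2) openE by blast
  have "continuous_on V g" using V(3) Ck_on.simps(1) by blast
  then have "continuous (at x within S) g"
    using V(1,2) continuous_on_eq_continuous_at continuous_at_imp_continuous_at_within by blast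
  then show "continuous (at x within S) f"
  proof (rule continuous_transform_within[OF _ d(1) x])
    fix x' assume x': "x' \<in> S" "dist x' x < d"
    then have "x' \<in> ball x d" by (simp add: dist_commute)
    then show "g x' = f x'" using d(2) V(4) x'(1) by blast
  qed
qed

lemma smooth_on_mult:
  fixes f h :: "'a::euclidean_space \<Rightarrow> real"
  assumes "smooth_on S f" "smooth_on S h"
  shows "smooth_on S (\<lambda>x. f x * h x)"
  unfolding smooth_on_def
proof
  fix x assume x: "x \<in> S"
  obtain V g where V: "open V" "x \<in> V" "\<forall>k. Ck_on k g V" "\<forall>y\<in>S \<inter> V. g y = f y"
    using assms(1) x unfolding smooth_on_def by blast
  obtain V' g' where V': "open V'" "x \<in> V'" "\<forall>k. Ck_on k g' V'" "\<forall>y\<in>S \<inter> V'. g' y = h y"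
    using assms(2) x unfolding smooth_on_def by blast
  have o: "open (V \<inter> V')" using V(1) V'(1) by blast
  have "Ck_on k (\<lambda>x. g x * g' x) (V \<inter> V')" for k
    by (rule Ck_on_mult[OF o Ck_on_subset Ck_on_subset]) (use V(3) V'(3) in auto)
  then show "\<exists>V g. open V \<and> x \<in> V \<and> (\<forall>k. Ck_on k g V) \<and> (\<forall>y\<in>S \<inter> V. g y = f y * h y)"
    using o V V' by (intro exI[of _ "V \<inter> V'"] exI[of _ "\<lambda>x. g x * g' x"]) auto
qed

lemma smooth_on_add:
  fixes f h :: "'a::euclidean_space \<Rightarrow> real"
  assumes "smooth_on S f" "smooth_on S h"
  shows "smooth_on S (\<lambda>x. f x + h x)"
  unfolding smooth_on_def
proof
  fix x assume x: "x \<in> S"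
  obtain V g where V: "open V" "x \<in> V" "\<forall>k. Ck_on k g V" "\<forall>y\<in>S \<inter> V. g y = f y"
    using assms(1) x unfolding smooth_on_def by blast
  obtain V' g' where V': "open V'" "x \<in> V'" "\<forall>k. Ck_on k g' V'" "\<forall>y\<in>S \<inter> V'. g' y = h y"
    using assms(2) x unfolding smooth_on_def by blast
  have o: "open (V \<inter> V')" using V(1) V'(1) by blast
  have "Ck_on k (\<lambda>x. g x + g' x) (V \<inter> V')" for k
    by (rule Ck_on_add[OF o Ck_on_subset Ck_on_subset]) (use V(3) V'(3) in auto)
  then show "\<exists>V g. open V \<and> x \<in> V \<and> (\<forall>k. Ck_on k g V) \<and> (\<forall>y\<in>S \<inter> V. g y = f y + h y)"
    using o V V' by (intro exI[of _ "V \<inter> V'"] exI[of _ "\<lambda>x. g x + g' x"]) auto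
qed

lemma smooth_on_UNIV_const: "smooth_on S (\<lambda>x. a)"
  unfolding smooth_on_def by (auto intro!: exI[of _ UNIV] exI[of _ "\<lambda>x. a"])

lemma smooth_on_sum:
  fixes f :: "'i \<Rightarrow> 'a::euclidean_space \<Rightarrow> real"
  assumes "\<And>i. i \<in> I \<Longrightarrow> smooth_on S (f i)"
  shows "smooth_on S (\<lambda>x. \<Sum>i\<in>I. f i x)"
  using assms
  by (induction I rule: infinite_finite_induct) (simp_all add: smooth_on_UNIV_const smooth_on_add)

lemma smooth_on_snd:
  assumes V: "open V" and f: "\<And>k. Ck_on k f V"
  shows "smooth_on (T \<times> V) (\<lambda>(t::real, y). f y)"
  unfolding smooth_on_def
proof
  fix x :: "real \<times> 'a" assume x: "x \<in> T \<times> V"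
  have o: "open (UNIV \<times> V :: (real \<times> 'a) set)" using V by (intro open_Times) auto
  have "Ck_on k (\<lambda>p. f (snd p)) (UNIV \<times> V :: (real \<times> 'a) set)" for k
    by (rule Ck_on_compose[OF o V _ f Ck_on_bounded_linear[OF bounded_linear_snd]]) auto
  then show "\<exists>W g. open W \<and> x \<in> W \<and> (\<forall>k. Ck_on k g W) \<and> (\<forall>q\<in>(T \<times> V) \<inter> W. g q = (case q of (t, y) \<Rightarrow> f y))"
    using x o by (intro exI[of _ "UNIV \<times> V"] exI[of _ "\<lambda>p. f (snd p)"]) auto
qed

text \<open>Time runs over a closed interval, where smoothness means local extension. Cutting
  \<open>U\<close> down to \<open>UNIV \<times> V\<close> leaves time as the only variable that can
  lie outside the given domain.\<close>

lemma parameter_extension: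
  fixes F :: "real \<Rightarrow> 'a::euclidean_space \<Rightarrow> 'b::euclidean_space"
  assumes V: "open V" and F: "smooth_on (T \<times> V) (\<lambda>(t, y). F t y)" and ty: "t \<in> T" "y \<in> V"
  obtains U G where "open U" "(t, y) \<in> U" "U \<subseteq> UNIV \<times> V" "\<And>k. Ck_on k G U"
    "\<And>t' y'. (t', y') \<in> U \<Longrightarrow> t' \<in> T \<Longrightarrow> F t' y' = G (t', y')"
proof -
  have "(t, y) \<in> T \<times> V" using ty by simp
  then obtain U G where U: "open U" "(t, y) \<in> U" "\<forall>k. Ck_on k G U"
    "\<forall>p\<in>(T \<times> V) \<inter> U. G p = (case p of (t, y) \<Rightarrow> F t y)"
    using F unfolding smooth_on_def by blast
  show ?thesis
  proof (rule that[of "U \<inter> (UNIV \<times> V)" G])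
    show "open (U \<inter> (UNIV \<times> V))" using U(1) V by (intro open_Int open_Times) auto
    show "Ck_on k G (U \<inter> (UNIV \<times> V))" for k using U(3) Ck_on_subset[of k G U] by blast
  qed (use U ty in auto)
qed

text \<open>Directions \<open>(0, v)\<close> stay in the slice of time \<open>t\<close>, and on that
  slice the extension agrees with \<open>F\<close>, even when \<open>t\<close> is an end point of
  the time interval.\<close>

lemma parameter_slice_derivative:
  fixes F :: "real \<Rightarrow> 'a::euclidean_space \<Rightarrow> 'b::euclidean_space"
  assumes U: "open U" "(t, y) \<in> U" and t: "t \<in> T" and G: "\<And>k. Ck_on k G U"
    and eq: "\<And>t' y'. (t', y') \<in> U \<Longrightarrow> t' \<in> T \<Longrightarrow> F t' y' = G (t', y')"
  shows "(F t has_derivative (\<lambda>v. frechet_derivative G (at (t, y)) (0, v))) (at y)"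
proof -
  have o: "open ((\<lambda>y. (t, y)) -` U)" using U(1) by (intro open_vimage continuous_intros)
  have "((\<lambda>y. (t, y)) has_derivative (\<lambda>v. (0, v))) (at y)" by (auto intro!: derivative_eq_intros)
  from diff_chain_at[OF this Ck_on_has_derivative[OF G[of "Suc 0"] U(2)]]
  have "((\<lambda>y. G (t, y)) has_derivative (\<lambda>v. frechet_derivative G (at (t, y)) (0, v))) (at y)"
    by (simp add: o_def)
  then show ?thesis
    by (rule has_derivative_transform_within_open[OF _ o]) (use U(2) eq t in auto)
qed

lemma parameter_slice:
  fixes F :: "real \<Rightarrow> 'a::euclidean_space \<Rightarrow> 'b::euclidean_space"
  assumes V: "open V" and F: "smooth_on (T \<times> V) (\<lambda>(t, y). F t y)" and t: "t \<in> T"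
  shows "Ck_on k (F t) V"
proof (rule Ck_on_local)
  fix y assume y: "y \<in> V"
  obtain U G where U: "open U" "(t, y) \<in> U" "U \<subseteq> UNIV \<times> V" "\<And>k. Ck_on k G U"
    "\<And>t' y'. (t', y') \<in> U \<Longrightarrow> t' \<in> T \<Longrightarrow> F t' y' = G (t', y')"
    by (rule parameter_extension[OF V F t y]) blast
  let ?W = "(\<lambda>y. (t, y)) -` U"
  have o: "open ?W" using U(1) by (intro open_vimage continuous_intros)
  have "Ck_on k (\<lambda>y. (t, y)) ?W"
  proof (rule Ck_on_componentwise[OF o])
    fix b :: "real \<times> 'a"
    have "Ck_on k (\<lambda>y. t * fst b + y \<bullet> snd b) ?W"
      by (intro Ck_on_add Ck_on_inner Ck_on_id Ck_on_const o)
    then show "Ck_on k (\<lambda>y. (t, y) \<bullet> b) ?W" by (simp add: inner_prod_def)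
  qed
  then have "Ck_on k (\<lambda>y. G (t, y)) ?W" by (intro Ck_on_compose[where g="\<lambda>y. (t, y)" and f=G, OF o U(1) _ U(4)]) auto
  then have "Ck_on k (F t) ?W" by (rule Ck_on_eqI[OF o]) (use U(5) t in auto)
  then show "\<exists>W. open W \<and> y \<in> W \<and> Ck_on k (F t) W" using o U(2) by (intro exI[of _ ?W]) auto
qed

lemma smooth_on_parameter_derivative:
  fixes F :: "real \<Rightarrow> 'a::euclidean_space \<Rightarrow> 'b::euclidean_space"
  assumes V: "open V" and F: "smooth_on (T \<times> V) (\<lambda>(t, y). F t y)"
  shows "smooth_on (T \<times> V) (\<lambda>(t, y). frechet_derivative (F t) (at y) v)"
  unfolding smooth_on_def
proof
  fix p assume p: "p \<in> T \<times> V"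
  obtain t y where ty: "p = (t, y)" "t \<in> T" "y \<in> V" using p by blast
  obtain U G where U: "open U" "(t, y) \<in> U" "U \<subseteq> UNIV \<times> V" "\<And>k. Ck_on k G U"
    "\<And>t' y'. (t', y') \<in> U \<Longrightarrow> t' \<in> T \<Longrightarrow> F t' y' = G (t', y')"
    by (rule parameter_extension[OF V F ty(2,3)]) blast
  have "frechet_derivative (F t') (at y') v = frechet_derivative G (at (t', y')) (0, v)"
    if "(t', y') \<in> U" "t' \<in> T" for t' y'
    using frechet_derivative_at[OF parameter_slice_derivative[OF U(1) that U(4,5)], symmetric] by (rule fun_cong)
  then show "\<exists>W g. open W \<and> p \<in> W \<and> (\<forall>k. Ck_on k g W) \<and>
      (\<forall>q\<in>(T \<times> V) \<inter> W. g q = (case q of (t, y) \<Rightarrow> frechet_derivative (F t) (at y) v))"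
    using U(1,2) Ck_on_frechet[OF U(4)] ty(1)
    by (intro exI[of _ U] exI[of _ "\<lambda>q. frechet_derivative G (at q) (0, v)"]) auto
qed

subsection \<open>The determinant near the identity\<close>

text \<open>The derivative in \<open>h\<close> of the determinant of \<open>1 + h M\<close>, kept as
  an explicit polynomial so that joint continuity in \<open>h\<close> and \<open>M\<close> can be
  read off.\<close>

definition det_slope :: "real \<Rightarrow> real ^ 'n ^ 'n \<Rightarrow> real" where
  "det_slope h M = (\<Sum>p | p permutes UNIV. of_int (sign p) *
     (\<Sum>i\<in>UNIV. M $ i $ p i * (\<Prod>j\<in>UNIV - {i}. (if p j = j then 1 else 0) + h * M $ j $ p j)))"

lemma det_has_slope:
  fixes M :: "real ^ 'n ^ 'n"
  shows "((\<lambda>h. det (mat 1 + h *\<^sub>R M)) has_real_derivative det_slope h M) (at h)"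
proof -
  have e: "det (mat 1 + h *\<^sub>R M) = (\<Sum>p | p permutes UNIV. of_int (sign p) *
      (\<Prod>i\<in>UNIV. (if p i = i then 1 else 0) + h * M $ i $ p i))" for h
    unfolding det_def by (simp add: mat_def eq_commute)
  have "((\<lambda>h. \<Prod>i\<in>UNIV. (if p i = i then 1 else 0) + h * M $ i $ p i) has_derivative
     (\<lambda>y. \<Sum>i\<in>UNIV. y * M $ i $ p i * (\<Prod>j\<in>UNIV - {i}. (if p j = j then 1 else 0) + h * M $ j $ p j))) (at h)" for p :: "'n \<Rightarrow> 'n"
    by (rule has_derivative_prod) (auto intro!: derivative_eq_intros)
  then have "((\<lambda>h. \<Prod>i\<in>UNIV. (if p i = i then 1 else 0) + h * M $ i $ p i) has_real_derivative
     (\<Sum>i\<in>UNIV. M $ i $ p i * (\<Prod>j\<in>UNIV - {i}. (if p j = j then 1 else 0) + h * M $ j $ p j))) (at h)" for p :: "'n \<Rightarrow> 'n"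
    unfolding has_field_derivative_def by (rule has_derivative_eq_rhs) (simp add: fun_eq_iff sum_distrib_left mult_ac)
  then have "((\<lambda>h. \<Sum>p | p permutes UNIV. of_int (sign p) *
      (\<Prod>i\<in>UNIV. (if p i = i then 1 else 0) + h * M $ i $ p i)) has_real_derivative det_slope h M) (at h)"
    unfolding det_slope_def by (intro DERIV_sum DERIV_cmult)
  then show ?thesis unfolding e .
qed

text \<open>At \<open>h = 0\<close> a permutation contributes only if it fixes all indices but one;
  by injectivity it then fixes that one too and is the identity. What remains is the trace.\<close>

lemma det_slope_0:
  fixes M :: "real ^ 'n ^ 'n"
  shows "det_slope 0 M = (\<Sum>i\<in>UNIV. M $ i $ i)"
proof -
  have fin: "finite {p. p permutes (UNIV :: 'n set)}" by (rule finite_permutations) simp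
  have z: "(\<Prod>j\<in>UNIV - {i}. (if p j = j then 1 else 0) + 0 * M $ j $ p j) = (if p = id then 1 else 0)"
    if p: "p permutes UNIV" for p i
  proof (cases "p = id")
    case False
    have "\<exists>j\<in>UNIV - {i}. p j \<noteq> j"
    proof (rule ccontr)
      assume "\<not> (\<exists>j\<in>UNIV - {i}. p j \<noteq> j)"
      then have fx: "p j = j" if "j \<noteq> i" for j using that by blast
      have "p i = i"
      proof (rule ccontr)
        assume "p i \<noteq> i"
        then have "p (p i) = p i" by (rule fx)
        then have "p i = i" using injD[OF permutes_inj[OF p]] by blast
        then show False using \<open>p i \<noteq> i\<close> by simp
      qed
      then have "p = id" using fx by (intro ext) (metis id_apply)
      then show False using False by simp
    qed
    then show ?thesis using False by (simp add: prod_zero_iff)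
  qed simp
  have "det_slope 0 M = (\<Sum>p | p permutes (UNIV :: 'n set). if p = id then (\<Sum>i\<in>UNIV. M $ i $ i) else 0)"
    unfolding det_slope_def
  proof (rule sum.cong[OF refl])
    fix p assume "p \<in> {p. p permutes (UNIV :: 'n set)}"
    then have p: "p permutes UNIV" by simp
    show "of_int (sign p) * (\<Sum>i\<in>UNIV. M $ i $ p i * (\<Prod>j\<in>UNIV - {i}. (if p j = j then 1 else 0) + 0 * M $ j $ p j)) =
        (if p = id then (\<Sum>i\<in>UNIV. M $ i $ i) else 0)"
      unfolding z[OF p] by (cases "p = id") simp_all
  qed
  also have "\<dots> = (\<Sum>i\<in>UNIV. M $ i $ i)" using fin permutes_id by simp
  finally show ?thesis .
qed

lemma continuous_on_det_slope:
  fixes M :: "'a::topological_space \<Rightarrow> real ^ 'n ^ 'n"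
  assumes "continuous_on S h" "\<And>i j. continuous_on S (\<lambda>x. M x $ i $ j)"
  shows "continuous_on S (\<lambda>x. det_slope (h x) (M x))"
  unfolding det_slope_def
  by (intro continuous_on_sum continuous_on_mult continuous_on_prod continuous_on_add continuous_on_const assms)

lemma continuous_on_det_perturbation:
  fixes M :: "'a::topological_space \<Rightarrow> real ^ 'n ^ 'n"
  assumes "continuous_on S h" "\<And>i j. continuous_on S (\<lambda>x. M x $ i $ j)"
  shows "continuous_on S (\<lambda>x. det (mat 1 + h x *\<^sub>R M x))"
  unfolding det_def
  by (intro continuous_on_sum continuous_on_mult continuous_on_prod continuous_on_const)
    (auto intro!: continuous_on_add continuous_on_mult continuous_on_const assms)

subsection \<open>Curves\<close>

lemma curve_speed_bound:
  fixes f :: "real \<Rightarrow> 'a::real_normed_vector"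
  assumes "a \<le> b" "\<And>t. t \<in> {a..b} \<Longrightarrow> \<exists>v. (f has_vector_derivative v) (at t within {a..b}) \<and> norm v \<le> B"
  shows "norm (f b - f a) \<le> B * (b - a)"
proof -
  obtain v where v: "\<And>t. t \<in> {a..b} \<Longrightarrow> (f has_vector_derivative v t) (at t within {a..b}) \<and> norm (v t) \<le> B"
    using assms(2) by metis
  have "norm (f b - f a) \<le> B * norm (b - a)"
  proof (rule differentiable_bound[where S="{a..b}" and f'="\<lambda>t h. h *\<^sub>R v t"])
    fix t assume t: "t \<in> {a..b}"
    show "(f has_derivative (\<lambda>h. h *\<^sub>R v t)) (at t within {a..b})"
      using v[OF t] unfolding has_vector_derivative_def by blast
    show "onorm (\<lambda>h. h *\<^sub>R v t) \<le> B"
    proof (rule onorm_le)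
      fix h :: real
      show "norm (h *\<^sub>R v t) \<le> B * norm h"
        using mult_left_mono[of "norm (v t)" B "\<bar>h\<bar>"] v[OF t] by (simp add: mult.commute)
    qed
  qed (use assms(1) in auto)
  then show ?thesis using assms(1) by simp
qed

text \<open>Gronwall's inequality: the squared distance of the two solutions, weighted by
  \<open>exp (- (2 * L) * t)\<close>, has nonpositive derivative.\<close>

lemma flow_lipschitz:
  fixes x y :: "real \<Rightarrow> 'a::euclidean_space"
  assumes ab: "a \<le> b"
    and x: "\<And>t. t \<in> {a..b} \<Longrightarrow> (x has_vector_derivative X t (x t)) (at t within {a..b})"
    and y: "\<And>t. t \<in> {a..b} \<Longrightarrow> (y has_vector_derivative X t (y t)) (at t within {a..b})"
    and L: "\<And>t. t \<in> {a..b} \<Longrightarrow> norm (X t (x t) - X t (y t)) \<le> L * norm (x t - y t)"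
  shows "norm (x b - y b) \<le> exp (L * (b - a)) * norm (x a - y a)"
proof -
  define q where "q t = exp (- (2 * L) * t) * ((x t - y t) \<bullet> (x t - y t))" for t
  have "q b \<le> q a"
  proof (rule DERIV_nonpos_imp_decreasing_open[OF ab])
    fix t assume t: "a < t" "t < b"
    then have at: "at t within {a..b} = at t" by (intro at_within_interior) simp
    have "((\<lambda>t. x t - y t) has_vector_derivative (X t (x t) - X t (y t))) (at t)"
      using has_vector_derivative_diff[OF x[of t] y[of t]] t unfolding at by simp
    then have xy: "((\<lambda>t. x t - y t) has_derivative (\<lambda>h. h *\<^sub>R (X t (x t) - X t (y t)))) (at t)"
      unfolding has_vector_derivative_def .
    from has_derivative_inner[OF xy xy]
    have "((\<lambda>t. (x t - y t) \<bullet> (x t - y t)) has_real_derivative 2 * ((x t - y t) \<bullet> (X t (x t) - X t (y t)))) (at t)"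
      unfolding has_field_derivative_def by (rule has_derivative_eq_rhs) (auto simp: inner_commute algebra_simps fun_eq_iff)
    moreover have "((\<lambda>t. exp (- (2 * L) * t)) has_real_derivative exp (- (2 * L) * t) * (- (2 * L))) (at t)"
      by (auto intro!: derivative_eq_intros)
    ultimately have "(q has_real_derivative exp (- (2 * L) * t) * (- (2 * L)) * ((x t - y t) \<bullet> (x t - y t)) +
        2 * ((x t - y t) \<bullet> (X t (x t) - X t (y t))) * exp (- (2 * L) * t)) (at t)"
      unfolding q_def[abs_def] by (rule DERIV_mult[rotated])
    moreover have "exp (- (2 * L) * t) * (- (2 * L)) * ((x t - y t) \<bullet> (x t - y t)) +
        2 * ((x t - y t) \<bullet> (X t (x t) - X t (y t))) * exp (- (2 * L) * t) \<le> 0"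
    proof -
      have "(x t - y t) \<bullet> (X t (x t) - X t (y t)) \<le> norm (x t - y t) * norm (X t (x t) - X t (y t))"
        by (rule norm_cauchy_schwarz)
      also have "\<dots> \<le> norm (x t - y t) * (L * norm (x t - y t))"
        by (rule mult_left_mono[OF L]) (use t in auto)
      also have "\<dots> = L * ((x t - y t) \<bullet> (x t - y t))" by (simp add: power2_norm_eq_inner[symmetric] power2_eq_square)
      finally have "exp (- (2 * L) * t) * (2 * ((x t - y t) \<bullet> (X t (x t) - X t (y t))) - 2 * L * ((x t - y t) \<bullet> (x t - y t))) \<le> 0"
        by (intro mult_nonneg_nonpos) auto
      then show ?thesis by (simp add: algebra_simps)
    qed
    ultimately show "\<exists>z. (q has_real_derivative z) (at t) \<and> z \<le> 0" by blast
  next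
    have "continuous_on {a..b} x" "continuous_on {a..b} y"
      using x y has_vector_derivative_continuous continuous_on_eq_continuous_within by blast+
    then show "continuous_on {a..b} q" unfolding q_def by (intro continuous_intros)
  qed
  then have "exp (2 * L * b) * q b \<le> exp (2 * L * b) * q a" by simp
  moreover have "exp (2 * L * b) * q b = (norm (x b - y b))\<^sup>2"
    unfolding q_def by (simp add: mult.assoc[symmetric] exp_add[symmetric] power2_norm_eq_inner)
  moreover have "exp (2 * L * b) * q a = (exp (L * (b - a)) * norm (x a - y a))\<^sup>2"
  proof -
    have "exp (2 * L * b) * exp (- (2 * L) * a) = exp (2 * (L * (b - a)))"
      by (simp add: exp_add[symmetric] algebra_simps)
    then show ?thesis
      unfolding q_def power_mult_distrib exp_double[symmetric] power2_norm_eq_inner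
      by (simp only: mult.assoc[symmetric])
  qed
  ultimately have "(norm (x b - y b))\<^sup>2 \<le> (exp (L * (b - a)) * norm (x a - y a))\<^sup>2" by simp
  then show ?thesis by (rule power2_le_imp_le) simp
qed

subsection \<open>Change of variables\<close>

text \<open>The change of variables yields the integral of \<open>f\<close> over the image of
  \<open>K\<close>, which lies in \<open>K'\<close>; nonnegativity of \<open>f\<close> gives the
  inequality.\<close>

lemma integral_change_of_variables_le:
  fixes f :: "(real, 'k::{finite,wellorder}) vec \<Rightarrow> real"
  assumes K: "compact K" "compact K'" and g: "\<And>x. x \<in> K \<Longrightarrow> (g has_derivative g' x) (at x)" "inj_on g K" "g ` K \<subseteq> K'"
    and f: "continuous_on K' f" "\<And>x. x \<in> K' \<Longrightarrow> 0 \<le> f x"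
  shows "(\<lambda>x. \<bar>det (matrix (g' x))\<bar> * f (g x)) integrable_on K"
    "integral K (\<lambda>x. \<bar>det (matrix (g' x))\<bar> * f (g x)) \<le> integral K' f"
proof -
  have gc: "continuous_on K g"
    by (rule continuous_at_imp_continuous_on) (use g(1) has_derivative_continuous in blast)
  have cgK: "compact (g ` K)" by (rule compact_continuous_image[OF gc K(1)])
  have fi: "f absolutely_integrable_on C" if "compact C" "C \<subseteq> K'" for C
  proof -
    have "integrable lborel (\<lambda>x. indicator C x *\<^sub>R f x)"
      by (rule borel_integrable_compact[OF that(1) continuous_on_subset[OF f(1) that(2)]])
    then show ?thesis unfolding set_integrable_def by (rule integrable_completion[THEN iffD2, rotated]) (use \<open>integrable lborel _\<close> in auto)
  qed
  have S: "K \<in> sets lebesgue" using K(1) by (simp add: lmeasurable_compact fmeasurableD)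
  have der: "(g has_derivative g' x) (at x within K)" if "x \<in> K" for x
    by (rule has_derivative_at_withinI[OF g(1)[OF that]])
  \<comment> \<open>Scalar functions are wrapped into \<open>real ^ 1\<close> to instantiate the
    theorem for vector-valued functions.\<close>
  have "(\<lambda>x. \<bar>det (matrix (g' x))\<bar> *\<^sub>R (vec (f (g x)) :: real ^ 1)) absolutely_integrable_on K \<and>
      integral K (\<lambda>x. \<bar>det (matrix (g' x))\<bar> *\<^sub>R (vec (f (g x)) :: real ^ 1)) = vec (integral (g ` K) f)
    \<longleftrightarrow> (\<lambda>x. vec (f x) :: real ^ 1) absolutely_integrable_on (g ` K) \<and>
      integral (g ` K) (\<lambda>x. vec (f x) :: real ^ 1) = vec (integral (g ` K) f)"
    by (rule has_absolute_integral_change_of_variables[OF S der g(2)])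
  then have *: "(\<lambda>x. \<bar>det (matrix (g' x))\<bar> * f (g x)) absolutely_integrable_on K \<and>
      integral K (\<lambda>x. \<bar>det (matrix (g' x))\<bar> * f (g x)) = integral (g ` K) f"
    using fi[OF cgK g(3)] by (simp add: absolutely_integrable_on_1_iff integral_on_1_eq)
  then show "(\<lambda>x. \<bar>det (matrix (g' x))\<bar> * f (g x)) integrable_on K"
    using set_lebesgue_integral_eq_integral(1) by blast
  have "integral (g ` K) f \<le> integral K' f"
    by (rule integral_subset_le[OF g(3)])
      (use fi[OF cgK g(3)] fi[OF K(2) order_refl] f(2) set_lebesgue_integral_eq_integral(1) in auto)
  then show "integral K (\<lambda>x. \<bar>det (matrix (g' x))\<bar> * f (g x)) \<le> integral K' f" using * by simp
qed

section \<open>Hamiltonian flows preserve the Liouville measure\<close>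

locale hamiltonian_flow = liouville_manifold A \<omega> \<mu> n + compact_dist d
  for A :: "('m::t2_space, 'k::{finite,wellorder}) chart set" and \<omega> \<mu> n and d :: "'m \<Rightarrow> 'm \<Rightarrow> real" +
  fixes H :: "real \<Rightarrow> 'm \<Rightarrow> real" and \<phi> :: "real \<Rightarrow> 'm \<Rightarrow> 'm"
  assumes ham: "\<And>c. c \<in> A \<Longrightarrow> smooth_on ({0..1} \<times> chart_image c) (\<lambda>(t, y). H t (chart_inv c y))"
    and flow: "is_hamiltonian_flow A \<omega> H \<phi>" and flow_path: "\<phi> \<in> cpaths"
begin

sublocale compact_dist_measure d \<mu>
  by (intro compact_dist_measure.intro compact_dist_measure_axioms.intro sets_liouville finite_liouville)
    unfold_locales

definition X :: "('m, 'k) chart \<Rightarrow> real \<Rightarrow> (real, 'k) vec \<Rightarrow> (real, 'k) vec" where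
  "X c t = symplectic_domain.field (\<lambda>y. \<omega> c (chart_inv c y)) (\<lambda>y. H t (chart_inv c y))"

lemma H_Ck: "c \<in> A \<Longrightarrow> t \<in> {0..1} \<Longrightarrow> Ck_on k (\<lambda>y. H t (chart_inv c y)) (chart_image c)"
  by (rule parameter_slice[OF image_open ham])

lemma X_nth:
  assumes c: "c \<in> A" and t: "t \<in> {0..1}" and y: "y \<in> chart_image c"
  shows "X c t y $ j = (\<Sum>l\<in>UNIV. symplectic_domain.dual (\<lambda>y. \<omega> c (chart_inv c y)) y j $ l *
    frechet_derivative (\<lambda>y. H t (chart_inv c y)) (at y) (axis l 1))"
proof -
  interpret S: symplectic_domain "chart_image c" "\<lambda>y. \<omega> c (chart_inv c y)" n by (rule symplectic_chart[OF c])
  have "linear (frechet_derivative (\<lambda>y. H t (chart_inv c y)) (at y))"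
    by (rule has_derivative_linear[OF Ck_on_has_derivative[OF H_Ck[OF c t, of "Suc 0"] y]])
  from linear_axis_expansion[OF this, of "S.dual y j"] show ?thesis by (simp add: X_def S.field_def)
qed

text \<open>The inverse of the form depends on \<open>y\<close> alone and is smooth; the dependence
  on time comes in through the derivatives of \<open>H\<close>, which are jointly smooth.\<close>

lemma X_smooth:
  assumes c: "c \<in> A"
  shows "smooth_on ({0..1} \<times> chart_image c) (\<lambda>(t, y). X c t y $ j)"
proof -
  interpret S: symplectic_domain "chart_image c" "\<lambda>y. \<omega> c (chart_inv c y)" n by (rule symplectic_chart[OF c])
  have "smooth_on ({0..1} \<times> chart_image c) (\<lambda>p. \<Sum>l\<in>UNIV. (\<lambda>(t, y). S.dual y j $ l) p *
      (\<lambda>(t, y). frechet_derivative (\<lambda>y. H t (chart_inv c y)) (at y) (axis l 1)) p)"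
    by (intro smooth_on_sum smooth_on_mult smooth_on_snd S.dual_Ck image_open c
        smooth_on_parameter_derivative[where F="\<lambda>t y. H t (chart_inv c y)"] ham)
  then show ?thesis by (rule smooth_on_cong) (auto simp: X_nth[OF c])
qed

lemma continuous_vecI:
  fixes f :: "'x::topological_space \<Rightarrow> (real, 'k) vec"
  assumes "\<And>j. continuous_on S (\<lambda>x. f x $ j)"
  shows "continuous_on S f"
proof -
  have "continuous_on S (\<lambda>x. \<chi> j. f x $ j)" by (rule continuous_on_vec_lambda[OF assms])
  then show ?thesis by simp
qed

lemma X_continuous:
  assumes c: "c \<in> A"
  shows "continuous_on ({0..1} \<times> chart_image c) (\<lambda>p. X c (fst p) (snd p))"
  by (rule continuous_vecI) (use smooth_on_continuous_on[OF X_smooth[OF c]] in \<open>simp add: case_prod_unfold\<close>)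

definition DX :: "('m, 'k) chart \<Rightarrow> real \<Rightarrow> (real, 'k) vec \<Rightarrow> ((real, 'k) vec, 'k) vec" where
  "DX c t y = (\<chi> i j. frechet_derivative (\<lambda>y. X c t y $ i) (at y) (axis j 1))"

lemma DX_continuous:
  assumes c: "c \<in> A"
  shows "continuous_on ({0..1} \<times> chart_image c) (\<lambda>p. DX c (fst p) (snd p) $ i $ j)"
  using smooth_on_continuous_on[OF smooth_on_parameter_derivative[OF image_open[OF c] X_smooth[OF c]]]
  by (simp add: DX_def case_prod_unfold)

lemma X_has_derivative:
  assumes c: "c \<in> A" and t: "t \<in> {0..1}" and y: "y \<in> chart_image c"
  shows "(X c t has_derivative (\<lambda>v. DX c t y *v v)) (at y)"
proof -
  have comp: "Ck_on k (\<lambda>y. X c t y $ i) (chart_image c)" for i k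
    by (rule parameter_slice[OF image_open[OF c] X_smooth[OF c] t])
  have D: "(X c t has_derivative frechet_derivative (X c t) (at y)) (at y)"
    by (rule Ck_on_has_derivative[OF Ck_on_vec[OF image_open[OF c] comp[of "Suc 0"]] y])
  have "frechet_derivative (X c t) (at y) v = DX c t y *v v" for v
  proof (rule vec_eq_iff[THEN iffD2, rule_format])
    fix i
    have h1: "((\<lambda>y. X c t y $ i) has_derivative (\<lambda>v. frechet_derivative (X c t) (at y) v $ i)) (at y)"
      by (rule bounded_linear.has_derivative[OF bounded_linear_vec_nth D])
    have h2: "((\<lambda>y. X c t y $ i) has_derivative frechet_derivative (\<lambda>y. X c t y $ i) (at y)) (at y)"
      by (rule Ck_on_has_derivative[OF comp[of "Suc 0"] y])
    have "frechet_derivative (X c t) (at y) v $ i = frechet_derivative (\<lambda>y. X c t y $ i) (at y) v"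
      using fun_cong[OF has_derivative_unique[OF h1 h2], of v] .
    also have "\<dots> = (\<Sum>j\<in>UNIV. v $ j *\<^sub>R frechet_derivative (\<lambda>y. X c t y $ i) (at y) (axis j 1))"
      by (rule linear_axis_expansion[OF has_derivative_linear[OF h2]])
    also have "\<dots> = (DX c t y *v v) $ i"
      by (simp add: matrix_vector_mult_def DX_def mult.commute)
    finally show "frechet_derivative (X c t) (at y) v $ i = (DX c t y *v v) $ i" .
  qed
  then have "frechet_derivative (X c t) (at y) = (\<lambda>v. DX c t y *v v)" by (rule ext)
  then show ?thesis using D by simp
qed

lemma flow_0: "\<phi> 0 = id" using flow unfolding is_hamiltonian_flow_def by blast

lemma flow_Homeo: "t \<in> {0..1} \<Longrightarrow> \<phi> t \<in> Homeo" by (rule cpaths_Homeo[OF flow_path])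

lemma flow_continuous: "continuous_on {0..1} (\<lambda>t. \<phi> t x)"
  using flow unfolding is_hamiltonian_flow_def by blast

lemma hamiltonian_field_eq:
  assumes c: "c \<in> A" and t: "t \<in> {0..1}" and p: "p \<in> fst c"
  shows "hamiltonian_field \<omega> (H t) c p = X c t (snd c p)"
proof -
  interpret S: symplectic_domain "chart_image c" "\<lambda>y. \<omega> c (chart_inv c y)" n by (rule symplectic_chart[OF c])
  have y: "snd c p \<in> chart_image c" and ip: "chart_inv c (snd c p) = p" using chart_in[OF c p] inv_chart[OF c p] .
  have df: "(\<lambda>y. H t (chart_inv c y)) differentiable (at (snd c p))"
    using H_Ck[OF c t, of "Suc 0"] y by simp
  show ?thesis
    unfolding hamiltonian_field_def X_def
  proof (rule the_equality)
    show "\<forall>v. \<omega> c p (S.field (\<lambda>y. H t (chart_inv c y)) (snd c p)) v =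
        frechet_derivative (\<lambda>y. H t (chart_inv c y)) (at (snd c p)) v"
      using S.field_eq[OF y df] by (simp add: ip)
    fix u assume "\<forall>v. \<omega> c p u v = frechet_derivative (\<lambda>y. H t (chart_inv c y)) (at (snd c p)) v"
    then show "u = S.field (\<lambda>y. H t (chart_inv c y)) (snd c p)"
      by (intro S.field_unique[OF y df]) (simp add: ip)
  qed
qed

lemma flow_has_derivative:
  assumes "c \<in> A" "t \<in> {0..1}" "\<phi> t x \<in> fst c"
  shows "((\<lambda>s. snd c (\<phi> s x)) has_vector_derivative X c t (snd c (\<phi> t x))) (at t within {0..1})"
proof -
  have "((\<lambda>s. snd c (\<phi> s x)) has_vector_derivative hamiltonian_field \<omega> (H t) c (\<phi> t x)) (at t within {0..1})"
    using flow assms unfolding is_hamiltonian_flow_def by blast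
  then show ?thesis using hamiltonian_field_eq[OF assms] by simp
qed

lemma tau_continuous:
  assumes c: "c \<in> A" and S: "continuous_on S y" "continuous_on S v" "\<And>s. s \<in> S \<Longrightarrow> y s \<in> chart_image c"
  shows "continuous_on S (\<lambda>s. symplectic_domain.tau (\<lambda>y. \<omega> c (chart_inv c y)) (y s) (v s))"
proof -
  interpret S: symplectic_domain "chart_image c" "\<lambda>y. \<omega> c (chart_inv c y)" n by (rule symplectic_chart[OF c])
  have "continuous_on S (\<lambda>s. \<Sum>l\<in>UNIV. v s $ l * S.tau (y s) (axis l 1))"
  proof (intro continuous_on_sum continuous_on_mult)
    show "continuous_on S (\<lambda>s. v s $ l)" for l using S(2) by (intro continuous_intros)
    show "continuous_on S (\<lambda>s. S.tau (y s) (axis l 1))" for l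
      by (rule continuous_on_compose2[OF Ck_on_continuous_on[OF S.tau_Ck[of 0]] S(1)]) (use S(3) in auto)
  qed
  moreover have "(\<Sum>l\<in>UNIV. v s $ l * S.tau (y s) (axis l 1)) = S.tau (y s) (v s)" if "s \<in> S" for s
    using linear_axis_expansion[OF S.tau_linear[OF S(3)[OF that]], of "v s"] by simp
  ultimately show ?thesis by (rule continuous_on_eq)
qed

text \<open>The density at the Euler point times the Jacobian of the Euler step has derivative 0 at
  \<open>h = 0\<close>, since the divergence of the field cancels \<open>tau\<close>. That
  derivative is continuous on a compact parameter set, so it stays below \<open>e\<close> for all
  short steps, and the mean value theorem applies.\<close>

lemma jacobian_estimate:
  assumes c: "c \<in> A" and K: "compact K" and K': "K' \<subseteq> chart_image c" and KK': "K \<subseteq> K'" and h0: "h0 > 0"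
    and step: "\<And>h t y. 0 \<le> h \<Longrightarrow> h \<le> h0 \<Longrightarrow> t \<in> {0..1} \<Longrightarrow> y \<in> K \<Longrightarrow> y + h *\<^sub>R X c t y \<in> K'"
    and e: "e > 0"
  shows "\<exists>\<delta>>0. \<delta> \<le> h0 \<and> (\<forall>h t y. 0 \<le> h \<longrightarrow> h \<le> \<delta> \<longrightarrow> t \<in> {0..1} \<longrightarrow> y \<in> K \<longrightarrow>
      dens c y \<le> \<bar>det (mat 1 + h *\<^sub>R DX c t y)\<bar> * dens c (y + h *\<^sub>R X c t y) + e * h)"
proof -
  interpret S: symplectic_domain "chart_image c" "\<lambda>y. \<omega> c (chart_inv c y)" n by (rule symplectic_chart[OF c])
  have dr: "dens c = S.rho" by (rule dens_eq[OF c])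
  let ?C = "{0..1::real} \<times> K"
  define z where "z h q = snd q + h *\<^sub>R X c (fst q) (snd q)" for h q
  \<comment> \<open>The derivative in \<open>h\<close> of the density at \<open>z h q\<close> times
    the determinant, by the product rule. Written out, it is jointly continuous in the step and in
    the point \<open>q\<close> of time and space.\<close>
  define J' where "J' h q = S.tau (z h q) (X c (fst q) (snd q)) * S.rho (z h q) * det (mat 1 + h *\<^sub>R DX c (fst q) (snd q))
      + S.rho (z h q) * det_slope h (DX c (fst q) (snd q))" for h q
  have KV: "K \<subseteq> chart_image c" using K' KK' by blast
  have zK: "z h q \<in> chart_image c" if "h \<in> {0..h0}" "q \<in> ?C" for h q
    using step[of h "fst q" "snd q"] that K' by (auto simp: z_def)
  have Xc: "continuous_on ({0..h0} \<times> ?C) (\<lambda>p. X c (fst (snd p)) (snd (snd p)))"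
    by (rule continuous_on_compose2[OF X_continuous[OF c], of _ snd]) (use KV in \<open>auto intro!: continuous_intros\<close>)
  have zc: "continuous_on ({0..h0} \<times> ?C) (\<lambda>p. z (fst p) (snd p))"
    unfolding z_def by (intro continuous_intros Xc)
  have DXc: "continuous_on ({0..h0} \<times> ?C) (\<lambda>p. DX c (fst (snd p)) (snd (snd p)) $ i $ j)" for i j
    by (rule continuous_on_compose2[OF DX_continuous[OF c], of _ snd]) (use KV in \<open>auto intro!: continuous_intros\<close>)
  have rc: "continuous_on ({0..h0} \<times> ?C) (\<lambda>p. S.rho (z (fst p) (snd p)))"
    by (rule continuous_on_compose2[OF S.rho_continuous zc]) (use zK in auto)
  have tc: "continuous_on ({0..h0} \<times> ?C) (\<lambda>p. S.tau (z (fst p) (snd p)) (X c (fst (snd p)) (snd (snd p))))"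
    by (rule tau_continuous[OF c zc Xc]) (use zK in auto)
  have "continuous_on ({0..h0} \<times> ?C) (\<lambda>p. J' (fst p) (snd p))"
    unfolding J'_def
    by (intro continuous_on_add continuous_on_mult tc rc continuous_on_det_slope continuous_on_det_perturbation DXc continuous_on_fst continuous_on_id)
  then have J'c: "continuous_on ({0..h0} \<times> ?C) (\<lambda>(h, q). J' h q)" by (simp add: case_prod_unfold)
  have J0: "J' 0 q = 0" if q: "q \<in> ?C" for q
  proof -
    have t: "fst q \<in> {0..1}" and y: "snd q \<in> chart_image c" using q KV by auto
    have "det_slope 0 (DX c (fst q) (snd q)) = - S.tau (snd q) (X c (fst q) (snd q))"
      using S.field_divergence[OF H_Ck[OF c t, of 2] y] by (simp add: det_slope_0 DX_def X_def)
    then show ?thesis by (simp add: J'_def z_def)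
  qed
  have "compact ?C" by (rule compact_Times[OF compact_Icc K])
  have "0 \<in> {0..h0}" using h0 by simp
  from continuous_on_prod_compactE[OF J'c \<open>compact ?C\<close> this e]
  obtain U where U: "0 \<in> U" "open U" and Ub: "\<forall>h\<in>U \<inter> {0..h0}. \<forall>q\<in>?C. dist (case (h, q) of (h, q) \<Rightarrow> J' h q) (case (0, q) of (h, q) \<Rightarrow> J' h q) \<le> e"
    by blast
  obtain \<delta>0 where \<delta>0: "\<delta>0 > 0" "ball 0 \<delta>0 \<subseteq> U" using U openE by blast
  define \<delta> where "\<delta> = min h0 (\<delta>0 / 2)"
  have J'b: "\<bar>J' h q\<bar> \<le> e" if "0 \<le> h" "h \<le> \<delta>" "q \<in> ?C" for h q
  proof -
    have "h \<in> U" using \<delta>0 that by (auto simp: \<delta>_def dist_real_def)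
    then have "dist (J' h q) (J' 0 q) \<le> e" using Ub that by (auto simp: \<delta>_def)
    then show ?thesis by (simp add: J0[OF that(3)] dist_real_def)
  qed
  show ?thesis
  proof (intro exI[of _ \<delta>] conjI allI impI)
    show "\<delta> > 0" "\<delta> \<le> h0" using h0 \<delta>0 by (auto simp: \<delta>_def)
    fix h t :: real and y assume h: "0 \<le> h" "h \<le> \<delta>" and t: "t \<in> {0..1}" and y: "y \<in> K"
    have q: "(t, y) \<in> ?C" using t y by simp
    define J where "J h = S.rho (y + h *\<^sub>R X c t y) * det (mat 1 + h *\<^sub>R DX c t y)" for h
    have dJ: "(J has_real_derivative J' x (t, y)) (at x)" if x: "0 \<le> x" "x \<le> \<delta>" for x
    proof -
      have zV: "y + x *\<^sub>R X c t y \<in> chart_image c" using zK[of x "(t, y)"] x q by (auto simp: z_def \<delta>_def)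
      have "((\<lambda>h. y + h *\<^sub>R X c t y) has_vector_derivative X c t y) (at x)" by (auto intro!: derivative_eq_intros)
      from diff_chain_at[OF this[unfolded has_vector_derivative_def] S.rho_has_derivative[OF zV]]
      have "((\<lambda>h. S.rho (y + h *\<^sub>R X c t y)) has_derivative (\<lambda>k. S.tau (y + x *\<^sub>R X c t y) (k *\<^sub>R X c t y) * S.rho (y + x *\<^sub>R X c t y))) (at x)"
        by (simp add: o_def)
      then have "((\<lambda>h. S.rho (y + h *\<^sub>R X c t y)) has_real_derivative S.tau (y + x *\<^sub>R X c t y) (X c t y) * S.rho (y + x *\<^sub>R X c t y)) (at x)"
        unfolding has_field_derivative_def
        by (rule has_derivative_eq_rhs) (simp add: linear_cmul[OF S.tau_linear[OF zV]] fun_eq_iff)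
      from DERIV_mult[OF this det_has_slope[of "DX c t y" x]]
      show ?thesis unfolding J_def[abs_def] by (rule DERIV_cong) (simp add: J'_def z_def algebra_simps)
    qed
    have "\<bar>J h - J 0\<bar> \<le> e * h"
    proof (cases "h = 0")
      case False
      then have "0 < h" using h by simp
      have "\<exists>\<xi>>0. \<xi> < h \<and> J h - J 0 = (h - 0) * J' \<xi> (t, y)"
        by (rule MVT2[OF \<open>0 < h\<close>]) (use dJ h in auto)
      then obtain \<xi> where \<xi>: "0 < \<xi>" "\<xi> < h" "J h - J 0 = h * J' \<xi> (t, y)" by auto
      have "\<bar>J h - J 0\<bar> = h * \<bar>J' \<xi> (t, y)\<bar>" using \<xi>(3) h(1) by (simp add: abs_mult)
      also have "\<dots> \<le> h * e" by (rule mult_left_mono[OF J'b[OF _ _ q]]) (use \<xi> h in auto)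
      finally show ?thesis by (simp add: mult.commute)
    qed simp
    moreover have "J 0 = S.rho y" by (simp add: J_def)
    moreover have "J h \<le> \<bar>det (mat 1 + h *\<^sub>R DX c t y)\<bar> * S.rho (y + h *\<^sub>R X c t y)"
      unfolding J_def by (subst mult.commute) (intro mult_right_mono S.rho_nonneg abs_ge_self)
    ultimately show "dens c y \<le> \<bar>det (mat 1 + h *\<^sub>R DX c t y)\<bar> * dens c (y + h *\<^sub>R X c t y) + e * h"
      unfolding dr by linarith
  qed
qed

section \<open>Bounds for the field and control of orbits over short times\<close>

lemma field_bounds:
  assumes c: "c \<in> A" and K: "compact K" "convex K" "K \<subseteq> chart_image c"
  obtains B L where "B \<ge> 0" "L \<ge> 0" "\<And>t y. t \<in> {0..1} \<Longrightarrow> y \<in> K \<Longrightarrow> norm (X c t y) \<le> B"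
    "\<And>t y y'. t \<in> {0..1} \<Longrightarrow> y \<in> K \<Longrightarrow> y' \<in> K \<Longrightarrow> norm (X c t y - X c t y') \<le> L * norm (y - y')"
proof -
  have cK: "compact ({0..1::real} \<times> K)" by (intro compact_Times compact_Icc K)
  have sub: "{0..1} \<times> K \<subseteq> {0..1} \<times> chart_image c" using K(3) by auto
  have "bounded ((\<lambda>p. X c (fst p) (snd p)) ` ({0..1} \<times> K))"
    by (rule compact_imp_bounded[OF compact_continuous_image[OF continuous_on_subset[OF X_continuous[OF c] sub] cK]])
  then obtain B where "\<forall>u\<in>(\<lambda>p. X c (fst p) (snd p)) ` ({0..1} \<times> K). norm u \<le> B"
    unfolding bounded_iff by (elim exE)
  then have B: "norm (X c (fst p) (snd p)) \<le> B" if "p \<in> {0..1} \<times> K" for p by (rule bspec[OF _ imageI[OF that]])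
  have "\<exists>C. \<forall>p\<in>{0..1} \<times> K. norm (DX c (fst p) (snd p) *v b) \<le> C" for b
  proof -
    have "continuous_on ({0..1} \<times> K) (\<lambda>p. DX c (fst p) (snd p) *v b)"
    proof (rule continuous_vecI)
      fix i
      have "continuous_on ({0..1} \<times> K) (\<lambda>p. \<Sum>j\<in>UNIV. DX c (fst p) (snd p) $ i $ j * b $ j)"
        by (intro continuous_on_sum continuous_on_mult continuous_on_subset[OF DX_continuous[OF c] sub] continuous_on_const)
      then show "continuous_on ({0..1} \<times> K) (\<lambda>p. (DX c (fst p) (snd p) *v b) $ i)" by (simp add: matrix_vector_mult_def)
    qed
    from compact_imp_bounded[OF compact_continuous_image[OF this cK]] show ?thesis by (auto simp: bounded_iff)
  qed
  then obtain C where C: "\<And>b p. p \<in> {0..1} \<times> K \<Longrightarrow> norm (DX c (fst p) (snd p) *v b) \<le> C b" by metis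
  define C' where "C' = (\<Sum>b\<in>(Basis :: (real, 'k) vec set). \<bar>C b\<bar>)"
  have C': "norm (DX c t y *v b) \<le> C'" if "t \<in> {0..1}" "y \<in> K" "b \<in> Basis" for t :: real and y b
  proof -
    have "norm (DX c t y *v b) \<le> C b" using C[of "(t, y)" b] that by simp
    also have "\<dots> \<le> \<bar>C b\<bar>" by simp
    also have "\<dots> \<le> C'" unfolding C'_def using that by (intro member_le_sum) auto
    finally show ?thesis .
  qed
  have C'0: "C' \<ge> 0" unfolding C'_def by (simp add: sum_nonneg)
  show ?thesis
  proof (rule that[of "\<bar>B\<bar>" "DIM((real, 'k) vec) * C'"])
    show "norm (X c t y) \<le> \<bar>B\<bar>" if "t \<in> {0..1}" "y \<in> K" for t :: real and y using B[of "(t, y)"] that by auto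
    fix t :: real and y y' assume t: "t \<in> {0..1}" and y: "y \<in> K" "y' \<in> K"
    show "norm (X c t y - X c t y') \<le> DIM((real, 'k) vec) * C' * norm (y - y')"
    proof (rule differentiable_bound[OF K(2) _ _ y])
      fix z assume z: "z \<in> K"
      show "(X c t has_derivative (\<lambda>v. DX c t z *v v)) (at z within K)"
        by (rule has_derivative_at_withinI[OF X_has_derivative[OF c t]]) (use z K(3) in auto)
      show "onorm (\<lambda>v. DX c t z *v v) \<le> DIM((real, 'k) vec) * C'"
        by (rule onorm_le, rule frechet_derivative_basis_bound[OF matrix_vector_mul_linear C'[OF t z]])
    qed
  qed (use C'0 in auto)
qed

end

text \<open>The velocity bound holds only while the curve is in the chart ball, so it cannot be
  integrated outright. At a first exit time the bound valid up to that time gives a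
  contradiction.\<close>

lemma (in closed_manifold) curve_stays_in_ball:
  assumes c: "c \<in> A" and R: "cball a R \<subseteq> chart_image c" and b: "0 \<le> \<beta>"
    and z: "continuous_on {0..\<beta>} z"
    and der: "\<And>t. t \<in> {0..\<beta>} \<Longrightarrow> z t \<in> fst c \<Longrightarrow> snd c (z t) \<in> cball a R \<Longrightarrow>
      \<exists>v. ((\<lambda>s. snd c (z s)) has_vector_derivative v) (at t within {0..\<beta>}) \<and> norm v \<le> B"
    and B: "B \<ge> 0" and z0: "z 0 \<in> fst c" "norm (snd c (z 0) - a) + B * \<beta> < R"
  shows "z \<beta> \<in> fst c \<and> norm (snd c (z \<beta>) - snd c (z 0)) \<le> B * \<beta>"
proof -
  define Ob where "Ob = {p \<in> fst c. snd c p \<in> ball a R}"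
  have Ob: "open Ob" unfolding Ob_def by (rule open_chart_vimage[OF c open_ball])
  have bound: "norm (snd c (z t) - snd c (z 0)) \<le> B * t" if t: "t \<in> {0..\<beta>}" and st: "\<And>s. s \<in> {0..t} \<Longrightarrow> z s \<in> Ob" for t
  proof -
    have "norm (snd c (z t) - snd c (z 0)) \<le> B * (t - 0)"
    proof (rule curve_speed_bound)
      fix s assume s: "s \<in> {0..t}"
      have "z s \<in> fst c" "snd c (z s) \<in> cball a R" using st[OF s] by (auto simp: Ob_def)
      then obtain v where v: "((\<lambda>s. snd c (z s)) has_vector_derivative v) (at s within {0..\<beta>})" "norm v \<le> B"
        using der[of s] s t by auto
      have "((\<lambda>s. snd c (z s)) has_vector_derivative v) (at s within {0..t})"
        by (rule has_vector_derivative_within_subset[OF v(1)]) (use t in auto)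
      then show "\<exists>v. ((\<lambda>s. snd c (z s)) has_vector_derivative v) (at s within {0..t}) \<and> norm v \<le> B" using v(2) by blast
    qed (use t in auto)
    then show ?thesis by simp
  qed
  have all: "z t \<in> Ob" if "t \<in> {0..\<beta>}" for t
  proof (rule ccontr)
    assume bad: "z t \<notin> Ob"
    define T where "T = {t \<in> {0..\<beta>}. z t \<in> - Ob}"
    have Tc: "closed T"
      using continuous_closed_preimage[OF z closed_atLeastAtMost closed_Compl[OF Ob]]
      unfolding T_def by (simp add: vimage_def Int_def)
    have Tne: "T \<noteq> {}" using bad that by (auto simp: T_def)
    have Tb: "bdd_below T" unfolding T_def by (auto simp: bdd_below_def intro: exI[of _ 0])
    define t1 where "t1 = Inf T"
    have t1T: "t1 \<in> T" unfolding t1_def by (rule closed_contains_Inf[OF Tne Tb Tc])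
    have before: "z s \<in> Ob" if "s \<in> {0..<t1}" for s
    proof (rule ccontr)
      assume "z s \<notin> Ob"
      then have "s \<in> T" using that t1T by (auto simp: T_def)
      then have "t1 \<le> s" unfolding t1_def using Tb by (intro cInf_lower)
      then show False using that by simp
    qed
    have "0 \<le> B * \<beta>" using B b by simp
    then have "z 0 \<in> Ob" using z0 by (auto simp: Ob_def dist_norm norm_minus_commute)
    then have "t1 \<noteq> 0" using t1T by (auto simp: T_def)
    then have t1: "0 < t1" "t1 \<le> \<beta>" using t1T by (auto simp: T_def)
    \<comment> \<open>Before the exit the curve lies in the closed ball of radius
      \<open>r' < R\<close>. Its preimage in the manifold is compact, hence closed, so the point at
      time \<open>t1\<close> lies there as well and is not outside the open ball.\<close>
    define r' where "r' = norm (snd c (z 0) - a) + B * \<beta>"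
    define K where "K = {p \<in> fst c. snd c p \<in> cball a r'}"
    have sub: "cball a r' \<subseteq> chart_image c" using R z0(2) by (auto simp: r'_def)
    have K: "closed K"
      using compact_imp_closed[OF compact_chart_inv_image[OF c compact_cball sub]] chart_inv_image[OF c sub]
      unfolding K_def by simp
    have inK: "z s \<in> K" if s: "s \<in> {0..<t1}" for s
    proof -
      have "norm (snd c (z s) - snd c (z 0)) \<le> B * s" by (rule bound) (use s t1 before in auto)
      also have "\<dots> \<le> B * \<beta>" by (rule mult_left_mono) (use s t1 B in auto)
      finally have "norm (snd c (z s) - a) \<le> r'"
        using norm_triangle_ineq[of "snd c (z s) - snd c (z 0)" "snd c (z 0) - a"] unfolding r'_def by simp
      then show ?thesis using before[OF s] by (auto simp: K_def Ob_def dist_norm norm_minus_commute)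
    qed
    have cl: "closure {0..<t1} = {0..t1}" using t1 by simp
    have "z ` closure {0..<t1} \<subseteq> K"
      by (rule image_closure_subset[OF continuous_on_subset[OF z] K]) (use t1 inK cl in auto)
    then have "z t1 \<in> K" using t1 unfolding cl by auto
    then have "z t1 \<in> Ob" using z0(2) by (auto simp: K_def Ob_def r'_def)
    then show False using t1T by (simp add: T_def)
  qed
  have "z \<beta> \<in> fst c" using all[of \<beta>] b by (simp add: Ob_def)
  moreover have "norm (snd c (z \<beta>) - snd c (z 0)) \<le> B * \<beta>" by (rule bound) (use all b in auto)
  ultimately show ?thesis by blast
qed

lemma integral_compact_lborel:
  fixes f :: "'a::euclidean_space \<Rightarrow> real"
  assumes "compact K" "continuous_on K f"
  shows "f integrable_on K" "(LINT y:K|lborel. f y) = integral K f"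
proof -
  have "set_integrable lborel K f"
    unfolding set_integrable_def using borel_integrable_compact[OF assms] .
  from set_borel_integral_eq_integral[OF this] show "f integrable_on K" "(LINT y:K|lborel. f y) = integral K f" by auto
qed

context hamiltonian_flow
begin

lemma flow_stays:
  assumes c: "c \<in> A" and R: "cball a R \<subseteq> chart_image c"
    and B: "B \<ge> 0" "\<And>t y. t \<in> {0..1} \<Longrightarrow> y \<in> cball a R \<Longrightarrow> norm (X c t y) \<le> B"
    and st: "s \<in> {0..1}" "t \<in> {0..1}" and x: "\<phi> s x \<in> fst c" "norm (snd c (\<phi> s x) - a) + B * \<bar>t - s\<bar> < R"
  shows "\<phi> t x \<in> fst c \<and> norm (snd c (\<phi> t x) - snd c (\<phi> s x)) \<le> B * \<bar>t - s\<bar>"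
proof -
  define \<beta> where "\<beta> = \<bar>t - s\<bar>"
  \<comment> \<open>The sign covers both directions of time: the curve
    \<open>\<lambda>u. \<phi> (s + \<sigma> * u) x\<close> starts at \<open>u = 0\<close> in either
    case.\<close>
  define \<sigma> :: real where "\<sigma> = (if s \<le> t then 1 else - 1)"
  have \<beta>: "0 \<le> \<beta>" "s + \<sigma> * \<beta> = t" by (auto simp: \<beta>_def \<sigma>_def)
  have \<sigma>: "norm \<sigma> = 1" by (simp add: \<sigma>_def)
  have rng: "s + \<sigma> * u \<in> {0..1}" if "u \<in> {0..\<beta>}" for u
    using that st by (auto simp: \<beta>_def \<sigma>_def split: if_splits)
  have z: "continuous_on {0..\<beta>} (\<lambda>u. \<phi> (s + \<sigma> * u) x)"
    by (rule continuous_on_compose2[OF flow_continuous[of x]]) (use rng in \<open>auto intro!: continuous_intros\<close>)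
  have "(\<lambda>u. \<phi> (s + \<sigma> * u) x) \<beta> \<in> fst c \<and> norm (snd c ((\<lambda>u. \<phi> (s + \<sigma> * u) x) \<beta>) - snd c ((\<lambda>u. \<phi> (s + \<sigma> * u) x) 0)) \<le> B * \<beta>"
  proof (rule curve_stays_in_ball[OF c R \<beta>(1) z _ B(1)])
    fix u assume u: "u \<in> {0..\<beta>}" "\<phi> (s + \<sigma> * u) x \<in> fst c" "snd c (\<phi> (s + \<sigma> * u) x) \<in> cball a R"
    have d1: "((\<lambda>u. s + \<sigma> * u) has_vector_derivative \<sigma>) (at u within {0..\<beta>})"
      by (auto intro!: derivative_eq_intros simp: has_vector_derivative_def)
    have "((\<lambda>t. snd c (\<phi> t x)) has_vector_derivative X c (s + \<sigma> * u) (snd c (\<phi> (s + \<sigma> * u) x)))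
        (at (s + \<sigma> * u) within (\<lambda>u. s + \<sigma> * u) ` {0..\<beta>})"
      by (rule has_vector_derivative_within_subset[OF flow_has_derivative[OF c rng[OF u(1)] u(2)]]) (use rng in auto)
    from vector_diff_chain_within[OF d1 this]
    have "((\<lambda>u. snd c (\<phi> (s + \<sigma> * u) x)) has_vector_derivative \<sigma> *\<^sub>R X c (s + \<sigma> * u) (snd c (\<phi> (s + \<sigma> * u) x)))
        (at u within {0..\<beta>})" by (simp add: o_def)
    moreover have "norm (\<sigma> *\<^sub>R X c (s + \<sigma> * u) (snd c (\<phi> (s + \<sigma> * u) x))) \<le> B"
      using B(2)[OF rng[OF u(1)] u(3)] \<sigma> by simp
    ultimately show "\<exists>v. ((\<lambda>u. snd c (\<phi> (s + \<sigma> * u) x)) has_vector_derivative v) (at u within {0..\<beta>}) \<and> norm v \<le> B" by blast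
  qed (use x in \<open>simp_all add: \<beta>_def\<close>)
  then show ?thesis using \<beta>(2) by (simp add: \<beta>_def)
qed

lemma flow_chart_lipschitz:
  assumes c: "c \<in> A" and R: "cball a R \<subseteq> chart_image c"
    and L: "\<And>t y y'. t \<in> {0..1} \<Longrightarrow> y \<in> cball a R \<Longrightarrow> y' \<in> cball a R \<Longrightarrow> norm (X c t y - X c t y') \<le> L * norm (y - y')"
    and st: "0 \<le> s" "s \<le> t" "t \<le> 1"
    and x: "\<And>u. u \<in> {s..t} \<Longrightarrow> \<phi> u x \<in> fst c \<and> snd c (\<phi> u x) \<in> cball a R"
    and x': "\<And>u. u \<in> {s..t} \<Longrightarrow> \<phi> u x' \<in> fst c \<and> snd c (\<phi> u x') \<in> cball a R"
  shows "norm (snd c (\<phi> t x) - snd c (\<phi> t x')) \<le> exp (L * (t - s)) * norm (snd c (\<phi> s x) - snd c (\<phi> s x'))"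
proof (rule flow_lipschitz[OF st(2), where X="X c"])
  have d: "((\<lambda>u. snd c (\<phi> u y)) has_vector_derivative X c u (snd c (\<phi> u y))) (at u within {s..t})"
    if "u \<in> {s..t}" "\<phi> u y \<in> fst c" for u y
    by (rule has_vector_derivative_within_subset[OF flow_has_derivative[OF c]]) (use that st in auto)
  fix u assume u: "u \<in> {s..t}"
  show "((\<lambda>u. snd c (\<phi> u x)) has_vector_derivative X c u (snd c (\<phi> u x))) (at u within {s..t})"
    using d[OF u] x[OF u] by simp
  show "((\<lambda>u. snd c (\<phi> u x')) has_vector_derivative X c u (snd c (\<phi> u x'))) (at u within {s..t})"
    using d[OF u] x'[OF u] by simp
  show "norm (X c u (snd c (\<phi> u x)) - X c u (snd c (\<phi> u x'))) \<le> L * norm (snd c (\<phi> u x) - snd c (\<phi> u x'))"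
    by (rule L) (use u st x[OF u] x'[OF u] in auto)
qed

text \<open>The difference between orbit and Euler step moves with velocity
  \<open>X c (s + u) - X c s\<close> taken along the orbit and at its start. Uniform continuity of
  the field makes this at most \<open>e\<close>, with one \<delta> for all points and times.\<close>

lemma euler_step:
  assumes c: "c \<in> A" and R: "cball a R \<subseteq> chart_image c" "r < R"
    and B: "B \<ge> 0" "\<And>t y. t \<in> {0..1} \<Longrightarrow> y \<in> cball a R \<Longrightarrow> norm (X c t y) \<le> B" and e: "e > 0"
  shows "\<exists>\<delta>>0. \<forall>h s x. 0 \<le> h \<longrightarrow> h \<le> \<delta> \<longrightarrow> 0 \<le> s \<longrightarrow> s + h \<le> 1 \<longrightarrow> \<phi> s x \<in> fst c \<longrightarrow> snd c (\<phi> s x) \<in> cball a r \<longrightarrow>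
      norm (snd c (\<phi> (s + h) x) - (snd c (\<phi> s x) + h *\<^sub>R X c s (snd c (\<phi> s x)))) \<le> e * h"
proof -
  let ?X = "\<lambda>p. X c (fst p) (snd p)"
  have "continuous_on ({0..1} \<times> cball a R) ?X"
    by (rule continuous_on_subset[OF X_continuous[OF c]]) (use R(1) in auto)
  from compact_uniformly_continuous[OF this compact_Times[OF compact_Icc compact_cball]]
  obtain \<eta> where \<eta>: "\<eta> > 0" "\<And>p p'. p \<in> {0..1} \<times> cball a R \<Longrightarrow> p' \<in> {0..1} \<times> cball a R \<Longrightarrow> dist p' p < \<eta> \<Longrightarrow> dist (?X p') (?X p) < e"
    unfolding uniformly_continuous_on_def using e by metis
  define m where "m = min \<eta> (R - r)"
  have m: "0 < m" "m \<le> \<eta>" "m \<le> R - r" using \<eta> R(2) by (auto simp: m_def)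
  \<comment> \<open>For \<open>u\<close> up to \<delta> one has
    \<open>u + B * u \<le> m / 2\<close>: the displacement in time and space stays below \<eta>, and
    the orbit stays in the ball of radius \<open>R\<close>.\<close>
  define \<delta> where "\<delta> = m / (2 * (B + 1))"
  have \<delta>: "\<delta> > 0" "(B + 1) * \<delta> = m / 2" using m B(1) by (auto simp: \<delta>_def field_simps)
  show ?thesis
  proof (intro exI[of _ \<delta>] conjI \<delta>(1) allI impI)
    fix h s x assume h: "0 \<le> h" "h \<le> \<delta>" and s: "0 \<le> s" "s + h \<le> 1" and x: "\<phi> s x \<in> fst c" "snd c (\<phi> s x) \<in> cball a r"
    let ?y = "snd c (\<phi> s x)"
    have ya: "norm (?y - a) \<le> r" using x(2) by (simp add: dist_norm norm_minus_commute)
    have small: "u + B * u \<le> m / 2" if "u \<in> {0..h}" for u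
    proof -
      have "(B + 1) * u \<le> (B + 1) * \<delta>" by (rule mult_left_mono) (use that h B in auto)
      then show ?thesis using \<delta>(2) by (simp add: algebra_simps)
    qed
    have st: "\<phi> (s + u) x \<in> fst c \<and> norm (snd c (\<phi> (s + u) x) - ?y) \<le> B * u" if u: "u \<in> {0..h}" for u
    proof -
      have "\<phi> (s + u) x \<in> fst c \<and> norm (snd c (\<phi> (s + u) x) - ?y) \<le> B * \<bar>s + u - s\<bar>"
        by (rule flow_stays[OF c R(1) B]) (use s u h small[OF u] m ya x in auto)
      then show ?thesis using u by simp
    qed
    have inR: "snd c (\<phi> (s + u) x) \<in> cball a R" if u: "u \<in> {0..h}" for u
    proof -
      have "norm (snd c (\<phi> (s + u) x) - a) \<le> norm (snd c (\<phi> (s + u) x) - ?y) + norm (?y - a)"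
        using norm_triangle_ineq[of "snd c (\<phi> (s + u) x) - ?y" "?y - a"] by simp
      then have "norm (snd c (\<phi> (s + u) x) - a) \<le> R" using st[OF u] small[OF u] m ya u by auto
      then show ?thesis by (simp add: dist_norm norm_minus_commute)
    qed
    define w where "w u = snd c (\<phi> (s + u) x) - u *\<^sub>R X c s ?y" for u
    have "norm (w h - w 0) \<le> e * (h - 0)"
    proof (rule curve_speed_bound[OF h(1)])
      fix u assume u: "u \<in> {0..h}"
      have su: "s + u \<in> {0..1}" using u s h by auto
      have d1: "((\<lambda>u. s + u) has_vector_derivative 1) (at u within {0..h})"
        by (auto intro!: derivative_eq_intros)
      have "((\<lambda>t. snd c (\<phi> t x)) has_vector_derivative X c (s + u) (snd c (\<phi> (s + u) x))) (at (s + u) within (\<lambda>u. s + u) ` {0..h})"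
        by (rule has_vector_derivative_within_subset[OF flow_has_derivative[OF c su]]) (use st[OF u] s in auto)
      from vector_diff_chain_within[OF d1 this]
      have d2: "((\<lambda>u. snd c (\<phi> (s + u) x)) has_vector_derivative X c (s + u) (snd c (\<phi> (s + u) x))) (at u within {0..h})"
        by (simp add: o_def)
      have "(w has_vector_derivative X c (s + u) (snd c (\<phi> (s + u) x)) - X c s ?y) (at u within {0..h})"
        unfolding w_def[abs_def] by (rule has_vector_derivative_diff[OF d2]) (auto intro!: derivative_eq_intros)
      moreover have "norm (X c (s + u) (snd c (\<phi> (s + u) x)) - X c s ?y) \<le> e"
      proof -
        have "dist (s + u, snd c (\<phi> (s + u) x)) (s, ?y) \<le> dist (s + u, snd c (\<phi> (s + u) x)) (s, snd c (\<phi> (s + u) x)) + dist (s, snd c (\<phi> (s + u) x)) (s, ?y)"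
          by (rule dist_triangle)
        also have "\<dots> = u + norm (snd c (\<phi> (s + u) x) - ?y)" using u by (simp add: dist_Pair_Pair dist_norm)
        also have "\<dots> \<le> u + B * u" using st[OF u] by simp
        also have "\<dots> < \<eta>" using small[OF u] m by simp
        finally have "dist (?X (s + u, snd c (\<phi> (s + u) x))) (?X (s, ?y)) < e"
          using inR[OF u] inR[of 0] su s h by (intro \<eta>(2)) auto
        then show ?thesis by (simp add: dist_norm)
      qed
      ultimately show "\<exists>v. (w has_vector_derivative v) (at u within {0..h}) \<and> norm v \<le> e" by blast
    qed
    then show "norm (snd c (\<phi> (s + h) x) - (?y + h *\<^sub>R X c s ?y)) \<le> e * h"
      by (simp add: w_def algebra_simps)
  qed
qed

text \<open>The evolution from time \<open>s\<close> to time \<open>t\<close>. Invariance of \<mu>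
  is proved for short evolutions and passes to \<open>\<phi> t\<close> by composition.\<close>

abbreviation \<Phi> :: "real \<Rightarrow> real \<Rightarrow> 'm \<Rightarrow> 'm" where
  "\<Phi> t s \<equiv> \<phi> t \<circ> inv_into UNIV (\<phi> s)"

lemma \<Phi>_Homeo: "s \<in> {0..1} \<Longrightarrow> t \<in> {0..1} \<Longrightarrow> \<Phi> t s \<in> Homeo"
  by (intro comp_Homeo(1) inv_Homeo flow_Homeo)

lemma \<Phi>_flow: "s \<in> {0..1} \<Longrightarrow> \<Phi> t s (\<phi> s x) = \<phi> t x"
  by (simp add: HomeoD(4)[OF flow_Homeo])

end

text \<open>Only continuity of \<open>\<phi> t x\<close> in \<open>x\<close> is known, so the Jacobian of the flow is not available. Instead, over a short
  time \<open>h\<close> the flow is replaced by the Euler step \<open>y + h X(y)\<close>, whose Jacobian is explicit; the error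
  is \<open>o(h)\<close> because the test function transported by the flow stays Lipschitz (Gronwall).\<close>

locale flow_box = hamiltonian_flow A \<omega> \<mu> n d H \<phi>
  for A :: "('m::t2_space, 'k::{finite,wellorder}) chart set" and \<omega> \<mu> n d H \<phi> +
  fixes c a r B L v \<Lambda> and s t :: real
  assumes c: "c \<in> A" and r: "r > 0" "cball a (6 * r) \<subseteq> chart_image c"
    and B: "B \<ge> 0" "\<And>t y. t \<in> {0..1} \<Longrightarrow> y \<in> cball a (6 * r) \<Longrightarrow> norm (X c t y) \<le> B"
    and L: "L \<ge> 0" "\<And>t y y'. t \<in> {0..1} \<Longrightarrow> y \<in> cball a (6 * r) \<Longrightarrow> y' \<in> cball a (6 * r) \<Longrightarrow>
        norm (X c t y - X c t y') \<le> L * norm (y - y')"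
    and v: "continuous_on UNIV v" "\<And>p. 0 \<le> v p" "\<And>p. v p \<noteq> 0 \<Longrightarrow> p \<in> chart_inv c ` cball a r"
    and \<Lambda>: "\<Lambda> \<ge> 0" "\<And>y y'. y \<in> cball a (6 * r) \<Longrightarrow> y' \<in> cball a (6 * r) \<Longrightarrow>
        \<bar>v (chart_inv c y) - v (chart_inv c y')\<bar> \<le> \<Lambda> * norm (y - y')"
    and st: "0 \<le> s" "s \<le> t" "t \<le> 1" "B * (t - s) < r"
begin

lemma ball_sub: "\<rho> \<le> 6 * r \<Longrightarrow> cball a \<rho> \<subseteq> chart_image c"
  using r(2) subset_cball[of \<rho> "6 * r" a] by blast

lemma r_sub: "cball a r \<subseteq> chart_image c" by (rule ball_sub) (use r(1) in simp)

lemma t01: "t \<in> {0..1}" using st by auto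

lemma time_bound: "\<sigma> \<in> {s..t} \<Longrightarrow> u \<in> {s..t} \<Longrightarrow> B * \<bar>u - \<sigma>\<bar> < r"
proof -
  assume "\<sigma> \<in> {s..t}" "u \<in> {s..t}"
  then have "B * \<bar>u - \<sigma>\<bar> \<le> B * (t - s)" by (intro mult_left_mono B(1)) auto
  then show ?thesis using st(4) by simp
qed

text \<open>An orbit moves by less than \<open>r\<close> between two times of the interval. This
  fixes the radii: \<open>v\<close> lives in radius \<open>r\<close>, its transports in
  \<open>2 * r\<close>, integration is over \<open>3 * r\<close>, Euler points lie in
  \<open>4 * r\<close>, and orbits from there remain in \<open>6 * r\<close>, where the bounds
  hold.\<close>

lemma stays:
  assumes "\<sigma> \<in> {s..t}" "u \<in> {s..t}" "\<phi> \<sigma> x \<in> fst c" "snd c (\<phi> \<sigma> x) \<in> cball a \<rho>" "\<rho> + r \<le> 6 * r"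
  shows "\<phi> u x \<in> fst c" "snd c (\<phi> u x) \<in> cball a (\<rho> + r)"
proof -
  have n: "norm (snd c (\<phi> \<sigma> x) - a) \<le> \<rho>" using assms(4) by (simp add: dist_norm norm_minus_commute)
  have tb: "B * \<bar>u - \<sigma>\<bar> < r" by (rule time_bound[OF assms(1,2)])
  have *: "\<phi> u x \<in> fst c \<and> norm (snd c (\<phi> u x) - snd c (\<phi> \<sigma> x)) \<le> B * \<bar>u - \<sigma>\<bar>"
    by (rule flow_stays[OF c r(2) B]) (use assms st n tb in auto)
  show "\<phi> u x \<in> fst c" using * by blast
  have "norm (snd c (\<phi> u x) - a) \<le> norm (snd c (\<phi> u x) - snd c (\<phi> \<sigma> x)) + norm (snd c (\<phi> \<sigma> x) - a)"
    using norm_triangle_ineq[of "snd c (\<phi> u x) - snd c (\<phi> \<sigma> x)" "snd c (\<phi> \<sigma> x) - a"] by simp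
  then show "snd c (\<phi> u x) \<in> cball a (\<rho> + r)" using * n tb by (simp add: dist_norm norm_minus_commute)
qed

text \<open>The test function pulled back by the evolution from \<sigma> to \<open>t\<close>.
  \<open>U t\<close> is \<open>v\<close> and \<open>U s\<close> is its transport over the whole
  interval, so the claim compares the integrals at the two ends.\<close>

definition U :: "real \<Rightarrow> 'm \<Rightarrow> real" where "U \<sigma> x = v (\<Phi> t \<sigma> x)"

lemma unit: "\<sigma> \<in> {s..t} \<Longrightarrow> \<sigma> \<in> {0..1}" using st by auto

lemma U_continuous: "\<sigma> \<in> {s..t} \<Longrightarrow> continuous_on UNIV (U \<sigma>)"
  unfolding U_def[abs_def]
  by (rule continuous_on_compose2[OF v(1) HomeoD(1)[OF \<Phi>_Homeo[OF unit t01]]]) auto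

lemma U_flow: "\<sigma> \<in> {s..t} \<Longrightarrow> U \<sigma> (\<phi> \<sigma> x) = v (\<phi> t x)"
  unfolding U_def by (subst \<Phi>_flow[OF unit]) auto

lemma flow_point: "\<sigma> \<in> {s..t} \<Longrightarrow> \<exists>z. x = \<phi> \<sigma> z"
  using HomeoD(5)[OF flow_Homeo[OF unit]] by metis

lemma U_support:
  assumes \<sigma>: "\<sigma> \<in> {s..t}" and nz: "U \<sigma> x \<noteq> 0"
  shows "x \<in> chart_inv c ` cball a (2 * r)"
proof -
  obtain z where z: "x = \<phi> \<sigma> z" using flow_point[OF \<sigma>] by blast
  have "v (\<phi> t z) \<noteq> 0" using nz U_flow[OF \<sigma>] z by simp
  from v(3)[OF this] have t: "\<phi> t z \<in> fst c" "snd c (\<phi> t z) \<in> cball a r"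
    unfolding chart_inv_image[OF c r_sub] by simp_all
  have tt: "t \<in> {s..t}" and r2: "r + r \<le> 6 * r" using st(2) r(1) by simp_all
  have "x \<in> fst c" unfolding z by (rule stays(1)[OF tt \<sigma> t r2])
  moreover have "snd c x \<in> cball a (2 * r)"
    unfolding z mult_2 by (rule stays(2)[OF tt \<sigma> t r2])
  ultimately have "x \<in> {p \<in> fst c. snd c p \<in> cball a (2 * r)}" by blast
  moreover have "chart_inv c ` cball a (2 * r) = {p \<in> fst c. snd c p \<in> cball a (2 * r)}"
    by (rule chart_inv_image[OF c ball_sub]) (use r(1) in simp)
  ultimately show ?thesis by (simp only:)
qed

lemma U_integral:
  assumes \<sigma>: "\<sigma> \<in> {s..t}" and \<rho>: "2 * r \<le> \<rho>" "\<rho> \<le> 6 * r"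
  shows "integral\<^sup>L \<mu> (U \<sigma>) = integral (cball a \<rho>) (\<lambda>y. U \<sigma> (chart_inv c y) * dens c y)"
    "continuous_on (cball a \<rho>) (\<lambda>y. U \<sigma> (chart_inv c y) * dens c y)"
proof -
  note sub = ball_sub[OF \<rho>(2)]
  show cont: "continuous_on (cball a \<rho>) (\<lambda>y. U \<sigma> (chart_inv c y) * dens c y)"
  proof (rule continuous_on_mult)
    show "continuous_on (cball a \<rho>) (\<lambda>y. U \<sigma> (chart_inv c y))"
      by (rule continuous_on_compose2[OF U_continuous[OF \<sigma>] continuous_on_subset[OF inv_cont[OF c] sub]]) auto
    show "continuous_on (cball a \<rho>) (dens c)" by (rule continuous_on_subset[OF dens_continuous[OF c] sub])
  qed
  have "integral\<^sup>L \<mu> (U \<sigma>) = (LINT y:cball a \<rho>|lborel. U \<sigma> (chart_inv c y) * dens c y)"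
  proof (rule integral_chart[OF c _ sub])
    show "U \<sigma> \<in> borel_measurable borel" by (rule borel_measurable_continuous_onI[OF U_continuous[OF \<sigma>]])
    fix p assume "U \<sigma> p \<noteq> 0"
    from U_support[OF \<sigma> this] show "p \<in> chart_inv c ` cball a \<rho>"
      using subset_cball[OF \<rho>(1), of a] by blast
  qed simp
  also have "\<dots> = integral (cball a \<rho>) (\<lambda>y. U \<sigma> (chart_inv c y) * dens c y)"
    by (rule integral_compact_lborel(2)[OF compact_cball cont])
  finally show "integral\<^sup>L \<mu> (U \<sigma>) = integral (cball a \<rho>) (\<lambda>y. U \<sigma> (chart_inv c y) * dens c y)" .
qed

text \<open>The orbits through two chart points are compared up to time \<open>t\<close> by
  Gronwall, and then the Lipschitz bound of \<open>v\<close> applies. The constant does not depend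
  on \<sigma>, because the time interval has length at most 1.\<close>

lemma U_lipschitz:
  assumes \<sigma>: "\<sigma> \<in> {s..t}" and q: "q \<in> cball a (4 * r)" "q' \<in> cball a (4 * r)"
  shows "\<bar>U \<sigma> (chart_inv c q) - U \<sigma> (chart_inv c q')\<bar> \<le> \<Lambda> * exp L * norm (q - q')"
proof -
  have orbit: "\<exists>z. chart_inv c q = \<phi> \<sigma> z \<and> snd c (\<phi> \<sigma> z) = q \<and> (\<forall>u\<in>{s..t}. \<phi> u z \<in> fst c \<and> snd c (\<phi> u z) \<in> cball a (6 * r))"
    if q: "q \<in> cball a (4 * r)" for q
  proof -
    have qV: "q \<in> chart_image c" using ball_sub[of "4 * r"] q r(1) by auto
    obtain z where z: "chart_inv c q = \<phi> \<sigma> z" using flow_point[OF \<sigma>] by blast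
    have zc: "\<phi> \<sigma> z \<in> fst c" "snd c (\<phi> \<sigma> z) = q" using inv_in[OF c qV] chart_inv_eq[OF c qV] z by simp_all
    have zq: "snd c (\<phi> \<sigma> z) \<in> cball a (4 * r)" using zc(2) q by simp
    have "\<phi> u z \<in> fst c \<and> snd c (\<phi> u z) \<in> cball a (6 * r)" if u: "u \<in> {s..t}" for u
    proof
      show "\<phi> u z \<in> fst c" by (rule stays(1)[OF \<sigma> u zc(1) zq]) (use r(1) in simp)
      have "snd c (\<phi> u z) \<in> cball a (4 * r + r)" by (rule stays(2)[OF \<sigma> u zc(1) zq]) (use r(1) in simp)
      then show "snd c (\<phi> u z) \<in> cball a (6 * r)" using r(1) by auto
    qed
    then show ?thesis using z zc(2) by (intro exI[of _ z]) auto
  qed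
  from orbit[OF q(1)] obtain z where zA: "chart_inv c q = \<phi> \<sigma> z \<and> snd c (\<phi> \<sigma> z) = q \<and>
      (\<forall>u\<in>{s..t}. \<phi> u z \<in> fst c \<and> snd c (\<phi> u z) \<in> cball a (6 * r))" by (elim exE)
  have z: "chart_inv c q = \<phi> \<sigma> z" "snd c (\<phi> \<sigma> z) = q" using conjunct1[OF zA] conjunct1[OF conjunct2[OF zA]] .
  have zo: "\<phi> u z \<in> fst c \<and> snd c (\<phi> u z) \<in> cball a (6 * r)" if "u \<in> {s..t}" for u
    by (rule bspec[OF conjunct2[OF conjunct2[OF zA]] that])
  from orbit[OF q(2)] obtain z' where z'A: "chart_inv c q' = \<phi> \<sigma> z' \<and> snd c (\<phi> \<sigma> z') = q' \<and>
      (\<forall>u\<in>{s..t}. \<phi> u z' \<in> fst c \<and> snd c (\<phi> u z') \<in> cball a (6 * r))" by (elim exE)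
  have z': "chart_inv c q' = \<phi> \<sigma> z'" "snd c (\<phi> \<sigma> z') = q'" using conjunct1[OF z'A] conjunct1[OF conjunct2[OF z'A]] .
  have zo': "\<phi> u z' \<in> fst c \<and> snd c (\<phi> u z') \<in> cball a (6 * r)" if "u \<in> {s..t}" for u
    by (rule bspec[OF conjunct2[OF conjunct2[OF z'A]] that])
  have tt: "t \<in> {s..t}" using st by simp
  have "U \<sigma> (chart_inv c q) = v (chart_inv c (snd c (\<phi> t z)))"
    using z(1) U_flow[OF \<sigma>] inv_chart[OF c] zo[OF tt] by simp
  moreover have "U \<sigma> (chart_inv c q') = v (chart_inv c (snd c (\<phi> t z')))"
    using z'(1) U_flow[OF \<sigma>] inv_chart[OF c] zo'[OF tt] by simp
  ultimately have "\<bar>U \<sigma> (chart_inv c q) - U \<sigma> (chart_inv c q')\<bar> \<le> \<Lambda> * norm (snd c (\<phi> t z) - snd c (\<phi> t z'))"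
    using \<Lambda>(2) zo[OF tt] zo'[OF tt] by simp
  also have "\<dots> \<le> \<Lambda> * (exp (L * (t - \<sigma>)) * norm (snd c (\<phi> \<sigma> z) - snd c (\<phi> \<sigma> z')))"
    by (intro mult_left_mono \<Lambda>(1) flow_chart_lipschitz[OF c r(2) L(2)]) (use \<sigma> st zo zo' in auto)
  also have "\<dots> \<le> \<Lambda> * (exp L * norm (q - q'))"
  proof (intro mult_left_mono \<Lambda>(1))
    have "L * (t - \<sigma>) \<le> L * 1" by (rule mult_left_mono) (use L(1) \<sigma> st in auto)
    then show "exp (L * (t - \<sigma>)) * norm (snd c (\<phi> \<sigma> z) - snd c (\<phi> \<sigma> z')) \<le> exp L * norm (q - q')"
      unfolding z(2) z'(2) by (intro mult_right_mono) auto
  qed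
  finally show ?thesis by (simp add: mult.assoc)
qed

text \<open>\<open>U \<sigma>\<close> at a point equals \<open>U (\<sigma> + h)\<close> at the
  flowed point. Passing to the Euler point, and from the density to Jacobian times density there,
  costs multiples of \<open>e * h\<close>; the Jacobian is then absorbed by the change of variables.
  \<open>C\<close> is chosen before \<open>e\<close>, so that the errors of many steps can be
  added.\<close>

lemma integral_step:
  obtains C where "C \<ge> 0" "\<And>e. e > 0 \<Longrightarrow> \<exists>\<delta>>0. \<forall>h \<sigma>. 0 \<le> h \<longrightarrow> h \<le> \<delta> \<longrightarrow> s \<le> \<sigma> \<longrightarrow> \<sigma> + h \<le> t \<longrightarrow>
      integral\<^sup>L \<mu> (U \<sigma>) \<le> integral\<^sup>L \<mu> (U (\<sigma> + h)) + C * (e * h)"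
proof -
  let ?K = "cball a (3 * r)" and ?K' = "cball a (4 * r)"
  have subK: "?K \<subseteq> chart_image c" and subK': "?K' \<subseteq> chart_image c" using ball_sub r(1) by auto
  have KK': "?K \<subseteq> ?K'" using r(1) by auto
  have K6: "?K \<subseteq> cball a (6 * r)" "?K' \<subseteq> cball a (6 * r)" using r(1) by auto
  have "bounded (dens c ` ?K)"
    by (rule compact_imp_bounded[OF compact_continuous_image[OF continuous_on_subset[OF dens_continuous[OF c] subK] compact_cball]])
  then obtain Dm where "\<forall>u\<in>dens c ` ?K. norm u \<le> Dm" unfolding bounded_iff by (elim exE)
  then have "norm (dens c y) \<le> Dm" if "y \<in> ?K" for y by (rule bspec[OF _ imageI[OF that]])
  then have Dm: "dens c y \<le> Dm" if "y \<in> ?K" for y using that by (simp add: abs_le_iff)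
  have Dm0: "0 \<le> Dm" using Dm[of a] dens_nonneg[of c a] r(1) by simp
  have "bounded (v ` UNIV)" by (rule compact_imp_bounded[OF compact_continuous_image[OF v(1) compact_UNIV]])
  then obtain Vm where "\<forall>u\<in>v ` UNIV. norm u \<le> Vm" unfolding bounded_iff by (elim exE)
  then have "norm (v p) \<le> Vm" for p by (rule bspec[OF _ imageI[OF UNIV_I]])
  then have Vm: "v p \<le> Vm" for p by (simp add: abs_le_iff)
  have Vm0: "0 \<le> Vm" using Vm[of undefined] v(2)[of undefined] by simp
  \<comment> \<open>\<open>Vm\<close> weighs the error in the density,
    \<open>\<Lambda> * exp L * Dm\<close> the error in the position of the Euler point.\<close>
  define c0 where "c0 = Vm + \<Lambda> * exp L * Dm"
  have c00: "0 \<le> c0" unfolding c0_def using Vm0 Dm0 \<Lambda>(1) by simp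
  have ci: "(\<lambda>y. b) integrable_on ?K" for b :: real by (rule integrable_on_const) (simp add: lmeasurable_cball)
  have step_in: "y + h *\<^sub>R X c u y \<in> ?K'" if "0 \<le> h" "h \<le> r / (B + 1)" "u \<in> {0..1}" "y \<in> ?K" for h u y
  proof -
    have "h * norm (X c u y) \<le> r / (B + 1) * (B + 1)"
      using that K6(1) B(2)[of u y] B(1) by (intro mult_mono) auto
    then have "norm (h *\<^sub>R X c u y) \<le> r" using that(1) B(1) by simp
    then show ?thesis using that(4) norm_triangle_ineq4[of "a - y" "h *\<^sub>R X c u y"] by (simp add: dist_norm algebra_simps)
  qed
  have h0: "r / (B + 1) > 0" using r(1) B(1) by simp
  show ?thesis
  proof (rule that[of "integral ?K (\<lambda>y. c0)"])
    show "0 \<le> integral ?K (\<lambda>y. c0)" by (rule integral_nonneg[OF ci]) (simp add: c00)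
    fix e :: real assume e: "e > 0"
    from jacobian_estimate[OF c compact_cball subK' KK' h0 step_in e]
    obtain \<delta>1 where \<delta>1: "\<delta>1 > 0" "\<delta>1 \<le> r / (B + 1)"
      "\<And>h t y. 0 \<le> h \<Longrightarrow> h \<le> \<delta>1 \<Longrightarrow> t \<in> {0..1} \<Longrightarrow> y \<in> ?K \<Longrightarrow>
        dens c y \<le> \<bar>det (mat 1 + h *\<^sub>R DX c t y)\<bar> * dens c (y + h *\<^sub>R X c t y) + e * h"
      by blast
    have "3 * r < 6 * r" using r(1) by simp
    from euler_step[OF c r(2) this B e] obtain \<delta>2 where \<delta>2: "\<delta>2 > 0"
      "\<And>h s x. 0 \<le> h \<Longrightarrow> h \<le> \<delta>2 \<Longrightarrow> 0 \<le> s \<Longrightarrow> s + h \<le> 1 \<Longrightarrow> \<phi> s x \<in> fst c \<Longrightarrow> snd c (\<phi> s x) \<in> ?K \<Longrightarrow>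
        norm (snd c (\<phi> (s + h) x) - (snd c (\<phi> s x) + h *\<^sub>R X c s (snd c (\<phi> s x)))) \<le> e * h" by blast
    \<comment> \<open>The last bound makes \<open>h * L \<le> 1/2\<close>: the Euler map differs
      from the identity by a contraction and is injective.\<close>
    define \<delta> where "\<delta> = min (min \<delta>1 \<delta>2) (1 / (2 * (L + 1)))"
    have \<delta>: "\<delta> > 0" "\<delta> \<le> \<delta>1" "\<delta> \<le> \<delta>2" "\<delta> \<le> 1 / (2 * (L + 1))" using \<delta>1(1) \<delta>2(1) L(1) by (auto simp: \<delta>_def)
    have main: "integral\<^sup>L \<mu> (U \<sigma>) \<le> integral\<^sup>L \<mu> (U (\<sigma> + h)) + integral ?K (\<lambda>y. c0) * (e * h)"
      if h: "0 \<le> h" "h \<le> \<delta>" and \<sigma>h: "s \<le> \<sigma>" "\<sigma> + h \<le> t" for h \<sigma>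
    proof -
      have \<sigma>: "\<sigma> \<in> {s..t}" "\<sigma> + h \<in> {s..t}" using h \<sigma>h by auto
      let ?W = "\<lambda>y. U (\<sigma> + h) (chart_inv c y)"
      define g where "g y = y + h *\<^sub>R X c \<sigma> y" for y
      define f where "f y = ?W y * dens c y" for y
      have g_in: "g y \<in> ?K'" if "y \<in> ?K" for y
        unfolding g_def by (rule step_in) (use h \<delta> \<delta>1 that unit[OF \<sigma>(1)] in auto)
      have W0: "0 \<le> ?W y" "?W y \<le> Vm" for y using v(2) Vm by (auto simp: U_def)
      have gd: "(g has_derivative (\<lambda>w. (mat 1 + h *\<^sub>R DX c \<sigma> y) *v w)) (at y)" if y: "y \<in> ?K" for y
      proof -
        have yV: "y \<in> chart_image c" using y subK by auto
        have "(g has_derivative (\<lambda>w. w + h *\<^sub>R (DX c \<sigma> y *v w))) (at y)"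
          unfolding g_def[abs_def] by (intro has_derivative_add has_derivative_ident has_derivative_scaleR_right X_has_derivative[OF c unit[OF \<sigma>(1)] yV])
        then show ?thesis by (simp add: matrix_vector_mult_add_rdistrib scaleR_matrix_vector_assoc)
      qed
      have inj: "inj_on g ?K"
      proof (rule inj_onI)
        fix y y' assume y: "y \<in> ?K" "y' \<in> ?K" "g y = g y'"
        have "y - y' = h *\<^sub>R (X c \<sigma> y' - X c \<sigma> y)" using y(3) by (simp add: g_def algebra_simps)
        then have "norm (y - y') = h * norm (X c \<sigma> y - X c \<sigma> y')" using h(1) by (simp add: norm_minus_commute)
        also have "\<dots> \<le> h * (L * norm (y - y'))"
          by (rule mult_left_mono[OF L(2)[OF unit[OF \<sigma>(1)]]]) (use y K6 h in auto)
        also have "\<dots> = (h * L) * norm (y - y')" by simp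
        also have "\<dots> \<le> 1/2 * norm (y - y')"
        proof (rule mult_right_mono)
          have "h * L \<le> 1 / (2 * (L + 1)) * (L + 1)" by (rule mult_mono) (use h \<delta>(4) L(1) in auto)
          also have "1 / (2 * (L + 1)) * (L + 1) = 1/2" using L(1) by (simp add: field_simps)
          finally show "h * L \<le> 1/2" .
        qed simp
        finally show "y = y'" by simp
      qed
      have fcont: "continuous_on ?K' f" unfolding f_def[abs_def] by (rule U_integral(2)[OF \<sigma>(2)]) (use r(1) in auto)
      have f0: "0 \<le> f y" for y unfolding f_def using W0(1) dens_nonneg by simp
      have gK: "g ` ?K \<subseteq> ?K'" using g_in by blast
      note cov = integral_change_of_variables_le[OF compact_cball compact_cball gd inj gK fcont f0]
      have cov1: "(\<lambda>y. \<bar>det (mat 1 + h *\<^sub>R DX c \<sigma> y)\<bar> * f (g y)) integrable_on ?K"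
        and cov2: "integral ?K (\<lambda>y. \<bar>det (mat 1 + h *\<^sub>R DX c \<sigma> y)\<bar> * f (g y)) \<le> integral ?K' f"
        using cov by simp_all
      have pw: "U \<sigma> (chart_inv c y) * dens c y \<le> \<bar>det (mat 1 + h *\<^sub>R DX c \<sigma> y)\<bar> * f (g y) + c0 * (e * h)" if y: "y \<in> ?K" for y
      proof -
        have yV: "y \<in> chart_image c" using y subK by auto
        obtain z where z: "chart_inv c y = \<phi> \<sigma> z" using flow_point[OF \<sigma>(1)] by blast
        have zc: "\<phi> \<sigma> z \<in> fst c" "snd c (\<phi> \<sigma> z) = y" using inv_in[OF c yV] chart_inv_eq[OF c yV] z by simp_all
        have zK: "snd c (\<phi> \<sigma> z) \<in> ?K" using zc(2) y by simp
        let ?q = "snd c (\<phi> (\<sigma> + h) z)"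
        have q1: "\<phi> (\<sigma> + h) z \<in> fst c" by (rule stays(1)[OF \<sigma> zc(1) zK]) (use r(1) in simp)
        have "?q \<in> cball a (3 * r + r)" by (rule stays(2)[OF \<sigma> zc(1) zK]) (use r(1) in simp)
        then have q2: "?q \<in> ?K'" by simp
        have q3: "norm (?q - g y) \<le> e * h"
          using \<delta>2(2)[OF h(1) _ _ _ zc(1) zK] h \<delta>(3) \<sigma>h st zc(2) by (simp add: g_def)
        have "U \<sigma> (chart_inv c y) = ?W ?q"
          using z U_flow[OF \<sigma>(1)] U_flow[OF \<sigma>(2)] inv_chart[OF c q1] by simp
        moreover have "?W ?q \<le> ?W (g y) + \<Lambda> * exp L * norm (?q - g y)"
          using U_lipschitz[OF \<sigma>(2) q2 g_in[OF y]] by simp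
        moreover have "\<Lambda> * exp L * norm (?q - g y) \<le> \<Lambda> * exp L * (e * h)"
          by (rule mult_left_mono[OF q3]) (use \<Lambda>(1) in simp)
        ultimately have "U \<sigma> (chart_inv c y) \<le> ?W (g y) + \<Lambda> * exp L * (e * h)" by linarith
        then have "U \<sigma> (chart_inv c y) * dens c y \<le> (?W (g y) + \<Lambda> * exp L * (e * h)) * dens c y"
          by (rule mult_right_mono[OF _ dens_nonneg])
        also have "\<dots> = ?W (g y) * dens c y + \<Lambda> * exp L * (e * h) * dens c y" by (rule distrib_right)
        also have "\<Lambda> * exp L * (e * h) * dens c y \<le> \<Lambda> * exp L * (e * h) * Dm"
          by (rule mult_left_mono[OF Dm[OF y]]) (use \<Lambda>(1) e h in simp)
        also have "?W (g y) * dens c y \<le> ?W (g y) * (\<bar>det (mat 1 + h *\<^sub>R DX c \<sigma> y)\<bar> * dens c (g y) + e * h)"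
          unfolding g_def by (rule mult_left_mono[OF \<delta>1(3) W0(1)]) (use h \<delta> unit[OF \<sigma>(1)] y in auto)
        also have "\<dots> = \<bar>det (mat 1 + h *\<^sub>R DX c \<sigma> y)\<bar> * f (g y) + ?W (g y) * (e * h)" by (simp add: f_def algebra_simps)
        also have "?W (g y) * (e * h) \<le> Vm * (e * h)" by (rule mult_right_mono[OF W0(2)]) (use e h in simp)
        finally show ?thesis by (simp add: c0_def algebra_simps)
      qed
      have "integral\<^sup>L \<mu> (U \<sigma>) = integral ?K (\<lambda>y. U \<sigma> (chart_inv c y) * dens c y)"
        by (rule U_integral(1)[OF \<sigma>(1)]) (use r(1) in auto)
      also have "\<dots> \<le> integral ?K (\<lambda>y. \<bar>det (mat 1 + h *\<^sub>R DX c \<sigma> y)\<bar> * f (g y) + c0 * (e * h))"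
      proof (rule integral_le)
        show "(\<lambda>y. U \<sigma> (chart_inv c y) * dens c y) integrable_on ?K"
          by (rule integral_compact_lborel(1)[OF compact_cball U_integral(2)[OF \<sigma>(1)]]) (use r(1) in auto)
        show "(\<lambda>y. \<bar>det (mat 1 + h *\<^sub>R DX c \<sigma> y)\<bar> * f (g y) + c0 * (e * h)) integrable_on ?K"
          by (rule integrable_add[OF cov1 ci])
      qed (rule pw)
      also have "\<dots> = integral ?K (\<lambda>y. \<bar>det (mat 1 + h *\<^sub>R DX c \<sigma> y)\<bar> * f (g y)) + integral ?K (\<lambda>y. c0 * (e * h))"
        by (rule Henstock_Kurzweil_Integration.integral_add[OF cov1 ci])
      also have "integral ?K (\<lambda>y. c0 * (e * h)) = integral ?K (\<lambda>y. c0) * (e * h)"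
        by (rule Henstock_Kurzweil_Integration.integral_mult_left)
      also have "integral ?K (\<lambda>y. \<bar>det (mat 1 + h *\<^sub>R DX c \<sigma> y)\<bar> * f (g y)) \<le> integral ?K' f" by (rule cov2)
      also have "integral ?K' f = integral\<^sup>L \<mu> (U (\<sigma> + h))"
        unfolding f_def[abs_def] by (rule U_integral(1)[OF \<sigma>(2), symmetric]) (use r(1) in auto)
      finally show ?thesis by simp
    qed
    show "\<exists>\<delta>>0. \<forall>h \<sigma>. 0 \<le> h \<longrightarrow> h \<le> \<delta> \<longrightarrow> s \<le> \<sigma> \<longrightarrow> \<sigma> + h \<le> t \<longrightarrow>
      integral\<^sup>L \<mu> (U \<sigma>) \<le> integral\<^sup>L \<mu> (U (\<sigma> + h)) + integral ?K (\<lambda>y. c0) * (e * h)"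
      using main \<delta>(1) by (intro exI[of _ \<delta>]) blast
  qed
qed

text \<open>The steps together fill an interval of length at most 1, so their errors add up to at
  most \<open>C * e\<close>, and \<open>e\<close> is arbitrary.\<close>

lemma integral_flow_le: "(\<integral>x. v (\<Phi> t s x) \<partial>\<mu>) \<le> integral\<^sup>L \<mu> v"
proof -
  obtain C where C: "C \<ge> 0" "\<And>e. e > 0 \<Longrightarrow> \<exists>\<delta>>0. \<forall>h \<sigma>. 0 \<le> h \<longrightarrow> h \<le> \<delta> \<longrightarrow> s \<le> \<sigma> \<longrightarrow> \<sigma> + h \<le> t \<longrightarrow>
      integral\<^sup>L \<mu> (U \<sigma>) \<le> integral\<^sup>L \<mu> (U (\<sigma> + h)) + C * (e * h)" by (rule integral_step) (rule that; simp)
  have le: "integral\<^sup>L \<mu> (U s) \<le> integral\<^sup>L \<mu> (U t) + C * e" if e: "e > 0" for e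
  proof -
    obtain \<delta> where \<delta>: "\<delta> > 0" "\<forall>h \<sigma>. 0 \<le> h \<longrightarrow> h \<le> \<delta> \<longrightarrow> s \<le> \<sigma> \<longrightarrow> \<sigma> + h \<le> t \<longrightarrow>
      integral\<^sup>L \<mu> (U \<sigma>) \<le> integral\<^sup>L \<mu> (U (\<sigma> + h)) + C * (e * h)" using C(2)[OF e] by (elim exE conjE)
    obtain N where N: "1 / \<delta> < real (Suc N)"
      using reals_Archimedean2[of "1 / \<delta>"] by (meson less_SucI of_nat_less_iff order_less_trans lessI)
    define h where "h = (t - s) / real (Suc N)"
    have "(t - s) \<le> \<delta> * real (Suc N)" using N \<delta>(1) st by (simp add: field_simps)
    then have h: "0 \<le> h" "h \<le> \<delta>" "s + real (Suc N) * h = t" using st by (auto simp: h_def field_simps)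
    have "k \<le> Suc N \<Longrightarrow> integral\<^sup>L \<mu> (U s) \<le> integral\<^sup>L \<mu> (U (s + real k * h)) + C * (e * (real k * h))" for k
    proof (induction k)
      case (Suc k)
      have "real (Suc k) * h \<le> real (Suc N) * h" using Suc.prems h(1) by (intro mult_right_mono) auto
      then have le: "s + real k * h + h \<le> t" using h(3) by (simp add: algebra_simps)
      have "s \<le> s + real k * h" using h(1) by simp
      with \<delta>(2)[rule_format, OF h(1,2) this le]
      have "integral\<^sup>L \<mu> (U (s + real k * h)) \<le> integral\<^sup>L \<mu> (U (s + real (Suc k) * h)) + C * (e * h)"
        by (simp add: algebra_simps)
      then show ?case using Suc by (simp add: algebra_simps)
    qed simp
    from this[of "Suc N"] have "integral\<^sup>L \<mu> (U s) \<le> integral\<^sup>L \<mu> (U t) + C * (e * (real (Suc N) * h))" using h(3) by simp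
    also have "C * (e * (real (Suc N) * h)) \<le> C * (e * 1)"
      using h(3) st by (intro mult_left_mono C(1)) (use e in auto)
    finally show ?thesis by simp
  qed
  have "integral\<^sup>L \<mu> (U s) \<le> integral\<^sup>L \<mu> (U t)"
  proof (rule field_le_epsilon)
    fix e :: real assume e: "e > 0"
    have "C * (e / (C + 1)) \<le> e" using C(1) e by (simp add: field_simps)
    then show "integral\<^sup>L \<mu> (U s) \<le> integral\<^sup>L \<mu> (U t) + e" using le[of "e / (C + 1)"] C(1) e by simp
  qed
  moreover have "U t = v" by (simp add: fun_eq_iff U_def HomeoD(5)[OF flow_Homeo[OF t01]])
  moreover have "U s = (\<lambda>x. v (\<Phi> t s x))" by (simp add: fun_eq_iff U_def)
  ultimately show ?thesis by simp
qed

end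

context hamiltonian_flow
begin

text \<open>The inequality is enough: applied to \<open>u + b\<close> and to \<open>b - u\<close> it gives invariance of the integral of \<open>u\<close>.\<close>

definition flow_decreases :: "('m, 'k) chart \<Rightarrow> (real, 'k) vec \<Rightarrow> real \<Rightarrow> real \<Rightarrow> bool" where
  "flow_decreases c a r \<tau> \<longleftrightarrow> (\<forall>(v :: 'm \<Rightarrow> real) s t. Ck_map 2 v \<longrightarrow> (\<forall>p. 0 \<le> v p) \<longrightarrow>
     (\<forall>p. v p \<noteq> 0 \<longrightarrow> p \<in> chart_inv c ` cball a r) \<longrightarrow> 0 \<le> s \<longrightarrow> s \<le> t \<longrightarrow> t \<le> 1 \<longrightarrow> t - s \<le> \<tau> \<longrightarrow>
     (\<integral>x. v (\<Phi> t s x) \<partial>\<mu>) \<le> integral\<^sup>L \<mu> v)"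

lemma flow_decreases_exists:
  assumes "c \<in> A" "r > 0" "cball a (6 * r) \<subseteq> chart_image c"
  shows "\<exists>\<tau>>0. flow_decreases c a r \<tau>"
proof -
  obtain B L where BL: "B \<ge> 0" "L \<ge> 0" "\<And>t y. t \<in> {0..1} \<Longrightarrow> y \<in> cball a (6 * r) \<Longrightarrow> norm (X c t y) \<le> B"
    "\<And>t y y'. t \<in> {0..1} \<Longrightarrow> y \<in> cball a (6 * r) \<Longrightarrow> y' \<in> cball a (6 * r) \<Longrightarrow> norm (X c t y - X c t y') \<le> L * norm (y - y')"
    by (rule field_bounds[OF assms(1) compact_cball convex_cball assms(3)]) (rule that; simp)
  \<comment> \<open>This time bound yields \<open>B * (t - s) < r\<close>; the summand 1 makes the
    inequality strict and covers \<open>B = 0\<close>.\<close>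
  have "flow_decreases c a r (r / (B + 1))"
    unfolding flow_decreases_def
  proof (intro allI impI)
    fix v :: "'m \<Rightarrow> real" and s t assume v: "Ck_map 2 v" and v1: "\<forall>p. 0 \<le> v p" and v2: "\<forall>p. v p \<noteq> 0 \<longrightarrow> p \<in> chart_inv c ` cball a r"
      and st: "0 \<le> s" "s \<le> t" "t \<le> 1" "t - s \<le> r / (B + 1)"
    have "Ck_on (Suc (Suc 0)) (\<lambda>y. v (chart_inv c y)) (chart_image c)"
      using Ck_mapD[OF v assms(1)] by (simp only: numeral_2_eq_2)
    from Ck_on_lipschitz[OF image_open[OF assms(1)] this compact_cball convex_cball assms(3)]
    obtain \<Lambda> where \<Lambda>: "\<And>y y'. y \<in> cball a (6 * r) \<Longrightarrow> y' \<in> cball a (6 * r) \<Longrightarrow> norm (v (chart_inv c y) - v (chart_inv c y')) \<le> \<Lambda> * norm (y - y')"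
      by blast
    have Bt: "B * (t - s) < r"
    proof (cases "t = s")
      case True
      then show ?thesis using assms(2) by simp
    next
      case False
      then have "B * (t - s) < (B + 1) * (t - s)" using st by simp
      also have "\<dots> \<le> (B + 1) * (r / (B + 1))" by (rule mult_left_mono[OF st(4)]) (use BL(1) in simp)
      finally show ?thesis using BL(1) by simp
    qed
    interpret flow_box A \<omega> \<mu> n d H \<phi> c a r B L v "\<bar>\<Lambda>\<bar>" s t
    proof
      show "continuous_on UNIV v" by (rule Ck_map_continuous[OF v])
      show "0 \<le> v p" for p using v1 by simp
      show "p \<in> chart_inv c ` cball a r" if "v p \<noteq> 0" for p using v2 that by simp
      fix y y' assume y: "y \<in> cball a (6 * r)" "y' \<in> cball a (6 * r)"
      have "\<Lambda> * norm (y - y') \<le> \<bar>\<Lambda>\<bar> * norm (y - y')" by (rule mult_right_mono) auto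
      then show "\<bar>v (chart_inv c y) - v (chart_inv c y')\<bar> \<le> \<bar>\<Lambda>\<bar> * norm (y - y')" using \<Lambda>[OF y] by simp
    qed (use assms BL st Bt in auto)
    show "(\<integral>x. v (\<Phi> t s x) \<partial>\<mu>) \<le> integral\<^sup>L \<mu> v" by (rule integral_flow_le)
  qed
  moreover have "r / (B + 1) > 0" using assms(2) BL(1) by simp
  ultimately show ?thesis by blast
qed

text \<open>The time \<tau> comes from a finite cover by chart balls and is fixed before
  \<open>u\<close>. A continuous \<open>u\<close> is then approximated uniformly by a combination of
  C^2 bumps, each inside one ball of the cover, where \<open>flow_decreases\<close> applies. The
  approximation error enters once on each side.\<close>

lemma integral_flow_short:
  "\<exists>\<tau>>0. \<forall>(u :: 'm \<Rightarrow> real) s t. continuous_on UNIV u \<longrightarrow> (\<forall>x. 0 \<le> u x) \<longrightarrow> 0 \<le> s \<longrightarrow> s \<le> t \<longrightarrow> t \<le> 1 \<longrightarrow> t - s \<le> \<tau> \<longrightarrow>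
    (\<integral>x. u (\<Phi> t s x) \<partial>\<mu>) \<le> integral\<^sup>L \<mu> u"
proof -
  have "\<exists>c r \<tau>. c \<in> A \<and> p \<in> fst c \<and> r > 0 \<and> cball (snd c p) (6 * r) \<subseteq> chart_image c \<and> \<tau> > 0 \<and> flow_decreases c (snd c p) r \<tau>" for p
  proof -
    obtain c where c: "c \<in> A" "p \<in> fst c" using chart_at by blast
    obtain R where R: "R > 0" "cball (snd c p) R \<subseteq> chart_image c"
      using image_open[OF c(1)] chart_in[OF c] open_contains_cball by blast
    have r: "R / 6 > 0" "cball (snd c p) (6 * (R / 6)) \<subseteq> chart_image c" using R by simp_all
    obtain \<tau> where "\<tau> > 0" "flow_decreases c (snd c p) (R / 6) \<tau>" using flow_decreases_exists[OF c(1) r] by blast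
    then show ?thesis using c r by (intro exI[of _ c] exI[of _ "R / 6"] exI[of _ \<tau>]) simp
  qed
  then obtain ch rad tm where ch: "\<And>p. ch p \<in> A" "\<And>p. p \<in> fst (ch p)" "\<And>p. rad p > 0"
    "\<And>p. cball (snd (ch p) p) (6 * rad p) \<subseteq> chart_image (ch p)" "\<And>p. tm p > 0"
    and mono: "\<And>p. flow_decreases (ch p) (snd (ch p) p) (rad p) (tm p)" by metis
  define G where "G p = chart_inv (ch p) ` ball (snd (ch p) p) (rad p)" for p
  have ballsub: "ball (snd (ch p) p) (rad p) \<subseteq> chart_image (ch p)" for p
  proof -
    have "ball (snd (ch p) p) (rad p) \<subseteq> cball (snd (ch p) p) (6 * rad p)" using ch(3)[of p] by auto
    then show ?thesis using ch(4)[of p] by blast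
  qed
  have G: "open (G p)" for p unfolding G_def by (rule open_chart_inv_image[OF ch(1) open_ball ballsub])
  have pG: "p \<in> G p" for p using ch(2,3)[of p] by (simp add: G_def chart_inv_image[OF ch(1) ballsub])
  have cov: "UNIV \<subseteq> (\<Union>p\<in>UNIV. G p)" using pG by blast
  obtain J where J: "J \<subseteq> UNIV" "finite J" "UNIV \<subseteq> (\<Union>p\<in>J. G p)" by (rule compactE_image[OF cpt G cov])
  then have "J \<noteq> {}" by auto
  define \<tau> where "\<tau> = Min (tm ` J)"
  have \<tau>: "\<tau> > 0" "\<And>p. p \<in> J \<Longrightarrow> \<tau> \<le> tm p" using J(2) \<open>J \<noteq> {}\<close> ch(5) by (auto simp: \<tau>_def)
  have "\<forall>q. \<exists>p. p \<in> J \<and> q \<in> G p" using J(3) by blast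
  from choice[OF this] obtain pt where pt: "\<And>q. pt q \<in> J" "\<And>q. q \<in> G (pt q)" by blast
  show ?thesis
  proof (intro exI[of _ \<tau>] conjI \<tau>(1) allI impI)
    fix u :: "'m \<Rightarrow> real" and s t assume u: "continuous_on UNIV u" "\<forall>x. 0 \<le> u x" and st: "0 \<le> s" "s \<le> t" "t \<le> 1" "t - s \<le> \<tau>"
    have hom: "\<Phi> t s \<in> Homeo" by (rule \<Phi>_Homeo) (use st in auto)
    have compc: "continuous_on UNIV (\<lambda>x. w (\<Phi> t s x))" if "continuous_on UNIV w" for w :: "'m \<Rightarrow> real"
      by (rule continuous_on_compose2[OF that HomeoD(1)[OF hom]]) auto
    have est: "(\<integral>x. u (\<Phi> t s x) \<partial>\<mu>) \<le> integral\<^sup>L \<mu> u + 2 * (e * measure \<mu> UNIV)" if e: "e > 0" for e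
    proof -
      \<comment> \<open>Small oscillation of \<open>u\<close> makes the approximation good;
        containment in \<open>G (pt q)\<close> makes each bump fit into a ball of the fixed
        cover.\<close>
      define N where "N q = {x. \<bar>u x - u q\<bar> < e} \<inter> G (pt q)" for q
      have No: "open (N q)" for q unfolding N_def
        by (intro open_Int G open_Collect_less continuous_intros u(1)) 
      have Nq: "q \<in> N q" for q using pt(2) e by (simp add: N_def)
      obtain I \<eta> cc rr where fin: "finite (I :: 'm set)"
        and cc: "\<And>i. i \<in> I \<Longrightarrow> cc i \<in> A \<and> i \<in> fst (cc i) \<and> rr i > 0 \<and> cball (snd (cc i) i) (rr i) \<subseteq> chart_image (cc i)
        \<and> chart_inv (cc i) ` cball (snd (cc i) i) (rr i) \<subseteq> N i"
        and \<eta>: "\<And>i. i \<in> I \<Longrightarrow> Ck_map 2 (\<eta> i)" "\<And>i p. 0 \<le> \<eta> i p" "\<And>p. (\<Sum>i\<in>I. \<eta> i p) = (1::real)"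
        and supp: "\<And>i p. i \<in> I \<Longrightarrow> \<eta> i p \<noteq> 0 \<Longrightarrow> p \<in> chart_inv (cc i) ` cball (snd (cc i) i) (rr i)"
        by (rule partition_of_unity[OF No Nq]) (rule that; simp)
      have inN: "p \<in> N i" if "i \<in> I" "\<eta> i p \<noteq> 0" for i p using supp[OF that] cc[OF that(1)] by blast
      define v where "v i p = u i * \<eta> i p" for i p
      have vC: "Ck_map 2 (v i)" if "i \<in> I" for i
        unfolding v_def[abs_def] by (rule Ck_map_mult[OF Ck_map_const \<eta>(1)[OF that]])
      note vcont = Ck_map_continuous[OF vC]
      define w where "w p = (\<Sum>i\<in>I. v i p)" for p
      have wc: "continuous_on UNIV w" unfolding w_def[abs_def] by (rule continuous_on_sum[OF vcont])
      have uw: "\<bar>u p - w p\<bar> \<le> e" for p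
      proof -
        have "u p - w p = (\<Sum>i\<in>I. (u p - u i) * \<eta> i p)"
          using \<eta>(3)[of p] by (simp add: w_def v_def left_diff_distrib sum_subtractf sum_distrib_left[symmetric])
        also have "\<bar>\<dots>\<bar> \<le> (\<Sum>i\<in>I. e * \<eta> i p)"
        proof (rule order_trans[OF sum_abs sum_mono])
          fix i assume i: "i \<in> I"
          show "\<bar>(u p - u i) * \<eta> i p\<bar> \<le> e * \<eta> i p"
          proof (cases "\<eta> i p = 0")
            case False
            then have "\<bar>u p - u i\<bar> \<le> e" using inN[OF i] by (simp add: N_def less_imp_le)
            then show ?thesis using \<eta>(2)[of i p] by (simp add: abs_mult mult_right_mono)
          qed simp
        qed
        also have "\<dots> = e" using \<eta>(3)[of p] by (simp add: sum_distrib_left[symmetric])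
        finally show ?thesis .
      qed
      have "(\<integral>x. w (\<Phi> t s x) \<partial>\<mu>) = (\<Sum>i\<in>I. \<integral>x. v i (\<Phi> t s x) \<partial>\<mu>)"
        unfolding w_def by (rule Bochner_Integration.integral_sum) (rule integrable_continuous[OF compc[OF vcont]])
      also have "\<dots> \<le> (\<Sum>i\<in>I. integral\<^sup>L \<mu> (v i))"
      proof (rule sum_mono)
        fix i assume i: "i \<in> I"
        show "(\<integral>x. v i (\<Phi> t s x) \<partial>\<mu>) \<le> integral\<^sup>L \<mu> (v i)"
        proof (rule mono[of "pt i", unfolded flow_decreases_def, rule_format, OF vC[OF i]])
          show "0 \<le> v i p" for p using u(2) \<eta>(2) by (simp add: v_def)
          show "q \<in> chart_inv (ch (pt i)) ` cball (snd (ch (pt i)) (pt i)) (rad (pt i))" if "v i q \<noteq> 0" for q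
          proof -
            have "\<eta> i q \<noteq> 0" using that by (auto simp: v_def)
            then have "q \<in> G (pt i)" using inN[OF i] by (simp add: N_def)
            then show ?thesis unfolding G_def using ball_subset_cball by blast
          qed
          show "t - s \<le> tm (pt i)" using st(4) \<tau>(2)[OF pt(1)[of i]] by simp
        qed (use st in auto)
      qed
      also have "\<dots> = integral\<^sup>L \<mu> w"
        unfolding w_def[abs_def] by (rule Bochner_Integration.integral_sum[symmetric]) (rule integrable_continuous[OF vcont])
      finally have 1: "(\<integral>x. w (\<Phi> t s x) \<partial>\<mu>) \<le> integral\<^sup>L \<mu> w" .
      have 2: "\<bar>integral\<^sup>L \<mu> u - integral\<^sup>L \<mu> w\<bar> \<le> e * measure \<mu> UNIV" by (rule abs_integral_diff_le[OF u(1) wc uw])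
      have 3: "\<bar>(\<integral>x. u (\<Phi> t s x) \<partial>\<mu>) - (\<integral>x. w (\<Phi> t s x) \<partial>\<mu>)\<bar> \<le> e * measure \<mu> UNIV"
        by (rule abs_integral_diff_le[OF compc[OF u(1)] compc[OF wc] uw])
      show ?thesis using 1 2 3 by linarith
    qed
    show "(\<integral>x. u (\<Phi> t s x) \<partial>\<mu>) \<le> integral\<^sup>L \<mu> u"
    proof (rule field_le_epsilon)
      fix e :: real assume e: "e > 0"
      let ?m = "measure \<mu> UNIV"
      have m: "0 \<le> ?m" by simp
      have "2 * (e / (2 * (b + 1)) * b) \<le> e" if "0 \<le> b" for b
        using that e by (simp add: field_simps)
      from this[OF m] have "2 * (e / (2 * (?m + 1)) * ?m) \<le> e" .
      then show "(\<integral>x. u (\<Phi> t s x) \<partial>\<mu>) \<le> integral\<^sup>L \<mu> u + e" using est[of "e / (2 * (?m + 1))"] m e by (simp add: add_nonneg_pos)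
    qed
  qed
qed

lemma Homeo_vol_comp: "h \<in> Homeo_vol \<mu> \<Longrightarrow> k \<in> Homeo_vol \<mu> \<Longrightarrow> h \<circ> k \<in> Homeo_vol \<mu>"
proof -
  assume h: "h \<in> Homeo_vol \<mu>" and k: "k \<in> Homeo_vol \<mu>"
  then have hk: "h \<in> Homeo" "k \<in> Homeo" "distr \<mu> \<mu> h = \<mu>" "distr \<mu> \<mu> k = \<mu>" by (auto simp: Homeo_vol_def)
  have "distr \<mu> \<mu> (h \<circ> k) = distr (distr \<mu> \<mu> k) \<mu> h"
    by (rule distr_distr[symmetric]) (use Homeo_measurable hk in auto)
  then show ?thesis using hk comp_Homeo(1) by (simp add: Homeo_vol_def)
qed

text \<open>Evolutions over times up to \<tau> preserve \<mu>, and \<open>\<phi> t\<close> is a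
  composition of finitely many of them, starting from the identity at time 0.\<close>

theorem flow_Homeo_vol:
  assumes t: "t \<in> {0..1}"
  shows "\<phi> t \<in> Homeo_vol \<mu>"
proof -
  obtain \<tau> where \<tau>: "\<tau> > 0" and dec: "\<forall>(u :: 'm \<Rightarrow> real) s t. continuous_on UNIV u \<longrightarrow> (\<forall>x. 0 \<le> u x) \<longrightarrow> 0 \<le> s \<longrightarrow> s \<le> t \<longrightarrow> t \<le> 1 \<longrightarrow> t - s \<le> \<tau> \<longrightarrow>
    (\<integral>x. u (\<Phi> t s x) \<partial>\<mu>) \<le> integral\<^sup>L \<mu> u" using integral_flow_short by (elim exE conjE)
  have short: "\<Phi> t s \<in> Homeo_vol \<mu>" if st: "0 \<le> s" "s \<le> t" "t \<le> 1" "t - s \<le> \<tau>" for s t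
  proof -
    have hom: "\<Phi> t s \<in> Homeo" by (rule \<Phi>_Homeo) (use st in auto)
    have "distr \<mu> \<mu> (\<Phi> t s) = \<mu>"
    proof (rule measure_eqI_continuous)
      show "finite_measure (distr \<mu> \<mu> (\<Phi> t s))" by (rule mu.finite_measure_distr[OF Homeo_measurable[OF hom]])
      fix u :: "'m \<Rightarrow> real" assume u: "continuous_on UNIV u"
      have uc: "continuous_on UNIV (\<lambda>x. u (\<Phi> t s x))" by (rule continuous_on_compose2[OF u HomeoD(1)[OF hom]]) auto
      note i1 = integrable_continuous[OF u] and i2 = integrable_continuous[OF uc]
      have "bounded (u ` UNIV)" by (rule compact_imp_bounded[OF compact_continuous_image[OF u compact_UNIV]])
      then obtain b where "\<forall>y\<in>u ` UNIV. norm y \<le> b" unfolding bounded_iff by (elim exE)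
      then have "norm (u x) \<le> b" for x by (rule bspec[OF _ imageI[OF UNIV_I]])
      then have b: "\<bar>u x\<bar> \<le> b" for x by simp
      have b': "0 \<le> u x + b" "0 \<le> b - u x" for x using b[of x] by linarith+
      have "(\<integral>x. u (\<Phi> t s x) + b \<partial>\<mu>) \<le> (\<integral>x. u x + b \<partial>\<mu>)"
        by (rule dec[rule_format, of "\<lambda>x. u x + b", OF _ b'(1) st]) (intro continuous_intros u)
      moreover have "(\<integral>x. b - u (\<Phi> t s x) \<partial>\<mu>) \<le> (\<integral>x. b - u x \<partial>\<mu>)"
        by (rule dec[rule_format, of "\<lambda>x. b - u x", OF _ b'(2) st]) (intro continuous_intros u)
      ultimately have "(\<integral>x. u (\<Phi> t s x) \<partial>\<mu>) = integral\<^sup>L \<mu> u" using i1 i2 by simp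
      then show "integral\<^sup>L (distr \<mu> \<mu> (\<Phi> t s)) u = integral\<^sup>L \<mu> u"
        using integral_distr[OF Homeo_measurable[OF hom] measurable_continuous[OF u]] by simp
    qed (simp_all add: sets_mu finite_mu)
    then show ?thesis using hom by (simp add: Homeo_vol_def)
  qed
  obtain N where N: "1 / \<tau> < real (Suc N)"
    using reals_Archimedean2[of "1 / \<tau>"] by (meson less_SucI of_nat_less_iff order_less_trans lessI)
  define h where "h = t / real (Suc N)"
  have "t \<le> \<tau> * real (Suc N)" using N \<tau> t by (simp add: field_simps)
  then have h: "0 \<le> h" "h \<le> \<tau>" "real (Suc N) * h = t" using t by (auto simp: h_def field_simps)
  have "k \<le> Suc N \<Longrightarrow> \<phi> (real k * h) \<in> Homeo_vol \<mu>" for k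
  proof (induction k)
    case 0
    show ?case using id_Homeo by (simp add: flow_0 Homeo_vol_def id_def distr_id)
  next
    case (Suc k)
    have "real (Suc k) * h \<le> real (Suc N) * h" using Suc.prems h(1) by (intro mult_right_mono) auto
    then have le: "real (Suc k) * h \<le> 1" using h(3) t by simp
    have k0: "0 \<le> real k * h" "real k * h \<le> real (Suc k) * h" using h(1) by (auto simp: algebra_simps)
    have kk: "real k * h \<in> {0..1}" using k0 le by auto
    have "\<Phi> (real (Suc k) * h) (real k * h) \<in> Homeo_vol \<mu>"
      by (rule short[OF k0 le]) (use h(2) in \<open>simp add: algebra_simps\<close>)
    from Homeo_vol_comp[OF this Suc.IH] Suc.prems
    have "\<Phi> (real (Suc k) * h) (real k * h) \<circ> \<phi> (real k * h) \<in> Homeo_vol \<mu>" by simp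
    moreover have "\<Phi> (real (Suc k) * h) (real k * h) \<circ> \<phi> (real k * h) = \<phi> (real (Suc k) * h)"
      using \<Phi>_flow[OF kk] by (simp add: fun_eq_iff)
    ultimately show ?case by simp
  qed
  from this[of "Suc N"] show ?thesis using h(3) by simp
qed

end

section \<open>The flux of a Hamiltonian flow\<close>

lemma arg_turn_has_derivative:
  assumes q: "(q has_derivative q') (at x within S)" and pos: "0 < Re (q x)"
  shows "((\<lambda>x. arg_turn (q x)) has_derivative (\<lambda>v. Im (q' v / q x) / (2 * pi))) (at x within S)"
proof -
  have "q x \<notin> \<real>\<^sub>\<le>\<^sub>0" using pos by (auto simp: complex_nonpos_Reals_iff)
  from has_derivative_compose[OF q has_field_derivative_Ln[OF this, unfolded has_field_derivative_def]]
  have "((\<lambda>x. Ln (q x)) has_derivative (\<lambda>v. inverse (q x) * q' v)) (at x within S)" .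
  from bounded_linear.has_derivative[OF bounded_linear_divide bounded_linear.has_derivative[OF bounded_linear_Im this]]
  have "((\<lambda>x. Im (Ln (q x)) / (2 * pi)) has_derivative (\<lambda>v. Im (inverse (q x) * q' v) / (2 * pi))) (at x within S)" .
  moreover have "inverse (q x) * w = w / q x" for w by (simp only: divide_inverse mult.commute)
  ultimately show ?thesis by (simp only: arg_turn_def)
qed

lemma Im_scale: "Im (of_real h * z / w) = h * Im (z / w)"
proof -
  have "of_real h * z / w = of_real h * (z / w)" by simp
  then show ?thesis by (simp del: times_divide_eq_right)
qed

lemma arg_turn_scale: "r > 0 \<Longrightarrow> z \<noteq> 0 \<Longrightarrow> arg_turn (of_real r * z) = arg_turn z"
  by (simp add: arg_turn_def Ln_times_of_real)

lemma (in closed_manifold) continuous_on_charts: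
  fixes T :: "real set" and f :: "real \<times> 'm \<Rightarrow> 'b::topological_space"
  assumes "\<And>c. c \<in> A \<Longrightarrow> continuous_on (T \<times> fst c) f"
  shows "continuous_on (T \<times> UNIV) f"
  unfolding continuous_on_eq_continuous_within
proof
  fix q assume q: "q \<in> T \<times> (UNIV :: 'm set)"
  obtain c where c: "c \<in> A" "snd q \<in> fst c" using chart_at by blast
  have "continuous (at q within T \<times> fst c) f"
    by (rule bspec[OF assms[OF c(1), unfolded continuous_on_eq_continuous_within]]) (use q c in \<open>simp add: mem_Times_iff\<close>)
  moreover have "at q within T \<times> fst c = at q within T \<times> UNIV"
    by (rule at_within_nhd[of q "UNIV \<times> fst c"])
      (use c(2) chart_open[OF c(1)] in \<open>auto simp: mem_Times_iff intro!: open_Times\<close>)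
  ultimately show "continuous (at q within T \<times> UNIV) f" by simp
qed

lemma (in closed_manifold) frechet_transition:
  assumes f: "Ck_map (Suc 0) f" and c: "c \<in> A" "c' \<in> A" and p: "p \<in> fst c" "p \<in> fst c'"
  shows "frechet_derivative (\<lambda>y. f (chart_inv c y)) (at (snd c p)) v =
    frechet_derivative (\<lambda>y. f (chart_inv c' y)) (at (snd c' p)) (transition_deriv c c' p v)"
proof -
  have tp: "snd c' (chart_inv c (snd c p)) = snd c' p" by (simp add: inv_chart[OF c(1) p(1)])
  have "((\<lambda>y. f (chart_inv c' y)) has_derivative frechet_derivative (\<lambda>y. f (chart_inv c' y)) (at (snd c' p)))
      (at (snd c' (chart_inv c (snd c p))))"
    unfolding tp by (rule Ck_on_has_derivative[OF Ck_mapD[OF f c(2)] chart_in[OF c(2) p(2)]])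
  from diff_chain_at[OF transition_derivative[OF c p] this]
  have comp: "((\<lambda>y. f (chart_inv c' (snd c' (chart_inv c y)))) has_derivative
      (\<lambda>v. frechet_derivative (\<lambda>y. f (chart_inv c' y)) (at (snd c' p)) (transition_deriv c c' p v))) (at (snd c p))"
    by (simp add: o_def)
  have y: "snd c p \<in> overlap c c'" using p by (simp add: overlap_eq[OF c(1)])
  have "((\<lambda>y. f (chart_inv c y)) has_derivative
      (\<lambda>v. frechet_derivative (\<lambda>y. f (chart_inv c' y)) (at (snd c' p)) (transition_deriv c c' p v))) (at (snd c p))"
    by (rule has_derivative_transform_within_open[OF comp overlap_open[OF c] y])
      (simp add: overlap_def inv_chart[OF c(2)])
  from fun_cong[OF frechet_derivative_at[OF this], of v] show ?thesis by (rule sym)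
qed

lemma (in closed_manifold) frechet_continuous:
  assumes g: "Ck_map (Suc 0) g" and c: "c \<in> A"
    and y: "continuous_on S y" "\<And>s. s \<in> S \<Longrightarrow> y s \<in> chart_image c" and v: "continuous_on S v"
  shows "continuous_on S (\<lambda>s. frechet_derivative (\<lambda>y. g (chart_inv c y)) (at (y s)) (v s))"
proof -
  let ?D = "\<lambda>y. frechet_derivative (\<lambda>y. g (chart_inv c y)) (at y)"
  have "continuous_on S (\<lambda>s. \<Sum>l\<in>UNIV. v s $ l *\<^sub>R ?D (y s) (axis l 1))"
  proof (intro continuous_on_sum continuous_on_scaleR)
    show "continuous_on S (\<lambda>s. v s $ l)" for l using v by (intro continuous_intros)
    show "continuous_on S (\<lambda>s. ?D (y s) (axis l 1))" for l
      by (rule continuous_on_compose2[OF Ck_on_continuous_on[OF Ck_on_frechet[OF Ck_mapD[OF g c]]] y(1)]) (use y(2) in auto)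
  qed
  moreover have "(\<Sum>l\<in>UNIV. v s $ l *\<^sub>R ?D (y s) (axis l 1)) = ?D (y s) (v s)" if "s \<in> S" for s
    using linear_axis_expansion[OF has_derivative_linear[OF Ck_on_has_derivative[OF Ck_mapD[OF g c] y(2)[OF that]]], of "v s"] by simp
  ultimately show ?thesis by (rule continuous_on_eq)
qed

section \<open>Derivatives along Hamiltonian fields on the manifold and their integrals\<close>

context liouville_manifold
begin

definition fld :: "('m, 'k) chart \<Rightarrow> ('m \<Rightarrow> real) \<Rightarrow> (real, 'k) vec \<Rightarrow> (real, 'k) vec" where
  "fld c u = symplectic_domain.field (\<lambda>y. \<omega> c (chart_inv c y)) (\<lambda>y. u (chart_inv c y))"

lemma Ck_map_differentiable:
  "Ck_map (Suc 0) u \<Longrightarrow> c \<in> A \<Longrightarrow> y \<in> chart_image c \<Longrightarrow> (\<lambda>y. u (chart_inv c y)) differentiable (at y)"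
  using Ck_on_has_derivative[OF Ck_mapD] by (rule differentiableI)

lemma fld_eq:
  assumes "Ck_map (Suc 0) u" "c \<in> A" "p \<in> fst c"
  shows "\<omega> c p (fld c u (snd c p)) v = frechet_derivative (\<lambda>y. u (chart_inv c y)) (at (snd c p)) v"
  using symplectic_domain.field_eq[OF symplectic_chart[OF assms(2)] chart_in[OF assms(2,3)]
      Ck_map_differentiable[OF assms(1,2) chart_in[OF assms(2,3)]], of v]
  by (simp add: fld_def inv_chart[OF assms(2,3)])

text \<open>Both sides represent the differential of \<open>u\<close> against the form in the chart
  \<open>c'\<close>. Nondegeneracy makes the transition derivative injective, hence surjective, so
  testing on its image is enough.\<close>

lemma fld_transition:
  assumes u: "Ck_map (Suc 0) u" and c: "c \<in> A" "c' \<in> A" and p: "p \<in> fst c" "p \<in> fst c'"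
  shows "transition_deriv c c' p (fld c u (snd c p)) = fld c' u (snd c' p)"
proof -
  let ?T = "transition_deriv c c' p"
  interpret S: symplectic_domain "chart_image c" "\<lambda>y. \<omega> c (chart_inv c y)" n by (rule symplectic_chart[OF c(1)])
  interpret S': symplectic_domain "chart_image c'" "\<lambda>y. \<omega> c' (chart_inv c' y)" n by (rule symplectic_chart[OF c(2)])
  have y: "snd c p \<in> chart_image c" and y': "snd c' p \<in> chart_image c'"
    using chart_in[OF c(1) p(1)] chart_in[OF c(2) p(2)] .
  have ip: "chart_inv c (snd c p) = p" "chart_inv c' (snd c' p) = p"
    using inv_chart[OF c(1) p(1)] inv_chart[OF c(2) p(2)] .
  have inv: "\<omega> c p a b = \<omega> c' p (?T a) (?T b)" for a b by (rule smooth_tensor2D(3)[OF omega_tensor c p])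
  have lin: "linear ?T" by (rule has_derivative_linear[OF transition_derivative[OF c p]])
  have "inj ?T"
  proof (rule linear_injective_0[OF lin, THEN iffD2], intro allI impI)
    fix a assume a: "?T a = 0"
    have "\<omega> c p a b = 0" for b
      using inv[of a b] a linear_0[OF S'.lin1[OF y', of "?T b"]] by (simp add: ip)
    then show "a = 0" using S.nondeg[OF y, of a] by (simp add: ip)
  qed
  then have surj: "surj ?T" by (rule linear_inj_imp_surj[OF lin])
  have "?T (fld c u (snd c p)) = S'.field (\<lambda>y. u (chart_inv c' y)) (snd c' p)"
  proof (rule S'.field_unique[OF y' Ck_map_differentiable[OF u c(2) y']])
    fix v
    obtain a where a: "v = ?T a" using surj by (rule surjE)
    have "\<omega> c' p (?T (fld c u (snd c p))) (?T a) = frechet_derivative (\<lambda>y. u (chart_inv c y)) (at (snd c p)) a"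
      using fld_eq[OF u c(1) p(1), of a] inv by simp
    also have "\<dots> = frechet_derivative (\<lambda>y. u (chart_inv c' y)) (at (snd c' p)) (?T a)"
      by (rule frechet_transition[OF u c p])
    finally show "\<omega> c' (chart_inv c' (snd c' p)) (?T (fld c u (snd c p))) v =
        frechet_derivative (\<lambda>y. u (chart_inv c' y)) (at (snd c' p)) v"
      by (simp add: ip a)
  qed
  then show ?thesis by (simp add: fld_def)
qed

text \<open>The derivative of \<open>g\<close> along the Hamiltonian field of \<open>u\<close>, up
  to sign the Poisson bracket; vector-valued so that complex \<open>g\<close> is covered. The chart
  is chosen at each point, and \<open>poisson_chart\<close> removes the choice.\<close>

definition poisson :: "('m \<Rightarrow> real) \<Rightarrow> ('m \<Rightarrow> 'b::euclidean_space) \<Rightarrow> 'm \<Rightarrow> 'b" where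
  "poisson u g p = (let c = SOME c. c \<in> A \<and> p \<in> fst c in
     frechet_derivative (\<lambda>y. g (chart_inv c y)) (at (snd c p)) (fld c u (snd c p)))"

lemma poisson_chart:
  assumes u: "Ck_map (Suc 0) u" and g: "Ck_map (Suc 0) g" and c: "c \<in> A" "p \<in> fst c"
  shows "poisson u g p = frechet_derivative (\<lambda>y. g (chart_inv c y)) (at (snd c p)) (fld c u (snd c p))"
proof -
  define c' where "c' = (SOME c. c \<in> A \<and> p \<in> fst c)"
  have c': "c' \<in> A \<and> p \<in> fst c'" unfolding c'_def by (rule someI[of _ c]) (use c in simp)
  show ?thesis
    unfolding poisson_def Let_def c'_def[symmetric]
    using frechet_transition[OF g _ c(1) _ c(2), of c'] fld_transition[OF u _ c(1) _ c(2), of c'] c' by simp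
qed

lemma fld_continuous:
  assumes u: "Ck_map 2 u" and c: "c \<in> A"
  shows "continuous_on (chart_image c) (fld c u)"
proof -
  interpret S: symplectic_domain "chart_image c" "\<lambda>y. \<omega> c (chart_inv c y)" n by (rule symplectic_chart[OF c])
  have "Ck_on (Suc (Suc 0)) (\<lambda>y. u (chart_inv c y)) (chart_image c)"
    using Ck_mapD[OF u c] by (simp only: numeral_2_eq_2)
  from Ck_on_continuous_on[OF S.field_Ck[OF this]]
  have "continuous_on (chart_image c) (\<lambda>y. \<chi> j. fld c u y $ j)"
    unfolding fld_def by (rule continuous_on_vec_lambda)
  then show ?thesis by simp
qed

lemma Ck_map_Suc0: "Ck_map 2 u \<Longrightarrow> Ck_map (Suc 0) u"
  unfolding Ck_map_def by (rule ballI, rule Ck_on_le[of 2], erule bspec, assumption, simp)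

lemma poisson_continuous:
  assumes u: "Ck_map 2 u" and g: "Ck_map (Suc 0) g"
  shows "continuous_on UNIV (poisson u g)"
proof -
  have "continuous_on (\<Union>c\<in>A. fst c) (poisson u g)"
  proof (rule continuous_on_open_UN)
    fix c assume c: "c \<in> A"
    show "open (fst c)" by (rule chart_open[OF c])
    have "continuous_on (fst c) (\<lambda>p. frechet_derivative (\<lambda>y. g (chart_inv c y)) (at (snd c p)) (fld c u (snd c p)))"
      by (rule frechet_continuous[OF g c chart_cont[OF c] chart_in[OF c]])
        (auto intro: continuous_on_compose2[OF fld_continuous[OF u c] chart_cont[OF c]] chart_in[OF c])
    then show "continuous_on (fst c) (poisson u g)"
      by (rule continuous_on_eq) (simp add: poisson_chart[OF Ck_map_Suc0[OF u] g c])
  qed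
  moreover have "(\<Union>c\<in>A. fst c) = UNIV" using chart_at by blast
  ultimately show ?thesis by simp
qed

lemma poisson_zero:
  assumes u: "Ck_map (Suc 0) u" and g: "Ck_map (Suc 0) g" and U: "open U" "p \<in> U" "\<And>q. q \<in> U \<Longrightarrow> u q = 0"
  shows "poisson u g p = 0"
proof -
  obtain c where c: "c \<in> A" "p \<in> fst c" using chart_at by blast
  have "frechet_derivative (\<lambda>y. u (chart_inv c y)) (at (snd c p)) = frechet_derivative (\<lambda>y. 0) (at (snd c p))"
    by (rule frechet_derivative_cong_open[OF open_inv_vimage[OF c(1) U(1)]])
      (use U(2,3) chart_in[OF c] inv_chart[OF c] in auto)
  then have "fld c u (snd c p) = 0"
    by (simp add: fld_def symplectic_domain.field_def[OF symplectic_chart[OF c(1)]] vec_eq_iff)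
  then show ?thesis
    using linear_0[OF has_derivative_linear[OF Ck_on_has_derivative[OF Ck_mapD[OF g c(1)] chart_in[OF c]]]]
    by (simp add: poisson_chart[OF u g c])
qed

lemma poisson_sum:
  assumes u: "\<And>i. i \<in> I \<Longrightarrow> Ck_map (Suc 0) (u i)" and g: "Ck_map (Suc 0) g"
  shows "poisson (\<lambda>p. \<Sum>i\<in>I. u i p) g p = (\<Sum>i\<in>I. poisson (u i) g p)"
proof -
  have S: "Ck_map (Suc 0) (\<lambda>p. \<Sum>i\<in>I. u i p)" by (rule Ck_map_sum[OF u])
  obtain c where c: "c \<in> A" "p \<in> fst c" using chart_at by blast
  have "((\<lambda>y. \<Sum>i\<in>I. u i (chart_inv c y)) has_derivative
      (\<lambda>v. \<Sum>i\<in>I. frechet_derivative (\<lambda>y. u i (chart_inv c y)) (at (snd c p)) v)) (at (snd c p))"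
    by (rule has_derivative_sum) (rule Ck_on_has_derivative[OF Ck_mapD[OF u c(1)] chart_in[OF c]])
  from fun_cong[OF frechet_derivative_at[OF this, symmetric]]
  have "fld c (\<lambda>p. \<Sum>i\<in>I. u i p) (snd c p) = (\<Sum>i\<in>I. fld c (u i) (snd c p))"
    by (simp add: fld_def symplectic_domain.field_def[OF symplectic_chart[OF c(1)]] vec_eq_iff sum_component)
  moreover have "linear (frechet_derivative (\<lambda>y. g (chart_inv c y)) (at (snd c p)))"
    by (rule has_derivative_linear[OF Ck_on_has_derivative[OF Ck_mapD[OF g c(1)] chart_in[OF c]]])
  ultimately show ?thesis
    using poisson_chart[OF S g c] poisson_chart[OF u g c] by (simp add: linear_sum)
qed

text \<open>On a small set a branch of the argument of \<open>g\<close> is a primitive of \<open>Im (dg / g)\<close>; cutting \<open>u\<close> into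
  pieces with small support reduces the claim to the divergence theorem in a chart.\<close>

lemma integral_poisson:
  fixes g :: "'m \<Rightarrow> complex"
  assumes u: "Ck_map 2 u" and g: "Ck_map (Suc 0) g" and nz: "\<And>p. g p \<noteq> 0"
  shows "(\<integral>p. Im (poisson u g p / g p) \<partial>\<mu>) = 0"
proof -
  have gc: "continuous_on UNIV g" by (rule Ck_map_continuous[OF g])
  \<comment> \<open>On \<open>N q\<close> the quotient \<open>g p / g q\<close> has positive real
    part, so its principal argument is a differentiable branch there.\<close>
  define N where "N q = {p. norm (g p / g q - 1) < 1}" for q
  have No: "open (N q)" for q unfolding N_def
    by (intro open_Collect_less continuous_intros gc) (use nz in auto)
  have Nq: "q \<in> N q" for q by (simp add: N_def nz)
  obtain I \<eta> cc rr where fin: "finite (I :: 'm set)"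
    and cc: "\<And>i. i \<in> I \<Longrightarrow> cc i \<in> A \<and> i \<in> fst (cc i) \<and> rr i > 0 \<and> cball (snd (cc i) i) (rr i) \<subseteq> chart_image (cc i)
        \<and> chart_inv (cc i) ` cball (snd (cc i) i) (rr i) \<subseteq> N i"
    and \<eta>: "\<And>i. i \<in> I \<Longrightarrow> Ck_map 2 (\<eta> i)" "\<And>i p. 0 \<le> \<eta> i p" "\<And>p. (\<Sum>i\<in>I. \<eta> i p) = (1::real)"
    and supp: "\<And>i p. i \<in> I \<Longrightarrow> \<eta> i p \<noteq> 0 \<Longrightarrow> p \<in> chart_inv (cc i) ` cball (snd (cc i) i) (rr i)"
    by (rule partition_of_unity[OF No Nq]) (rule that; simp)
  define v where "v i p = \<eta> i p * u p" for i p
  have vC: "Ck_map 2 (v i)" if "i \<in> I" for i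
    unfolding v_def[abs_def] by (rule Ck_map_mult[OF \<eta>(1)[OF that] u])
  note vC1 = Ck_map_Suc0[OF vC]
  define \<psi> where "\<psi> i p = Im (poisson (v i) g p / g p)" for i p
  have \<psi>c: "continuous_on UNIV (\<psi> i)" if "i \<in> I" for i
    unfolding \<psi>_def[abs_def] by (intro continuous_intros poisson_continuous[OF vC[OF that] g] gc) (simp add: nz)
  have fm: "finite_measure \<mu>" by (rule finite_liouville)
  have int: "integrable \<mu> (\<psi> i)" if i: "i \<in> I" for i
  proof -
    have "bounded (\<psi> i ` UNIV)" by (rule compact_imp_bounded[OF compact_continuous_image[OF \<psi>c[OF i] cpt]])
    then obtain b where "\<forall>y\<in>\<psi> i ` UNIV. norm y \<le> b" unfolding bounded_iff by (elim exE)
    then have b: "norm (\<psi> i p) \<le> b" for p by (rule bspec[OF _ imageI[OF UNIV_I]])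
    have "\<psi> i \<in> borel_measurable \<mu>"
      using borel_measurable_continuous_onI[OF \<psi>c[OF i]] measurable_cong_sets[OF sets_liouville refl, of borel] by auto
    then show ?thesis by (intro finite_measure.integrable_const_bound[OF fm, where B=b] AE_I2 b)
  qed
  have zero: "integral\<^sup>L \<mu> (\<psi> i) = 0" if i: "i \<in> I" for i
  proof -
    define c where "c = cc i"
    define K where "K = cball (snd c i) (rr i)"
    have c: "c \<in> A" and KV: "K \<subseteq> chart_image c" and KN: "chart_inv c ` K \<subseteq> N i"
      using cc[OF i] by (simp_all add: c_def K_def)
    interpret S: symplectic_domain "chart_image c" "\<lambda>y. \<omega> c (chart_inv c y)" n by (rule symplectic_chart[OF c])
    have Kc: "compact K" by (simp add: K_def)
    have clK: "closed (chart_inv c ` K)" by (rule compact_imp_closed[OF compact_chart_inv_image[OF c Kc KV]])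
    define Ni where "Ni = {y \<in> chart_image c. chart_inv c y \<in> N i}"
    have Ni: "open Ni" "Ni \<subseteq> chart_image c" "K \<subseteq> Ni"
      using open_inv_vimage[OF c No] KN KV by (auto simp: Ni_def)
    have v0: "v i p = 0" if "p \<notin> chart_inv c ` K" for p
      using supp[OF i, of p] that by (auto simp: v_def c_def K_def)
    have \<psi>0: "p \<in> chart_inv c ` K" if "\<psi> i p \<noteq> 0" for p
    proof (rule ccontr)
      assume p: "p \<notin> chart_inv c ` K"
      have "poisson (v i) g p = 0"
        by (rule poisson_zero[OF vC1[OF i] g, of "- (chart_inv c ` K)"]) (use clK p v0 in auto)
      then show False using that by (simp add: \<psi>_def)
    qed
    define q where "q y = g (chart_inv c y) / g i" for y
    define k where "k y = arg_turn (q y)" for y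
    let ?D = "\<lambda>y. frechet_derivative (\<lambda>y. g (chart_inv c y)) (at y)"
    have kD: "(k has_derivative (\<lambda>w. Im (?D y w / g (chart_inv c y)) / (2 * pi))) (at y)" if y: "y \<in> Ni" for y
    proof -
      have yV: "y \<in> chart_image c" and yN: "norm (q y - 1) < 1" using y by (auto simp: Ni_def N_def q_def)
      have "((\<lambda>y. g (chart_inv c y) / g i) has_derivative (\<lambda>w. ?D y w / g i)) (at y)"
        by (rule bounded_linear.has_derivative[OF bounded_linear_divide Ck_on_has_derivative[OF Ck_mapD[OF g c] yV]])
      then have "(q has_derivative (\<lambda>w. ?D y w / g i)) (at y)" unfolding q_def[abs_def] .
      from arg_turn_has_derivative[OF this near_one_Re[OF yN]]
      show ?thesis unfolding k_def[abs_def] by (simp add: q_def nz)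
    qed
    have kC: "Ck_on (Suc 0) k Ni"
    proof (rule Ck_on_SucI[OF Ni(1) kD])
      fix w
      have "continuous_on Ni (\<lambda>y. Im (?D y w / g (chart_inv c y)) / (2 * pi))"
        by (intro continuous_intros frechet_continuous[OF g c] continuous_on_compose2[OF gc continuous_on_subset[OF inv_cont[OF c] Ni(2)]])
          (use Ni(2) nz in auto)
      then show "Ck_on 0 (\<lambda>y. Im (?D y w / g (chart_inv c y)) / (2 * pi)) Ni" by simp
    qed
    have F0: "v i (chart_inv c y) = 0" if y: "y \<in> chart_image c - K" for y
    proof (rule v0)
      show "chart_inv c y \<notin> chart_inv c ` K"
      proof
        assume "chart_inv c y \<in> chart_inv c ` K"
        then obtain y' where y': "y' \<in> K" "chart_inv c y = chart_inv c y'" by blast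
        then have "y = y'" using chart_inv_eq[OF c, of y] chart_inv_eq[OF c, of y'] y KV by auto
        then show False using y y' by simp
      qed
    qed
    have "integral\<^sup>L \<mu> (\<psi> i) = (LINT y:K|lborel. \<psi> i (chart_inv c y) * dens c y)"
      by (rule integral_chart[OF c _ KV borel_measurable_continuous_onI[OF \<psi>c[OF i]] \<psi>0]) (use compact_imp_closed[OF Kc] in auto)
    also have "\<dots> = (LINT y:K|lborel. (2 * pi) * (frechet_derivative k (at y) (S.field (\<lambda>y. v i (chart_inv c y)) y) * S.rho y))"
    proof (rule set_lebesgue_integral_cong, goal_cases)
      case 1
      show ?case using compact_imp_closed[OF Kc] by simp
    next
      case 2
      show ?case
      proof (intro allI impI)
        fix y assume y: "y \<in> K"
        then have yV: "y \<in> chart_image c" and yN: "y \<in> Ni" using KV Ni(3) by auto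
        have "frechet_derivative k (at y) w = Im (?D y w / g (chart_inv c y)) / (2 * pi)" for w
          using fun_cong[OF frechet_derivative_at[OF kD[OF yN]], of w] by simp
        then show "\<psi> i (chart_inv c y) * dens c y = (2 * pi) * (frechet_derivative k (at y) (S.field (\<lambda>y. v i (chart_inv c y)) y) * S.rho y)"
          using poisson_chart[OF vC1[OF i] g c inv_in[OF c yV]] chart_inv_eq[OF c yV]
          by (simp add: \<psi>_def dens_eq[OF c] fld_def)
      qed
    qed
    also have "\<dots> = (2 * pi) * (LINT y:K|lborel. frechet_derivative k (at y) (S.field (\<lambda>y. v i (chart_inv c y)) y) * S.rho y)"
      by (rule set_integral_mult_right)
    also have "\<dots> = 0"
      using S.integral_derivative_along_field[OF Ni(1,2) Kc Ni(3) Ck_mapD[OF vC[OF i] c] F0 kC] by simp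
    finally show ?thesis .
  qed
  have "Im (poisson u g p / g p) = (\<Sum>i\<in>I. \<psi> i p)" for p
  proof -
    have "(\<lambda>p. \<Sum>i\<in>I. v i p) = u" using \<eta>(3) by (simp add: fun_eq_iff v_def sum_distrib_right[symmetric])
    then have "poisson u g p = (\<Sum>i\<in>I. poisson (v i) g p)" using poisson_sum[where u=v and I=I and p=p, OF vC1 g] by simp
    then show ?thesis by (simp add: \<psi>_def sum_divide_distrib)
  qed
  then have "(\<integral>p. Im (poisson u g p / g p) \<partial>\<mu>) = (\<Sum>i\<in>I. integral\<^sup>L \<mu> (\<psi> i))"
    using int by (simp add: Bochner_Integration.integral_sum)
  then show ?thesis using zero by simp
qed

end

section \<open>The mass flow along a Hamiltonian flow\<close>

context hamiltonian_flow
begin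

lemma Ck_map_H: "t \<in> {0..1} \<Longrightarrow> Ck_map k (H t)"
  unfolding Ck_map_def using H_Ck by blast

lemma fld_H: "fld c (H t) = X c t" by (simp add: fld_def X_def)

lemma poisson_H_continuous:
  assumes g: "Ck_map (Suc 0) g"
  shows "continuous_on ({0..1} \<times> UNIV) (\<lambda>q. poisson (H (fst q)) g (snd q))"
proof (rule continuous_on_charts)
  fix c assume c: "c \<in> A"
  have sc: "continuous_on ({0..1::real} \<times> fst c) (\<lambda>q. snd c (snd q))"
    by (rule continuous_on_compose2[OF chart_cont[OF c]]) (auto intro!: continuous_intros)
  have "continuous_on ({0..1} \<times> fst c) (\<lambda>q. frechet_derivative (\<lambda>y. g (chart_inv c y)) (at (snd c (snd q))) (X c (fst q) (snd c (snd q))))"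
  proof (rule frechet_continuous[OF g c sc])
    show "continuous_on ({0..1} \<times> fst c) (\<lambda>q. X c (fst q) (snd c (snd q)))"
      by (rule continuous_on_compose2[OF X_continuous[OF c] continuous_on_Pair[OF continuous_on_fst[OF continuous_on_id] sc], simplified])
        (use chart_in[OF c] in auto)
  qed (use chart_in[OF c] in auto)
  then show "continuous_on ({0..1} \<times> fst c) (\<lambda>q. poisson (H (fst q)) g (snd q))"
    by (rule continuous_on_eq) (auto simp: poisson_chart[OF Ck_map_H g c] fld_H)
qed

lemma flow_function_derivative:
  assumes g: "Ck_map (Suc 0) g" and t: "t \<in> {0..1}"
  shows "((\<lambda>s. g (\<phi> s x)) has_vector_derivative poisson (H t) g (\<phi> t x)) (at t within {0..1})"
proof -
  obtain c where c: "c \<in> A" "\<phi> t x \<in> fst c" using chart_at by blast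
  let ?D = "frechet_derivative (\<lambda>y. g (chart_inv c y)) (at (snd c (\<phi> t x)))"
  have D: "((\<lambda>y. g (chart_inv c y)) has_derivative ?D) (at (snd c (\<phi> t x)))"
    by (rule Ck_on_has_derivative[OF Ck_mapD[OF g c(1)] chart_in[OF c]])
  have "((\<lambda>s. g (chart_inv c (snd c (\<phi> s x)))) has_derivative (\<lambda>h. ?D (h *\<^sub>R X c t (snd c (\<phi> t x))))) (at t within {0..1})"
    by (rule has_derivative_compose[OF flow_has_derivative[OF c(1) t c(2), unfolded has_vector_derivative_def] D])
  then have 1: "((\<lambda>s. g (chart_inv c (snd c (\<phi> s x)))) has_vector_derivative poisson (H t) g (\<phi> t x)) (at t within {0..1})"
    unfolding has_vector_derivative_def
    by (simp add: linear_cmul[OF has_derivative_linear[OF D]] poisson_chart[OF Ck_map_H[OF t] g c] fld_H)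
  obtain e where e: "e > 0" "\<And>s. s \<in> {0..1} \<Longrightarrow> dist s t < e \<Longrightarrow> \<phi> s x \<in> fst c"
  proof -
    have "continuous (at t within {0..1}) (\<lambda>s. \<phi> s x)"
      using flow_continuous[of x] t by (simp add: continuous_on_eq_continuous_within)
    then have "\<forall>\<^sub>F s in at t within {0..1}. \<phi> s x \<in> fst c"
      unfolding continuous_within by (rule topological_tendstoD) (use chart_open[OF c(1)] c(2) in auto)
    then obtain e where "e > 0" "\<forall>s\<in>{0..1}. s \<noteq> t \<and> dist s t < e \<longrightarrow> \<phi> s x \<in> fst c"
      unfolding eventually_at by (elim exE conjE)
    then show ?thesis using c(2) by (intro that[of e]) auto
  qed
  show ?thesis
    by (rule has_vector_derivative_transform_within[OF 1 e(1) t]) (use e(2) inv_chart[OF c(1)] in auto)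
qed

text \<open>A circle map is only continuous, so it is first replaced by the normalisation
  \<open>f'\<close> of a nearby C^2 map \<open>g\<close>, with the same mass flow. Where the orbit
  passes, the lift of \<open>f'\<close> moves at the speed \<beta>, the derivative of the argument
  of \<open>g\<close> along the field, and this has integral 0 at every time.\<close>

theorem path_mass_flow_zero:
  assumes f: "f \<in> circle_maps"
  shows "path_mass_flow \<mu> \<phi> f = 0"
proof -
  have fc: "continuous_on UNIV f" and f1: "norm (f p) = 1" for p using circle_mapsD[OF f] by auto
  \<comment> \<open>With 1/4 for each of the passages from \<open>f\<close> to \<open>g\<close> and
    from \<open>g\<close> to \<open>f'\<close>, the map \<open>f'\<close> stays within 1/2 of
    \<open>f\<close>, as \<open>path_mass_flow_circle_close\<close> permits; \<open>g\<close> also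
    stays away from 0.\<close>
  obtain g where g: "Ck_map 2 g" "\<And>p. norm (g p - f p) \<le> 1/4"
  proof -
    define N where "N q = {p. norm (f p - f q) < 1/4}" for q
    have No: "open (N q)" for q unfolding N_def by (intro open_Collect_less continuous_intros fc)
    have Nq: "q \<in> N q" for q by (simp add: N_def)
    obtain I \<eta> cc rr where fin: "finite (I :: 'm set)"
      and cc: "\<And>i. i \<in> I \<Longrightarrow> cc i \<in> A \<and> i \<in> fst (cc i) \<and> rr i > 0 \<and> cball (snd (cc i) i) (rr i) \<subseteq> chart_image (cc i)
          \<and> chart_inv (cc i) ` cball (snd (cc i) i) (rr i) \<subseteq> N i"
      and \<eta>: "\<And>i. i \<in> I \<Longrightarrow> Ck_map 2 (\<eta> i)" "\<And>i p. 0 \<le> \<eta> i p" "\<And>p. (\<Sum>i\<in>I. \<eta> i p) = (1::real)"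
      and supp: "\<And>i p. i \<in> I \<Longrightarrow> \<eta> i p \<noteq> 0 \<Longrightarrow> p \<in> chart_inv (cc i) ` cball (snd (cc i) i) (rr i)"
      by (rule partition_of_unity[OF No Nq]) (rule that; simp)
    define g where "g p = (\<Sum>i\<in>I. \<eta> i p *\<^sub>R f i)" for p
    have "Ck_map 2 g" unfolding g_def[abs_def]
      by (rule Ck_map_sum, rule Ck_map_scaleR[OF \<eta>(1) Ck_map_const])
    moreover have "norm (g p - f p) \<le> 1/4" for p
    proof -
      have "g p - f p = (\<Sum>i\<in>I. \<eta> i p *\<^sub>R (f i - f p))"
        using \<eta>(3)[of p] by (simp add: g_def scaleR_diff_right sum_subtractf scaleR_left.sum[symmetric])
      also have "norm \<dots> \<le> (\<Sum>i\<in>I. \<eta> i p * (1/4))"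
      proof (rule order_trans[OF norm_sum sum_mono])
        fix i assume i: "i \<in> I"
        show "norm (\<eta> i p *\<^sub>R (f i - f p)) \<le> \<eta> i p * (1/4)"
        proof (cases "\<eta> i p = 0")
          case False
          have "p \<in> N i" using supp[OF i False] cc[OF i] by blast
          then have "norm (f i - f p) \<le> 1/4" by (simp add: N_def norm_minus_commute)
          from mult_left_mono[OF this \<eta>(2)[of i p]] show ?thesis using \<eta>(2)[of i p] by simp
        qed simp
      qed
      also have "\<dots> = (\<Sum>i\<in>I. \<eta> i p) * (1/4)" by (rule sum_distrib_right[symmetric])
      also have "\<dots> = 1/4" using \<eta>(3)[of p] by simp
      finally show ?thesis .
    qed
    ultimately show thesis by (rule that)
  qed
  note g1 = Ck_map_Suc0[OF g(1)]
  have gc: "continuous_on UNIV g" by (rule Ck_map_continuous[OF g(1)])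
  have gn: "\<bar>norm (g p) - 1\<bar> \<le> 1/4" for p
    using norm_triangle_ineq3[of "g p" "f p"] g(2)[of p] f1[of p] by simp
  have gnz: "norm (g p) > 0" "g p \<noteq> 0" for p using gn[of p] by auto
  define f' where "f' p = g p / of_real (norm (g p))" for p
  have f'1: "norm (f' p) = 1" for p using gnz[of p] by (simp add: f'_def norm_divide)
  have f': "f' \<in> circle_maps"
    by (rule circle_mapsI[OF _ f'1]) (auto simp: f'_def[abs_def] gnz intro!: continuous_intros gc)
  have near: "norm (f' p - f p) < 1" for p
  proof -
    have "f' p - g p = of_real (1 - norm (g p)) * f' p" using gnz[of p] by (simp add: f'_def field_simps)
    then have "norm (f' p - g p) = \<bar>1 - norm (g p)\<bar>" by (simp add: norm_mult f'1 del: of_real_diff)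
    then have "norm (f' p - g p) \<le> 1/4" using gn[of p] by (simp only: abs_minus_commute[of 1])
    then show ?thesis using norm_triangle_ineq[of "f' p - g p" "g p - f p"] g(2)[of p] by simp
  qed
  have pm: "path_mass_flow \<mu> \<phi> f = path_mass_flow \<mu> \<phi> f'"
    using path_mass_flow_circle_close[OF flow_path flow_0 flow_Homeo_vol f f' near] by simp
  obtain F where F: "is_flow_lift \<phi> f' F" by (rule flow_lift_exists[OF flow_path flow_0 f'])
  define \<beta> where "\<beta> t p = Im (poisson (H t) g p / g p) / (2 * pi)" for t p
  \<comment> \<open>Near time \<open>t\<close> the lift moves by less than 1/2 and so differs from
    \<open>F (t, x)\<close> by a principal argument. Replacing \<open>f'\<close> by \<open>g\<close>
    in the quotient only rescales it by a positive number.\<close>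
  have der: "((\<lambda>s. F (s, x)) has_vector_derivative \<beta> t (\<phi> t x)) (at t within {0..1})" if t: "t \<in> {0..1}" for t x
  proof -
    define q where "q s = g (\<phi> s x) / g (\<phi> t x)" for s
    have "(q has_derivative (\<lambda>h. (h *\<^sub>R poisson (H t) g (\<phi> t x)) / g (\<phi> t x))) (at t within {0..1})"
      unfolding q_def[abs_def]
      by (rule bounded_linear.has_derivative[OF bounded_linear_divide flow_function_derivative[OF g1 t, unfolded has_vector_derivative_def]])
    from arg_turn_has_derivative[OF this]
    have "((\<lambda>s. arg_turn (q s)) has_derivative (\<lambda>h. h *\<^sub>R \<beta> t (\<phi> t x))) (at t within {0..1})"
      by (simp add: q_def gnz \<beta>_def scaleR_conv_of_real Im_scale)
    then have 1: "((\<lambda>s. F (t, x) + arg_turn (q s)) has_vector_derivative \<beta> t (\<phi> t x)) (at t within {0..1})"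
      unfolding has_vector_derivative_def by (rule has_derivative_add_const[OF _, of _ _ _ "F (t, x)", simplified add.commute[of _ "F (t, x)"]])
    have "continuous_on {0..1} (\<lambda>s. F (s, x))" using is_flow_lift_slice[OF F] by blast
    then obtain e where e: "e > 0" "\<And>s. s \<in> {0..1} \<Longrightarrow> dist s t < e \<Longrightarrow> \<bar>F (s, x) - F (t, x)\<bar> < 1/2"
      unfolding continuous_on_iff dist_real_def using t by (metis half_gt_zero_iff zero_less_one)
    show ?thesis
    proof (rule has_vector_derivative_transform_within[OF 1 e(1) t])
      fix s assume s: "s \<in> {0..1}" "dist s t < e"
      let ?r = "norm (g (\<phi> t x)) / norm (g (\<phi> s x))"
      have "cis (2 * pi * (F (s, x) - F (t, x))) = cis (2 * pi * F (s, x)) / cis (2 * pi * F (t, x))"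
        by (simp add: cis_divide right_diff_distrib)
      also have "\<dots> = f' (\<phi> s x) / f' (\<phi> t x)"
        using is_flow_liftD(1)[OF F] s(1) t circle_mapsD(3)[OF f'] by simp
      also have "\<dots> = of_real ?r * q s" by (simp add: f'_def q_def)
      finally have "arg_turn (of_real ?r * q s) = F (s, x) - F (t, x)" using arg_turn_cis[OF e(2)[OF s]] by simp
      moreover have "arg_turn (of_real ?r * q s) = arg_turn (q s)"
        by (rule arg_turn_scale) (use gnz in \<open>simp_all add: q_def\<close>)
      ultimately show "F (t, x) + arg_turn (q s) = F (s, x)" by simp
    qed
  qed
  have \<beta>c: "continuous_on UNIV (\<beta> t)" if "t \<in> {0..1}" for t
    unfolding \<beta>_def[abs_def] by (intro continuous_intros poisson_continuous[OF Ck_map_H[OF that] g1] gc) (use gnz in auto)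
  have "continuous_on ({0..1} \<times> UNIV) (\<lambda>q. \<beta> (fst q) (\<phi> (fst q) (snd q)))"
  proof -
    have j: "continuous_on ({0..1} \<times> UNIV) (\<lambda>q. \<phi> (fst q) (snd q))"
      using cpaths_continuous[OF flow_path] by (simp add: case_prod_unfold)
    have "continuous_on ({0..1} \<times> UNIV) (\<lambda>q. (fst q, \<phi> (fst q) (snd q)))"
      by (intro continuous_on_Pair continuous_on_fst continuous_on_id j)
    from continuous_on_compose2[OF poisson_H_continuous[OF g1] this]
    have "continuous_on ({0..1} \<times> UNIV) (\<lambda>q. poisson (H (fst q)) g (\<phi> (fst q) (snd q)))"
      by (simp add: image_subset_iff mem_Times_iff)
    then show ?thesis unfolding \<beta>_def
      by (intro continuous_intros continuous_on_compose2[OF gc j]) (use gnz in auto)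
  qed
  note unif = uniform_in_time[OF compact_UNIV this]
  \<comment> \<open>Invariance of \<mu> under \<open>\<phi> t\<close> removes the flow from the
    integral, and \<open>integral_poisson\<close> does the rest.\<close>
  have \<beta>0: "(\<integral>x. \<beta> t (\<phi> t x) \<partial>\<mu>) = 0" if t: "t \<in> {0..1}" for t
  proof -
    have "integral\<^sup>L \<mu> (\<beta> t) = 0"
      using integral_poisson[OF Ck_map_H[OF t] g1 gnz(2)] by (simp add: \<beta>_def[abs_def])
    then show ?thesis using integral_Homeo_vol[OF flow_Homeo_vol[OF t] \<beta>c[OF t]] by simp
  qed
  have Fc: "continuous_on UNIV (\<lambda>x. F (t, x))" if "t \<in> {0..1}" for t
  proof -
    have "continuous_on ({0..1} \<times> UNIV) F" using F unfolding is_flow_lift_def by blast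
    then show ?thesis by (rule continuous_on_compose2) (use that in \<open>auto intro!: continuous_intros\<close>)
  qed
  define G where "G t = (\<integral>x. F (t, x) \<partial>\<mu>)" for t
  \<comment> \<open>Differentiation under the integral sign: over a short interval \<open>F\<close>
    moves by \<open>(b - a) * \<beta> a (\<phi> a x)\<close> up to \<open>e' * (b - a)\<close>,
    uniformly in \<open>x\<close>, and the leading term integrates to 0.\<close>
  have Gd: "(G has_derivative (\<lambda>h. 0)) (at t within {0..1})" if t: "t \<in> {0..1}" for t
    unfolding has_derivative_within_alt
  proof (intro conjI allI impI)
    fix e :: real assume e: "e > 0"
    let ?m = "measure \<mu> UNIV"
    define e' where "e' = e / (?m + 1)"
    have m: "0 \<le> ?m" by simp
    have "0 < ?m + 1" using m by linarith
    then have e': "e' > 0" unfolding e'_def using e by (rule divide_pos_pos[rotated])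
    have "e / (b + 1) * b \<le> e" if "0 \<le> b" for b :: real using that e by (simp add: field_simps)
    from this[OF m] have e'm: "e' * ?m \<le> e" by (simp add: e'_def)
    from unif[OF e'] obtain r where r: "r > 0" "\<forall>s\<in>{0..1}. \<forall>t\<in>{0..1}. \<bar>s - t\<bar> < r \<longrightarrow>
        (\<forall>x\<in>UNIV. dist (\<beta> s (\<phi> s x)) (\<beta> t (\<phi> t x)) < e')" by auto
    have step: "\<bar>G b - G a\<bar> \<le> e * (b - a)" if ab: "a \<in> {0..1}" "b \<in> {0..1}" "a \<le> b" "b - a < r" for a b
    proof -
      have pw: "\<bar>(F (b, x) - F (a, x)) - (b - a) * \<beta> a (\<phi> a x)\<bar> \<le> e' * (b - a)" for x
      proof -
        define w where "w s = F (s, x) - s *\<^sub>R \<beta> a (\<phi> a x)" for s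
        have "norm (w b - w a) \<le> e' * (b - a)"
        proof (rule curve_speed_bound[OF ab(3)])
          fix s assume s: "s \<in> {a..b}"
          have s1: "s \<in> {0..1}" and sr: "\<bar>s - a\<bar> < r" using s ab by auto
          have "((\<lambda>s. F (s, x)) has_vector_derivative \<beta> s (\<phi> s x)) (at s within {a..b})"
            by (rule has_vector_derivative_within_subset[OF der[OF s1]]) (use ab in auto)
          then have "(w has_vector_derivative \<beta> s (\<phi> s x) - \<beta> a (\<phi> a x)) (at s within {a..b})"
            unfolding w_def[abs_def] by (rule has_vector_derivative_diff) (auto intro!: derivative_eq_intros)
          moreover have "norm (\<beta> s (\<phi> s x) - \<beta> a (\<phi> a x)) \<le> e'"
            using r(2)[rule_format, OF s1 ab(1) sr, of x] by (simp add: dist_norm)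
          ultimately show "\<exists>v. (w has_vector_derivative v) (at s within {a..b}) \<and> norm v \<le> e'" by blast
        qed
        then show ?thesis by (simp add: w_def algebra_simps)
      qed
      have \<beta>\<phi>: "continuous_on UNIV (\<lambda>x. \<beta> a (\<phi> a x))"
        by (rule continuous_on_compose2[OF \<beta>c[OF ab(1)] HomeoD(1)[OF flow_Homeo[OF ab(1)]]]) auto
      have "\<bar>(\<integral>x. F (b, x) - F (a, x) \<partial>\<mu>) - (\<integral>x. (b - a) * \<beta> a (\<phi> a x) \<partial>\<mu>)\<bar> \<le> (e' * (b - a)) * ?m"
        by (rule abs_integral_diff_le[OF _ _ pw]) (intro continuous_intros Fc ab \<beta>\<phi>)+
      moreover have "(\<integral>x. (b - a) * \<beta> a (\<phi> a x) \<partial>\<mu>) = 0" using \<beta>0[OF ab(1)] by simp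
      moreover have "(\<integral>x. F (b, x) - F (a, x) \<partial>\<mu>) = G b - G a"
        unfolding G_def by (rule Bochner_Integration.integral_diff) (intro integrable_continuous Fc ab)+
      moreover have "(e' * (b - a)) * ?m \<le> e * (b - a)"
        using mult_right_mono[OF e'm, of "b - a"] ab(3) by (simp add: algebra_simps)
      ultimately show ?thesis by linarith
    qed
    show "\<exists>\<delta>>0. \<forall>y\<in>{0..1}. norm (y - t) < \<delta> \<longrightarrow> norm (G y - G t - 0) \<le> e * norm (y - t)"
    proof (intro exI[of _ r] conjI r(1) ballI impI)
      fix y assume y: "y \<in> {0..1}" "norm (y - t) < r"
      show "norm (G y - G t - 0) \<le> e * norm (y - t)"
        using step[OF t y(1)] step[OF y(1) t] y(2) by (cases "t \<le> y") auto
    qed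
  qed simp
  have "\<exists>b. \<forall>t\<in>{0..1}. G t = b" by (rule has_derivative_zero_constant[OF convex_real_interval(5) Gd])
  then have "G 1 = G 0" by force
  also have "G 0 = 0" using is_flow_liftD(2)[OF F] by (simp add: G_def)
  finally show ?thesis using path_mass_flow_eq[OF F f'] pm by (simp add: G_def)
qed

end

section \<open>The completed space of Hamiltonians\<close>

lemma INF_eq_uminus_SUP: "(INF x. u x :: real) = - (SUP x. - u x)"
  by (simp add: Inf_real_def image_image)

lemma ham_norm_uminus: "ham_norm (\<lambda>t x. - u t x) = ham_norm u"
  unfolding ham_norm_def INF_eq_uminus_SUP by (simp add: add.commute)

lemma ham_dist_sym: "ham_dist H K = ham_dist K H"
  using ham_norm_uminus[of "\<lambda>t x. H t x - K t x"] by (simp add: ham_dist_def)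

lemma ham_dist_refl: "ham_dist H H = 0"
  by (simp add: ham_dist_def ham_norm_def)

context closed_manifold
begin

definition jointly_continuous :: "(real \<Rightarrow> 'm \<Rightarrow> real) \<Rightarrow> bool" where
  "jointly_continuous u \<longleftrightarrow> continuous_on ({0..1} \<times> UNIV) (\<lambda>q. u (fst q) (snd q))"

lemma jointly_continuous_normalized:
  assumes H: "H \<in> normalized_hamiltonians A \<mu>"
  shows "jointly_continuous H"
  unfolding jointly_continuous_def
proof (rule continuous_on_charts)
  fix c assume c: "c \<in> A"
  have "smooth_on ({0..1} \<times> chart_image c) (\<lambda>(t, y). H t (chart_inv c y))"
    using H c unfolding normalized_hamiltonians_def by blast
  from smooth_on_continuous_on[OF this]
  have Hc: "continuous_on ({0..1} \<times> chart_image c) (\<lambda>q. H (fst q) (chart_inv c (snd q)))" by (simp add: case_prod_unfold)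
  have sc: "continuous_on ({0..1::real} \<times> fst c) (\<lambda>q. snd c (snd q))"
    by (rule continuous_on_compose2[OF chart_cont[OF c]]) (auto intro!: continuous_intros)
  have "continuous_on ({0..1} \<times> fst c) (\<lambda>q. H (fst q) (chart_inv c (snd c (snd q))))"
    by (rule continuous_on_compose2[OF Hc continuous_on_Pair[OF continuous_on_fst[OF continuous_on_id] sc], simplified])
      (use chart_in[OF c] in auto)
  then show "continuous_on ({0..1} \<times> fst c) (\<lambda>q. H (fst q) (snd q))"
    by (rule continuous_on_eq) (auto simp: inv_chart[OF c])
qed

lemma jointly_continuous_bdd:
  assumes u: "jointly_continuous u" and t: "t \<in> {0..1}"
  shows "bdd_above (range (u t))"
proof -
  have "continuous_on UNIV (\<lambda>x. u (fst (t, x)) (snd (t, x)))"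
    by (rule continuous_on_compose2[OF u[unfolded jointly_continuous_def]]) (use t in \<open>auto intro!: continuous_intros\<close>)
  then have "continuous_on UNIV (u t)" by simp
  from compact_imp_bounded[OF compact_continuous_image[OF this cpt]] show ?thesis by (rule bounded_imp_bdd_above)
qed

lemma jointly_continuous_minus: "jointly_continuous u \<Longrightarrow> jointly_continuous (\<lambda>t x. - u t x)"
  unfolding jointly_continuous_def by (intro continuous_intros)

lemma jointly_continuous_diff: "jointly_continuous u \<Longrightarrow> jointly_continuous v \<Longrightarrow> jointly_continuous (\<lambda>t x. u t x - v t x)"
  unfolding jointly_continuous_def by (intro continuous_intros)

lemma SUP_continuous:
  assumes u: "jointly_continuous u"
  shows "continuous_on {0..1} (\<lambda>t. SUP x. u t x)"
  unfolding continuous_on_iff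
proof (intro ballI allI impI)
  fix s e :: real assume s: "s \<in> {0..1}" and e: "e > 0"
  have e2: "e / 2 > 0" using e by simp
  from uniform_in_time[OF cpt u[unfolded jointly_continuous_def] e2] obtain r where r: "r > 0"
    "\<forall>s\<in>{0..1}. \<forall>t\<in>{0..1}. \<bar>s - t\<bar> < r \<longrightarrow> (\<forall>x\<in>UNIV. dist (u s x) (u t x) < e / 2)" by auto
  have le: "(SUP x. u a x) \<le> (SUP x. u b x) + e / 2" if ab: "a \<in> {0..1}" "b \<in> {0..1}" "\<bar>a - b\<bar> < r" for a b
  proof (rule cSUP_least)
    fix x
    have "u a x \<le> u b x + e / 2" using r(2)[rule_format, OF ab UNIV_I, of x] unfolding dist_real_def by linarith
    also have "u b x \<le> (SUP x. u b x)" by (rule cSUP_upper[OF UNIV_I jointly_continuous_bdd[OF u ab(2)]])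
    finally show "u a x \<le> (SUP x. u b x) + e / 2" by simp
  qed simp
  show "\<exists>\<delta>>0. \<forall>t\<in>{0..1}. dist t s < \<delta> \<longrightarrow> dist (SUP x. u t x) (SUP x. u s x) < e"
  proof (intro exI[of _ r] conjI r(1) ballI impI)
    fix t assume t: "t \<in> {0..1}" "dist t s < r"
    then have "\<bar>t - s\<bar> < r" "\<bar>s - t\<bar> < r" by (simp_all add: dist_real_def abs_minus_commute)
    then show "dist (SUP x. u t x) (SUP x. u s x) < e"
      using le[OF t(1) s] le[OF s t(1)] e by (simp add: dist_real_def abs_less_iff)
  qed
qed

text \<open>\<open>integral\<close> is 0 by convention on functions that are not integrable, so
  monotonicity and additivity of \<open>ham_norm\<close> rest on this. The oscillation is continuous
  in time because compactness makes continuity in time uniform in space.\<close>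

lemma osc_integrable:
  assumes u: "jointly_continuous u"
  shows "(\<lambda>t. (SUP x. u t x) - (INF x. u t x)) integrable_on {0..1}"
  unfolding INF_eq_uminus_SUP
  by (intro integrable_continuous_real continuous_intros SUP_continuous u jointly_continuous_minus)

lemma ham_norm_nonneg:
  assumes u: "jointly_continuous u"
  shows "0 \<le> ham_norm u"
  unfolding ham_norm_def
proof (rule Henstock_Kurzweil_Integration.integral_nonneg[OF osc_integrable[OF u]])
  fix t :: real assume t: "t \<in> {0..1}"
  have "u t undefined \<le> (SUP x. u t x)" by (rule cSUP_upper[OF UNIV_I jointly_continuous_bdd[OF u t]])
  moreover have "- u t undefined \<le> (SUP x. - u t x)"
    by (rule cSUP_upper[OF UNIV_I jointly_continuous_bdd[OF jointly_continuous_minus[OF u] t]])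
  ultimately show "0 \<le> (SUP x. u t x) - (INF x. u t x)" unfolding INF_eq_uminus_SUP by linarith
qed

lemma ham_norm_triangle:
  assumes u: "jointly_continuous u" and v: "jointly_continuous v"
  shows "ham_norm (\<lambda>t x. u t x + v t x) \<le> ham_norm u + ham_norm v"
proof -
  have uv: "jointly_continuous (\<lambda>t x. u t x + v t x)"
    using u v unfolding jointly_continuous_def by (intro continuous_intros)
  have SUP: "(SUP x. a t x + b t x) \<le> (SUP x. a t x) + (SUP x. b t x)"
    if a: "jointly_continuous a" and b: "jointly_continuous b" and t: "t \<in> {0..1}" for a b t
    by (rule cSUP_least) (auto intro!: add_mono cSUP_upper jointly_continuous_bdd a b t)
  have "ham_norm (\<lambda>t x. u t x + v t x) \<le>
      integral {0..1} (\<lambda>t. ((SUP x. u t x) - (INF x. u t x)) + ((SUP x. v t x) - (INF x. v t x)))"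
    unfolding ham_norm_def
  proof (rule integral_le[OF osc_integrable[OF uv] integrable_add[OF osc_integrable[OF u] osc_integrable[OF v]]])
    fix t :: real assume t: "t \<in> {0..1}"
    show "(SUP x. u t x + v t x) - (INF x. u t x + v t x) \<le>
        ((SUP x. u t x) - (INF x. u t x)) + ((SUP x. v t x) - (INF x. v t x))"
      using SUP[OF u v t] SUP[OF jointly_continuous_minus[OF u] jointly_continuous_minus[OF v] t]
      unfolding INF_eq_uminus_SUP by simp
  qed
  also have "\<dots> = ham_norm u + ham_norm v"
    unfolding ham_norm_def by (rule Henstock_Kurzweil_Integration.integral_add[OF osc_integrable[OF u] osc_integrable[OF v]])
  finally show ?thesis .
qed

lemma ham_dist_nonneg:
  assumes "H \<in> normalized_hamiltonians A \<mu>" "K \<in> normalized_hamiltonians A \<mu>"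
  shows "0 \<le> ham_dist H K"
  unfolding ham_dist_def
  by (rule ham_norm_nonneg[OF jointly_continuous_diff[OF jointly_continuous_normalized[OF assms(1)]
        jointly_continuous_normalized[OF assms(2)]]])

lemma ham_dist_triangle:
  assumes "H \<in> normalized_hamiltonians A \<mu>" "K \<in> normalized_hamiltonians A \<mu>" "L \<in> normalized_hamiltonians A \<mu>"
  shows "ham_dist H L \<le> ham_dist H K + ham_dist K L"
  using ham_norm_triangle[OF jointly_continuous_diff[OF jointly_continuous_normalized[OF assms(1)] jointly_continuous_normalized[OF assms(2)]]
      jointly_continuous_diff[OF jointly_continuous_normalized[OF assms(2)] jointly_continuous_normalized[OF assms(3)]]]
  by (simp add: ham_dist_def)

lemma ham_dist_quadrangle:
  assumes "H \<in> normalized_hamiltonians A \<mu>" "K \<in> normalized_hamiltonians A \<mu>"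
    "H' \<in> normalized_hamiltonians A \<mu>" "K' \<in> normalized_hamiltonians A \<mu>"
  shows "\<bar>ham_dist H' K' - ham_dist H K\<bar> \<le> ham_dist H H' + ham_dist K K'"
  using ham_dist_triangle[OF assms(1,3,2)] ham_dist_triangle[OF assms(3,4,2)]
    ham_dist_triangle[OF assms(3,1,4)] ham_dist_triangle[OF assms(1,2,4)]
    ham_dist_sym[of H' H] ham_dist_sym[of K' K] by linarith

text \<open>\<open>ham_completion_dist\<close> is a definite description: its sign is unknown until
  the limit is shown to exist and to be unique. Nonnegativity lets the small sum in
  \<open>ham_Q_closure\<close> bound the distance of the paths.\<close>

lemma ham_completion_dist_nonneg:
  assumes X: "X \<in> ham_completion A \<mu>" and H: "H \<in> normalized_hamiltonians A \<mu>"
  shows "0 \<le> ham_completion_dist X (ham_embed A \<mu> H)"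
proof -
  obtain F0 where F0: "F0 \<in> ham_cauchy A \<mu>" and X_eq: "X = ham_cauchy_rel A \<mu> `` {F0}"
    using X unfolding ham_completion_def by (rule quotientE)
  have H0: "(\<lambda>i. H) \<in> ham_cauchy A \<mu>" using H by (simp add: ham_cauchy_def ham_dist_refl)
  have nF: "F i \<in> normalized_hamiltonians A \<mu>" if "F \<in> ham_cauchy A \<mu>" for F i
    using that unfolding ham_cauchy_def by blast
  \<comment> \<open>The limit is computed on one representative \<open>F0\<close> and the constant
    sequence \<open>H\<close>; \<open>ham_dist_quadrangle\<close> carries it to all
    representatives.\<close>
  define a where "a i = ham_dist (F0 i) H" for i
  have "Cauchy a"
    unfolding Cauchy_iff
  proof (intro allI impI)
    fix e :: real assume "e > 0"
    then obtain N where N: "\<forall>i\<ge>N. \<forall>j\<ge>N. ham_dist (F0 i) (F0 j) < e" using F0 unfolding ham_cauchy_def by blast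
    have "norm (a i - a j) < e" if "i \<ge> N" "j \<ge> N" for i j
      using ham_dist_quadrangle[OF nF[OF F0] H nF[OF F0] H, of i j] N[rule_format, OF that(2,1)] N[rule_format, OF that] ham_dist_refl[of H]
      unfolding a_def real_norm_def by (simp add: abs_minus_commute)
    then show "\<exists>N. \<forall>i\<ge>N. \<forall>j\<ge>N. norm (a i - a j) < e" by blast
  qed
  then obtain r where r: "a \<longlonglongrightarrow> r" using real_Cauchy_convergent convergent_def by blast
  have lim: "(\<lambda>i. ham_dist (F i) (G i)) \<longlonglongrightarrow> r" if FG: "F \<in> X" "G \<in> ham_embed A \<mu> H" for F G
  proof -
    have F: "F \<in> ham_cauchy A \<mu>" "(\<lambda>i. ham_dist (F0 i) (F i)) \<longlonglongrightarrow> 0"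
      using FG(1) unfolding X_eq ham_cauchy_rel_def by auto
    have G: "G \<in> ham_cauchy A \<mu>" "(\<lambda>i. ham_dist H (G i)) \<longlonglongrightarrow> 0"
      using FG(2) unfolding ham_embed_def ham_cauchy_rel_def by auto
    have "(\<lambda>i. ham_dist (F i) (G i) - a i) \<longlonglongrightarrow> 0"
    proof (rule Lim_null_comparison)
      show "\<forall>\<^sub>F i in sequentially. norm (ham_dist (F i) (G i) - a i) \<le> ham_dist (F0 i) (F i) + ham_dist H (G i)"
        unfolding a_def real_norm_def
        by (intro always_eventually allI ham_dist_quadrangle[OF nF[OF F0] H nF[OF F(1)] nF[OF G(1)]])
      show "(\<lambda>i. ham_dist (F0 i) (F i) + ham_dist H (G i)) \<longlonglongrightarrow> 0"
        using tendsto_add[OF F(2) G(2)] by simp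
    qed
    from tendsto_add[OF this r] show ?thesis by simp
  qed
  have F0X: "F0 \<in> X" unfolding X_eq ham_cauchy_rel_def using F0 by (simp add: ham_dist_refl)
  have HY: "(\<lambda>i. H) \<in> ham_embed A \<mu> H" unfolding ham_embed_def ham_cauchy_rel_def using H0 by (simp add: ham_dist_refl)
  have "ham_completion_dist X (ham_embed A \<mu> H) = r"
    unfolding ham_completion_dist_def
  proof (rule the_equality)
    show "\<forall>F\<in>X. \<forall>G\<in>ham_embed A \<mu> H. (\<lambda>i. ham_dist (F i) (G i)) \<longlonglongrightarrow> r" using lim by blast
    fix r' assume r': "\<forall>F\<in>X. \<forall>G\<in>ham_embed A \<mu> H. (\<lambda>i. ham_dist (F i) (G i)) \<longlonglongrightarrow> r'"
    have "a \<longlonglongrightarrow> r'" using bspec[OF bspec[OF r' F0X] HY] by (simp add: a_def[abs_def])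
    then show "r' = r" by (rule LIMSEQ_unique[OF _ r])
  qed
  moreover have "0 \<le> r"
    by (rule LIMSEQ_le_const[OF r]) (auto simp: a_def intro!: exI[of _ 0] ham_dist_nonneg[OF nF[OF F0] H])
  ultimately show ?thesis by simp
qed

end

section \<open>Vanishing of the mass flow\<close>

text \<open>Membership in \<open>Homeo_vol0\<close> belongs to the conclusion:
  \<open>mass_flow\<close> is a \<open>the_elem\<close> over classes of paths that end in
  \<open>h\<close>, so its value carries meaning only where such a path exists.\<close>

theorem mainTheorem3:
  fixes A :: "('m::t2_space, 'k::{finite,wellorder}) chart set"
    and \<omega> g :: "('m, 'k) tensor2"
    and \<mu> :: "'m measure"
    and n :: nat
    and h :: "'m \<Rightarrow> 'm"
  assumes "closed_connected_symplectic_manifold n A \<omega>"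
    and "liouville_measure n A \<omega> \<mu>"
    and "riemannian_metric A g"
    and "h \<in> Hameo A \<omega> \<mu> (riemannian_dist A g)"
  shows "h \<in> Homeo_vol0 (riemannian_dist A g) \<mu> \<and>
    mass_flow (riemannian_dist A g) \<mu> h = \<one>\<^bsub>mass_flow_target (riemannian_dist A g) \<mu>\<^esub>"
proof -
  let ?d = "riemannian_dist A g"
  have M: "card (UNIV :: 'k set) = 2 * n" "compact (UNIV :: 'm set)" "connected (UNIV :: 'm set)"
      "smooth_atlas A" "symplectic_form A \<omega>"
    using assms(1) unfolding closed_connected_symplectic_manifold_def by blast+
  interpret riemannian_manifold A g by unfold_locales (rule M assms(3))+
  interpret compact_dist ?d by (rule riemannian_compact_dist)
  interpret liouville_manifold A \<omega> \<mu> n by unfold_locales (rule M assms(2))+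
  interpret compact_dist_measure ?d \<mu>
    by (intro compact_dist_measure.intro compact_dist_measure_axioms.intro sets_liouville finite_liouville) unfold_locales
  obtain \<gamma> X where h: "h = \<gamma> 1" and cl: "(\<gamma>, X) \<in> ham_Q_closure A \<omega> \<mu> ?d"
    using assms(4) unfolding Hameo_def by blast
  have "\<gamma> \<in> paths_from_id ?d Homeo" and X: "X \<in> ham_completion A \<mu>"
    and near: "\<forall>e>0. \<exists>(\<phi>, Y) \<in> ham_Q A \<omega> \<mu> ?d. path_dist ?d \<gamma> \<phi> + ham_completion_dist X Y < e"
    using cl unfolding ham_Q_closure_def by blast+
  then have \<gamma>: "\<gamma> \<in> cpaths" "\<gamma> 0 = id" by (simp_all add: paths_from_id_Homeo)
  have approx: "\<exists>\<phi> H. hamiltonian_flow A \<omega> \<mu> n ?d H \<phi> \<and> (\<forall>t\<in>{0..1}. \<forall>x. ?d (\<gamma> t x) (\<phi> t x) < e)" if e: "e > 0" for e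
  proof -
    obtain \<phi> Y where Q: "(\<phi>, Y) \<in> ham_Q A \<omega> \<mu> ?d" and lt: "path_dist ?d \<gamma> \<phi> + ham_completion_dist X Y < e"
      using near[rule_format, OF e] by blast
    obtain H where H: "Y = ham_embed A \<mu> H" "H \<in> normalized_hamiltonians A \<mu>" "is_hamiltonian_flow A \<omega> H \<phi>"
        "\<phi> \<in> paths_from_id ?d Homeo"
      using Q unfolding ham_Q_def by blast
    have "hamiltonian_flow A \<omega> \<mu> n ?d H \<phi>"
    proof unfold_locales
      show "smooth_on ({0..1} \<times> chart_image c) (\<lambda>(t, y). H t (chart_inv c y))" if "c \<in> A" for c
        using H(2) that unfolding normalized_hamiltonians_def by blast
      show "is_hamiltonian_flow A \<omega> H \<phi>" by (rule H(3))
      show "\<phi> \<in> cpaths" using H(4) by (simp add: paths_from_id_Homeo)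
    qed
    moreover have "?d (\<gamma> t x) (\<phi> t x) < e" if t: "t \<in> {0..1}" for t x
    proof -
      have "?d (\<gamma> t x) (\<phi> t x) \<le> path_dist ?d \<gamma> \<phi>"
        by (rule order_trans[OF d_le_dist_bar dist_bar_le_path_dist[OF t]])
      then show ?thesis using lt ham_completion_dist_nonneg[OF X H(2)] unfolding H(1) by linarith
    qed
    ultimately show ?thesis by blast
  qed
  have vol: "\<gamma> t \<in> Homeo_vol \<mu>" if t: "t \<in> {0..1}" for t
  proof (rule preserves_measure_limit[OF sets_mu finite_mu cpaths_Homeo[OF \<gamma>(1) t]])
    fix e :: real assume "e > 0"
    from approx[OF this] obtain \<phi> H where \<phi>: "hamiltonian_flow A \<omega> \<mu> n ?d H \<phi>"
      "\<forall>t\<in>{0..1}. \<forall>x. ?d (\<gamma> t x) (\<phi> t x) < e" by blast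
    show "\<exists>k\<in>Homeo_vol \<mu>. \<forall>x. ?d (\<gamma> t x) (k x) < e"
      using bspec[OF \<phi>(2) t] hamiltonian_flow.flow_Homeo_vol[OF \<phi>(1) t] by (intro bexI[of _ "\<phi> t"])
  qed
  have zero: "path_mass_flow \<mu> \<gamma> f = 0" if f: "f \<in> circle_maps" for f
  proof (rule ccontr)
    let ?p = "\<bar>path_mass_flow \<mu> \<gamma> f\<bar>" and ?m = "measure \<mu> UNIV"
    assume "path_mass_flow \<mu> \<gamma> f \<noteq> 0"
    then have p: "?p > 0" by simp
    \<comment> \<open>The bound 1/2 is what \<open>path_mass_flow_close\<close> asks for; the other
      one makes the error at most half of the supposedly nonzero value, also when the total mass is
      0.\<close>
    define e where "e = min (1/2) (?p / (2 * (?m + 1)))"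
    have m: "0 \<le> ?m" by simp
    have pos: "0 < 2 * (?m + 1)" by (rule mult_pos_pos[OF zero_less_numeral add_nonneg_pos[OF m zero_less_one]])
    have e: "e > 0" unfolding e_def min_less_iff_conj using divide_pos_pos[OF p pos] by (intro conjI) simp_all
    have e': "e \<le> 1/2" unfolding e_def by (rule min.cobounded1)
    obtain r where r: "r > 0" "\<forall>x y. ?d x y < r \<longrightarrow> dist (f x) (f y) < e"
      using uniformly_continuous[OF circle_mapsD(1)[OF f] e] by blast
    from approx[OF r(1)] obtain \<phi> H where \<phi>: "hamiltonian_flow A \<omega> \<mu> n ?d H \<phi>"
      "\<forall>t\<in>{0..1}. \<forall>x. ?d (\<gamma> t x) (\<phi> t x) < r" by blast
    interpret F: hamiltonian_flow A \<omega> \<mu> n ?d H \<phi> by (rule \<phi>(1))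
    have close: "norm (f (\<gamma> t x) - f (\<phi> t x)) < e" if "t \<in> {0..1}" for t x
      using r(2)[rule_format, OF \<phi>(2)[rule_format, OF that]] by (simp add: dist_norm)
    have "\<bar>path_mass_flow \<mu> \<gamma> f - path_mass_flow \<mu> \<phi> f\<bar> \<le> e * ?m"
      by (rule path_mass_flow_close(1)[OF \<gamma> F.flow_path F.flow_0 f e' close])
    then have "?p \<le> e * ?m" by (simp add: F.path_mass_flow_zero[OF f])
    also have "\<dots> \<le> ?p / (2 * (?m + 1)) * ?m"
      unfolding e_def by (rule mult_right_mono[OF min.cobounded2 m])
    also have "\<dots> \<le> ?p / 2"
    proof -
      have "b / (2 * (a + 1)) * a \<le> b / 2" if "0 \<le> a" "0 \<le> b" for a b :: real
        using that by (simp add: field_simps)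
      from this[OF m abs_ge_zero] show ?thesis .
    qed
    finally show False using p by simp
  qed
  have "\<gamma> \<in> P" by (rule paths_Homeo_vol0[OF \<gamma> vol])
  then have "\<gamma> 1 \<in> Homeo_vol0 ?d \<mu>" unfolding paths_from_id_iff by force
  moreover have "mass_flow ?d \<mu> (\<gamma> 1) = mass_flow_Gamma ?d \<mu>" by (rule mass_flow_eq_Gamma[OF \<open>\<gamma> \<in> P\<close> zero])
  \<comment> \<open>The unit of the factor group is \<open>mass_flow_Gamma\<close> itself.\<close>
  ultimately show ?thesis by (simp add: h mass_flow_target_def FactGroup_def)
qed

end
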